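(* Let $\alpha\in\Bbbk\setminus\mathbb{Z}$, let $f=z(z+\alpha)$, and let $\Gamma=\mathbb{Z}_{\mathrm{fin}}\times\mathbb{Z}_{\mathrm{fin}}$. There is an equivalence of categories $$\operatorname{gr}\text{-}A(f)\equiv\operatorname{gr}\text{-}(D,\Gamma).$$
   Context: $\Bbbk$ is an algebraically closed field of characteristic zero; equivalences are $\Bbbk$-linear. $\mathbb{Z}_{\mathrm{fin}}$ is the group of finite subsets of $\mathbb{Z}$ under symmetric difference $\oplus$; a singleton $\{n\}$ is written $n$. The sum in $\Gamma$ is $(I,I')+(J,J')=(I\oplus J,I'\oplus J')$. $A=A(f)$ is the $\Bbbk$-algebra generated over $\Bbbk[z]$ by $x,y$ with relations $xz=(z+1)x$, $yz=(z-1)y$, $xy=f(z)$, $yx=f(z-1)$, with $\mathbb{Z}$-grading $\deg x=1$, $\deg y=-1$, $\deg z=0$. $\operatorname{gr}\text{-}A$ is the category of finitely generated $\mathbb{Z}$-graded right $A$-modules with degree-preserving homomorphisms; for a $\Gamma$-graded ring $R$, $\operatorname{gr}\text{-}(R,\Gamma)$ is the category of finitely generated $\Gamma$-graded right $R$-modules with degree-preserving homomorphisms. Shifts: $M\langle n\rangle_i=M_{i-n}$. Put $X_0=A/(x,z)A$, $Y_0=(A/(y,z-1)A)\langle1\rangle$, $X_\alpha=A/(x,z+\alpha)A$, $Y_\alpha=(A/(y,z+\alpha-1)A)\langle1\rangle$. Rank one graded projective $A$-modules are regarded as graded submodules of the graded quotient ring $Q_{\mathrm{gr}}(A)=\Bbbk(z)[x^{\pm1};\sigma]$,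 $\sigma(z)=z+1$; graded homomorphisms between them are given by left multiplication by elements of $\Bbbk(z)$. Each rank one graded projective $P$ surjects, for each $n$, onto exactly one of $X_0\langle n\rangle,Y_0\langle n\rangle$ and exactly one of $X_\alpha\langle n\rangle,Y_\alpha\langle n\rangle$. For $n\in\mathbb{Z}$, $\iota_{(n,\emptyset)}$ (resp. $\iota_{(\emptyset,n)}$) is the autoequivalence of $\operatorname{gr}\text{-}A$ (constructed in earlier work of the author) swapping $X_0\langle n\rangle$ and $Y_0\langle n\rangle$ (resp. $X_\alpha\langle n\rangle$ and $Y_\alpha\langle n\rangle$) up to isomorphism and fixing all other simples. On a rank one graded projective $P$, $\iota_{(n,\emptyset)}P\subseteq P$ (resp. $\iota_{(\emptyset,n)}P\subseteq P$) is the kernel of the nonzero morphism from $P$ to whichever of $X_0\langle n\rangle,Y_0\langle n\rangle$ (resp. $X_\alpha\langle n\rangle,Y_\alpha\langle n\rangle$) it surjects onto; these functors act on morphisms between rank one projectives by restriction. They commute, and $\iota_{(n,\emptyset)}^2P=(z+n)P$, $\iota_{(\emptyset,n)}^2P=(z+n+\alpha)P$. For $(J,J')\in\Gamma$ put $\iota_{(J,J')}=\prod_{j\in J}\iota_{(j,\emptyset)}\prod_{j\in J'}\iota_{(\emptyset,j)}$, $\iota_{(\emptyset,\emptyset)}=\operatorname{Id}$, and $h_{(J,J')}=\prod_{j\in J}(z+j)\prod_{j'\in J'}(z+j'+\alpha)$. Let $\sigma_{(J,J')}:\iota_{(J,J')}^2A\to A$ be left multiplication by $h_{(J,J')}^{-1}$,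 and $$\Theta_{(I,I'),(J,J')}=\iota_{(I\oplus J,I'\oplus J')}(\sigma_{(I\cap J,I'\cap J')}):\ \iota_{(I,I')}\iota_{(J,J')}A=\iota_{(I\oplus J,I'\oplus J')}\iota_{(I\cap J,I'\cap J')}^2A\to\iota_{(I\oplus J,I'\oplus J')}A.$$ $D$ is the $\Gamma$-graded ring $$D=\bigoplus_{\gamma\in\Gamma}D_\gamma,\qquad D_\gamma=\operatorname{Hom}_{\operatorname{gr}\text{-}A}(A,\iota_\gamma A),$$ with multiplication $a\cdot b=\Theta_{\delta,\gamma}\circ\iota_\delta(a)\circ b$ for $a\in D_\gamma$, $b\in D_\delta$. *)

theory Defs
  imports
    "HOL-Algebra.Algebra"
    "HOL-Algebra.Algebraic_Closure_Type"
    "HOL-Computational_Algebra.Computational_Algebra"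
    "HOL-Library.Poly_Mapping"
    "HOL-Library.Product_Plus"
begin

section \<open>Linear categories and their equivalences\<close>

text \<open>
  A category enriched over \<open>'k\<close>-vector spaces, given by its data only. An arrow is always considered
  together with its source and target, so the operations take these objects as arguments;
  \<open>Cmp C U V W g f\<close> is the composite of \<open>f : U \<rightarrow> V\<close> and \<open>g : V \<rightarrow> W\<close>.
\<close>

record ('o, 'h, 'k) lin_cat =
  Obj :: "'o set"
  Hom :: "'o \<Rightarrow> 'o \<Rightarrow> 'h set"
  Idt :: "'o \<Rightarrow> 'h"
  Cmp :: "'o \<Rightarrow> 'o \<Rightarrow> 'o \<Rightarrow> 'h \<Rightarrow> 'h \<Rightarrow> 'h"
  Hadd :: "'o \<Rightarrow> 'o \<Rightarrow> 'h \<Rightarrow> 'h \<Rightarrow> 'h"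
  Hscale :: "'o \<Rightarrow> 'o \<Rightarrow> 'k \<Rightarrow> 'h \<Rightarrow> 'h"

definition linear_functor ::
  "('o, 'h, 'k) lin_cat \<Rightarrow> ('p, 'i, 'k) lin_cat \<Rightarrow> ('o \<Rightarrow> 'p) \<Rightarrow> ('o \<Rightarrow> 'o \<Rightarrow> 'h \<Rightarrow> 'i) \<Rightarrow> bool" where
  "linear_functor C D F F' \<longleftrightarrow>
     (\<forall>U\<in>Obj C. F U \<in> Obj D \<and> F' U U (Idt C U) = Idt D (F U)) \<and>
     (\<forall>U\<in>Obj C. \<forall>V\<in>Obj C. \<forall>f\<in>Hom C U V. F' U V f \<in> Hom D (F U) (F V)) \<and>
     (\<forall>U\<in>Obj C. \<forall>V\<in>Obj C. \<forall>W\<in>Obj C. \<forall>f\<in>Hom C U V. \<forall>g\<in>Hom C V W.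
        F' U W (Cmp C U V W g f) = Cmp D (F U) (F V) (F W) (F' V W g) (F' U V f)) \<and>
     (\<forall>U\<in>Obj C. \<forall>V\<in>Obj C. \<forall>f\<in>Hom C U V. \<forall>g\<in>Hom C U V.
        F' U V (Hadd C U V f g) = Hadd D (F U) (F V) (F' U V f) (F' U V g)) \<and>
     (\<forall>U\<in>Obj C. \<forall>V\<in>Obj C. \<forall>c. \<forall>f\<in>Hom C U V.
        F' U V (Hscale C U V c f) = Hscale D (F U) (F V) c (F' U V f))"

definition iso_arrow :: "('o, 'h, 'k) lin_cat \<Rightarrow> 'o \<Rightarrow> 'o \<Rightarrow> 'h \<Rightarrow> bool" where
  "iso_arrow C U V f \<longleftrightarrow> f \<in> Hom C U V \<and>
     (\<exists>g\<in>Hom C V U. Cmp C U V U g f = Idt C U \<and> Cmp C V U V f g = Idt C V)"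

definition naturally_isomorphic ::
  "('o, 'h, 'k) lin_cat \<Rightarrow> ('p, 'i, 'k) lin_cat \<Rightarrow>
   ('o \<Rightarrow> 'p) \<Rightarrow> ('o \<Rightarrow> 'o \<Rightarrow> 'h \<Rightarrow> 'i) \<Rightarrow> ('o \<Rightarrow> 'p) \<Rightarrow> ('o \<Rightarrow> 'o \<Rightarrow> 'h \<Rightarrow> 'i) \<Rightarrow> bool" where
  "naturally_isomorphic C D F F' G G' \<longleftrightarrow>
     (\<exists>\<eta>. (\<forall>U\<in>Obj C. iso_arrow D (F U) (G U) (\<eta> U)) \<and>
          (\<forall>U\<in>Obj C. \<forall>V\<in>Obj C. \<forall>f\<in>Hom C U V.
             Cmp D (F U) (F V) (G V) (\<eta> V) (F' U V f) = Cmp D (F U) (G U) (G V) (G' U V f) (\<eta> U)))"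

definition linearly_equivalent ::
  "('o, 'h, 'k) lin_cat \<Rightarrow> ('p, 'i, 'k) lin_cat \<Rightarrow> bool" where
  "linearly_equivalent C D \<longleftrightarrow>
     (\<exists>F F' G G'. linear_functor C D F F' \<and> linear_functor D C G G' \<and>
        naturally_isomorphic C C (\<lambda>U. G (F U)) (\<lambda>U V f. G' (F U) (F V) (F' U V f))
          (\<lambda>U. U) (\<lambda>U V f. f) \<and>
        naturally_isomorphic D D (\<lambda>U. F (G U)) (\<lambda>U V f. F' (G U) (G V) (G' U V f))
          (\<lambda>U. U) (\<lambda>U V f. f))"


section \<open>Graded right modules\<close>

text \<open>
  \<open>scal\<close> is the structure map of a \<open>'k\<close>-algebra. As with \<^typ>\<open>('a, 'b) module\<close>, a module is a ring
  record whose multiplicative fields are ignored.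
\<close>

record ('a, 'g, 'k) gr_alg = "'a ring" +
  hcomp :: "'g \<Rightarrow> 'a set"
  scal :: "'k \<Rightarrow> 'a"

record ('a, 'm, 'g) gr_mod = "'m ring" +
  ract :: "'m \<Rightarrow> 'a \<Rightarrow> 'm"
  gcomp :: "'g \<Rightarrow> 'm set"

locale right_module = R: ring R + M: abelian_group M
  for R :: "('a, 'g::ab_group_add, 'k) gr_alg" and M :: "('a, 'm, 'g) gr_mod" +
  assumes ract_closed: "\<lbrakk>m \<in> carrier M; r \<in> carrier R\<rbrakk> \<Longrightarrow> ract M m r \<in> carrier M"
    and ract_add_left: "\<lbrakk>m \<in> carrier M; n \<in> carrier M; r \<in> carrier R\<rbrakk> \<Longrightarrow>
          ract M (m \<oplus>\<^bsub>M\<^esub> n) r = ract M m r \<oplus>\<^bsub>M\<^esub> ract M n r"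
    and ract_add_right: "\<lbrakk>m \<in> carrier M; r \<in> carrier R; s \<in> carrier R\<rbrakk> \<Longrightarrow>
          ract M m (r \<oplus>\<^bsub>R\<^esub> s) = ract M m r \<oplus>\<^bsub>M\<^esub> ract M m s"
    and ract_assoc: "\<lbrakk>m \<in> carrier M; r \<in> carrier R; s \<in> carrier R\<rbrakk> \<Longrightarrow>
          ract M m (r \<otimes>\<^bsub>R\<^esub> s) = ract M (ract M m r) s"
    and ract_one: "m \<in> carrier M \<Longrightarrow> ract M m \<one>\<^bsub>R\<^esub> = m"

locale graded_right_module = right_module +
  assumes gcomp_subgroup: "additive_subgroup (gcomp M \<gamma>) M"
    and direct_sum: "m \<in> carrier M \<Longrightarrow>
          \<exists>!c. (\<forall>\<gamma>. c \<gamma> \<in> gcomp M \<gamma>) \<and> finite {\<gamma>. c \<gamma> \<noteq> \<zero>\<^bsub>M\<^esub>} \<and>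
               m = (\<Oplus>\<^bsub>M\<^esub>\<gamma>\<in>{\<gamma>. c \<gamma> \<noteq> \<zero>\<^bsub>M\<^esub>}. c \<gamma>)"
    and ract_degree: "\<lbrakk>m \<in> gcomp M \<gamma>; r \<in> hcomp R \<delta>\<rbrakk> \<Longrightarrow> ract M m r \<in> gcomp M (\<gamma> + \<delta>)"

definition fin_gen :: "('a, 'g, 'k) gr_alg \<Rightarrow> ('a, 'm, 'g) gr_mod \<Rightarrow> bool" where
  "fin_gen R M \<longleftrightarrow> (\<exists>S. finite S \<and> S \<subseteq> carrier M \<and>
     carrier M = {\<Oplus>\<^bsub>M\<^esub>s\<in>S. ract M s (r s) | r. r \<in> S \<rightarrow> carrier R})"

definition gr_hom ::
  "('a, 'g, 'k) gr_alg \<Rightarrow> ('a, 'm, 'g) gr_mod \<Rightarrow> ('a, 'n, 'g) gr_mod \<Rightarrow> ('m \<Rightarrow> 'n) set" where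
  "gr_hom R M N = {\<phi> \<in> carrier M \<rightarrow>\<^sub>E carrier N.
     (\<forall>m\<in>carrier M. \<forall>n\<in>carrier M. \<phi> (m \<oplus>\<^bsub>M\<^esub> n) = \<phi> m \<oplus>\<^bsub>N\<^esub> \<phi> n) \<and>
     (\<forall>m\<in>carrier M. \<forall>r\<in>carrier R. \<phi> (ract M m r) = ract N (\<phi> m) r) \<and>
     (\<forall>\<gamma>. \<phi> ` gcomp M \<gamma> \<subseteq> gcomp N \<gamma>)}"

text \<open>
  The category of finitely generated graded right \<open>R\<close>-modules whose elements are drawn from the
  type \<open>'m\<close>.
\<close>

definition gr_cat ::
  "'m itself \<Rightarrow> ('a, 'g::ab_group_add, 'k) gr_alg \<Rightarrow> (('a, 'm, 'g) gr_mod, 'm \<Rightarrow> 'm, 'k) lin_cat" where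
  "gr_cat U R = \<lparr>
     Obj = {M. graded_right_module R M \<and> fin_gen R M},
     Hom = gr_hom R,
     Idt = (\<lambda>M. \<lambda>m\<in>carrier M. m),
     Cmp = (\<lambda>L M N \<psi> \<phi>. compose (carrier L) \<psi> \<phi>),
     Hadd = (\<lambda>M N \<phi> \<psi>. \<lambda>m\<in>carrier M. \<phi> m \<oplus>\<^bsub>N\<^esub> \<psi> m),
     Hscale = (\<lambda>M N c \<phi>. \<lambda>m\<in>carrier M. ract N (\<phi> m) (scal R c))\<rparr>"

definition shift :: "('a, 'm, int) gr_mod \<Rightarrow> int \<Rightarrow> ('a, 'm, int) gr_mod" where
  "shift M n = M\<lparr>gcomp := (\<lambda>i. gcomp M (i - n))\<rparr>"

text \<open>The cyclic graded right module \<open>R/(a,b)R\<close>, for homogeneous \<open>a\<close> and \<open>b\<close>.\<close>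

definition right_ideal2 :: "('a, 'g, 'k) gr_alg \<Rightarrow> 'a \<Rightarrow> 'a \<Rightarrow> 'a set" where
  "right_ideal2 R a b = {a \<otimes>\<^bsub>R\<^esub> r \<oplus>\<^bsub>R\<^esub> b \<otimes>\<^bsub>R\<^esub> s | r s. r \<in> carrier R \<and> s \<in> carrier R}"

definition cyclic2 :: "('a, 'g, 'k) gr_alg \<Rightarrow> 'a \<Rightarrow> 'a \<Rightarrow> ('a, 'a set, 'g) gr_mod" where
  "cyclic2 R a b = (let K = right_ideal2 R a b in \<lparr>
     carrier = a_rcosets\<^bsub>R\<^esub> K, monoid.mult = undefined, one = undefined, ring.zero = K, add = set_add R,
     ract = (\<lambda>C r. \<Union>c\<in>C. K +>\<^bsub>R\<^esub> (c \<otimes>\<^bsub>R\<^esub> r)),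
     gcomp = (\<lambda>\<gamma>. (\<lambda>r. K +>\<^bsub>R\<^esub> r) ` hcomp R \<gamma>)\<rparr>)"


section \<open>The algebra \<open>A(f)\<close>\<close>

datatype gen = GX | GY | GZ

text \<open>The free monoid on the three generators, written additively as \<open>poly_mapping\<close> requires.\<close>

datatype gword = GWord (letters: "gen list")

instantiation gword :: monoid_add
begin
definition "0 = GWord []"
definition "v + w = GWord (letters v @ letters w)"
instance
  by standard (auto simp: zero_gword_def plus_gword_def)
end

type_synonym 'k falg = "gword \<Rightarrow>\<^sub>0 'k"

abbreviation fx :: "'k::field_char_0 falg" where "fx \<equiv> Poly_Mapping.single (GWord [GX]) 1"
abbreviation fy :: "'k::field_char_0 falg" where "fy \<equiv> Poly_Mapping.single (GWord [GY]) 1"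
abbreviation fz :: "'k::field_char_0 falg" where "fz \<equiv> Poly_Mapping.single (GWord [GZ]) 1"
abbreviation fconst :: "'k::field_char_0 \<Rightarrow> 'k falg" where "fconst \<equiv> Poly_Mapping.single 0"

definition peval :: "'k::field_char_0 poly \<Rightarrow> 'k falg \<Rightarrow> 'k falg" where
  "peval f t = (\<Sum>i\<le>degree f. fconst (coeff f i) * t ^ i)"

definition gwa_rels :: "'k::field_char_0 poly \<Rightarrow> 'k falg set" where
  "gwa_rels f = {fx * fz - (fz + 1) * fx, fy * fz - (fz - 1) * fy,
                 fx * fy - peval f fz, fy * fx - peval f (fz - 1)}"

definition gwa_ideal :: "'k::field_char_0 poly \<Rightarrow> 'k falg set" where
  "gwa_ideal f = genideal ring_of_type_algebra (gwa_rels f)"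

definition cls :: "'k::field_char_0 poly \<Rightarrow> 'k falg \<Rightarrow> 'k falg set" where
  "cls f p = gwa_ideal f +>\<^bsub>ring_of_type_algebra\<^esub> p"

primrec gdeg :: "gen \<Rightarrow> int" where
  "gdeg GX = 1" | "gdeg GY = -1" | "gdeg GZ = 0"

definition gwa :: "'k::field_char_0 poly \<Rightarrow> ('k falg set, int, 'k) gr_alg" where
  "gwa f = (let B = ring_of_type_algebra Quot gwa_ideal f in \<lparr>
     carrier = carrier B, monoid.mult = monoid.mult B, one = one B, ring.zero = ring.zero B, add = add B,
     hcomp = (\<lambda>n. cls f ` {p. \<forall>w\<in>Poly_Mapping.keys p. (\<Sum>g\<leftarrow>letters w. gdeg g) = n}),
     scal = (\<lambda>c. cls f (fconst c))\<rparr>)"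

text \<open>For \<open>f = z(z + \<alpha>)\<close>, these are \<open>X\<^sub>\<beta>\<close> and \<open>Y\<^sub>\<beta>\<close> for the two roots \<open>-\<beta>\<close>, \<open>\<beta> \<in> {0, \<alpha>}\<close>, of \<open>f\<close>.\<close>

definition simpleX :: "'k::field_char_0 poly \<Rightarrow> 'k \<Rightarrow> ('k falg set, 'k falg set set, int) gr_mod" where
  "simpleX f \<beta> = cyclic2 (gwa f) (cls f fx) (cls f (fz + fconst \<beta>))"

definition simpleY :: "'k::field_char_0 poly \<Rightarrow> 'k \<Rightarrow> ('k falg set, 'k falg set set, int) gr_mod" where
  "simpleY f \<beta> = shift (cyclic2 (gwa f) (cls f fy) (cls f (fz + fconst \<beta> - 1))) 1"


section \<open>The graded quotient ring \<open>k(z)[x\<^sup>\<plusminus>\<^sup>1; \<sigma>]\<close>\<close>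

text \<open>The \<open>n\<close>-th power of the automorphism \<open>z \<mapsto> z + 1\<close> of \<open>k(z)\<close>.\<close>

definition zshift :: "int \<Rightarrow> 'k::field_char_0 poly fract \<Rightarrow> 'k poly fract" where
  "zshift n q = (THE r. \<exists>a b. b \<noteq> 0 \<and> q = Fract a b \<and>
     r = Fract (pcompose a [:of_int n, 1:]) (pcompose b [:of_int n, 1:]))"

lemma zshift_Fract:
  fixes a b :: "'k::field_char_0 poly"
  assumes "b \<noteq> 0"
  shows "zshift n (Fract a b) = Fract (pcompose a [:of_int n, 1:]) (pcompose b [:of_int n, 1:])"
proof -
  have nz: "pcompose r [:of_int n, 1:] \<noteq> 0" if "r \<noteq> 0" for r :: "'k poly"
    using that by (simp add: pcompose_eq_0_iff)
  show ?thesis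
    unfolding zshift_def
  proof (rule the_equality)
    fix r
    assume "\<exists>c d. d \<noteq> 0 \<and> Fract a b = Fract c d \<and>
      r = Fract (pcompose c [:of_int n, 1:]) (pcompose d [:of_int n, 1:])"
    then obtain c d where d: "d \<noteq> 0" and eq: "a * d = c * b"
      and r: "r = Fract (pcompose c [:of_int n, 1:]) (pcompose d [:of_int n, 1:])"
      using assms by (auto simp: eq_fract)
    show "r = Fract (pcompose a [:of_int n, 1:]) (pcompose b [:of_int n, 1:])"
      unfolding r using nz[OF d] nz[OF assms] arg_cong[OF eq, of "\<lambda>p. pcompose p [:of_int n, 1:]"]
      by (simp add: eq_fract pcompose_mult)
  qed (use assms in auto)
qed

text \<open>
  \<^term>\<open>Poly_Mapping.single n q\<close> stands for \<open>q x\<^sup>n\<close>. The multiplication is \<open>skew_mult\<close>, not the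
  untwisted one that \<open>poly_mapping\<close> carries as a type.
\<close>

type_synonym 'k skewl = "int \<Rightarrow>\<^sub>0 'k poly fract"

definition skew_mult :: "'k::field_char_0 skewl \<Rightarrow> 'k skewl \<Rightarrow> 'k skewl" where
  "skew_mult p q = (\<Sum>i\<in>Poly_Mapping.keys p. \<Sum>j\<in>Poly_Mapping.keys q.
     Poly_Mapping.single (i + j)
       (Poly_Mapping.lookup p i * zshift i (Poly_Mapping.lookup q j)))"

definition kz_mult :: "'k::field_char_0 poly fract \<Rightarrow> 'k skewl \<Rightarrow> 'k skewl" where
  "kz_mult r q = skew_mult (Poly_Mapping.single 0 r) q"

text \<open>The inclusion of \<open>A(f)\<close> sends \<open>y\<close> to \<open>x\<^sup>-\<^sup>1 f(z) = f(z - 1) x\<^sup>-\<^sup>1\<close>.\<close>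

primrec gen_val :: "'k::field_char_0 poly \<Rightarrow> gen \<Rightarrow> 'k skewl" where
  "gen_val f GX = Poly_Mapping.single 1 1"
| "gen_val f GY = skew_mult (Poly_Mapping.single (-1) 1) (Poly_Mapping.single 0 (Fract f 1))"
| "gen_val f GZ = Poly_Mapping.single 0 (Fract [:0, 1:] 1)"

definition falg_val :: "'k::field_char_0 poly \<Rightarrow> 'k falg \<Rightarrow> 'k skewl" where
  "falg_val f p = (\<Sum>w\<in>Poly_Mapping.keys p. kz_mult (Fract [:Poly_Mapping.lookup p w:] 1)
     (foldr (\<lambda>g. skew_mult (gen_val f g)) (letters w) (Poly_Mapping.single 0 1)))"

definition gwa_val :: "'k::field_char_0 poly \<Rightarrow> 'k falg set \<Rightarrow> 'k skewl" where
  "gwa_val f C = the_elem (falg_val f ` C)"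

text \<open>A graded \<open>A(f)\<close>-submodule \<open>P\<close> of the graded quotient ring; \<open>A(f)\<close> itself is one.\<close>

definition submod :: "'k::field_char_0 poly \<Rightarrow> 'k skewl set \<Rightarrow> ('k falg set, 'k skewl, int) gr_mod" where
  "submod f P = \<lparr>carrier = P, monoid.mult = undefined, one = undefined, ring.zero = 0, add = (+),
     ract = (\<lambda>q C. skew_mult q (gwa_val f C)),
     gcomp = (\<lambda>n. P \<inter> range (Poly_Mapping.single n))\<rparr>"

definition gwa_sub :: "'k::field_char_0 poly \<Rightarrow> 'k skewl set" where
  "gwa_sub f = gwa_val f ` carrier (gwa f)"


section \<open>The group \<open>\<Gamma>\<close>\<close>

typedef zfin = "{S :: int set. finite S}"
  morphisms zset Abs_zfin
  by auto

setup_lifting type_definition_zfin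

instantiation zfin :: ab_group_add
begin
lift_definition zero_zfin :: zfin is "{}" by simp
lift_definition plus_zfin :: "zfin \<Rightarrow> zfin \<Rightarrow> zfin" is "\<lambda>I J. (I - J) \<union> (J - I)" by simp
definition uminus_zfin :: "zfin \<Rightarrow> zfin" where "uminus_zfin I = I"
definition minus_zfin :: "zfin \<Rightarrow> zfin \<Rightarrow> zfin" where "minus_zfin I J = I + J"
instance
proof
  fix I J K :: zfin
  show "I + J + K = I + (J + K)" by transfer auto
  show "I + J = J + I" by transfer auto
  show "0 + I = I" by transfer auto
  show "- I + I = 0" unfolding uminus_zfin_def by transfer auto
  show "I - J = I + - J" by (simp add: uminus_zfin_def minus_zfin_def)
qed
end

type_synonym gam = "zfin \<times> zfin"

lift_definition zinter :: "zfin \<Rightarrow> zfin \<Rightarrow> zfin" is "\<lambda>I J. I \<inter> J" by simp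

definition ginter :: "gam \<Rightarrow> gam \<Rightarrow> gam" where
  "ginter \<gamma> \<delta> = (zinter (fst \<gamma>) (fst \<delta>), zinter (snd \<gamma>) (snd \<delta>))"


section \<open>The functors \<open>\<iota>\<^sub>\<gamma>\<close> on rank one projectives\<close>

definition falpha :: "'k::field_char_0 \<Rightarrow> 'k poly" where
  "falpha \<alpha> = [:0, 1:] * [:\<alpha>, 1:]"

text \<open>
  The elementary functor that swaps \<open>X\<^sub>\<beta>\<langle>n\<rangle>\<close> and \<open>Y\<^sub>\<beta>\<langle>n\<rangle>\<close>: \<open>\<beta> = 0\<close> gives \<open>\<iota>\<^sub>(\<^sub>n\<^sub>,\<^sub>\<emptyset>\<^sub>)\<close> and \<open>\<beta> = \<alpha>\<close> gives
  \<open>\<iota>\<^sub>(\<^sub>\<emptyset>\<^sub>,\<^sub>n\<^sub>)\<close>. The kernel is well-defined since, for a rank one projective \<open>P\<close>, exactly one of the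
  two simple modules is a quotient of \<open>P\<close>, and the space of morphisms to it is one-dimensional.
\<close>

definition iota1 :: "'k::field_char_0 \<Rightarrow> 'k \<Rightarrow> int \<Rightarrow> 'k skewl set \<Rightarrow> 'k skewl set" where
  "iota1 \<alpha> \<beta> n P = (THE K.
     \<exists>S \<in> {shift (simpleX (falpha \<alpha>) \<beta>) n, shift (simpleY (falpha \<alpha>) \<beta>) n}.
     \<exists>\<phi> \<in> gr_hom (gwa (falpha \<alpha>)) (submod (falpha \<alpha>) P) S.
       (\<exists>p\<in>P. \<phi> p \<noteq> \<zero>\<^bsub>S\<^esub>) \<and> K = {p \<in> P. \<phi> p = \<zero>\<^bsub>S\<^esub>})"

text \<open>The factors commute; the products are taken in increasing order of the indices.\<close>

definition iota :: "'k::field_char_0 \<Rightarrow> gam \<Rightarrow> 'k skewl set \<Rightarrow> 'k skewl set" where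
  "iota \<alpha> \<gamma> P =
     foldr (iota1 \<alpha> 0) (sorted_list_of_set (zset (fst \<gamma>)))
       (foldr (iota1 \<alpha> \<alpha>) (sorted_list_of_set (zset (snd \<gamma>))) P)"

text \<open>The action of \<open>\<iota>\<^sub>\<gamma>\<close> on a morphism with source \<open>P\<close>.\<close>

definition iota_mor ::
  "'k::field_char_0 \<Rightarrow> gam \<Rightarrow> 'k skewl set \<Rightarrow> ('k skewl \<Rightarrow> 'k skewl) \<Rightarrow> 'k skewl \<Rightarrow> 'k skewl" where
  "iota_mor \<alpha> \<gamma> P \<phi> = restrict \<phi> (iota \<alpha> \<gamma> P)"

abbreviation Asub :: "'k::field_char_0 \<Rightarrow> 'k skewl set" where
  "Asub \<alpha> \<equiv> gwa_sub (falpha \<alpha>)"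

definition hfun :: "'k::field_char_0 \<Rightarrow> gam \<Rightarrow> 'k poly fract" where
  "hfun \<alpha> \<gamma> = (\<Prod>j\<in>zset (fst \<gamma>). Fract [:of_int j, 1:] 1) *
              (\<Prod>j\<in>zset (snd \<gamma>). Fract [:of_int j + \<alpha>, 1:] 1)"

definition sigma_map :: "'k::field_char_0 \<Rightarrow> gam \<Rightarrow> 'k skewl \<Rightarrow> 'k skewl" where
  "sigma_map \<alpha> \<gamma> = restrict (kz_mult (inverse (hfun \<alpha> \<gamma>))) (iota \<alpha> \<gamma> (iota \<alpha> \<gamma> (Asub \<alpha>)))"

definition Theta :: "'k::field_char_0 \<Rightarrow> gam \<Rightarrow> gam \<Rightarrow> 'k skewl \<Rightarrow> 'k skewl" where
  "Theta \<alpha> \<gamma> \<delta> =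
     iota_mor \<alpha> (\<gamma> + \<delta>) (iota \<alpha> (ginter \<gamma> \<delta>) (iota \<alpha> (ginter \<gamma> \<delta>) (Asub \<alpha>)))
       (sigma_map \<alpha> (ginter \<gamma> \<delta>))"


section \<open>The \<open>\<Gamma>\<close>-graded ring \<open>D\<close>\<close>

definition D_hom :: "'k::field_char_0 \<Rightarrow> gam \<Rightarrow> ('k skewl \<Rightarrow> 'k skewl) set" where
  "D_hom \<alpha> \<gamma> = gr_hom (gwa (falpha \<alpha>)) (submod (falpha \<alpha>) (Asub \<alpha>))
                  (submod (falpha \<alpha>) (iota \<alpha> \<gamma> (Asub \<alpha>)))"

text \<open>\<open>D_mult \<alpha> \<gamma> \<delta> a b\<close> is the product of \<open>a \<in> D\<^sub>\<gamma>\<close> and \<open>b \<in> D\<^sub>\<delta>\<close>.\<close>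

definition D_mult ::
  "'k::field_char_0 \<Rightarrow> gam \<Rightarrow> gam \<Rightarrow> ('k skewl \<Rightarrow> 'k skewl) \<Rightarrow> ('k skewl \<Rightarrow> 'k skewl) \<Rightarrow>
   'k skewl \<Rightarrow> 'k skewl" where
  "D_mult \<alpha> \<gamma> \<delta> a b =
     compose (Asub \<alpha>) (Theta \<alpha> \<delta> \<gamma>) (compose (Asub \<alpha>) (iota_mor \<alpha> \<delta> (Asub \<alpha>) a) b)"

definition D_zero :: "'k::field_char_0 \<Rightarrow> 'k skewl \<Rightarrow> 'k skewl" where
  "D_zero \<alpha> = (\<lambda>p\<in>Asub \<alpha>. 0)"

definition D_supp :: "'k::field_char_0 \<Rightarrow> (gam \<Rightarrow> 'k skewl \<Rightarrow> 'k skewl) \<Rightarrow> gam set" where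
  "D_supp \<alpha> d = {\<gamma>. d \<gamma> \<noteq> D_zero \<alpha>}"

definition D_single :: "'k::field_char_0 \<Rightarrow> gam \<Rightarrow> ('k skewl \<Rightarrow> 'k skewl) \<Rightarrow>
    gam \<Rightarrow> 'k skewl \<Rightarrow> 'k skewl" where
  "D_single \<alpha> \<gamma> a = (\<lambda>_. D_zero \<alpha>)(\<gamma> := a)"

definition D_carrier :: "'k::field_char_0 \<Rightarrow> (gam \<Rightarrow> 'k skewl \<Rightarrow> 'k skewl) set" where
  "D_carrier \<alpha> = {d. (\<forall>\<gamma>. d \<gamma> \<in> D_hom \<alpha> \<gamma>) \<and> finite (D_supp \<alpha> d)}"

definition D_ring :: "'k::field_char_0 \<Rightarrow> (gam \<Rightarrow> 'k skewl \<Rightarrow> 'k skewl, gam, 'k) gr_alg" where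
  "D_ring \<alpha> = \<lparr>
     carrier = D_carrier \<alpha>,
     monoid.mult = (\<lambda>d e \<epsilon>. \<lambda>p\<in>Asub \<alpha>.
       \<Sum>(\<gamma>, \<delta>) \<in> {(\<gamma>, \<delta>). \<gamma> \<in> D_supp \<alpha> d \<and> \<delta> \<in> D_supp \<alpha> e \<and> \<gamma> + \<delta> = \<epsilon>}.
         D_mult \<alpha> \<gamma> \<delta> (d \<gamma>) (e \<delta>) p),
     one = D_single \<alpha> 0 (\<lambda>p\<in>Asub \<alpha>. p),
     ring.zero = (\<lambda>_. D_zero \<alpha>),
     add = (\<lambda>d e \<gamma>. \<lambda>p\<in>Asub \<alpha>. d \<gamma> p + e \<gamma> p),
     hcomp = (\<lambda>\<gamma>. D_single \<alpha> \<gamma> ` D_hom \<alpha> \<gamma>),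
     scal = (\<lambda>c. D_single \<alpha> 0 (\<lambda>p\<in>Asub \<alpha>. kz_mult (Fract [:c:] 1) p))\<rparr>"

end

theory Submission
  imports Defs
begin

text \<open>
  Let \<open>f = z(z + \<alpha>)\<close>. The algebra \<open>A(f)\<close> is a corner of \<open>D\<close>. For an integer \<open>n\<close> let \<open>J n\<close> be the set of integers
  between \<open>0\<close> and \<open>n\<close>, so that the symmetric difference of \<open>J m\<close> and \<open>J n\<close> is the interval between
  \<open>m\<close> and \<open>n\<close>, and put \<open>\<rho> n = (J n, J n)\<close>. The component of \<open>D\<close> of degree \<open>\<rho> (n + j) - \<rho> n\<close> is a copy of the
  component \<open>A\<^sub>j\<close>, compatibly with multiplication (\<open>corner_D\<close>). Hence a \<open>\<Gamma>\<close>-graded \<open>D\<close>-module restricts to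
  a \<open>\<int>\<close>-graded \<open>A\<close>-module: keep only the degrees \<open>\<rho> n\<close>.
  
  Restriction is an equivalence as soon as every degree \<open>\<gamma>\<close> is covered by the degrees \<open>\<rho> n\<close>, in the
  sense that \<open>1\<close> is a finite sum of products \<open>d d'\<close> with \<open>d\<close> of degree \<open>\<rho> n - \<gamma>\<close> and \<open>d'\<close> of degree
  \<open>\<gamma> - \<rho> n\<close>; the quasi-inverse is coinduction. This graded Morita theorem is \<open>equivalence_functor_res\<close>.
  For \<open>D\<close> two values of \<open>n\<close> suffice. If \<open>N\<close> exceeds all elements of the two sets of \<open>\<gamma>\<close> in absolute
  value, then the symmetric differences of \<open>\<gamma>\<close> with \<open>\<rho> (- N)\<close> and with \<open>\<rho> N\<close> are disjoint, and since \<open>\<alpha>\<close> is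
  not an integer the polynomials \<open>h\<close> of disjoint index sets are comaximal (\<open>D_cover\<close>).
  
  All of this needs \<open>D\<close> in explicit form. A morphism from \<open>A\<close> to \<open>\<iota>\<^sub>\<gamma> A\<close> is left multiplication by an
  element of degree zero of \<open>\<iota>\<^sub>\<gamma> A\<close>, and these elements form \<open>h\<^sub>\<gamma> k[z]\<close> (\<open>D_hom_iff\<close>). To see this, the
  rank one projectives that occur are described degree by degree by polynomials \<open>p\<^sub>m\<close>, and the
  morphisms to the simple modules \<open>X\<^sub>\<beta>\<langle>n\<rangle>\<close> and \<open>Y\<^sub>\<beta>\<langle>n\<rangle>\<close> are determined in these terms: exactly one of the two
  modules admits a nonzero morphism, and its kernel multiplies \<open>p\<^sub>m\<close> by \<open>z + n + \<beta>\<close> in the degrees in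
  which that simple module lives (\<open>iota1_Pl\<close>). The product of \<open>a \<in> D\<^sub>\<gamma>\<close> and \<open>b \<in> D\<^sub>\<delta>\<close> is then
  \<open>a b / h\<close> for the polynomial \<open>h\<close> of the intersection of \<open>\<gamma>\<close> and \<open>\<delta>\<close> (\<open>D_mult_eq\<close>).
  
  The two categories in the theorem take the elements of their modules from different types. A
  finitely generated module over \<open>A\<close> or \<open>D\<close> has at most as many elements as \<open>k\<close>, so the category of
  these modules is the same, up to equivalence, for every type into which \<open>k\<close> embeds
  (\<open>equivalence_functor_transport\<close>).
\<close>

section \<open>Fully faithful and essentially surjective functors\<close>

locale linear_category =
  fixes C :: "('o, 'h, 'k) lin_cat"
  assumes Idt_Hom: "U \<in> Obj C \<Longrightarrow> Idt C U \<in> Hom C U U"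
    and Cmp_Hom: "\<lbrakk>U \<in> Obj C; V \<in> Obj C; W \<in> Obj C; f \<in> Hom C U V; g \<in> Hom C V W\<rbrakk>
      \<Longrightarrow> Cmp C U V W g f \<in> Hom C U W"
    and Cmp_assoc: "\<lbrakk>T \<in> Obj C; U \<in> Obj C; V \<in> Obj C; W \<in> Obj C;
        e \<in> Hom C T U; f \<in> Hom C U V; g \<in> Hom C V W\<rbrakk>
      \<Longrightarrow> Cmp C T V W g (Cmp C T U V f e) = Cmp C T U W (Cmp C U V W g f) e"
    and Cmp_Idt_right: "\<lbrakk>U \<in> Obj C; V \<in> Obj C; f \<in> Hom C U V\<rbrakk> \<Longrightarrow> Cmp C U U V f (Idt C U) = f"
    and Cmp_Idt_left: "\<lbrakk>U \<in> Obj C; V \<in> Obj C; f \<in> Hom C U V\<rbrakk> \<Longrightarrow> Cmp C U V V (Idt C V) f = f"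
    and Hadd_Hom: "\<lbrakk>U \<in> Obj C; V \<in> Obj C; f \<in> Hom C U V; g \<in> Hom C U V\<rbrakk>
      \<Longrightarrow> Hadd C U V f g \<in> Hom C U V"
    and Hscale_Hom: "\<lbrakk>U \<in> Obj C; V \<in> Obj C; f \<in> Hom C U V\<rbrakk> \<Longrightarrow> Hscale C U V c f \<in> Hom C U V"
    and Cmp_Hadd_right: "\<lbrakk>U \<in> Obj C; V \<in> Obj C; W \<in> Obj C; f \<in> Hom C U V; f' \<in> Hom C U V; g \<in> Hom C V W\<rbrakk>
      \<Longrightarrow> Cmp C U V W g (Hadd C U V f f') = Hadd C U W (Cmp C U V W g f) (Cmp C U V W g f')"
    and Cmp_Hadd_left: "\<lbrakk>U \<in> Obj C; V \<in> Obj C; W \<in> Obj C; f \<in> Hom C U V; g \<in> Hom C V W; g' \<in> Hom C V W\<rbrakk>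
      \<Longrightarrow> Cmp C U V W (Hadd C V W g g') f = Hadd C U W (Cmp C U V W g f) (Cmp C U V W g' f)"
    and Cmp_Hscale_right: "\<lbrakk>U \<in> Obj C; V \<in> Obj C; W \<in> Obj C; f \<in> Hom C U V; g \<in> Hom C V W\<rbrakk>
      \<Longrightarrow> Cmp C U V W g (Hscale C U V c f) = Hscale C U W c (Cmp C U V W g f)"
    and Cmp_Hscale_left: "\<lbrakk>U \<in> Obj C; V \<in> Obj C; W \<in> Obj C; f \<in> Hom C U V; g \<in> Hom C V W\<rbrakk>
      \<Longrightarrow> Cmp C U V W (Hscale C V W c g) f = Hscale C U W c (Cmp C U V W g f)"

definition equivalence_functor ::
  "('o, 'h, 'k) lin_cat \<Rightarrow> ('p, 'i, 'k) lin_cat \<Rightarrow> ('o \<Rightarrow> 'p) \<Rightarrow> ('o \<Rightarrow> 'o \<Rightarrow> 'h \<Rightarrow> 'i) \<Rightarrow> bool" where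
  "equivalence_functor C D F F' \<longleftrightarrow> linear_functor C D F F' \<and>
     (\<forall>U\<in>Obj C. \<forall>V\<in>Obj C. bij_betw (F' U V) (Hom C U V) (Hom D (F U) (F V))) \<and>
     (\<forall>P\<in>Obj D. \<exists>U\<in>Obj C. \<exists>f. iso_arrow D (F U) P f)"

lemma (in linear_category) iso_arrow_comp:
  assumes "U \<in> Obj C" "V \<in> Obj C" "W \<in> Obj C" and f: "iso_arrow C U V f" and g: "iso_arrow C V W g"
  shows "iso_arrow C U W (Cmp C U V W g f)"
proof -
  obtain f' where f': "f' \<in> Hom C V U" "Cmp C U V U f' f = Idt C U" "Cmp C V U V f f' = Idt C V"
    and fh: "f \<in> Hom C U V"
    using f unfolding iso_arrow_def by auto
  obtain g' where g': "g' \<in> Hom C W V" "Cmp C V W V g' g = Idt C V" "Cmp C W V W g g' = Idt C W"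
    and gh: "g \<in> Hom C V W"
    using g unfolding iso_arrow_def by auto
  have 1: "Cmp C U W U (Cmp C W V U f' g') (Cmp C U V W g f) = Idt C U"
  proof -
    have "Cmp C U W U (Cmp C W V U f' g') (Cmp C U V W g f)
        = Cmp C U V U f' (Cmp C U W V g' (Cmp C U V W g f))"
      using assms(1-3) f'(1) g'(1) fh gh by (intro Cmp_assoc[symmetric] Cmp_Hom) auto
    also have "Cmp C U W V g' (Cmp C U V W g f) = Cmp C U V V (Cmp C V W V g' g) f"
      using assms(1-3) f'(1) g'(1) fh gh by (intro Cmp_assoc) auto
    finally show ?thesis using f' g' fh assms(1-3) by (simp add: Cmp_Idt_left)
  qed
  have 2: "Cmp C W U W (Cmp C U V W g f) (Cmp C W V U f' g') = Idt C W"
  proof -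
    have "Cmp C W U W (Cmp C U V W g f) (Cmp C W V U f' g')
        = Cmp C W V W g (Cmp C W U V f (Cmp C W V U f' g'))"
      using assms(1-3) f'(1) g'(1) fh gh by (intro Cmp_assoc[symmetric] Cmp_Hom) auto
    also have "Cmp C W U V f (Cmp C W V U f' g') = Cmp C W V V (Cmp C V U V f f') g'"
      using assms(1-3) f'(1) g'(1) fh gh by (intro Cmp_assoc) auto
    finally show ?thesis using f' g' fh assms(1-3) by (simp add: Cmp_Idt_left)
  qed
  show ?thesis
    unfolding iso_arrow_def
    using 1 2 Cmp_Hom[OF assms(1-3) fh gh] Cmp_Hom[OF assms(3,2,1) g'(1) f'(1)] by blast
qed

lemma linear_functor_iso_arrow:
  assumes F: "linear_functor C D F F'" and "U \<in> Obj C" "V \<in> Obj C" and f: "iso_arrow C U V f"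
  shows "iso_arrow D (F U) (F V) (F' U V f)"
proof -
  obtain g where g: "g \<in> Hom C V U" "Cmp C U V U g f = Idt C U" "Cmp C V U V f g = Idt C V"
    and fh: "f \<in> Hom C U V"
    using f unfolding iso_arrow_def by auto
  have "F' U V f \<in> Hom D (F U) (F V)" "F' V U g \<in> Hom D (F V) (F U)"
    "Cmp D (F U) (F V) (F U) (F' V U g) (F' U V f) = Idt D (F U)"
    "Cmp D (F V) (F U) (F V) (F' U V f) (F' V U g) = Idt D (F V)"
    using F fh g assms(2,3) unfolding linear_functor_def by metis+
  then show ?thesis unfolding iso_arrow_def by blast
qed

lemma equivalence_functor_compose:
  assumes E: "linear_category E"
    and F: "equivalence_functor C D F F'" and G: "equivalence_functor D E G G'"
  shows "equivalence_functor C E (\<lambda>U. G (F U)) (\<lambda>U V f. G' (F U) (F V) (F' U V f))"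
proof -
  interpret E: linear_category E by fact
  have Fl: "linear_functor C D F F'" and Gl: "linear_functor D E G G'"
    using F G unfolding equivalence_functor_def by auto
  have FO: "\<And>U. U \<in> Obj C \<Longrightarrow> F U \<in> Obj D" and GO: "\<And>U. U \<in> Obj D \<Longrightarrow> G U \<in> Obj E"
    using Fl Gl unfolding linear_functor_def by auto
  have lin: "linear_functor C E (\<lambda>U. G (F U)) (\<lambda>U V f. G' (F U) (F V) (F' U V f))"
    using Fl Gl FO unfolding linear_functor_def by simp
  have "bij_betw (\<lambda>f. G' (F U) (F V) (F' U V f)) (Hom C U V) (Hom E (G (F U)) (G (F V)))"
    if "U \<in> Obj C" "V \<in> Obj C" for U V
    using bij_betw_trans[of "F' U V" "Hom C U V" "Hom D (F U) (F V)" "G' (F U) (F V)"] F G that FO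
    unfolding equivalence_functor_def comp_def by blast
  moreover have "\<exists>U\<in>Obj C. \<exists>f. iso_arrow E (G (F U)) R f" if R: "R \<in> Obj E" for R
  proof -
    obtain Q g where Q: "Q \<in> Obj D" "iso_arrow E (G Q) R g"
      using G R unfolding equivalence_functor_def by blast
    obtain P f where P: "P \<in> Obj C" "iso_arrow D (F P) Q f"
      using F Q unfolding equivalence_functor_def by blast
    show ?thesis
      using E.iso_arrow_comp[OF _ _ R linear_functor_iso_arrow[OF Gl FO[OF P(1)] Q(1) P(2)] Q(2)]
        P(1) Q(1) FO GO by blast
  qed
  ultimately show ?thesis using lin unfolding equivalence_functor_def by blast
qed

text \<open>
  A quasi-inverse sends \<open>P\<close> to a chosen preimage \<open>G P\<close> with a chosen isomorphism
  \<open>e P : F (G P) \<rightarrow> P\<close>; an arrow is conjugated by these isomorphisms and then lifted along the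
  bijection that \<open>F\<close> induces on arrows. The isomorphisms \<open>e P\<close> and the lifts of \<open>e (F U)\<close> are the
  two natural isomorphisms.
\<close>

lemma equivalence_functor_imp_linearly_equivalent:
  assumes C: "linear_category C" and D: "linear_category D" and F: "equivalence_functor C D F F'"
  shows "linearly_equivalent C D"
proof -
  interpret C: linear_category C by fact
  interpret D: linear_category D by fact
  have Fl: "linear_functor C D F F'"
    and bij: "\<And>U V. U \<in> Obj C \<Longrightarrow> V \<in> Obj C \<Longrightarrow> bij_betw (F' U V) (Hom C U V) (Hom D (F U) (F V))"
    and es: "\<And>P. P \<in> Obj D \<Longrightarrow> \<exists>U\<in>Obj C. \<exists>f. iso_arrow D (F U) P f"
    using F unfolding equivalence_functor_def by auto
  have FO: "\<And>U. U \<in> Obj C \<Longrightarrow> F U \<in> Obj D"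
    and FI: "\<And>U. U \<in> Obj C \<Longrightarrow> F' U U (Idt C U) = Idt D (F U)"
    and FH: "\<And>U V f. U \<in> Obj C \<Longrightarrow> V \<in> Obj C \<Longrightarrow> f \<in> Hom C U V \<Longrightarrow> F' U V f \<in> Hom D (F U) (F V)"
    and FC: "\<And>U V W f g. U \<in> Obj C \<Longrightarrow> V \<in> Obj C \<Longrightarrow> W \<in> Obj C \<Longrightarrow> f \<in> Hom C U V \<Longrightarrow> g \<in> Hom C V W \<Longrightarrow>
      F' U W (Cmp C U V W g f) = Cmp D (F U) (F V) (F W) (F' V W g) (F' U V f)"
    and FA: "\<And>U V f g. U \<in> Obj C \<Longrightarrow> V \<in> Obj C \<Longrightarrow> f \<in> Hom C U V \<Longrightarrow> g \<in> Hom C U V \<Longrightarrow>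
      F' U V (Hadd C U V f g) = Hadd D (F U) (F V) (F' U V f) (F' U V g)"
    and FS: "\<And>U V f c. U \<in> Obj C \<Longrightarrow> V \<in> Obj C \<Longrightarrow> f \<in> Hom C U V \<Longrightarrow>
      F' U V (Hscale C U V c f) = Hscale D (F U) (F V) c (F' U V f)"
    using Fl unfolding linear_functor_def by auto
  have inj: "f = g" if "U \<in> Obj C" "V \<in> Obj C" "f \<in> Hom C U V" "g \<in> Hom C U V" "F' U V f = F' U V g" for U V f g
    using bij[OF that(1,2)] that by (meson bij_betw_imp_inj_on inj_onD)
  define lft where "lft U V = the_inv_into (Hom C U V) (F' U V)" for U V
  have lft: "lft U V h \<in> Hom C U V" "F' U V (lft U V h) = h"
    if "U \<in> Obj C" "V \<in> Obj C" "h \<in> Hom D (F U) (F V)" for U V h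
  proof -
    note b = bij[OF that(1,2)]
    have h: "h \<in> F' U V ` Hom C U V" using b that(3) by (simp add: bij_betw_def)
    show "lft U V h \<in> Hom C U V"
      unfolding lft_def using the_inv_into_into[OF bij_betw_imp_inj_on[OF b] h subset_refl] .
    show "F' U V (lft U V h) = h"
      unfolding lft_def using f_the_inv_into_f[OF bij_betw_imp_inj_on[OF b] h] .
  qed
  obtain G e where G: "\<And>P. P \<in> Obj D \<Longrightarrow> G P \<in> Obj C" and e: "\<And>P. P \<in> Obj D \<Longrightarrow> iso_arrow D (F (G P)) P (e P)"
    using es by metis
  have eh: "e P \<in> Hom D (F (G P)) P" if "P \<in> Obj D" for P using e[OF that] unfolding iso_arrow_def by auto
  have "\<exists>d. d \<in> Hom D P (F (G P)) \<and> Cmp D (F (G P)) P (F (G P)) d (e P) = Idt D (F (G P)) \<and>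
      Cmp D P (F (G P)) P (e P) d = Idt D P" if "P \<in> Obj D" for P
    using e[OF that] unfolding iso_arrow_def by auto
  then obtain d where dh: "\<And>P. P \<in> Obj D \<Longrightarrow> d P \<in> Hom D P (F (G P))"
    and de: "\<And>P. P \<in> Obj D \<Longrightarrow> Cmp D (F (G P)) P (F (G P)) (d P) (e P) = Idt D (F (G P))"
    and ed: "\<And>P. P \<in> Obj D \<Longrightarrow> Cmp D P (F (G P)) P (e P) (d P) = Idt D P"
    by metis
  define conj where "conj P Q g = Cmp D (F (G P)) Q (F (G Q)) (d Q) (Cmp D (F (G P)) P Q g (e P))" for P Q g
  have cH: "conj P Q g \<in> Hom D (F (G P)) (F (G Q))"
    if "P \<in> Obj D" "Q \<in> Obj D" "g \<in> Hom D P Q" for P Q g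
    unfolding conj_def using that FO G eh dh by (intro D.Cmp_Hom) auto
  have ec: "Cmp D (F (G P)) (F (G Q)) Q (e Q) (conj P Q g) = Cmp D (F (G P)) P Q g (e P)"
    if "P \<in> Obj D" "Q \<in> Obj D" "g \<in> Hom D P Q" for P Q g
  proof -
    have "Cmp D (F (G P)) (F (G Q)) Q (e Q) (conj P Q g)
        = Cmp D (F (G P)) Q Q (Cmp D Q (F (G Q)) Q (e Q) (d Q)) (Cmp D (F (G P)) P Q g (e P))"
      unfolding conj_def using that FO G eh dh by (intro D.Cmp_assoc D.Cmp_Hom) auto
    then show ?thesis
      using that FO G eh dh ed by (simp add: D.Cmp_Idt_left D.Cmp_Hom)
  qed
  have uniq: "p = q" if "Q \<in> Obj D" "W \<in> Obj D" "p \<in> Hom D W (F (G Q))" "q \<in> Hom D W (F (G Q))"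
    "Cmp D W (F (G Q)) Q (e Q) p = Cmp D W (F (G Q)) Q (e Q) q" for Q W p q
  proof -
    have *: "r = Cmp D W Q (F (G Q)) (d Q) (Cmp D W (F (G Q)) Q (e Q) r)" if "r \<in> Hom D W (F (G Q))" for r
    proof -
      have "Cmp D W Q (F (G Q)) (d Q) (Cmp D W (F (G Q)) Q (e Q) r)
          = Cmp D W (F (G Q)) (F (G Q)) (Cmp D (F (G Q)) Q (F (G Q)) (d Q) (e Q)) r"
        using that \<open>Q \<in> Obj D\<close> \<open>W \<in> Obj D\<close> FO G eh dh by (intro D.Cmp_assoc) auto
      then show ?thesis using that \<open>Q \<in> Obj D\<close> \<open>W \<in> Obj D\<close> FO G de by (simp add: D.Cmp_Idt_left)
    qed
    show ?thesis using *[OF that(3)] *[OF that(4)] that(5) by simp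
  qed
  define G' where "G' P Q g = lft (G P) (G Q) (conj P Q g)" for P Q g
  have G'H: "G' P Q g \<in> Hom C (G P) (G Q)" and FG': "F' (G P) (G Q) (G' P Q g) = conj P Q g"
    if "P \<in> Obj D" "Q \<in> Obj D" "g \<in> Hom D P Q" for P Q g
    using lft[OF G[OF that(1)] G[OF that(2)] cH[OF that]] unfolding G'_def by auto
  have Gl: "linear_functor D C G G'"
    unfolding linear_functor_def
  proof (intro conjI ballI allI)
    fix P assume P: "P \<in> Obj D"
    show "G P \<in> Obj C" using G[OF P] .
    have "conj P P (Idt D P) = Idt D (F (G P))"
      unfolding conj_def using P FO G eh de by (simp add: D.Cmp_Idt_left)
    then show "G' P P (Idt D P) = Idt C (G P)"
      using P G G'H FG' D.Idt_Hom C.Idt_Hom FI by (intro inj[of "G P" "G P"]) auto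
  next
    fix P Q g assume "P \<in> Obj D" "Q \<in> Obj D" "g \<in> Hom D P Q"
    then show "G' P Q g \<in> Hom C (G P) (G Q)" by (rule G'H)
  next
    fix P Q R f g
    assume P: "P \<in> Obj D" "Q \<in> Obj D" "R \<in> Obj D" and f: "f \<in> Hom D P Q" and g: "g \<in> Hom D Q R"
    have gf: "Cmp D P Q R g f \<in> Hom D P R" using D.Cmp_Hom[OF P f g] .
    note [simp] = P G FO
    have "conj P R (Cmp D P Q R g f) = Cmp D (F (G P)) (F (G Q)) (F (G R)) (conj Q R g) (conj P Q f)"
    proof (rule uniq[OF P(3), of "F (G P)"])
      have "Cmp D (F (G P)) (F (G R)) R (e R) (Cmp D (F (G P)) (F (G Q)) (F (G R)) (conj Q R g) (conj P Q f))
          = Cmp D (F (G P)) (F (G Q)) R (Cmp D (F (G Q)) (F (G R)) R (e R) (conj Q R g)) (conj P Q f)"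
        using f g eh cH by (intro D.Cmp_assoc) auto
      also have "\<dots> = Cmp D (F (G P)) (F (G Q)) R (Cmp D (F (G Q)) Q R g (e Q)) (conj P Q f)"
        using ec[OF P(2,3) g] by simp
      also have "\<dots> = Cmp D (F (G P)) Q R g (Cmp D (F (G P)) (F (G Q)) Q (e Q) (conj P Q f))"
        using f g eh cH by (intro D.Cmp_assoc[symmetric]) auto
      also have "\<dots> = Cmp D (F (G P)) Q R g (Cmp D (F (G P)) P Q f (e P))"
        using ec[OF P(1,2) f] by simp
      also have "\<dots> = Cmp D (F (G P)) P R (Cmp D P Q R g f) (e P)"
        using f g eh by (intro D.Cmp_assoc) auto
      finally show "Cmp D (F (G P)) (F (G R)) R (e R) (conj P R (Cmp D P Q R g f)) =
        Cmp D (F (G P)) (F (G R)) R (e R) (Cmp D (F (G P)) (F (G Q)) (F (G R)) (conj Q R g) (conj P Q f))"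
        using ec[OF P(1,3) gf] by simp
    qed (use P f g gf cH D.Cmp_Hom in auto)
    then show "G' P R (Cmp D P Q R g f) = Cmp C (G P) (G Q) (G R) (G' Q R g) (G' P Q f)"
      using P f g gf G'H FG' FC C.Cmp_Hom by (intro inj[of "G P" "G R"]) auto
  next
    fix P Q f g assume P: "P \<in> Obj D" "Q \<in> Obj D" and f: "f \<in> Hom D P Q" and g: "g \<in> Hom D P Q"
    have fg: "Hadd D P Q f g \<in> Hom D P Q" using D.Hadd_Hom[OF P f g] .
    have "conj P Q (Hadd D P Q f g) = Hadd D (F (G P)) (F (G Q)) (conj P Q f) (conj P Q g)"
      unfolding conj_def using P f g eh dh FO G
      by (subst D.Cmp_Hadd_left D.Cmp_Hadd_right; (intro D.Cmp_Hom)?; auto)+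
    then show "G' P Q (Hadd D P Q f g) = Hadd C (G P) (G Q) (G' P Q f) (G' P Q g)"
      using P f g fg G G'H FG' FA C.Hadd_Hom by (intro inj[of "G P" "G Q"]) auto
  next
    fix P Q c f assume P: "P \<in> Obj D" "Q \<in> Obj D" and f: "f \<in> Hom D P Q"
    have fg: "Hscale D P Q c f \<in> Hom D P Q" using D.Hscale_Hom[OF P f] .
    have "conj P Q (Hscale D P Q c f) = Hscale D (F (G P)) (F (G Q)) c (conj P Q f)"
      unfolding conj_def using P f eh dh FO G
      by (subst D.Cmp_Hscale_left D.Cmp_Hscale_right; (intro D.Cmp_Hom)?; auto)+
    then show "G' P Q (Hscale D P Q c f) = Hscale C (G P) (G Q) c (G' P Q f)"
      using P f fg G G'H FG' FS C.Hscale_Hom by (intro inj[of "G P" "G Q"]) auto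
  qed
  have FGid: "naturally_isomorphic D D (\<lambda>U. F (G U)) (\<lambda>U V f. F' (G U) (G V) (G' U V f)) (\<lambda>U. U) (\<lambda>U V f. f)"
    unfolding naturally_isomorphic_def
    using e ec FG' by (intro exI[of _ e]) auto
  define \<eta> where "\<eta> U = lft (G (F U)) U (e (F U))" for U
  have \<eta>H: "\<eta> U \<in> Hom C (G (F U)) U" and F\<eta>: "F' (G (F U)) U (\<eta> U) = e (F U)" if "U \<in> Obj C" for U
    using lft[OF G[OF FO[OF that]] that eh[OF FO[OF that]]] unfolding \<eta>_def by auto
  have \<eta>iso: "iso_arrow C (G (F U)) U (\<eta> U)" if U: "U \<in> Obj C" for U
  proof -
    note [simp] = U G FO
    define \<theta> where "\<theta> = lft U (G (F U)) (d (F U))"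
    have \<theta>: "\<theta> \<in> Hom C U (G (F U))" "F' U (G (F U)) \<theta> = d (F U)"
      using lft[OF U G[OF FO[OF U]] dh[OF FO[OF U]]] unfolding \<theta>_def by auto
    have "Cmp C (G (F U)) U (G (F U)) \<theta> (\<eta> U) = Idt C (G (F U))"
      using \<theta> \<eta>H[OF U] F\<eta>[OF U] FC FI de C.Cmp_Hom C.Idt_Hom by (intro inj[of "G (F U)" "G (F U)"]) auto
    moreover have "Cmp C U (G (F U)) U (\<eta> U) \<theta> = Idt C U"
      using \<theta> \<eta>H[OF U] F\<eta>[OF U] FC FI ed C.Cmp_Hom C.Idt_Hom by (intro inj[of U U]) auto
    ultimately show ?thesis unfolding iso_arrow_def using \<theta>(1) \<eta>H[OF U] by blast
  qed
  have \<eta>nat: "Cmp C (G (F U)) (G (F V)) V (\<eta> V) (G' (F U) (F V) (F' U V f)) = Cmp C (G (F U)) U V f (\<eta> U)"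
    if U: "U \<in> Obj C" "V \<in> Obj C" and f: "f \<in> Hom C U V" for U V f
  proof (rule inj[of "G (F U)" V])
    note [simp] = U G FO
    have Ff: "F' U V f \<in> Hom D (F U) (F V)" using FH U f by simp
    show "F' (G (F U)) V (Cmp C (G (F U)) (G (F V)) V (\<eta> V) (G' (F U) (F V) (F' U V f))) =
        F' (G (F U)) V (Cmp C (G (F U)) U V f (\<eta> U))"
      using f Ff \<eta>H F\<eta> G'H FG' FC ec by simp
  qed (use U f FH \<eta>H G'H C.Cmp_Hom G FO in auto)
  have GFid: "naturally_isomorphic C C (\<lambda>U. G (F U)) (\<lambda>U V f. G' (F U) (F V) (F' U V f)) (\<lambda>U. U) (\<lambda>U V f. f)"
    unfolding naturally_isomorphic_def
    using \<eta>iso \<eta>nat by (intro exI[of _ \<eta>]) auto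
  show ?thesis
    unfolding linearly_equivalent_def using Fl Gl FGid GFid by blast
qed

lemma linearly_equivalent_sym: "linearly_equivalent C D \<Longrightarrow> linearly_equivalent D C"
  unfolding linearly_equivalent_def by blast

section \<open>Additive maps and graded abelian groups\<close>

definition additive_map :: "('a, 'x) ring_scheme \<Rightarrow> ('b, 'y) ring_scheme \<Rightarrow> ('a \<Rightarrow> 'b) \<Rightarrow> bool" where
  "additive_map G H h \<longleftrightarrow> h \<in> carrier G \<rightarrow> carrier H \<and>
     (\<forall>x\<in>carrier G. \<forall>y\<in>carrier G. h (x \<oplus>\<^bsub>G\<^esub> y) = h x \<oplus>\<^bsub>H\<^esub> h y)"

lemma additive_map_closed: "\<lbrakk>additive_map G H h; x \<in> carrier G\<rbrakk> \<Longrightarrow> h x \<in> carrier H"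
  by (auto simp: additive_map_def)

lemma additive_map_add:
  "\<lbrakk>additive_map G H h; x \<in> carrier G; y \<in> carrier G\<rbrakk> \<Longrightarrow> h (x \<oplus>\<^bsub>G\<^esub> y) = h x \<oplus>\<^bsub>H\<^esub> h y"
  by (auto simp: additive_map_def)

lemma (in abelian_group) add_eq_self_imp_zero:
  assumes "x \<in> carrier G" "y \<in> carrier G" "x \<oplus> y = x"
  shows "y = \<zero>"
  using assms add.l_cancel[of x y \<zero>] by simp

lemma additive_map_zero:
  assumes "abelian_group G" "abelian_group H" "additive_map G H h"
  shows "h \<zero>\<^bsub>G\<^esub> = \<zero>\<^bsub>H\<^esub>"
proof -
  interpret G: abelian_group G by fact
  interpret H: abelian_group H by fact
  have "h \<zero>\<^bsub>G\<^esub> \<oplus>\<^bsub>H\<^esub> h \<zero>\<^bsub>G\<^esub> = h \<zero>\<^bsub>G\<^esub>"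
    using additive_map_add[OF assms(3), of "\<zero>\<^bsub>G\<^esub>" "\<zero>\<^bsub>G\<^esub>"] by simp
  then show ?thesis
    using H.add_eq_self_imp_zero additive_map_closed[OF assms(3)] by blast
qed

lemma additive_map_minus:
  assumes "abelian_group G" "abelian_group H" "additive_map G H h" "x \<in> carrier G"
  shows "h (\<ominus>\<^bsub>G\<^esub> x) = \<ominus>\<^bsub>H\<^esub> h x"
proof -
  interpret G: abelian_group G by fact
  interpret H: abelian_group H by fact
  have "h (\<ominus>\<^bsub>G\<^esub> x) \<oplus>\<^bsub>H\<^esub> h x = \<zero>\<^bsub>H\<^esub>"
    using additive_map_add[OF assms(3), of "\<ominus>\<^bsub>G\<^esub> x" x] additive_map_zero[OF assms(1-3)] assms(4)
    by (simp add: G.l_neg)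
  then show ?thesis
    using H.minus_equality additive_map_closed[OF assms(3)] assms(4) by (metis G.a_inv_closed)
qed

lemma additive_map_finsum:
  assumes G: "abelian_group G" and H: "abelian_group H" and h: "additive_map G H h"
    and f: "f \<in> A \<rightarrow> carrier G"
  shows "h (finsum G f A) = finsum H (\<lambda>x. h (f x)) A"
proof -
  interpret G: abelian_group G by fact
  interpret H: abelian_group H by fact
  show ?thesis
  proof (cases "finite A")
    case True
    then show ?thesis using f
    proof (induction A)
      case (insert a A)
      then show ?case
        using additive_map_closed[OF h] additive_map_add[OF h] G.finsum_closed
        by (subst G.finsum_insert) (auto simp: Pi_iff H.finsum_insert)
    qed (simp add: additive_map_zero[OF G H h])
  qed (simp add: additive_map_zero[OF G H h] G.finsum_infinite H.finsum_infinite)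
qed

lemma (in abelian_group) finsum_mono_neutral:
  assumes "finite B" "A \<subseteq> B" "\<And>x. x \<in> B - A \<Longrightarrow> f x = \<zero>" "f \<in> A \<rightarrow> carrier G"
  shows "finsum G f B = finsum G f A"
  by (rule add.finprod_mono_neutral_cong_right) (use assms in \<open>auto simp: Pi_iff\<close>)

locale graded_group = abelian_group M for M :: "('m, 'x) ring_scheme" (structure) +
  fixes C :: "'g \<Rightarrow> 'm set"
  assumes C_subgroup: "additive_subgroup (C g) M"
    and C_direct_sum: "m \<in> carrier M \<Longrightarrow>
          \<exists>!c. (\<forall>\<gamma>. c \<gamma> \<in> C \<gamma>) \<and> finite {\<gamma>. c \<gamma> \<noteq> \<zero>} \<and> m = (\<Oplus>\<gamma>\<in>{\<gamma>. c \<gamma> \<noteq> \<zero>}. c \<gamma>)"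
begin

definition part :: "'m \<Rightarrow> 'g \<Rightarrow> 'm" where
  "part m = (THE c. (\<forall>\<gamma>. c \<gamma> \<in> C \<gamma>) \<and> finite {\<gamma>. c \<gamma> \<noteq> \<zero>} \<and> m = (\<Oplus>\<gamma>\<in>{\<gamma>. c \<gamma> \<noteq> \<zero>}. c \<gamma>))"

definition supp :: "'m \<Rightarrow> 'g set" where "supp m = {g. part m g \<noteq> \<zero>}"

lemma C_carrier: "m \<in> C g \<Longrightarrow> m \<in> carrier M"
  using C_subgroup additive_subgroup.a_Hcarr by metis

lemma C_zero: "\<zero> \<in> C g"
  using C_subgroup additive_subgroup.zero_closed by metis

lemma C_add: "m \<in> C g \<Longrightarrow> n \<in> C g \<Longrightarrow> m \<oplus> n \<in> C g"
  using C_subgroup additive_subgroup.a_closed by metis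

lemma C_minus: "m \<in> C g \<Longrightarrow> \<ominus> m \<in> C g"
  using C_subgroup[of g] abelian_group_axioms
  by (metis a_inv_def additive_subgroup.a_subgroup subgroup.m_inv_closed)

lemma C_finsum: "f \<in> A \<rightarrow> C g \<Longrightarrow> finsum M f A \<in> C g"
proof (induction A rule: infinite_finite_induct)
  case (insert x F)
  then show ?case using C_carrier C_add by (subst finsum_insert) (auto simp: Pi_iff)
qed (auto simp: C_zero finsum_infinite)

lemma part_spec:
  assumes "m \<in> carrier M"
  shows part_in: "part m g \<in> C g" and finite_supp: "finite (supp m)"
    and sum_part: "m = (\<Oplus>g\<in>supp m. part m g)"
  using theI'[OF C_direct_sum[OF assms]] unfolding part_def[symmetric] supp_def by auto

lemma part_carrier: "m \<in> carrier M \<Longrightarrow> part m g \<in> carrier M"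
  using part_in C_carrier by blast

lemma sum_part':
  assumes "m \<in> carrier M" "finite B" "supp m \<subseteq> B"
  shows "m = (\<Oplus>g\<in>B. part m g)"
proof -
  have "(\<Oplus>g\<in>B. part m g) = (\<Oplus>g\<in>supp m. part m g)"
    by (rule finsum_mono_neutral) (use assms part_carrier in \<open>auto simp: supp_def\<close>)
  then show ?thesis using sum_part[OF assms(1)] by simp
qed

lemma part_unique:
  assumes c: "\<And>g. c g \<in> C g" and F: "finite F" "\<And>g. g \<notin> F \<Longrightarrow> c g = \<zero>" and m: "m = (\<Oplus>g\<in>F. c g)"
  shows "part m = c"
proof -
  have sub: "{g. c g \<noteq> \<zero>} \<subseteq> F" using F by auto
  have cc: "c g \<in> carrier M" for g using c C_carrier by blast
  have mc: "m \<in> carrier M" unfolding m using cc by (intro finsum_closed) auto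
  have "m = (\<Oplus>g\<in>{g. c g \<noteq> \<zero>}. c g)"
    unfolding m by (rule finsum_mono_neutral) (use F sub cc in auto)
  then show ?thesis
    unfolding part_def using c finite_subset[OF sub F(1)]
    by (intro the1_equality[OF C_direct_sum[OF mc]]) auto
qed

lemma part_add:
  assumes m: "m \<in> carrier M" and n: "n \<in> carrier M"
  shows "part (m \<oplus> n) g = part m g \<oplus> part n g"
proof -
  let ?F = "supp m \<union> supp n"
  have fin: "finite ?F" using finite_supp m n by auto
  have "m \<oplus> n = (\<Oplus>g\<in>?F. part m g) \<oplus> (\<Oplus>g\<in>?F. part n g)"
    using sum_part'[OF m fin] sum_part'[OF n fin] by simp
  also have "\<dots> = (\<Oplus>g\<in>?F. part m g \<oplus> part n g)"
    using part_carrier m n by (intro finsum_addf[symmetric]) auto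
  finally have "part (m \<oplus> n) = (\<lambda>g. part m g \<oplus> part n g)"
    using part_in m n C_add fin by (intro part_unique[of _ ?F]) (auto simp: supp_def)
  then show ?thesis by simp
qed

lemma part_homogeneous:
  assumes "m \<in> C g"
  shows "part m h = (if h = g then m else \<zero>)"
proof -
  have "part m = (\<lambda>h. if h = g then m else \<zero>)"
    using assms C_zero C_carrier by (intro part_unique[of _ "{g}"]) auto
  then show ?thesis by simp
qed

lemma part_zero: "part \<zero> g = \<zero>"
  using part_homogeneous[OF C_zero[of g], of g] by simp

lemma supp_homogeneous: "m \<in> C g \<Longrightarrow> supp m \<subseteq> {g}"
  by (auto simp: supp_def part_homogeneous)

lemma part_additive_map: "additive_map M M (\<lambda>m. part m g)"
  unfolding additive_map_def using part_carrier part_add by auto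

lemma eq_by_parts:
  assumes "m \<in> carrier M" "n \<in> carrier M" "\<And>g. part m g = part n g"
  shows "m = n"
  using sum_part[OF assms(1)] sum_part[OF assms(2)] assms(3) by (simp add: supp_def)

lemma homogeneous_induct [consumes 1, case_names add homogeneous]:
  assumes m: "m \<in> carrier M"
    and add: "\<And>m n. \<lbrakk>m \<in> carrier M; n \<in> carrier M; P m; P n\<rbrakk> \<Longrightarrow> P (m \<oplus> n)"
    and hom: "\<And>g m. m \<in> C g \<Longrightarrow> P m"
  shows "P m"
proof -
  have "P (finsum M f A)" if "finite A" "\<And>a. a \<in> A \<Longrightarrow> f a \<in> carrier M" "\<And>a. a \<in> A \<Longrightarrow> P (f a)"
    for f and A :: "'g set"
    using that
  proof (induction A)
    case empty
    then show ?case using hom C_zero by simp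
  next
    case (insert a A)
    then show ?case using add by (subst finsum_insert) (auto simp: Pi_iff)
  qed
  from this[of "supp m" "part m", OF finite_supp[OF m] part_carrier[OF m] hom[OF part_in[OF m]]]
  show ?thesis by (simp flip: sum_part[OF m])
qed

text \<open>The universal property of the direct sum of the components.\<close>

definition extend :: "('n, 'y) ring_scheme \<Rightarrow> ('g \<Rightarrow> 'm \<Rightarrow> 'n) \<Rightarrow> 'm \<Rightarrow> 'n" where
  "extend N \<theta> m = (\<Oplus>\<^bsub>N\<^esub>g\<in>supp m. \<theta> g (part m g))"

lemma
  assumes N: "abelian_group N"
    and closed: "\<And>g m. m \<in> C g \<Longrightarrow> \<theta> g m \<in> carrier N"
    and add: "\<And>g m n. \<lbrakk>m \<in> C g; n \<in> C g\<rbrakk> \<Longrightarrow> \<theta> g (m \<oplus> n) = \<theta> g m \<oplus>\<^bsub>N\<^esub> \<theta> g n"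
  shows extend_additive: "additive_map M N (extend N \<theta>)"
    and extend_homogeneous: "m \<in> C g \<Longrightarrow> extend N \<theta> m = \<theta> g m"
    and extend_closed: "m \<in> carrier M \<Longrightarrow> extend N \<theta> m \<in> carrier N"
proof -
  interpret N: abelian_group N by fact
  have z: "\<theta> g \<zero> = \<zero>\<^bsub>N\<^esub>" for g
    using add[OF C_zero C_zero, of g, symmetric] closed[OF C_zero, of g]
    by (intro N.add_eq_self_imp_zero[of "\<theta> g \<zero>"]) simp_all
  have ext: "extend N \<theta> m = (\<Oplus>\<^bsub>N\<^esub>g\<in>B. \<theta> g (part m g))" if "m \<in> carrier M" "finite B" "supp m \<subseteq> B" for m B
    unfolding extend_def
    by (rule N.finsum_mono_neutral[symmetric])
      (use that z closed part_in in \<open>auto simp: supp_def\<close>)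
  have cl: "extend N \<theta> m \<in> carrier N" if "m \<in> carrier M" for m
    unfolding extend_def using that closed part_in by (intro N.finsum_closed) auto
  then show "m \<in> carrier M \<Longrightarrow> extend N \<theta> m \<in> carrier N" .
  have "extend N \<theta> (m \<oplus> n) = extend N \<theta> m \<oplus>\<^bsub>N\<^esub> extend N \<theta> n" if m: "m \<in> carrier M" and n: "n \<in> carrier M" for m n
  proof -
    let ?B = "supp m \<union> supp n"
    have fin: "finite ?B" using finite_supp m n by auto
    have sub: "supp (m \<oplus> n) \<subseteq> ?B" using m n by (auto simp: supp_def part_add)
    have "extend N \<theta> (m \<oplus> n) = (\<Oplus>\<^bsub>N\<^esub>g\<in>?B. \<theta> g (part m g) \<oplus>\<^bsub>N\<^esub> \<theta> g (part n g))"
      using ext[OF add.m_closed[OF m n] fin sub] m n part_in by (simp add: part_add add)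
    also have "\<dots> = (\<Oplus>\<^bsub>N\<^esub>g\<in>?B. \<theta> g (part m g)) \<oplus>\<^bsub>N\<^esub> (\<Oplus>\<^bsub>N\<^esub>g\<in>?B. \<theta> g (part n g))"
      using part_in m n closed by (intro N.finsum_addf) auto
    finally show ?thesis using ext[OF m fin] ext[OF n fin] by simp
  qed
  then show "additive_map M N (extend N \<theta>)" unfolding additive_map_def using cl by auto
  assume m: "m \<in> C g"
  have "extend N \<theta> m = (\<Oplus>\<^bsub>N\<^esub>h\<in>{g}. \<theta> h (part m h))"
    using ext[OF C_carrier[OF m] _ supp_homogeneous[OF m]] by simp
  then show "extend N \<theta> m = \<theta> g m" using closed[OF m] m by (simp add: part_homogeneous N.finsum_insert)
qed

end

text \<open>A direct sum decomposition can be read off from a family of additive projections.\<close>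

lemma graded_groupI:
  assumes M: "abelian_group M" and sub: "\<And>g. additive_subgroup (C g) M"
    and proj: "\<And>g. additive_map M M (\<pi> g)"
    and proj_in: "\<And>g m. m \<in> carrier M \<Longrightarrow> \<pi> g m \<in> C g"
    and proj_same: "\<And>g m. m \<in> C g \<Longrightarrow> \<pi> g m = m"
    and proj_other: "\<And>g h m. m \<in> C g \<Longrightarrow> h \<noteq> g \<Longrightarrow> \<pi> h m = \<zero>\<^bsub>M\<^esub>"
    and fin: "\<And>m. m \<in> carrier M \<Longrightarrow> finite {g. \<pi> g m \<noteq> \<zero>\<^bsub>M\<^esub>}"
    and sum: "\<And>m. m \<in> carrier M \<Longrightarrow> m = (\<Oplus>\<^bsub>M\<^esub>g\<in>{g. \<pi> g m \<noteq> \<zero>\<^bsub>M\<^esub>}. \<pi> g m)"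
  shows "graded_group M C"
proof -
  interpret M: abelian_group M by fact
  have Cc: "m \<in> carrier M" if "m \<in> C g" for g m using sub additive_subgroup.a_Hcarr that by metis
  show ?thesis
  proof (intro graded_group.intro graded_group_axioms.intro M sub)
    fix m assume m: "m \<in> carrier M"
    show "\<exists>!c. (\<forall>\<gamma>. c \<gamma> \<in> C \<gamma>) \<and> finite {\<gamma>. c \<gamma> \<noteq> \<zero>\<^bsub>M\<^esub>} \<and> m = (\<Oplus>\<^bsub>M\<^esub>\<gamma>\<in>{\<gamma>. c \<gamma> \<noteq> \<zero>\<^bsub>M\<^esub>}. c \<gamma>)"
    proof (rule ex1I[of _ "\<lambda>g. \<pi> g m"])
      show "(\<forall>\<gamma>. \<pi> \<gamma> m \<in> C \<gamma>) \<and> finite {\<gamma>. \<pi> \<gamma> m \<noteq> \<zero>\<^bsub>M\<^esub>} \<and> m = (\<Oplus>\<^bsub>M\<^esub>\<gamma>\<in>{\<gamma>. \<pi> \<gamma> m \<noteq> \<zero>\<^bsub>M\<^esub>}. \<pi> \<gamma> m)"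
        by (intro conjI allI proj_in[OF m] fin[OF m] sum[OF m])
    next
      fix c assume c: "(\<forall>\<gamma>. c \<gamma> \<in> C \<gamma>) \<and> finite {\<gamma>. c \<gamma> \<noteq> \<zero>\<^bsub>M\<^esub>} \<and> m = (\<Oplus>\<^bsub>M\<^esub>\<gamma>\<in>{\<gamma>. c \<gamma> \<noteq> \<zero>\<^bsub>M\<^esub>}. c \<gamma>)"
      let ?A = "{\<gamma>. c \<gamma> \<noteq> \<zero>\<^bsub>M\<^esub>}"
      have cc: "c \<gamma> \<in> carrier M" and c1: "\<pi> \<gamma> (c \<gamma>) = c \<gamma>" for \<gamma>
        using c Cc[of "c \<gamma>" \<gamma>] proj_same by auto
      have c2: "\<pi> g (c \<gamma>) = \<zero>\<^bsub>M\<^esub>" if "g \<noteq> \<gamma>" for g \<gamma> using c proj_other that by blast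
      show "c = (\<lambda>g. \<pi> g m)"
      proof
        fix g
        have "\<pi> g m = (\<Oplus>\<^bsub>M\<^esub>\<gamma>\<in>?A. \<pi> g (c \<gamma>))"
          using additive_map_finsum[OF M M proj, of c ?A g] c cc by auto
        also have "\<dots> = (\<Oplus>\<^bsub>M\<^esub>\<gamma>\<in>?A. if g = \<gamma> then c \<gamma> else \<zero>\<^bsub>M\<^esub>)"
          using cc c1 c2 by (intro M.finsum_cong') auto
        also have "\<dots> = c g"
        proof (cases "g \<in> ?A")
          case True
          then show ?thesis
            using c cc M.finsum_singleton[of g ?A c] by auto
        next
          case False
          then have "(\<Oplus>\<^bsub>M\<^esub>\<gamma>\<in>?A. if g = \<gamma> then c \<gamma> else \<zero>\<^bsub>M\<^esub>) = (\<Oplus>\<^bsub>M\<^esub>\<gamma>\<in>?A. \<zero>\<^bsub>M\<^esub>)"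
            by (intro M.finsum_cong') auto
          then show ?thesis using False by simp
        qed
        finally show "c g = \<pi> g m" by simp
      qed
    qed
  qed
qed

section \<open>Graded rings and graded modules\<close>

locale graded_ring = ring R + RG: graded_group R "hcomp R"
  for R :: "('a, 'g::ab_group_add, 'k) gr_alg" (structure) +
  assumes one_deg: "\<one> \<in> hcomp R 0"
    and mult_deg: "\<lbrakk>a \<in> hcomp R g; b \<in> hcomp R h\<rbrakk> \<Longrightarrow> a \<otimes> b \<in> hcomp R (g + h)"
    and scal_deg: "scal R c \<in> hcomp R 0"
    and scal_central: "r \<in> carrier R \<Longrightarrow> scal R c \<otimes> r = r \<otimes> scal R c"

sublocale graded_right_module \<subseteq> MG: graded_group M "gcomp M"
  by (intro graded_group.intro graded_group_axioms.intro M.abelian_group_axioms gcomp_subgroup direct_sum)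

context right_module
begin

lemma ract_additive_left: "r \<in> carrier R \<Longrightarrow> additive_map M M (\<lambda>m. ract M m r)"
  unfolding additive_map_def using ract_closed ract_add_left by auto

lemma ract_additive_right: "m \<in> carrier M \<Longrightarrow> additive_map R M (ract M m)"
  unfolding additive_map_def using ract_closed ract_add_right by auto

lemma ract_zero_left: "r \<in> carrier R \<Longrightarrow> ract M \<zero>\<^bsub>M\<^esub> r = \<zero>\<^bsub>M\<^esub>"
  using additive_map_zero[OF M.abelian_group_axioms M.abelian_group_axioms ract_additive_left] by simp

lemma ract_zero_right: "m \<in> carrier M \<Longrightarrow> ract M m \<zero>\<^bsub>R\<^esub> = \<zero>\<^bsub>M\<^esub>"
  using additive_map_zero[OF R.abelian_group_axioms M.abelian_group_axioms ract_additive_right] by simp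

end

text \<open>
  An action of a graded ring on a graded group need only be given, and its laws only be checked, on
  homogeneous elements.
\<close>

locale graded_action = S: graded_ring S + N: graded_group N "gcomp N"
  for S :: "('b, 'h::ab_group_add, 'k) gr_alg" and N :: "('b, 'm, 'h) gr_mod" +
  fixes \<theta> :: "'h \<Rightarrow> 'h \<Rightarrow> 'm \<Rightarrow> 'b \<Rightarrow> 'm"
  assumes \<theta>_deg: "\<lbrakk>m \<in> gcomp N n; a \<in> hcomp S j\<rbrakk> \<Longrightarrow> \<theta> n j m a \<in> gcomp N (n + j)"
    and \<theta>_add_left: "\<lbrakk>m \<in> gcomp N n; m' \<in> gcomp N n; a \<in> hcomp S j\<rbrakk>
      \<Longrightarrow> \<theta> n j (m \<oplus>\<^bsub>N\<^esub> m') a = \<theta> n j m a \<oplus>\<^bsub>N\<^esub> \<theta> n j m' a"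
    and \<theta>_add_right: "\<lbrakk>m \<in> gcomp N n; a \<in> hcomp S j; a' \<in> hcomp S j\<rbrakk>
      \<Longrightarrow> \<theta> n j m (a \<oplus>\<^bsub>S\<^esub> a') = \<theta> n j m a \<oplus>\<^bsub>N\<^esub> \<theta> n j m a'"
    and \<theta>_assoc: "\<lbrakk>m \<in> gcomp N n; a \<in> hcomp S j; b \<in> hcomp S l\<rbrakk>
      \<Longrightarrow> \<theta> n (j + l) m (a \<otimes>\<^bsub>S\<^esub> b) = \<theta> (n + j) l (\<theta> n j m a) b"
    and \<theta>_one: "m \<in> gcomp N n \<Longrightarrow> \<theta> n 0 m \<one>\<^bsub>S\<^esub> = m"
begin

definition act :: "'m \<Rightarrow> 'b \<Rightarrow> 'm" where
  "act m a = N.extend N (\<lambda>n m. S.RG.extend N (\<lambda>j. \<theta> n j m) a) m"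

lemma inner:
  assumes "m \<in> gcomp N n"
  shows "additive_map S N (S.RG.extend N (\<lambda>j. \<theta> n j m))"
    and "a \<in> hcomp S j \<Longrightarrow> S.RG.extend N (\<lambda>j. \<theta> n j m) a = \<theta> n j m a"
    and "r \<in> carrier S \<Longrightarrow> S.RG.extend N (\<lambda>j. \<theta> n j m) r \<in> carrier N"
proof -
  have cl: "\<theta> n j m a \<in> carrier N" if "a \<in> hcomp S j" for j a
    using N.C_carrier[OF \<theta>_deg[OF assms that]] .
  note ext = N.abelian_group_axioms cl \<theta>_add_right[OF assms]
  show "additive_map S N (S.RG.extend N (\<lambda>j. \<theta> n j m))" by (rule S.RG.extend_additive[OF ext])
  show "a \<in> hcomp S j \<Longrightarrow> S.RG.extend N (\<lambda>j. \<theta> n j m) a = \<theta> n j m a"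
    by (rule S.RG.extend_homogeneous[OF ext])
  show "r \<in> carrier S \<Longrightarrow> S.RG.extend N (\<lambda>j. \<theta> n j m) r \<in> carrier N"
    by (rule S.RG.extend_closed[OF ext])
qed

lemma inner_add_left:
  assumes m: "m \<in> gcomp N n" "m' \<in> gcomp N n" and r: "r \<in> carrier S"
  shows "S.RG.extend N (\<lambda>j. \<theta> n j (m \<oplus>\<^bsub>N\<^esub> m')) r =
    S.RG.extend N (\<lambda>j. \<theta> n j m) r \<oplus>\<^bsub>N\<^esub> S.RG.extend N (\<lambda>j. \<theta> n j m') r"
  using r
proof (induction rule: S.RG.homogeneous_induct)
  case (add r s)
  then show ?case
    using additive_map_add[OF inner(1)] m N.C_add[OF m] inner(3)[OF m(1)] inner(3)[OF m(2)]
    by (simp add: N.add.m_ac)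
next
  case (homogeneous j a)
  then show ?case using inner(2) m N.C_add[OF m] \<theta>_add_left by simp
qed

lemma act_left_additive: "r \<in> carrier S \<Longrightarrow> additive_map N N (\<lambda>m. act m r)"
  unfolding act_def by (rule N.extend_additive[OF N.abelian_group_axioms inner(3) inner_add_left])

lemma act_closed: "m \<in> carrier N \<Longrightarrow> r \<in> carrier S \<Longrightarrow> act m r \<in> carrier N"
  using additive_map_closed[OF act_left_additive] .

lemma act_left_homogeneous:
  "m \<in> gcomp N n \<Longrightarrow> r \<in> carrier S \<Longrightarrow> act m r = S.RG.extend N (\<lambda>j. \<theta> n j m) r"
  unfolding act_def by (rule N.extend_homogeneous[OF N.abelian_group_axioms inner(3) inner_add_left])

lemma act_homogeneous: "m \<in> gcomp N n \<Longrightarrow> a \<in> hcomp S j \<Longrightarrow> act m a = \<theta> n j m a"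
  using act_left_homogeneous S.RG.C_carrier inner(2) by simp

lemma act_add_right:
  assumes m: "m \<in> carrier N" and r: "r \<in> carrier S" "s \<in> carrier S"
  shows "act m (r \<oplus>\<^bsub>S\<^esub> s) = act m r \<oplus>\<^bsub>N\<^esub> act m s"
  using m
proof (induction rule: N.homogeneous_induct)
  case (add m n)
  then show ?case
    using r additive_map_add[OF act_left_additive] act_closed by (simp add: N.add.m_ac)
next
  case (homogeneous n m)
  then show ?case using r additive_map_add[OF inner(1)] by (simp add: act_left_homogeneous)
qed

lemma act_assoc:
  assumes m: "m \<in> carrier N" and r: "r \<in> carrier S" and s: "s \<in> carrier S"
  shows "act m (r \<otimes>\<^bsub>S\<^esub> s) = act (act m r) s"
  using m
proof (induction rule: N.homogeneous_induct)
  case (add m n)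
  then show ?case
    using r s additive_map_add[OF act_left_additive] act_closed by simp
next
  case (homogeneous n m)
  note m = homogeneous N.C_carrier[OF homogeneous]
  show ?case using r
  proof (induction rule: S.RG.homogeneous_induct)
    case (add r r')
    then show ?case
      using s m additive_map_add[OF act_left_additive] act_closed by (simp add: S.l_distr act_add_right)
  next
    case (homogeneous j a)
    note a = homogeneous S.RG.C_carrier[OF homogeneous]
    show ?case using s
    proof (induction rule: S.RG.homogeneous_induct)
      case (add s s')
      then show ?case using a m act_closed by (simp add: S.r_distr act_add_right)
    next
      case (homogeneous l b)
      show ?case
        using act_homogeneous[OF m(1) S.mult_deg[OF a(1) homogeneous]] act_homogeneous[OF m(1) a(1)]
          act_homogeneous[OF \<theta>_deg[OF m(1) a(1)] homogeneous] \<theta>_assoc[OF m(1) a(1) homogeneous] by simp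
    qed
  qed
qed

lemma act_one: "m \<in> carrier N \<Longrightarrow> act m \<one>\<^bsub>S\<^esub> = m"
proof (induction rule: N.homogeneous_induct)
  case (add m n)
  then show ?case using additive_map_add[OF act_left_additive] by simp
next
  case (homogeneous n m)
  then show ?case using act_homogeneous[OF homogeneous S.one_deg] \<theta>_one[OF homogeneous] by simp
qed

end

lemma graded_right_moduleI:
  assumes R: "ring R" and M: "graded_group M (gcomp M)"
    and "\<And>m r. \<lbrakk>m \<in> carrier M; r \<in> carrier R\<rbrakk> \<Longrightarrow> ract M m r \<in> carrier M"
    and "\<And>m n r. \<lbrakk>m \<in> carrier M; n \<in> carrier M; r \<in> carrier R\<rbrakk> \<Longrightarrow>
          ract M (m \<oplus>\<^bsub>M\<^esub> n) r = ract M m r \<oplus>\<^bsub>M\<^esub> ract M n r"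
    and "\<And>m r s. \<lbrakk>m \<in> carrier M; r \<in> carrier R; s \<in> carrier R\<rbrakk> \<Longrightarrow>
          ract M m (r \<oplus>\<^bsub>R\<^esub> s) = ract M m r \<oplus>\<^bsub>M\<^esub> ract M m s"
    and "\<And>m r s. \<lbrakk>m \<in> carrier M; r \<in> carrier R; s \<in> carrier R\<rbrakk> \<Longrightarrow>
          ract M m (r \<otimes>\<^bsub>R\<^esub> s) = ract M (ract M m r) s"
    and "\<And>m. m \<in> carrier M \<Longrightarrow> ract M m \<one>\<^bsub>R\<^esub> = m"
    and "\<And>\<gamma> \<delta> m r. \<lbrakk>m \<in> gcomp M \<gamma>; r \<in> hcomp R \<delta>\<rbrakk> \<Longrightarrow> ract M m r \<in> gcomp M (\<gamma> + \<delta>)"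
  shows "graded_right_module R M"
proof -
  interpret R: ring R by fact
  interpret M: graded_group M "gcomp M" by fact
  have r: "right_module R M"
    by (intro right_module.intro right_module_axioms.intro R M.abelian_group_axioms) (fact assms)+
  show ?thesis
    by (intro graded_right_module.intro graded_right_module_axioms.intro r M.C_subgroup M.C_direct_sum)
      (use assms in auto)
qed

section \<open>Homomorphisms of graded modules\<close>

lemma gr_hom_additive: "\<phi> \<in> gr_hom R M N \<Longrightarrow> additive_map M N \<phi>"
  by (auto simp: gr_hom_def additive_map_def PiE_def)

lemma gr_hom_closed: "\<lbrakk>\<phi> \<in> gr_hom R M N; m \<in> carrier M\<rbrakk> \<Longrightarrow> \<phi> m \<in> carrier N"
  by (auto simp: gr_hom_def)

lemma gr_hom_add: "\<lbrakk>\<phi> \<in> gr_hom R M N; m \<in> carrier M; n \<in> carrier M\<rbrakk> \<Longrightarrow> \<phi> (m \<oplus>\<^bsub>M\<^esub> n) = \<phi> m \<oplus>\<^bsub>N\<^esub> \<phi> n"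
  by (auto simp: gr_hom_def)

lemma gr_hom_ract: "\<lbrakk>\<phi> \<in> gr_hom R M N; m \<in> carrier M; r \<in> carrier R\<rbrakk> \<Longrightarrow> \<phi> (ract M m r) = ract N (\<phi> m) r"
  by (auto simp: gr_hom_def)

lemma gr_hom_deg: "\<lbrakk>\<phi> \<in> gr_hom R M N; m \<in> gcomp M g\<rbrakk> \<Longrightarrow> \<phi> m \<in> gcomp N g"
  by (auto simp: gr_hom_def image_subset_iff)

lemma gr_hom_extensional: "\<phi> \<in> gr_hom R M N \<Longrightarrow> \<phi> \<in> extensional (carrier M)"
  by (auto simp: gr_hom_def PiE_def)

lemma gr_homI:
  assumes "\<phi> \<in> extensional (carrier M)" and "\<And>m. m \<in> carrier M \<Longrightarrow> \<phi> m \<in> carrier N"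
    and "\<And>m n. \<lbrakk>m \<in> carrier M; n \<in> carrier M\<rbrakk> \<Longrightarrow> \<phi> (m \<oplus>\<^bsub>M\<^esub> n) = \<phi> m \<oplus>\<^bsub>N\<^esub> \<phi> n"
    and "\<And>m r. \<lbrakk>m \<in> carrier M; r \<in> carrier R\<rbrakk> \<Longrightarrow> \<phi> (ract M m r) = ract N (\<phi> m) r"
    and "\<And>g m. m \<in> gcomp M g \<Longrightarrow> \<phi> m \<in> gcomp N g"
  shows "\<phi> \<in> gr_hom R M N"
  unfolding gr_hom_def using assms by (auto simp: PiE_def)

text \<open>
  Linearity extends from homogeneous elements because both arguments are sums of their homogeneous parts.
\<close>

lemma gr_hom_homogeneousI:
  assumes "graded_ring R" and "graded_right_module R M" and "graded_right_module R N"
    and ext: "\<phi> \<in> extensional (carrier M)" and add: "additive_map M N \<phi>"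
    and deg: "\<And>g m. m \<in> gcomp M g \<Longrightarrow> \<phi> m \<in> gcomp N g"
    and lin: "\<And>g m h r. m \<in> gcomp M g \<Longrightarrow> r \<in> hcomp R h \<Longrightarrow> \<phi> (ract M m r) = ract N (\<phi> m) r"
  shows "\<phi> \<in> gr_hom R M N"
proof -
  interpret R: graded_ring R by fact
  interpret M: graded_right_module R M by fact
  interpret N: graded_right_module R N by fact
  note cl = additive_map_closed[OF add] and ad = additive_map_add[OF add]
  have "\<phi> (ract M m r) = ract N (\<phi> m) r" if m: "m \<in> carrier M" and r: "r \<in> carrier R" for m r
    using m
  proof (induction rule: M.MG.homogeneous_induct)
    case (add m n)
    then show ?case using cl ad r M.ract_closed by (simp add: M.ract_add_left N.ract_add_left)
  next
    case (homogeneous g m)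
    note m = homogeneous M.MG.C_carrier[OF homogeneous]
    show ?case using r
    proof (induction rule: R.RG.homogeneous_induct)
      case (add m n)
      then show ?case using cl ad m M.ract_closed by (simp add: M.ract_add_right N.ract_add_right)
    next
      case (homogeneous h r)
      then show ?case using lin m by blast
    qed
  qed
  then show ?thesis
    unfolding gr_hom_def using ext cl ad deg by (auto simp: PiE_def)
qed

lemma gr_hom_eqI:
  assumes "graded_right_module R M" "graded_right_module R N" "\<phi> \<in> gr_hom R M N" "\<psi> \<in> gr_hom R M N"
    and eq: "\<And>g m. m \<in> gcomp M g \<Longrightarrow> \<phi> m = \<psi> m"
  shows "\<phi> = \<psi>"
proof (rule extensionalityI[OF gr_hom_extensional gr_hom_extensional])
  interpret M: graded_right_module R M by fact
  fix m assume "m \<in> carrier M"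
  then show "\<phi> m = \<psi> m"
  proof (induction rule: M.MG.homogeneous_induct)
    case (add m n)
    then show ?case using gr_hom_add assms(3,4) by metis
  qed (use eq in auto)
qed (use assms in auto)

lemma gr_hom_inverse:
  assumes "graded_right_module R M" "graded_right_module R N" and \<phi>: "\<phi> \<in> gr_hom R M N"
    and b: "bij_betw \<phi> (carrier M) (carrier N)"
  shows "(\<lambda>n\<in>carrier N. inv_into (carrier M) \<phi> n) \<in> gr_hom R N M"
proof -
  interpret M: graded_right_module R M by fact
  interpret N: graded_right_module R N by fact
  let ?i = "inv_into (carrier M) \<phi>"
  have ic: "?i n \<in> carrier M" and fi: "\<phi> (?i n) = n" if "n \<in> carrier N" for n
    using that b by (auto simp: bij_betw_def inv_into_into f_inv_into_f)
  have inv: "?i n = m" if "m \<in> carrier M" "\<phi> m = n" for m n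
    using that b by (auto simp: bij_betw_def inv_into_f_f)
  have deg: "?i n \<in> gcomp M g" if n: "n \<in> gcomp N g" for n g
  proof -
    have nc: "n \<in> carrier N" using N.MG.C_carrier n .
    let ?m = "?i n"
    have p: "\<phi> (M.MG.part ?m h) = N.MG.part n h" for h
    proof -
      have "n = \<phi> (\<Oplus>\<^bsub>M\<^esub>h\<in>M.MG.supp ?m. M.MG.part ?m h)"
        using M.MG.sum_part[OF ic[OF nc]] fi[OF nc] by simp
      also have "\<dots> = (\<Oplus>\<^bsub>N\<^esub>h\<in>M.MG.supp ?m. \<phi> (M.MG.part ?m h))"
        using M.MG.part_carrier ic nc
        by (intro additive_map_finsum[OF M.M.abelian_group_axioms N.M.abelian_group_axioms gr_hom_additive[OF \<phi>]]) auto
      finally have "N.MG.part n = (\<lambda>h. \<phi> (M.MG.part ?m h))"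
        using gr_hom_deg[OF \<phi> M.MG.part_in[OF ic[OF nc]]] M.MG.finite_supp[OF ic[OF nc]]
          additive_map_zero[OF M.M.abelian_group_axioms N.M.abelian_group_axioms gr_hom_additive[OF \<phi>]]
        by (intro N.MG.part_unique[of _ "M.MG.supp ?m"]) (auto simp: M.MG.supp_def)
      then show ?thesis by simp
    qed
    have "\<phi> (M.MG.part ?m g) = \<phi> ?m" using p[of g] N.MG.part_homogeneous[OF n, of g] fi[OF nc] by simp
    then have "M.MG.part ?m g = ?m"
      using b ic[OF nc] M.MG.part_carrier[OF ic[OF nc]] by (meson bij_betw_imp_inj_on inj_onD)
    then show ?thesis using M.MG.part_in[OF ic[OF nc], of g] by simp
  qed
  have "?i (m \<oplus>\<^bsub>N\<^esub> n) = ?i m \<oplus>\<^bsub>M\<^esub> ?i n" if "m \<in> carrier N" "n \<in> carrier N" for m n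
    using that ic fi gr_hom_add[OF \<phi>] by (intro inv) auto
  moreover have "?i (ract N m r) = ract M (?i m) r" if "m \<in> carrier N" "r \<in> carrier R" for m r
    using that ic fi gr_hom_ract[OF \<phi>] M.ract_closed by (intro inv) auto
  ultimately show ?thesis
    unfolding gr_hom_def using ic deg N.ract_closed N.MG.C_carrier by auto
qed

lemma gr_hom_compose:
  assumes "graded_right_module R L" "\<phi> \<in> gr_hom R L M" "\<psi> \<in> gr_hom R M N"
  shows "compose (carrier L) \<psi> \<phi> \<in> gr_hom R L N"
proof -
  interpret L: graded_right_module R L by fact
  show ?thesis
    using assms(2,3) L.ract_closed L.MG.C_carrier unfolding gr_hom_def
    by (auto simp: compose_def PiE_def Pi_iff image_subset_iff)
qed

lemma gr_cat_simps [simp]: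
  "Obj (gr_cat TYPE('m) R) = {M :: ('a, 'm, 'g) gr_mod. graded_right_module R M \<and> fin_gen R M}"
  "Hom (gr_cat TYPE('m) R) = (gr_hom R :: ('a, 'm, 'g) gr_mod \<Rightarrow> _)"
  "Idt (gr_cat TYPE('m) R) M = (\<lambda>m\<in>carrier M. m)"
  "Cmp (gr_cat TYPE('m) R) L M N \<psi> \<phi> = compose (carrier L) \<psi> \<phi>"
  "Hadd (gr_cat TYPE('m) R) M N \<phi> \<psi> = (\<lambda>m\<in>carrier M. \<phi> m \<oplus>\<^bsub>N\<^esub> \<psi> m)"
  "Hscale (gr_cat TYPE('m) R) M N c \<phi> = (\<lambda>m\<in>carrier M. ract N (\<phi> m) (scal R c))"
  for R :: "('a, 'g::ab_group_add, 'k) gr_alg"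
  by (auto simp: gr_cat_def)

lemma (in graded_ring) linear_category_gr_cat: "linear_category (gr_cat TYPE('m) R)"
proof
  fix U V :: "('a, 'm, 'g) gr_mod" and f g c
  assume O: "U \<in> Obj (gr_cat TYPE('m) R)" "V \<in> Obj (gr_cat TYPE('m) R)"
    and f: "f \<in> Hom (gr_cat TYPE('m) R) U V"
  interpret U: graded_right_module R U using O by auto
  interpret V: graded_right_module R V using O by auto
  show "Hscale (gr_cat TYPE('m) R) U V c f \<in> Hom (gr_cat TYPE('m) R) U V"
  proof -
    have sc: "scal R c \<in> carrier R" using RG.C_carrier scal_deg .
    have fh: "f \<in> gr_hom R U V" using f by simp
    have "(\<lambda>m\<in>carrier U. ract V (f m) (scal R c)) \<in> gr_hom R U V"
    proof (rule gr_homI)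
      fix m r assume m: "m \<in> carrier U" and r: "r \<in> carrier R"
      show "(\<lambda>m\<in>carrier U. ract V (f m) (scal R c)) (ract U m r) =
          ract V ((\<lambda>m\<in>carrier U. ract V (f m) (scal R c)) m) r"
        using m r sc U.ract_closed gr_hom_closed[OF fh m] gr_hom_ract[OF fh m r]
        by (simp add: V.ract_assoc[symmetric] scal_central)
    next
      fix g m assume m: "m \<in> gcomp U g"
      show "(\<lambda>m\<in>carrier U. ract V (f m) (scal R c)) m \<in> gcomp V g"
        using V.ract_degree[OF gr_hom_deg[OF fh m] scal_deg, of c] U.MG.C_carrier[OF m] by simp
    qed (use sc gr_hom_closed[OF fh] gr_hom_add[OF fh] in \<open>simp_all add: V.ract_closed V.ract_add_left\<close>)
    then show ?thesis by simp
  qed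
  assume g: "g \<in> Hom (gr_cat TYPE('m) R) U V"
  show "Hadd (gr_cat TYPE('m) R) U V f g \<in> Hom (gr_cat TYPE('m) R) U V"
  proof -
    have fh: "f \<in> gr_hom R U V" and gh: "g \<in> gr_hom R U V" using f g by simp_all
    have "(\<lambda>m\<in>carrier U. f m \<oplus>\<^bsub>V\<^esub> g m) \<in> gr_hom R U V"
    proof (rule gr_homI)
      fix d m assume m: "m \<in> gcomp U d"
      show "(\<lambda>m\<in>carrier U. f m \<oplus>\<^bsub>V\<^esub> g m) m \<in> gcomp V d"
        using V.MG.C_add[OF gr_hom_deg[OF fh m] gr_hom_deg[OF gh m]] U.MG.C_carrier[OF m] by simp
    qed (use gr_hom_closed[OF fh] gr_hom_add[OF fh] gr_hom_closed[OF gh] gr_hom_add[OF gh]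
          gr_hom_ract[OF fh] gr_hom_ract[OF gh] U.ract_closed
        in \<open>simp_all add: V.ract_add_left V.M.add.m_ac\<close>)
    then show ?thesis by simp
  qed
next
  fix T U V W :: "('a, 'm, 'g) gr_mod" and e f g
  assume O: "T \<in> Obj (gr_cat TYPE('m) R)"
    and e: "e \<in> Hom (gr_cat TYPE('m) R) T U"
  show "Cmp (gr_cat TYPE('m) R) T V W g (Cmp (gr_cat TYPE('m) R) T U V f e) =
       Cmp (gr_cat TYPE('m) R) T U W (Cmp (gr_cat TYPE('m) R) U V W g f) e"
    using e by (auto simp: compose_def gr_hom_def fun_eq_iff)
next
  fix U V :: "('a, 'm, 'g) gr_mod" and f
  assume f: "f \<in> Hom (gr_cat TYPE('m) R) U V"
  show "Cmp (gr_cat TYPE('m) R) U U V f (Idt (gr_cat TYPE('m) R) U) = f"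
    "Cmp (gr_cat TYPE('m) R) U V V (Idt (gr_cat TYPE('m) R) V) f = f"
    using f by (auto simp: compose_def gr_hom_def fun_eq_iff PiE_def extensional_def)
next
  fix U :: "('a, 'm, 'g) gr_mod"
  assume O: "U \<in> Obj (gr_cat TYPE('m) R)"
  interpret U: graded_right_module R U using O by auto
  show "Idt (gr_cat TYPE('m) R) U \<in> Hom (gr_cat TYPE('m) R) U U"
    using U.ract_closed U.MG.C_carrier by (auto simp: gr_hom_def)
next
  fix U V W :: "('a, 'm, 'g) gr_mod" and f g f' g' c
  assume O: "U \<in> Obj (gr_cat TYPE('m) R)" "V \<in> Obj (gr_cat TYPE('m) R)" "W \<in> Obj (gr_cat TYPE('m) R)"
    and f: "f \<in> Hom (gr_cat TYPE('m) R) U V" and g: "g \<in> Hom (gr_cat TYPE('m) R) V W"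
  interpret V: graded_right_module R V using O by auto
  have sc: "scal R c \<in> carrier R" using RG.C_carrier scal_deg .
  have fh: "f \<in> gr_hom R U V" and gh: "g \<in> gr_hom R V W" using f g by simp_all
  show "Cmp (gr_cat TYPE('m) R) U V W g f \<in> Hom (gr_cat TYPE('m) R) U W"
    using gr_hom_compose f g O by auto
  show "Cmp (gr_cat TYPE('m) R) U V W g (Hscale (gr_cat TYPE('m) R) U V c f) =
       Hscale (gr_cat TYPE('m) R) U W c (Cmp (gr_cat TYPE('m) R) U V W g f)"
    using sc gr_hom_closed[OF fh] gr_hom_ract[OF gh] by (simp add: compose_def fun_eq_iff)
  show "Cmp (gr_cat TYPE('m) R) U V W (Hscale (gr_cat TYPE('m) R) V W c g) f =
       Hscale (gr_cat TYPE('m) R) U W c (Cmp (gr_cat TYPE('m) R) U V W g f)"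
    using sc gr_hom_closed[OF fh] by (simp add: compose_def fun_eq_iff)
  assume f': "f' \<in> Hom (gr_cat TYPE('m) R) U V"
  show "Cmp (gr_cat TYPE('m) R) U V W g (Hadd (gr_cat TYPE('m) R) U V f f') =
       Hadd (gr_cat TYPE('m) R) U W (Cmp (gr_cat TYPE('m) R) U V W g f) (Cmp (gr_cat TYPE('m) R) U V W g f')"
    using gr_hom_closed[OF fh] gr_hom_closed[of f' R U V] f' gr_hom_add[OF gh] by (simp add: compose_def fun_eq_iff)
next
  fix U V W :: "('a, 'm, 'g) gr_mod" and f g g'
  assume f: "f \<in> Hom (gr_cat TYPE('m) R) U V" and "g \<in> Hom (gr_cat TYPE('m) R) V W" "g' \<in> Hom (gr_cat TYPE('m) R) V W"
  show "Cmp (gr_cat TYPE('m) R) U V W (Hadd (gr_cat TYPE('m) R) V W g g') f =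
       Hadd (gr_cat TYPE('m) R) U W (Cmp (gr_cat TYPE('m) R) U V W g f) (Cmp (gr_cat TYPE('m) R) U V W g' f)"
    using f gr_hom_closed[of f R U V] by (simp add: compose_def fun_eq_iff)
qed

text \<open>
  The inverse map of a bijective homomorphism respects degrees, because the homomorphism commutes with
  taking homogeneous parts.
\<close>

lemma iso_arrow_gr_cat:
  assumes "graded_right_module R M" "graded_right_module R N" and \<phi>: "\<phi> \<in> gr_hom R M N"
    and b: "bij_betw \<phi> (carrier M) (carrier N)"
  shows "iso_arrow (gr_cat TYPE('m) R) M (N :: ('a, 'm, 'g::ab_group_add) gr_mod) \<phi>"
  unfolding iso_arrow_def
proof (intro conjI bexI[of _ "\<lambda>n\<in>carrier N. inv_into (carrier M) \<phi> n"])
  show "\<phi> \<in> Hom (gr_cat TYPE('m) R) M N" using \<phi> by simp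
  show "(\<lambda>n\<in>carrier N. inv_into (carrier M) \<phi> n) \<in> Hom (gr_cat TYPE('m) R) N M"
    using gr_hom_inverse[OF assms] by simp
  show "Cmp (gr_cat TYPE('m) R) M N M (\<lambda>n\<in>carrier N. inv_into (carrier M) \<phi> n) \<phi> = Idt (gr_cat TYPE('m) R) M"
    using b by (auto simp: compose_def fun_eq_iff bij_betw_def)
  show "Cmp (gr_cat TYPE('m) R) N M N \<phi> (\<lambda>n\<in>carrier N. inv_into (carrier M) \<phi> n) = Idt (gr_cat TYPE('m) R) N"
    using b by (auto simp: compose_def fun_eq_iff bij_betw_def f_inv_into_f)
qed

section \<open>Finitely generated graded modules\<close>

context right_module
begin

definition span :: "'m set \<Rightarrow> 'm set" where
  "span T = {\<Oplus>\<^bsub>M\<^esub>s\<in>T. ract M s (r s) | r. r \<in> T \<rightarrow> carrier R}"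

lemma span_carrier: "T \<subseteq> carrier M \<Longrightarrow> span T \<subseteq> carrier M"
  unfolding span_def using ract_closed by (auto intro!: M.finsum_closed)

lemma span_add:
  assumes T: "T \<subseteq> carrier M" and m: "m \<in> span T" and n: "n \<in> span T"
  shows "m \<oplus>\<^bsub>M\<^esub> n \<in> span T"
proof -
  obtain r where r: "r \<in> T \<rightarrow> carrier R" and mr: "m = (\<Oplus>\<^bsub>M\<^esub>s\<in>T. ract M s (r s))"
    using m unfolding span_def by auto
  obtain r' where r': "r' \<in> T \<rightarrow> carrier R" and nr: "n = (\<Oplus>\<^bsub>M\<^esub>s\<in>T. ract M s (r' s))"
    using n unfolding span_def by auto
  have "m \<oplus>\<^bsub>M\<^esub> n = (\<Oplus>\<^bsub>M\<^esub>s\<in>T. ract M s (r s) \<oplus>\<^bsub>M\<^esub> ract M s (r' s))"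
    unfolding mr nr using T r r' ract_closed by (intro M.finsum_addf[symmetric]) (auto simp: Pi_iff subset_iff)
  also have "\<dots> = (\<Oplus>\<^bsub>M\<^esub>s\<in>T. ract M s (r s \<oplus>\<^bsub>R\<^esub> r' s))"
    using T r r' ract_closed by (intro M.finsum_cong') (auto simp: ract_add_right Pi_iff subset_iff)
  finally show ?thesis unfolding span_def using r r' by (auto intro!: exI[of _ "\<lambda>s. r s \<oplus>\<^bsub>R\<^esub> r' s"])
qed

lemma span_ract:
  assumes T: "T \<subseteq> carrier M" and m: "m \<in> span T" and q: "q \<in> carrier R"
  shows "ract M m q \<in> span T"
proof -
  obtain r where r: "r \<in> T \<rightarrow> carrier R" and mr: "m = (\<Oplus>\<^bsub>M\<^esub>s\<in>T. ract M s (r s))"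
    using m unfolding span_def by auto
  have "ract M m q = (\<Oplus>\<^bsub>M\<^esub>s\<in>T. ract M (ract M s (r s)) q)"
    unfolding mr using T r ract_closed
    by (intro additive_map_finsum[OF M.abelian_group_axioms M.abelian_group_axioms ract_additive_left[OF q]]) auto
  also have "\<dots> = (\<Oplus>\<^bsub>M\<^esub>s\<in>T. ract M s (r s \<otimes>\<^bsub>R\<^esub> q))"
    using T r q ract_closed by (intro M.finsum_cong') (auto simp: ract_assoc Pi_iff subset_iff)
  finally show ?thesis unfolding span_def using r q by (auto intro!: exI[of _ "\<lambda>s. r s \<otimes>\<^bsub>R\<^esub> q"])
qed

lemma span_gen:
  assumes T: "T \<subseteq> carrier M" "finite T" and m: "m \<in> T"
  shows "m \<in> span T"
proof -
  let ?r = "\<lambda>s. if m = s then \<one>\<^bsub>R\<^esub> else \<zero>\<^bsub>R\<^esub>"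
  have "(\<Oplus>\<^bsub>M\<^esub>s\<in>T. ract M s (?r s)) = (\<Oplus>\<^bsub>M\<^esub>s\<in>T. if m = s then s else \<zero>\<^bsub>M\<^esub>)"
    using T by (intro M.finsum_cong') (auto simp: ract_one ract_zero_right)
  also have "\<dots> = m" using M.finsum_singleton[of m T "\<lambda>s. s"] T m by auto
  finally show ?thesis unfolding span_def by (auto intro!: exI[of _ ?r])
qed

lemma span_finsum:
  assumes T: "T \<subseteq> carrier M" and f: "f \<in> A \<rightarrow> span T"
  shows "finsum M f A \<in> span T"
proof -
  have z: "\<zero>\<^bsub>M\<^esub> \<in> span T"
  proof -
    have "(\<Oplus>\<^bsub>M\<^esub>s\<in>T. ract M s \<zero>\<^bsub>R\<^esub>) = (\<Oplus>\<^bsub>M\<^esub>s\<in>T. \<zero>\<^bsub>M\<^esub>)"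
      using T by (intro M.finsum_cong') (auto simp: ract_zero_right)
    then show ?thesis unfolding span_def by (auto intro!: exI[of _ "\<lambda>_. \<zero>\<^bsub>R\<^esub>"])
  qed
  show ?thesis using f
  proof (induction A rule: infinite_finite_induct)
    case (insert x F)
    then show ?case
      using span_add[OF T] span_carrier[OF T] by (subst M.finsum_insert) (auto simp: Pi_iff subset_iff)
  qed (auto simp: z)
qed

lemma fin_gen_iff: "fin_gen R M \<longleftrightarrow> (\<exists>T. finite T \<and> T \<subseteq> carrier M \<and> carrier M = span T)"
  unfolding fin_gen_def span_def ..

end

context graded_right_module
begin

lemma fin_genI:
  assumes T: "finite T" "T \<subseteq> carrier M" and gen: "\<And>g m. m \<in> gcomp M g \<Longrightarrow> m \<in> span T"
  shows "fin_gen R M"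
proof -
  have "m \<in> span T" if "m \<in> carrier M" for m
    using that
  proof (induction rule: MG.homogeneous_induct)
    case (add m n)
    then show ?case using span_add[OF T(2)] by simp
  qed (fact gen)
  then show ?thesis using T span_carrier[OF T(2)] unfolding fin_gen_iff by (intro exI[of _ T]) auto
qed

lemma fin_gen_homogeneous:
  assumes "fin_gen R M"
  obtains T where "finite T" "T \<subseteq> carrier M" "\<And>t. t \<in> T \<Longrightarrow> \<exists>g. t \<in> gcomp M g" "carrier M = span T"
proof -
  obtain S where S: "finite S" "S \<subseteq> carrier M" "carrier M = span S"
    using assms unfolding fin_gen_iff by blast
  define T where "T = (\<Union>s\<in>S. MG.part s ` MG.supp s)"
  have T: "finite T" "T \<subseteq> carrier M" "\<And>t. t \<in> T \<Longrightarrow> \<exists>g. t \<in> gcomp M g"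
    unfolding T_def using S(1,2) MG.finite_supp MG.part_carrier MG.part_in by auto blast+
  have ST: "s \<in> span T" if s: "s \<in> S" for s
  proof -
    have sc: "s \<in> carrier M" using s S by auto
    have "(\<Oplus>\<^bsub>M\<^esub>g\<in>MG.supp s. MG.part s g) \<in> span T"
      using s by (intro span_finsum[OF T(2)] Pi_I span_gen[OF T(2,1)]) (auto simp: T_def)
    then show ?thesis by (simp flip: MG.sum_part[OF sc])
  qed
  have "m \<in> span T" if "m \<in> carrier M" for m
  proof -
    have "m \<in> span S" using S(3) that by simp
    then obtain r where r: "r \<in> S \<rightarrow> carrier R" "m = (\<Oplus>\<^bsub>M\<^esub>s\<in>S. ract M s (r s))"
      unfolding span_def by auto
    show ?thesis
      unfolding r(2) using r(1) by (intro span_finsum[OF T(2)] Pi_I span_ract[OF T(2)] ST) auto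
  qed
  then have "carrier M = span T" using span_carrier[OF T(2)] by auto
  from that[OF T this] show ?thesis .
qed

lemma part_ract:
  assumes s: "s \<in> gcomp M h" and r: "r \<in> carrier R" and R: "graded_ring R"
  shows "MG.part (ract M s r) g = ract M s (graded_group.part R (hcomp R) r (g - h))"
proof -
  interpret R: graded_ring R by fact
  have sc: "s \<in> carrier M" using MG.C_carrier[OF s] .
  show ?thesis using r
  proof (induction rule: R.RG.homogeneous_induct)
    case (add r r')
    then show ?case
      using sc by (simp add: ract_add_right MG.part_add ract_closed R.RG.part_add R.RG.part_carrier)
  next
    case (homogeneous k r)
    have "MG.part (ract M s r) g = (if g = h + k then ract M s r else \<zero>\<^bsub>M\<^esub>)"
      using MG.part_homogeneous[OF ract_degree[OF s homogeneous]] .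
    moreover have "R.RG.part r (g - h) = (if g = h + k then r else \<zero>\<^bsub>R\<^esub>)"
      using R.RG.part_homogeneous[OF homogeneous, of "g - h"] by (auto simp: algebra_simps)
    ultimately show ?case using sc by (simp add: ract_zero_right)
  qed
qed

end

lemma gr_hom_bijI:
  assumes M: "graded_right_module R M" and N: "graded_right_module R N" and \<phi>: "\<phi> \<in> gr_hom R M N"
    and inj: "\<And>g m. m \<in> gcomp M g \<Longrightarrow> \<phi> m = \<zero>\<^bsub>N\<^esub> \<Longrightarrow> m = \<zero>\<^bsub>M\<^esub>"
    and surj: "\<And>g n. n \<in> gcomp N g \<Longrightarrow> \<exists>m\<in>gcomp M g. \<phi> m = n"
  shows "bij_betw \<phi> (carrier M) (carrier N)"
proof -
  interpret M: graded_right_module R M by fact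
  interpret N: graded_right_module R N by fact
  note gM = M.M.abelian_group_axioms and gN = N.M.abelian_group_axioms
  note ad = gr_hom_additive[OF \<phi>]
  have part: "\<phi> (M.MG.part m g) = N.MG.part (\<phi> m) g" if m: "m \<in> carrier M" for m g
    using m
  proof (induction rule: M.MG.homogeneous_induct)
    case (add m n)
    then show ?case
      using gr_hom_closed[OF \<phi>] by (simp add: M.MG.part_add N.MG.part_add gr_hom_add[OF \<phi>] M.MG.part_carrier)
  next
    case (homogeneous h m)
    then show ?case
      using additive_map_zero[OF gM gN ad]
      by (simp add: M.MG.part_homogeneous[OF homogeneous] N.MG.part_homogeneous[OF gr_hom_deg[OF \<phi> homogeneous]])
  qed
  have ker: "m = \<zero>\<^bsub>M\<^esub>" if m: "m \<in> carrier M" and z: "\<phi> m = \<zero>\<^bsub>N\<^esub>" for m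
  proof (rule M.MG.eq_by_parts[OF m M.M.zero_closed])
    fix g
    have "\<phi> (M.MG.part m g) = \<zero>\<^bsub>N\<^esub>" using part[OF m] z N.MG.part_zero by simp
    then show "M.MG.part m g = M.MG.part \<zero>\<^bsub>M\<^esub> g"
      using inj[OF M.MG.part_in[OF m]] M.MG.part_zero by simp
  qed
  have "inj_on \<phi> (carrier M)"
  proof (rule inj_onI)
    fix m n assume m: "m \<in> carrier M" and n: "n \<in> carrier M" and eq: "\<phi> m = \<phi> n"
    have "\<phi> (m \<oplus>\<^bsub>M\<^esub> (\<ominus>\<^bsub>M\<^esub> n)) = \<zero>\<^bsub>N\<^esub>"
      using m n eq gr_hom_closed[OF \<phi>] by (simp add: gr_hom_add[OF \<phi>] additive_map_minus[OF gM gN ad] N.M.r_neg)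
    then have "m \<oplus>\<^bsub>M\<^esub> (\<ominus>\<^bsub>M\<^esub> n) = \<zero>\<^bsub>M\<^esub>" using m n by (intro ker) auto
    then show "m = n" using m n M.M.minus_equality[of m "\<ominus>\<^bsub>M\<^esub> n"] by simp
  qed
  moreover have "n \<in> \<phi> ` carrier M" if "n \<in> carrier N" for n
    using that
  proof (induction rule: N.MG.homogeneous_induct)
    case (add n n')
    then obtain m m' where "m \<in> carrier M" "m' \<in> carrier M" "n = \<phi> m" "n' = \<phi> m'" by auto
    then show ?case using gr_hom_add[OF \<phi>, of m m'] M.M.add.m_closed by (metis imageI)
  next
    case (homogeneous g n)
    then show ?case using surj M.MG.C_carrier by blast
  qed
  ultimately show ?thesis
    unfolding bij_betw_def using gr_hom_closed[OF \<phi>] by auto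
qed

lemma (in abelian_group) additive_subgroupI':
  assumes H: "H \<subseteq> carrier G" "\<zero> \<in> H" and add: "\<And>a b. a \<in> H \<Longrightarrow> b \<in> H \<Longrightarrow> a \<oplus> b \<in> H"
    and inv: "\<And>a. a \<in> H \<Longrightarrow> \<exists>b\<in>H. b \<oplus> a = \<zero>"
  shows "additive_subgroup H G"
  unfolding additive_subgroup_def
proof (rule group.subgroupI[OF a_group])
  fix a assume a: "a \<in> H"
  then obtain b where b: "b \<in> H" "b \<oplus> a = \<zero>" using inv by blast
  then have "\<ominus> a = b" using a H by (intro minus_equality) auto
  then show "inv\<^bsub>add_monoid G\<^esub> a \<in> H" using b by (simp add: a_inv_def)
qed (use H add in auto)

section \<open>Changing the underlying set of a module\<close>

definition transport :: "('m \<Rightarrow> 'n) \<Rightarrow> ('a, 'm, 'g) gr_mod \<Rightarrow> ('a, 'n, 'g) gr_mod" where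
  "transport f M = (let u = inv_into (carrier M) f in \<lparr>
     carrier = f ` carrier M, monoid.mult = undefined, one = undefined, ring.zero = f \<zero>\<^bsub>M\<^esub>,
     add = (\<lambda>x y. f (u x \<oplus>\<^bsub>M\<^esub> u y)), ract = (\<lambda>x r. f (ract M (u x) r)), gcomp = (\<lambda>g. f ` gcomp M g)\<rparr>)"

lemma
  assumes R: "ring R" and M: "graded_right_module R M" and inj: "inj_on f (carrier M)"
  shows graded_right_module_transport: "graded_right_module R (transport f M)"
    and gr_hom_transport: "restrict f (carrier M) \<in> gr_hom R M (transport f M)"
    and bij_betw_transport: "bij_betw (restrict f (carrier M)) (carrier M) (carrier (transport f M))"
proof -
  interpret M: graded_right_module R M by fact
  let ?u = "inv_into (carrier M) f" and ?T = "transport f M"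
  have u: "?u (f m) = m" if "m \<in> carrier M" for m using inj that by (rule inv_into_f_f)
  have T [simp]: "carrier ?T = f ` carrier M" "\<zero>\<^bsub>?T\<^esub> = f \<zero>\<^bsub>M\<^esub>" "gcomp ?T g = f ` gcomp M g" for g
    by (auto simp: transport_def Let_def)
  have add: "f m \<oplus>\<^bsub>?T\<^esub> f n = f (m \<oplus>\<^bsub>M\<^esub> n)" if "m \<in> carrier M" "n \<in> carrier M" for m n
    using that u by (simp add: transport_def Let_def)
  have act: "ract ?T (f m) r = f (ract M m r)" if "m \<in> carrier M" for m r
    using that u by (simp add: transport_def Let_def)
  have ab: "abelian_group ?T"
  proof (rule abelian_groupI)
    fix x assume "x \<in> carrier ?T"
    then obtain m where m: "m \<in> carrier M" "x = f m" by auto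
    then show "\<exists>y\<in>carrier ?T. y \<oplus>\<^bsub>?T\<^esub> x = \<zero>\<^bsub>?T\<^esub>"
      by (intro bexI[of _ "f (\<ominus>\<^bsub>M\<^esub> m)"]) (auto simp: add M.M.l_neg)
  qed (auto simp: add M.M.add.m_ac)
  interpret T: abelian_group ?T by fact
  have fadd: "additive_map M ?T f" unfolding additive_map_def by (auto simp: add)
  have uadd: "additive_map ?T M ?u" unfolding additive_map_def by (auto simp: add u)
  have sub: "additive_subgroup (f ` gcomp M g) ?T" for g
  proof (rule T.additive_subgroupI')
    fix a assume "a \<in> f ` gcomp M g"
    then obtain m where m: "m \<in> gcomp M g" "a = f m" by auto
    then show "\<exists>b\<in>f ` gcomp M g. b \<oplus>\<^bsub>?T\<^esub> a = \<zero>\<^bsub>?T\<^esub>"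
      using M.MG.C_minus M.MG.C_carrier by (intro bexI[of _ "f (\<ominus>\<^bsub>M\<^esub> m)"]) (auto simp: add M.M.l_neg)
  next
    fix a b assume "a \<in> f ` gcomp M g" "b \<in> f ` gcomp M g"
    then show "a \<oplus>\<^bsub>?T\<^esub> b \<in> f ` gcomp M g"
      using M.MG.C_add M.MG.C_carrier by (auto simp: add)
  qed (use M.MG.C_carrier M.MG.C_zero in auto)
  have gr: "graded_group ?T (gcomp ?T)"
  proof (rule graded_groupI[OF ab, where \<pi> = "\<lambda>g x. f (M.MG.part (?u x) g)"])
    show "additive_subgroup (gcomp ?T g) ?T" for g using sub by simp
    show "additive_map ?T ?T (\<lambda>x. f (M.MG.part (?u x) g))" for g
      unfolding additive_map_def by (auto simp: u add M.MG.part_add M.MG.part_carrier)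
    show "f (M.MG.part (?u x) g) \<in> gcomp ?T g" if "x \<in> carrier ?T" for g x
      using that M.MG.part_in by (auto simp: u)
    show "f (M.MG.part (?u x) g) = x" if "x \<in> gcomp ?T g" for g x
      using that M.MG.C_carrier by (auto simp: u M.MG.part_homogeneous)
    show "f (M.MG.part (?u x) h) = \<zero>\<^bsub>?T\<^esub>" if x: "x \<in> gcomp ?T g" and hg: "h \<noteq> g" for g h x
    proof -
      obtain m where m: "m \<in> gcomp M g" "x = f m" using x by auto
      then show ?thesis using hg M.MG.part_homogeneous[OF m(1), of h] by (simp add: u M.MG.C_carrier)
    qed
    have supp: "{g. f (M.MG.part m g) \<noteq> \<zero>\<^bsub>?T\<^esub>} = M.MG.supp m" if "m \<in> carrier M" for m
      using that inj M.MG.part_carrier[OF that] by (auto simp: M.MG.supp_def dest: inj_onD)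
    show "finite {g. f (M.MG.part (?u x) g) \<noteq> \<zero>\<^bsub>?T\<^esub>}" if "x \<in> carrier ?T" for x
      using that supp M.MG.finite_supp by (auto simp: u)
    show "x = (\<Oplus>\<^bsub>?T\<^esub>g\<in>{g. f (M.MG.part (?u x) g) \<noteq> \<zero>\<^bsub>?T\<^esub>}. f (M.MG.part (?u x) g))" if x: "x \<in> carrier ?T" for x
    proof -
      obtain m where m: "m \<in> carrier M" "x = f m" using x by auto
      have "f m = f (\<Oplus>\<^bsub>M\<^esub>g\<in>M.MG.supp m. M.MG.part m g)" using M.MG.sum_part[OF m(1)] by simp
      also have "\<dots> = (\<Oplus>\<^bsub>?T\<^esub>g\<in>M.MG.supp m. f (M.MG.part m g))"
        using M.MG.part_carrier[OF m(1)]
        by (intro additive_map_finsum[OF M.M.abelian_group_axioms ab fadd]) auto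
      finally show ?thesis using supp[OF m(1)] u[OF m(1)] m(2) by simp
    qed
  qed
  show gm: "graded_right_module R ?T"
  proof (rule graded_right_moduleI[OF R gr])
    show "ract ?T m r \<in> gcomp ?T (\<gamma> + \<delta>)" if mr: "m \<in> gcomp ?T \<gamma>" "r \<in> hcomp R \<delta>" for \<gamma> \<delta> m r
    proof -
      obtain m' where m: "m' \<in> gcomp M \<gamma>" "m = f m'" using mr by auto
      then show ?thesis using M.ract_degree[OF m(1) mr(2)] by (simp add: act M.MG.C_carrier)
    qed
  qed (auto simp: act add M.ract_closed M.ract_add_left M.ract_add_right M.ract_assoc M.ract_one)
  show "restrict f (carrier M) \<in> gr_hom R M ?T"
    by (rule gr_homI) (auto simp: add act M.ract_closed M.MG.C_carrier)
  show "bij_betw (restrict f (carrier M)) (carrier M) (carrier ?T)"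
    using inj by (auto simp: bij_betw_def inj_on_def)
qed

lemma fin_gen_iso:
  assumes M: "graded_right_module R M" and N: "graded_right_module R N" and \<phi>: "\<phi> \<in> gr_hom R M N"
    and surj: "\<phi> ` carrier M = carrier N" and fg: "fin_gen R M"
  shows "fin_gen R N"
proof -
  interpret M: graded_right_module R M by fact
  interpret N: graded_right_module R N by fact
  obtain T where T: "finite T" "T \<subseteq> carrier M" "carrier M = M.span T"
    using fg unfolding M.fin_gen_iff by blast
  have fT: "finite (\<phi> ` T)" "\<phi> ` T \<subseteq> carrier N" using T gr_hom_closed[OF \<phi>] by auto
  show ?thesis
  proof (rule N.fin_genI[OF fT])
    fix g n assume "n \<in> gcomp N g"
    then obtain m where m: "m \<in> carrier M" "n = \<phi> m" using surj N.MG.C_carrier by blast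
    then obtain r where r: "r \<in> T \<rightarrow> carrier R" "m = (\<Oplus>\<^bsub>M\<^esub>s\<in>T. ract M s (r s))"
      using T unfolding M.span_def by auto
    have "n = (\<Oplus>\<^bsub>N\<^esub>s\<in>T. \<phi> (ract M s (r s)))"
      unfolding m(2) r(2) using r(1) T(1,2) M.ract_closed
      by (intro additive_map_finsum[OF M.M.abelian_group_axioms N.M.abelian_group_axioms gr_hom_additive[OF \<phi>]]) auto
    also have "\<dots> = (\<Oplus>\<^bsub>N\<^esub>s\<in>T. ract N (\<phi> s) (r s))"
      using r(1) T gr_hom_closed[OF \<phi>] N.ract_closed
      by (intro N.M.finsum_cong') (auto simp: Pi_iff subset_iff gr_hom_ract[OF \<phi>])
    also have "\<dots> \<in> N.span (\<phi> ` T)"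
      using r(1) by (intro N.span_finsum[OF fT(2)] Pi_I N.span_ract[OF fT(2)] N.span_gen[OF fT(2,1)]) auto
    finally show "n \<in> N.span (\<phi> ` T)" .
  qed
qed

text \<open>
  An injective pairing \<open>'k \<times> 'k \<Rightarrow> 'k\<close> is iterated along the list, and the length is recorded separately.
\<close>

lemma ex_inj_list_code:
  assumes "infinite (UNIV :: 'k set)"
  shows "\<exists>c :: 'k list \<Rightarrow> 'k. inj c"
proof -
  obtain pr :: "'k \<times> 'k \<Rightarrow> 'k" where pr: "inj pr"
    using card_of_Times_same_infinite[OF assms] card_of_ordIso[of "UNIV \<times> UNIV :: ('k \<times> 'k) set" "UNIV :: 'k set"]
    by (auto simp: bij_betw_def)
  obtain nt :: "nat \<Rightarrow> 'k" where nt: "inj nt" using infinite_countable_subset[OF assms] by auto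
  define e where "e = rec_list (nt 0) (\<lambda>x _ y. pr (x, y))"
  have e: "e [] = nt 0" "e (x # xs) = pr (x, e xs)" for x xs by (auto simp: e_def)
  have e_inj: "length xs = length ys \<Longrightarrow> e xs = e ys \<Longrightarrow> xs = ys" for xs ys
    by (induction xs ys rule: list_induct2') (auto simp: e dest: injD[OF pr])
  have "inj (\<lambda>xs. pr (nt (length xs), e xs))"
    using injD[OF pr] injD[OF nt] e_inj by (intro injI) blast
  then show ?thesis by blast
qed

text \<open>
  An element is coded by the list of coefficients that express it in a fixed finite family of generators.
\<close>

lemma fin_gen_inj_on:
  fixes c :: "'a \<Rightarrow> 'k" and M :: "('a, 'm, 'g::ab_group_add) gr_mod"
  assumes inf: "infinite (UNIV :: 'k set)" and c: "inj_on c (carrier R)"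
    and M: "graded_right_module R M" and fg: "fin_gen R M"
  shows "\<exists>f :: 'm \<Rightarrow> 'k. inj_on f (carrier M)"
proof -
  interpret M: graded_right_module R M by fact
  obtain lc :: "'k list \<Rightarrow> 'k" where lc: "inj lc" using ex_inj_list_code[OF inf] by blast
  obtain T where T: "finite T" "T \<subseteq> carrier M" "carrier M = M.span T"
    using fg unfolding M.fin_gen_iff by blast
  obtain ts where ts: "set ts = T" using finite_list[OF T(1)] by blast
  have "\<exists>r. r \<in> T \<rightarrow>\<^sub>E carrier R \<and> m = (\<Oplus>\<^bsub>M\<^esub>s\<in>T. ract M s (r s))" if "m \<in> carrier M" for m
  proof -
    have "m \<in> M.span T" using that T(3) by simp
    then obtain r where r: "r \<in> T \<rightarrow> carrier R" "m = (\<Oplus>\<^bsub>M\<^esub>s\<in>T. ract M s (r s))"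
      unfolding M.span_def by auto
    have "m = (\<Oplus>\<^bsub>M\<^esub>s\<in>T. ract M s (restrict r T s))"
      unfolding r(2) using r(1) T(2) M.ract_closed by (intro M.M.finsum_cong') (auto simp: Pi_iff subset_iff)
    then show ?thesis using r(1) by (intro exI[of _ "restrict r T"]) auto
  qed
  then obtain r where r: "\<And>m. m \<in> carrier M \<Longrightarrow> r m \<in> T \<rightarrow>\<^sub>E carrier R"
    "\<And>m. m \<in> carrier M \<Longrightarrow> m = (\<Oplus>\<^bsub>M\<^esub>s\<in>T. ract M s (r m s))"
    by metis
  have "inj_on (\<lambda>m. lc (map (\<lambda>s. c (r m s)) ts)) (carrier M)"
  proof (rule inj_onI)
    fix m n assume m: "m \<in> carrier M" and n: "n \<in> carrier M"
      and eq: "lc (map (\<lambda>s. c (r m s)) ts) = lc (map (\<lambda>s. c (r n s)) ts)"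
    have "c (r m s) = c (r n s)" if "s \<in> T" for s
      using injD[OF lc eq] that ts by auto
    then have "r m s = r n s" if "s \<in> T" for s
      using that PiE_mem[OF r(1)[OF m] that] PiE_mem[OF r(1)[OF n] that] c by (meson inj_onD)
    then have "r m = r n" by (rule PiE_ext[OF r(1)[OF m] r(1)[OF n]])
    then show "m = n" using r(2)[OF m] r(2)[OF n] by metis
  qed
  then show ?thesis by blast
qed

text \<open>
  Up to equivalence the category of finitely generated graded modules does not depend on the type
  that supplies the elements, as long as every such module embeds into that type.
\<close>

lemma (in graded_ring) equivalence_functor_transport:
  fixes i :: "'e \<Rightarrow> 'm" and j :: "'e \<Rightarrow> 'n"
  assumes inf: "infinite (UNIV :: 'e set)" and c: "inj_on (c :: 'a \<Rightarrow> 'e) (carrier R)"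
    and i: "inj i" and j: "inj j"
  shows "\<exists>F F'. equivalence_functor (gr_cat TYPE('m) R) (gr_cat TYPE('n) R) F F'"
proof -
  have "\<exists>f :: 'm \<Rightarrow> 'n. inj_on f (carrier M)" if M: "graded_right_module R M" "fin_gen R M" for M :: "('a, 'm, 'g) gr_mod"
  proof -
    obtain f :: "'m \<Rightarrow> 'e" where "inj_on f (carrier M)" using fin_gen_inj_on[OF inf c M] by blast
    then have "inj_on (j \<circ> f) (carrier M)" using j by (meson comp_inj_on inj_on_subset subset_UNIV)
    then show ?thesis by blast
  qed
  then obtain f :: "('a, 'm, 'g) gr_mod \<Rightarrow> 'm \<Rightarrow> 'n" where f: "\<And>M. graded_right_module R M \<Longrightarrow> fin_gen R M \<Longrightarrow> inj_on (f M) (carrier M)"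
    by metis
  define F where "F M = transport (f M) M" for M
  define e where "e M = restrict (f M) (carrier M)" for M
  define d where "d M = (\<lambda>n\<in>carrier (F M). inv_into (carrier M) (e M) n)" for M
  define F' where "F' M N \<phi> = compose (carrier (F M)) (e N) (compose (carrier (F M)) \<phi> (d M))"
    for M N :: "('a, 'm, 'g) gr_mod" and \<phi>
  let ?C = "gr_cat TYPE('m) R" and ?D = "gr_cat TYPE('n) R"
  have obj: "graded_right_module R M" "fin_gen R M" if "M \<in> Obj ?C" for M using that by auto
  have FM: "graded_right_module R (F M)" "e M \<in> gr_hom R M (F M)" "bij_betw (e M) (carrier M) (carrier (F M))"
    if "M \<in> Obj ?C" for M
    using graded_right_module_transport[OF ring_axioms obj(1)[OF that] f[OF obj[OF that]]]
      gr_hom_transport[OF ring_axioms obj(1)[OF that] f[OF obj[OF that]]]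
      bij_betw_transport[OF ring_axioms obj(1)[OF that] f[OF obj[OF that]]]
    unfolding F_def e_def by auto
  have FO: "F M \<in> Obj ?D" if "M \<in> Obj ?C" for M
    using FM[OF that] obj[OF that] fin_gen_iso[OF obj(1)[OF that] FM(1,2)[OF that]] by (auto simp: bij_betw_def)
  have d: "d M \<in> gr_hom R (F M) M" if "M \<in> Obj ?C" for M
    unfolding d_def by (rule gr_hom_inverse[OF obj(1)[OF that] FM(1,2,3)[OF that]])
  have de: "d M (e M m) = m" if "M \<in> Obj ?C" "m \<in> carrier M" for M m
    using FM[OF that(1)] that(2) unfolding d_def by (auto simp: bij_betw_def gr_hom_closed)
  have ed: "e M (d M n) = n" if "M \<in> Obj ?C" "n \<in> carrier (F M)" for M n
    using FM(3)[OF that(1)] that(2) unfolding d_def by (auto simp: bij_betw_def f_inv_into_f)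
  have F'H: "F' M N \<phi> \<in> gr_hom R (F M) (F N)" if "M \<in> Obj ?C" "N \<in> Obj ?C" "\<phi> \<in> gr_hom R M N" for M N \<phi>
    unfolding F'_def
    by (rule gr_hom_compose[OF FM(1)[OF that(1)] gr_hom_compose[OF FM(1)[OF that(1)] d[OF that(1)] that(3)] FM(2)[OF that(2)]])
  have F'v: "F' M N \<phi> n = e N (\<phi> (d M n))" if "n \<in> carrier (F M)" for M N \<phi> n
    using that by (simp add: F'_def compose_def)
  have F'x: "F' M N \<phi> \<in> extensional (carrier (F M))" for M N \<phi>
    by (simp add: F'_def compose_def)
  have lin: "linear_functor ?C ?D F F'"
    unfolding linear_functor_def
  proof (intro conjI ballI allI)
    fix U assume U: "U \<in> Obj ?C"
    show "F U \<in> Obj ?D" using FO[OF U] .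
    show "F' U U (Idt ?C U) = Idt ?D (F U)"
      using gr_hom_closed[OF d[OF U]] ed[OF U] by (auto simp: F'_def compose_def fun_eq_iff)
  next
    fix U V f assume "U \<in> Obj ?C" "V \<in> Obj ?C" "f \<in> Hom ?C U V"
    then show "F' U V f \<in> Hom ?D (F U) (F V)" using F'H by simp
  next
    fix U V W f g
    assume U: "U \<in> Obj ?C" "V \<in> Obj ?C" "W \<in> Obj ?C" and f: "f \<in> Hom ?C U V" and g: "g \<in> Hom ?C V W"
    have fh: "f \<in> gr_hom R U V" using f by simp
    show "F' U W (Cmp ?C U V W g f) = Cmp ?D (F U) (F V) (F W) (F' V W g) (F' U V f)"
      using gr_hom_closed[OF d[OF U(1)]] gr_hom_closed[OF fh] gr_hom_closed[OF FM(2)[OF U(2)]] de[OF U(2)]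
      by (auto simp: F'_def compose_def fun_eq_iff)
  next
    fix U V f g assume U: "U \<in> Obj ?C" "V \<in> Obj ?C" and f: "f \<in> Hom ?C U V" and g: "g \<in> Hom ?C U V"
    have fh: "f \<in> gr_hom R U V" and gh: "g \<in> gr_hom R U V" using f g by simp_all
    show "F' U V (Hadd ?C U V f g) = Hadd ?D (F U) (F V) (F' U V f) (F' U V g)"
      using gr_hom_closed[OF d[OF U(1)]] gr_hom_closed[OF fh] gr_hom_closed[OF gh] gr_hom_add[OF FM(2)[OF U(2)]]
      by (auto simp: F'_def compose_def fun_eq_iff)
  next
    fix U V b f assume U: "U \<in> Obj ?C" "V \<in> Obj ?C" and f: "f \<in> Hom ?C U V"
    have fh: "f \<in> gr_hom R U V" using f by simp
    have "scal R b \<in> carrier R" using RG.C_carrier[OF scal_deg] .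
    then show "F' U V (Hscale ?C U V b f) = Hscale ?D (F U) (F V) b (F' U V f)"
      using gr_hom_closed[OF d[OF U(1)]] gr_hom_closed[OF fh] gr_hom_ract[OF FM(2)[OF U(2)]]
      by (auto simp: F'_def compose_def fun_eq_iff)
  qed
  moreover have "bij_betw (F' U V) (Hom ?C U V) (Hom ?D (F U) (F V))" if U: "U \<in> Obj ?C" "V \<in> Obj ?C" for U V
  proof (rule bij_betw_byWitness[where f' = "\<lambda>\<psi>. compose (carrier U) (d V) (compose (carrier U) \<psi> (e U))"])
    show "\<forall>a\<in>Hom ?C U V. compose (carrier U) (d V) (compose (carrier U) (F' U V a) (e U)) = a"
    proof
      fix a assume a: "a \<in> Hom ?C U V"
      then have ah: "a \<in> gr_hom R U V" by simp
      show "compose (carrier U) (d V) (compose (carrier U) (F' U V a) (e U)) = a"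
        using gr_hom_closed[OF ah] gr_hom_closed[OF FM(2)[OF U(1)]] de[OF U(1)] de[OF U(2)] gr_hom_extensional[OF ah]
        by (auto simp: compose_def fun_eq_iff F'v extensional_def)
    qed
    show "\<forall>a'\<in>Hom ?D (F U) (F V). F' U V (compose (carrier U) (d V) (compose (carrier U) a' (e U))) = a'"
    proof
      fix a assume a: "a \<in> Hom ?D (F U) (F V)"
      then have ah: "a \<in> gr_hom R (F U) (F V)" by simp
      show "F' U V (compose (carrier U) (d V) (compose (carrier U) a (e U))) = a"
        using gr_hom_closed[OF ah] gr_hom_closed[OF d[OF U(1)]] ed[OF U(1)] ed[OF U(2)] gr_hom_extensional[OF ah]
        by (auto simp: F'_def compose_def fun_eq_iff extensional_def)
    qed
    show "F' U V ` Hom ?C U V \<subseteq> Hom ?D (F U) (F V)" using F'H[OF U] by auto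
    show "(\<lambda>\<psi>. compose (carrier U) (d V) (compose (carrier U) \<psi> (e U))) ` Hom ?D (F U) (F V) \<subseteq> Hom ?C U V"
      using gr_hom_compose[OF obj(1)[OF U(1)] gr_hom_compose[OF obj(1)[OF U(1)] FM(2)[OF U(1)]] d[OF U(2)]] by auto
  qed
  moreover have "\<exists>U\<in>Obj ?C. \<exists>f. iso_arrow ?D (F U) N f" if N: "N \<in> Obj ?D" for N
  proof -
    have No: "graded_right_module R N" "fin_gen R N" using N by auto
    obtain h :: "'n \<Rightarrow> 'e" where h: "inj_on h (carrier N)" using fin_gen_inj_on[OF inf c No] by blast
    let ?h = "i \<circ> h"
    have h': "inj_on ?h (carrier N)" using h i by (meson comp_inj_on inj_on_subset subset_UNIV)
    note T = graded_right_module_transport[OF ring_axioms No(1) h'] gr_hom_transport[OF ring_axioms No(1) h']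
      bij_betw_transport[OF ring_axioms No(1) h']
    let ?U = "transport ?h N"
    have U: "?U \<in> Obj ?C" using T fin_gen_iso[OF No(1) T(1,2) _ No(2)] by (auto simp: bij_betw_def)
    let ?\<phi> = "compose (carrier N) (e ?U) (restrict ?h (carrier N))"
    have "?\<phi> \<in> gr_hom R N (F ?U)" using gr_hom_compose[OF No(1) T(2) FM(2)[OF U]] .
    moreover have "bij_betw ?\<phi> (carrier N) (carrier (F ?U))"
      using bij_betw_trans[OF T(3) FM(3)[OF U]] by (subst bij_betw_cong[of _ _ "e ?U \<circ> restrict ?h (carrier N)"]) (auto simp: compose_def)
    ultimately have "iso_arrow ?D N (F ?U) ?\<phi>"
      by (intro iso_arrow_gr_cat No(1) FM(1)[OF U])
    then show ?thesis using U unfolding iso_arrow_def by blast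
  qed
  ultimately show ?thesis unfolding equivalence_functor_def by blast
qed

section \<open>A Morita theorem for graded rings\<close>

lemma abelian_group_ract_update [simp]: "abelian_group (N\<lparr>ract := a\<rparr>) = abelian_group N"
  by (simp add: abelian_group_def abelian_monoid_def abelian_group_axioms_def)

lemma finsum_ract_update [simp]: "finsum (N\<lparr>ract := a\<rparr>) f A = finsum N f A"
  by (simp add: finsum_def)

lemma graded_group_ract_update [simp]: "graded_group (N\<lparr>ract := a\<rparr>) C = graded_group N C"
  by (simp add: graded_group_def graded_group_axioms_def additive_subgroup_def)

lemma (in graded_action) graded_right_module_ract_update: "graded_right_module S (N\<lparr>ract := act\<rparr>)"
proof (rule graded_right_moduleI)
  show "ring S" by (rule S.ring_axioms)
  show "graded_group (N\<lparr>ract := act\<rparr>) (gcomp (N\<lparr>ract := act\<rparr>))" using N.graded_group_axioms by simp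
  show "ract (N\<lparr>ract := act\<rparr>) m r \<in> gcomp (N\<lparr>ract := act\<rparr>) (g + d)"
    if "m \<in> gcomp (N\<lparr>ract := act\<rparr>) g" "r \<in> hcomp S d" for g d m r
    using that act_homogeneous[of m g r d] \<theta>_deg[of m g r d] by simp
qed (simp_all add: act_closed act_add_right act_assoc act_one additive_map_add[OF act_left_additive])

text \<open>
  The ring \<open>S\<close> is a corner of \<open>R\<close>. Regard \<open>R\<close> as a category whose objects are the degrees and whose
  morphisms between \<open>g\<close> and \<open>h\<close> are the elements of degree \<open>h - g\<close>, and likewise \<open>S\<close>. Then \<open>\<rho>\<close> and \<open>lam\<close>
  form a fully faithful functor from the second category to the first; \<open>lam n j\<close> depends on the source \<open>n\<close>
  and not only on the degree \<open>j\<close>. The last condition says that every object of the first category is a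
  direct summand of a finite sum of objects \<open>\<rho> n\<close>.
\<close>

locale corner = R: graded_ring R + S: graded_ring S
  for R :: "('a, 'g::ab_group_add, 'k) gr_alg" and S :: "('b, 'h::ab_group_add, 'k) gr_alg" +
  fixes \<rho> :: "'h \<Rightarrow> 'g" and lam :: "'h \<Rightarrow> 'h \<Rightarrow> 'b \<Rightarrow> 'a"
  assumes inj_\<rho>: "inj \<rho>"
    and lam_bij: "bij_betw (lam n j) (hcomp S j) (hcomp R (\<rho> (n + j) - \<rho> n))"
    and lam_add: "\<lbrakk>a \<in> hcomp S j; b \<in> hcomp S j\<rbrakk> \<Longrightarrow> lam n j (a \<oplus>\<^bsub>S\<^esub> b) = lam n j a \<oplus>\<^bsub>R\<^esub> lam n j b"
    and lam_mult: "\<lbrakk>a \<in> hcomp S j; b \<in> hcomp S l\<rbrakk>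
      \<Longrightarrow> lam n (j + l) (a \<otimes>\<^bsub>S\<^esub> b) = lam n j a \<otimes>\<^bsub>R\<^esub> lam (n + j) l b"
    and lam_one: "lam n 0 \<one>\<^bsub>S\<^esub> = \<one>\<^bsub>R\<^esub>"
    and lam_scal: "lam n 0 (scal S c) = scal R c"
    and cover: "\<exists>(I :: nat set) p d d'. finite I \<and>
      (\<forall>i\<in>I. d i \<in> hcomp R (\<rho> (p i) - g) \<and> d' i \<in> hcomp R (g - \<rho> (p i))) \<and>
      \<one>\<^bsub>R\<^esub> = (\<Oplus>\<^bsub>R\<^esub>i\<in>I. d i \<otimes>\<^bsub>R\<^esub> d' i)"
begin

lemma lam_in: "a \<in> hcomp S j \<Longrightarrow> lam n j a \<in> hcomp R (\<rho> (n + j) - \<rho> n)"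
  using lam_bij[of n j] by (auto simp: bij_betw_def)

lemma lam_surj:
  assumes "e \<in> hcomp R (\<rho> l - \<rho> n)"
  obtains a where "a \<in> hcomp S (l - n)" "e = lam n (l - n) a"
  using lam_bij[of n "l - n"] assms that by (auto simp: bij_betw_def)

lemma R_mult_deg: "\<lbrakk>a \<in> hcomp R (h - g); b \<in> hcomp R (k - h)\<rbrakk> \<Longrightarrow> a \<otimes>\<^bsub>R\<^esub> b \<in> hcomp R (k - g)"
  using R.mult_deg[of a "h - g" b "k - h"] by simp

subsection \<open>Restriction\<close>

text \<open>
  The module structure of the restriction is assembled from its homogeneous pieces, so the restriction is
  first a graded group, whose field \<open>ract\<close> is only a placeholder.
\<close>

definition res_group :: "('a, 'm, 'g) gr_mod \<Rightarrow> ('b, 'm, 'h) gr_mod" where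
  "res_group M = \<lparr>carrier = {m \<in> carrier M. \<forall>g. g \<notin> range \<rho> \<longrightarrow> graded_group.part M (gcomp M) m g = \<zero>\<^bsub>M\<^esub>},
     monoid.mult = undefined, one = undefined, ring.zero = \<zero>\<^bsub>M\<^esub>, add = add M,
     ract = (\<lambda>m _. m), gcomp = (\<lambda>n. gcomp M (\<rho> n))\<rparr>"

definition res :: "('a, 'm, 'g) gr_mod \<Rightarrow> ('b, 'm, 'h) gr_mod" where
  "res M = (res_group M)\<lparr>ract := graded_action.act S (res_group M) (\<lambda>n j m a. ract M m (lam n j a))\<rparr>"

lemma res_simps [simp]:
  "\<zero>\<^bsub>res M\<^esub> = \<zero>\<^bsub>M\<^esub>" "add (res M) = add M" "gcomp (res M) n = gcomp M (\<rho> n)"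
  by (auto simp: res_def res_group_def)

lemma res_carrier:
  "carrier (res M) = {m \<in> carrier M. \<forall>g. g \<notin> range \<rho> \<longrightarrow> graded_group.part M (gcomp M) m g = \<zero>\<^bsub>M\<^esub>}"
  by (auto simp: res_def res_group_def)

lemma res_graded_group:
  assumes "graded_right_module R M"
  shows "graded_group (res_group M) (gcomp (res_group M))"
proof -
  interpret M: graded_right_module R M by fact
  let ?N = "res_group M"
  have simps [simp]: "\<zero>\<^bsub>?N\<^esub> = \<zero>\<^bsub>M\<^esub>" "add ?N = add M" "gcomp ?N n = gcomp M (\<rho> n)" for n
    by (auto simp: res_group_def)
  have car: "carrier ?N = {m \<in> carrier M. \<forall>g. g \<notin> range \<rho> \<longrightarrow> M.MG.part m g = \<zero>\<^bsub>M\<^esub>}"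
    by (auto simp: res_group_def)
  have sub: "carrier ?N \<subseteq> carrier M" by (auto simp: car)
  have inC: "m \<in> carrier ?N" if "m \<in> gcomp M (\<rho> n)" for m n
    using that M.MG.C_carrier M.MG.part_homogeneous[OF that] by (auto simp: car)
  have ab: "abelian_group ?N"
  proof (rule abelian_groupI)
    fix x assume x: "x \<in> carrier ?N"
    have "\<ominus>\<^bsub>M\<^esub> x \<in> carrier ?N"
      using x additive_map_minus[OF M.M.abelian_group_axioms M.M.abelian_group_axioms M.MG.part_additive_map]
      by (auto simp: car)
    then show "\<exists>y\<in>carrier ?N. y \<oplus>\<^bsub>?N\<^esub> x = \<zero>\<^bsub>?N\<^esub>"
      using x by (intro bexI[of _ "\<ominus>\<^bsub>M\<^esub> x"]) (auto simp: car M.M.l_neg)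
  qed (auto simp: car M.MG.part_add M.MG.part_zero M.M.add.m_ac)
  interpret N: abelian_group ?N by fact
  have incl: "additive_map ?N M (\<lambda>x. x)" unfolding additive_map_def using sub by auto
  show ?thesis
  proof (rule graded_groupI[OF ab, where \<pi> = "\<lambda>n m. M.MG.part m (\<rho> n)"])
    show "additive_subgroup (gcomp ?N n) ?N" for n
    proof (rule N.additive_subgroupI')
      fix a assume "a \<in> gcomp ?N n"
      then show "\<exists>b\<in>gcomp ?N n. b \<oplus>\<^bsub>?N\<^esub> a = \<zero>\<^bsub>?N\<^esub>"
        using M.MG.C_minus[of a "\<rho> n"] M.M.l_neg[of a] M.MG.C_carrier[of a "\<rho> n"] by auto
    qed (use inC M.MG.C_zero M.MG.C_add in auto)
    show "additive_map ?N ?N (\<lambda>m. M.MG.part m (\<rho> n))" for n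
      unfolding additive_map_def using sub inC[OF M.MG.part_in] by (auto simp: M.MG.part_add subset_iff)
    show "M.MG.part m (\<rho> n) \<in> gcomp ?N n" if "m \<in> carrier ?N" for m n
      using that sub M.MG.part_in by auto
    show "M.MG.part m (\<rho> n) = m" if "m \<in> gcomp ?N n" for m n
      using that by (simp add: M.MG.part_homogeneous)
    show "M.MG.part m (\<rho> h) = \<zero>\<^bsub>?N\<^esub>" if "m \<in> gcomp ?N n" "h \<noteq> n" for m n h
      using that M.MG.part_homogeneous[of m "\<rho> n" "\<rho> h"] inj_\<rho> by (auto dest: injD)
    fix m assume m: "m \<in> carrier ?N"
    have mc: "m \<in> carrier M" using m sub by auto
    let ?A = "{n. M.MG.part m (\<rho> n) \<noteq> \<zero>\<^bsub>?N\<^esub>}"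
    have im: "\<rho> ` ?A = M.MG.supp m" using m by (auto simp: car M.MG.supp_def)
    show "finite ?A"
      using M.MG.finite_supp[OF mc] im inj_\<rho> by (metis (no_types, lifting) finite_imageD inj_on_subset subset_UNIV)
    have "m = (\<Oplus>\<^bsub>M\<^esub>g\<in>\<rho> ` ?A. M.MG.part m g)" unfolding im by (rule M.MG.sum_part[OF mc])
    also have "\<dots> = (\<Oplus>\<^bsub>M\<^esub>n\<in>?A. M.MG.part m (\<rho> n))"
      using M.MG.part_carrier[OF mc] inj_\<rho> by (intro M.M.finsum_reindex) (auto intro: inj_on_subset)
    also have "\<dots> = (\<Oplus>\<^bsub>?N\<^esub>n\<in>?A. M.MG.part m (\<rho> n))"
      using inC[OF M.MG.part_in[OF mc]]
      by (intro additive_map_finsum[OF ab M.M.abelian_group_axioms incl, symmetric]) auto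
    finally show "m = (\<Oplus>\<^bsub>?N\<^esub>n\<in>?A. M.MG.part m (\<rho> n))" .
  qed
qed

lemma res_action:
  assumes "graded_right_module R M"
  shows "graded_action S (res_group M) (\<lambda>n j m a. ract M m (lam n j a))"
proof -
  interpret M: graded_right_module R M by fact
  have simps [simp]: "\<zero>\<^bsub>res_group M\<^esub> = \<zero>\<^bsub>M\<^esub>" "add (res_group M) = add M"
    "gcomp (res_group M) n = gcomp M (\<rho> n)" for n
    by (auto simp: res_group_def)
  note lc = R.RG.C_carrier[OF lam_in]
  show ?thesis
  proof (intro graded_action.intro graded_action_axioms.intro S.graded_ring_axioms res_graded_group assms)
    fix m n a j assume "m \<in> gcomp (res_group M) n" "a \<in> hcomp S j"
    then show "ract M m (lam n j a) \<in> gcomp (res_group M) (n + j)"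
      using M.ract_degree[of m "\<rho> n" "lam n j a"] lam_in[of a j n] by fastforce
  next
    fix m n a j b l assume "m \<in> gcomp (res_group M) n" "a \<in> hcomp S j" "b \<in> hcomp S l"
    then show "ract M m (lam n (j + l) (a \<otimes>\<^bsub>S\<^esub> b)) = ract M (ract M m (lam n j a)) (lam (n + j) l b)"
      using M.MG.C_carrier lc by (simp add: lam_mult M.ract_assoc)
  next
    fix m n assume "m \<in> gcomp (res_group M) n"
    then show "ract M m (lam n 0 \<one>\<^bsub>S\<^esub>) = m"
      using M.MG.C_carrier by (simp add: lam_one M.ract_one)
  qed (use M.MG.C_carrier lc in \<open>simp_all add: lam_add M.ract_add_left M.ract_add_right\<close>)
qed

lemma graded_right_module_res:
  assumes "graded_right_module R M"
  shows "graded_right_module S (res M)"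
  unfolding res_def by (rule graded_action.graded_right_module_ract_update[OF res_action[OF assms]])

lemma res_ract:
  assumes "graded_right_module R M" "m \<in> gcomp M (\<rho> n)" "a \<in> hcomp S j"
  shows "ract (res M) m a = ract M m (lam n j a)"
  using graded_action.act_homogeneous[OF res_action[OF assms(1)], of m n a j] assms
  by (simp add: res_def res_group_def)

lemma res_homogeneous_carrier:
  assumes "graded_right_module R M" "m \<in> gcomp M (\<rho> n)"
  shows "m \<in> carrier (res M)"
proof -
  interpret N: graded_right_module S "res M" by (rule graded_right_module_res[OF assms(1)])
  show ?thesis using N.MG.C_carrier[of m n] assms(2) by simp
qed

lemma res_scal:
  assumes M: "graded_right_module R M" and m: "m \<in> carrier (res M)"
  shows "ract (res M) m (scal S c) = ract M m (scal R c)"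
proof -
  interpret M: graded_right_module R M by fact
  interpret N: graded_right_module S "res M" by (rule graded_right_module_res[OF M])
  have s: "scal S c \<in> carrier S" "scal R c \<in> carrier R"
    using S.RG.C_carrier[OF S.scal_deg] R.RG.C_carrier[OF R.scal_deg] by auto
  show ?thesis using m
  proof (induction rule: N.MG.homogeneous_induct)
    case (add m n)
    then show ?case
      using N.ract_add_left[OF add(1,2) s(1)] s by (simp add: M.ract_add_left res_carrier)
  next
    case (homogeneous n m)
    then show ?case using res_ract[OF M, of m n "scal S c" 0] S.scal_deg by (simp add: lam_scal)
  qed
qed

lemma gr_hom_res:
  assumes M: "graded_right_module R M" and N: "graded_right_module R N" and \<phi>: "\<phi> \<in> gr_hom R M N"
  shows "restrict \<phi> (carrier (res M)) \<in> gr_hom S (res M) (res N)"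
proof (rule gr_hom_homogeneousI[OF S.graded_ring_axioms graded_right_module_res[OF M] graded_right_module_res[OF N]])
  interpret M: graded_right_module R M by fact
  interpret N: graded_right_module R N by fact
  interpret rM: graded_right_module S "res M" by (rule graded_right_module_res[OF M])
  interpret rN: graded_right_module S "res N" by (rule graded_right_module_res[OF N])
  have sub: "carrier (res M) \<subseteq> carrier M" "carrier (res N) \<subseteq> carrier N" by (auto simp: res_carrier)
  have cl: "\<phi> m \<in> carrier (res N)" if "m \<in> carrier (res M)" for m
    using that
  proof (induction rule: rM.MG.homogeneous_induct)
    case (add m n)
    then show ?case using rN.M.add.m_closed[of "\<phi> m" "\<phi> n"] gr_hom_add[OF \<phi> subsetD[OF sub(1) add(1)] subsetD[OF sub(1) add(2)]] by simp
  next
    case (homogeneous n m)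
    then show ?case using gr_hom_deg[OF \<phi>, of m "\<rho> n"] res_homogeneous_carrier[OF N] by simp
  qed
  show "additive_map (res M) (res N) (restrict \<phi> (carrier (res M)))"
    unfolding additive_map_def
  proof (intro conjI ballI)
    fix x y assume x: "x \<in> carrier (res M)" and y: "y \<in> carrier (res M)"
    then show "restrict \<phi> (carrier (res M)) (x \<oplus>\<^bsub>res M\<^esub> y) =
        restrict \<phi> (carrier (res M)) x \<oplus>\<^bsub>res N\<^esub> restrict \<phi> (carrier (res M)) y"
      using rM.M.add.m_closed[OF x y] gr_hom_add[OF \<phi> subsetD[OF sub(1) x] subsetD[OF sub(1) y]] by simp
  qed (use cl in auto)
  show "restrict \<phi> (carrier (res M)) m \<in> gcomp (res N) n" if "m \<in> gcomp (res M) n" for m n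
    using that rM.MG.C_carrier gr_hom_deg[OF \<phi>, of m "\<rho> n"] by simp
  show "restrict \<phi> (carrier (res M)) (ract (res M) m a) = ract (res N) (restrict \<phi> (carrier (res M)) m) a"
    if m: "m \<in> gcomp (res M) n" and a: "a \<in> hcomp S j" for m n a j
  proof -
    have mc: "m \<in> carrier (res M)" using rM.MG.C_carrier[OF m] .
    have ac: "a \<in> carrier S" using S.RG.C_carrier[OF a] .
    have m': "m \<in> gcomp M (\<rho> n)" using m by simp
    have "\<phi> (ract M m (lam n j a)) = ract N (\<phi> m) (lam n j a)"
      using gr_hom_ract[OF \<phi> M.MG.C_carrier[OF m'] R.RG.C_carrier[OF lam_in[OF a]]] .
    then show ?thesis
      using rM.ract_closed[OF mc ac] mc res_ract[OF M m' a] res_ract[OF N gr_hom_deg[OF \<phi> m'] a] by simp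
  qed
qed auto

subsection \<open>Restriction is fully faithful\<close>

text \<open>
  An element of degree \<open>g\<close> is determined by its multiples in the degrees \<open>\<rho> n\<close>: multiply by the
  decomposition of \<open>1\<close> that passes through these degrees.
\<close>

lemma separated:
  assumes M: "graded_right_module R M" and w: "w \<in> gcomp M g" "w' \<in> gcomp M g"
    and eq: "\<And>n c. c \<in> hcomp R (\<rho> n - g) \<Longrightarrow> ract M w c = ract M w' c"
  shows "w = w'"
proof -
  interpret M: graded_right_module R M by fact
  obtain I :: "nat set" and p d d' where I: "finite I"
    "\<And>i. i \<in> I \<Longrightarrow> d i \<in> hcomp R (\<rho> (p i) - g)" "\<And>i. i \<in> I \<Longrightarrow> d' i \<in> hcomp R (g - \<rho> (p i))"
    "\<one>\<^bsub>R\<^esub> = (\<Oplus>\<^bsub>R\<^esub>i\<in>I. d i \<otimes>\<^bsub>R\<^esub> d' i)"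
    using cover[of g] by blast
  note c = R.RG.C_carrier[OF I(2)] R.RG.C_carrier[OF I(3)]
  have dec: "u = (\<Oplus>\<^bsub>M\<^esub>i\<in>I. ract M (ract M u (d i)) (d' i))" if "u \<in> gcomp M g" for u
  proof -
    have uc: "u \<in> carrier M" using M.MG.C_carrier[OF that] .
    have "ract M u \<one>\<^bsub>R\<^esub> = (\<Oplus>\<^bsub>M\<^esub>i\<in>I. ract M u (d i \<otimes>\<^bsub>R\<^esub> d' i))"
      unfolding I(4) using c
      by (intro additive_map_finsum[OF R.abelian_group_axioms M.M.abelian_group_axioms M.ract_additive_right[OF uc]]) auto
    also have "\<dots> = (\<Oplus>\<^bsub>M\<^esub>i\<in>I. ract M (ract M u (d i)) (d' i))"
      using c uc by (intro M.M.finsum_cong') (auto simp: M.ract_assoc M.ract_closed)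
    finally show ?thesis using M.ract_one[OF uc] by simp
  qed
  have "(\<Oplus>\<^bsub>M\<^esub>i\<in>I. ract M (ract M w (d i)) (d' i)) = (\<Oplus>\<^bsub>M\<^esub>i\<in>I. ract M (ract M w' (d i)) (d' i))"
    using c M.MG.C_carrier[OF w(2)] eq[OF I(2)] by (intro M.M.finsum_cong') (auto simp: M.ract_closed)
  then show ?thesis using dec[OF w(1)] dec[OF w(2)] by metis
qed

text \<open>
  The decomposition \<open>1 = \<Sum> d\<^sub>i d'\<^sub>i\<close> also forces the element with prescribed multiples: it is the sum of
  the \<open>F d\<^sub>i d'\<^sub>i\<close>. Compatibility of the family shows that this element has the right multiples.
\<close>

lemma gluing:
  assumes M: "graded_right_module R M"
    and F_deg: "\<And>n c. c \<in> hcomp R (\<rho> n - g) \<Longrightarrow> F n c \<in> gcomp M (\<rho> n)"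
    and F_add: "\<And>n c c'. c \<in> hcomp R (\<rho> n - g) \<Longrightarrow> c' \<in> hcomp R (\<rho> n - g) \<Longrightarrow>
      F n (c \<oplus>\<^bsub>R\<^esub> c') = F n c \<oplus>\<^bsub>M\<^esub> F n c'"
    and F_lin: "\<And>n c l e. c \<in> hcomp R (\<rho> n - g) \<Longrightarrow> e \<in> hcomp R (\<rho> l - \<rho> n) \<Longrightarrow>
      ract M (F n c) e = F l (c \<otimes>\<^bsub>R\<^esub> e)"
  shows "\<exists>w\<in>gcomp M g. \<forall>n. \<forall>c\<in>hcomp R (\<rho> n - g). ract M w c = F n c"
proof -
  interpret M: graded_right_module R M by fact
  obtain I :: "nat set" and p d d' where I: "finite I"
    "\<And>i. i \<in> I \<Longrightarrow> d i \<in> hcomp R (\<rho> (p i) - g)" "\<And>i. i \<in> I \<Longrightarrow> d' i \<in> hcomp R (g - \<rho> (p i))"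
    "\<one>\<^bsub>R\<^esub> = (\<Oplus>\<^bsub>R\<^esub>i\<in>I. d i \<otimes>\<^bsub>R\<^esub> d' i)"
    using cover[of g] by blast
  note c = R.RG.C_carrier[OF I(2)] R.RG.C_carrier[OF I(3)]
  define w where "w = (\<Oplus>\<^bsub>M\<^esub>i\<in>I. ract M (F (p i) (d i)) (d' i))"
  have wi: "ract M (F (p i) (d i)) (d' i) \<in> gcomp M g" if "i \<in> I" for i
    using M.ract_degree[OF F_deg[OF I(2)[OF that]] I(3)[OF that]] by simp
  have w: "w \<in> gcomp M g" unfolding w_def by (intro M.MG.C_finsum Pi_I wi)
  have "ract M w b = F n b" if b: "b \<in> hcomp R (\<rho> n - g)" for n b
  proof -
    have bc: "b \<in> carrier R" using R.RG.C_carrier[OF b] .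
    let ?G = "\<lambda>r. F n (R.RG.part r (\<rho> n - g))"
    have G: "additive_map R M ?G"
      unfolding additive_map_def
      using F_deg[OF R.RG.part_in] F_add[OF R.RG.part_in R.RG.part_in] M.MG.C_carrier
      by (auto simp: R.RG.part_add) blast
    have ddb: "(d i \<otimes>\<^bsub>R\<^esub> d' i) \<otimes>\<^bsub>R\<^esub> b \<in> hcomp R (\<rho> n - g)" if "i \<in> I" for i
      using R.mult_deg[OF R_mult_deg[OF I(2,3)[OF that]] b] by simp
    have "ract M w b = (\<Oplus>\<^bsub>M\<^esub>i\<in>I. ract M (ract M (F (p i) (d i)) (d' i)) b)"
      unfolding w_def using M.MG.C_carrier[OF wi]
      by (intro additive_map_finsum[OF M.M.abelian_group_axioms M.M.abelian_group_axioms M.ract_additive_left[OF bc]]) auto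
    also have "\<dots> = (\<Oplus>\<^bsub>M\<^esub>i\<in>I. ?G ((d i \<otimes>\<^bsub>R\<^esub> d' i) \<otimes>\<^bsub>R\<^esub> b))"
    proof (rule M.M.finsum_cong')
      fix i assume i: "i \<in> I"
      have "ract M (ract M (F (p i) (d i)) (d' i)) b = ract M (F (p i) (d i)) (d' i \<otimes>\<^bsub>R\<^esub> b)"
        using M.MG.C_carrier[OF F_deg[OF I(2)[OF i]]] c(2)[OF i] bc by (simp add: M.ract_assoc)
      also have "\<dots> = F n (d i \<otimes>\<^bsub>R\<^esub> (d' i \<otimes>\<^bsub>R\<^esub> b))"
        by (rule F_lin[OF I(2)[OF i] R_mult_deg[OF I(3)[OF i] b]])
      finally show "ract M (ract M (F (p i) (d i)) (d' i)) b = ?G ((d i \<otimes>\<^bsub>R\<^esub> d' i) \<otimes>\<^bsub>R\<^esub> b)"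
        using R.RG.part_homogeneous[OF ddb[OF i]] c[OF i] bc by (simp add: R.m_assoc)
    qed (use additive_map_closed[OF G] c bc in auto)
    also have "\<dots> = ?G (\<Oplus>\<^bsub>R\<^esub>i\<in>I. (d i \<otimes>\<^bsub>R\<^esub> d' i) \<otimes>\<^bsub>R\<^esub> b)"
      using c bc by (intro additive_map_finsum[OF R.abelian_group_axioms M.M.abelian_group_axioms G, symmetric]) auto
    also have "(\<Oplus>\<^bsub>R\<^esub>i\<in>I. (d i \<otimes>\<^bsub>R\<^esub> d' i) \<otimes>\<^bsub>R\<^esub> b) = (\<Oplus>\<^bsub>R\<^esub>i\<in>I. d i \<otimes>\<^bsub>R\<^esub> d' i) \<otimes>\<^bsub>R\<^esub> b"
      using c bc I(1) by (intro R.finsum_ldistr[symmetric]) auto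
    also have "\<dots> = b" using bc by (simp flip: I(4))
    finally show ?thesis using R.RG.part_homogeneous[OF b] by simp
  qed
  then show ?thesis using w by blast
qed

lemma res_hom_lin:
  assumes M: "graded_right_module R M" and N: "graded_right_module R N"
    and \<psi>: "\<psi> \<in> gr_hom S (res M) (res N)" and x: "x \<in> gcomp M (\<rho> n)" and e: "e \<in> hcomp R (\<rho> l - \<rho> n)"
  shows "\<psi> (ract M x e) = ract N (\<psi> x) e"
proof -
  obtain a where a: "a \<in> hcomp S (l - n)" "e = lam n (l - n) a" by (rule lam_surj[OF e])
  have "\<psi> x \<in> gcomp N (\<rho> n)" using gr_hom_deg[OF \<psi>, of x n] x by simp
  then show ?thesis
    using gr_hom_ract[OF \<psi> res_homogeneous_carrier[OF M x] S.RG.C_carrier[OF a(1)]]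
      res_ract[OF M x a(1)] res_ract[OF N _ a(1)] a(2) by simp
qed

text \<open>
  A homomorphism \<open>\<psi>\<close> of the restrictions extends to an element \<open>w\<close> of degree \<open>g\<close> by gluing the family
  \<open>c \<mapsto> \<psi> (w c)\<close>.
\<close>

lemma res_full:
  assumes M: "graded_right_module R M" and N: "graded_right_module R N"
    and \<psi>: "\<psi> \<in> gr_hom S (res M) (res N)"
  shows "\<exists>\<phi>\<in>gr_hom R M N. restrict \<phi> (carrier (res M)) = \<psi>"
proof -
  interpret M: graded_right_module R M by fact
  interpret N: graded_right_module R N by fact
  have deg: "\<psi> x \<in> gcomp N (\<rho> n)" if "x \<in> gcomp M (\<rho> n)" for x n
    using gr_hom_deg[OF \<psi>, of x n] that by simp
  have mc: "ract M m c \<in> gcomp M (\<rho> n)" if "m \<in> gcomp M g" "c \<in> hcomp R (\<rho> n - g)" for m g c n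
    using M.ract_degree[OF that] by simp
  have "\<exists>w\<in>gcomp N g. \<forall>n. \<forall>c\<in>hcomp R (\<rho> n - g). ract N w c = \<psi> (ract M m c)" if m: "m \<in> gcomp M g" for m g
  proof (rule gluing[OF N])
    show "\<psi> (ract M m c) \<in> gcomp N (\<rho> n)" if "c \<in> hcomp R (\<rho> n - g)" for n c
      by (rule deg[OF mc[OF m that]])
    show "\<psi> (ract M m (c \<oplus>\<^bsub>R\<^esub> c')) = \<psi> (ract M m c) \<oplus>\<^bsub>N\<^esub> \<psi> (ract M m c')"
      if c: "c \<in> hcomp R (\<rho> n - g)" "c' \<in> hcomp R (\<rho> n - g)" for n c c'
      using gr_hom_add[OF \<psi> res_homogeneous_carrier[OF M mc[OF m c(1)]] res_homogeneous_carrier[OF M mc[OF m c(2)]]]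
        M.ract_add_right[OF M.MG.C_carrier[OF m] R.RG.C_carrier[OF c(1)] R.RG.C_carrier[OF c(2)]] by simp
    show "ract N (\<psi> (ract M m c)) e = \<psi> (ract M m (c \<otimes>\<^bsub>R\<^esub> e))"
      if c: "c \<in> hcomp R (\<rho> n - g)" and e: "e \<in> hcomp R (\<rho> l - \<rho> n)" for n c l e
      using res_hom_lin[OF M N \<psi> mc[OF m c] e]
        M.ract_assoc[OF M.MG.C_carrier[OF m] R.RG.C_carrier[OF c] R.RG.C_carrier[OF e]] by simp
  qed
  then have "\<exists>w. m \<in> gcomp M g \<longrightarrow> w \<in> gcomp N g \<and> (\<forall>n. \<forall>c\<in>hcomp R (\<rho> n - g). ract N w c = \<psi> (ract M m c))" for m g
    by blast
  then have "\<forall>g m. \<exists>w. m \<in> gcomp M g \<longrightarrow> w \<in> gcomp N g \<and> (\<forall>n. \<forall>c\<in>hcomp R (\<rho> n - g). ract N w c = \<psi> (ract M m c))"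
    by blast
  then obtain W where W: "\<And>g m. m \<in> gcomp M g \<Longrightarrow> W g m \<in> gcomp N g"
    "\<And>g m n c. m \<in> gcomp M g \<Longrightarrow> c \<in> hcomp R (\<rho> n - g) \<Longrightarrow> ract N (W g m) c = \<psi> (ract M m c)"
    by (simp only: choice_iff) blast
  have W_add: "W g (m \<oplus>\<^bsub>M\<^esub> m') = W g m \<oplus>\<^bsub>N\<^esub> W g m'" if m: "m \<in> gcomp M g" "m' \<in> gcomp M g" for g m m'
  proof (rule separated[OF N W(1)[OF M.MG.C_add[OF m]] N.MG.C_add[OF W(1)[OF m(1)] W(1)[OF m(2)]]])
    fix n c assume c: "c \<in> hcomp R (\<rho> n - g)"
    have cc: "c \<in> carrier R" using R.RG.C_carrier[OF c] .
    have "\<psi> (ract M m c \<oplus>\<^bsub>M\<^esub> ract M m' c) = \<psi> (ract M m c) \<oplus>\<^bsub>N\<^esub> \<psi> (ract M m' c)"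
      using gr_hom_add[OF \<psi> res_homogeneous_carrier[OF M mc[OF m(1) c]] res_homogeneous_carrier[OF M mc[OF m(2) c]]] by simp
    then show "ract N (W g (m \<oplus>\<^bsub>M\<^esub> m')) c = ract N (W g m \<oplus>\<^bsub>N\<^esub> W g m') c"
      using W(2)[OF M.MG.C_add[OF m] c] W(2)[OF m(1) c] W(2)[OF m(2) c]
        M.ract_add_left[OF M.MG.C_carrier[OF m(1)] M.MG.C_carrier[OF m(2)] cc]
        N.ract_add_left[OF N.MG.C_carrier[OF W(1)[OF m(1)]] N.MG.C_carrier[OF W(1)[OF m(2)]] cc] by simp
  qed
  note ext = N.M.abelian_group_axioms N.MG.C_carrier[OF W(1)] W_add
  let ?e = "M.MG.extend N W"
  have e_add: "additive_map M N ?e" by (rule M.MG.extend_additive[OF ext])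
  have e_hom: "?e m = W g m" if "m \<in> gcomp M g" for m g by (rule M.MG.extend_homogeneous[OF ext that])
  let ?\<phi> = "restrict ?e (carrier M)"
  have \<phi>_hom: "?\<phi> m = W g m" if "m \<in> gcomp M g" for m g using e_hom[OF that] M.MG.C_carrier[OF that] by simp
  have \<phi>: "?\<phi> \<in> gr_hom R M N"
  proof (rule gr_hom_homogeneousI[OF R.graded_ring_axioms M N])
    show "additive_map M N ?\<phi>"
      unfolding additive_map_def using additive_map_closed[OF e_add] additive_map_add[OF e_add] by auto
    show "?\<phi> m \<in> gcomp N g" if "m \<in> gcomp M g" for m g using W(1)[OF that] \<phi>_hom[OF that] by simp
    fix g m h r assume m: "m \<in> gcomp M g" and r: "r \<in> hcomp R h"
    have mr: "ract M m r \<in> gcomp M (g + h)" using M.ract_degree[OF m r] .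
    have "W (g + h) (ract M m r) = ract N (W g m) r"
    proof (rule separated[OF N W(1)[OF mr] N.ract_degree[OF W(1)[OF m] r]])
      fix n c assume c: "c \<in> hcomp R (\<rho> n - (g + h))"
      have rc: "r \<otimes>\<^bsub>R\<^esub> c \<in> hcomp R (\<rho> n - g)" using R.mult_deg[OF r c] by (simp add: algebra_simps)
      have cr: "c \<in> carrier R" "r \<in> carrier R" using R.RG.C_carrier c r by auto
      show "ract N (W (g + h) (ract M m r)) c = ract N (ract N (W g m) r) c"
        using W(2)[OF mr c] W(2)[OF m rc] cr M.MG.C_carrier[OF m] N.MG.C_carrier[OF W(1)[OF m]]
        by (simp add: M.ract_assoc N.ract_assoc)
    qed
    then show "?\<phi> (ract M m r) = ract N (?\<phi> m) r" using \<phi>_hom[OF mr] \<phi>_hom[OF m] by simp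
  qed auto
  moreover have "restrict ?\<phi> (carrier (res M)) = \<psi>"
  proof (rule gr_hom_eqI[OF graded_right_module_res[OF M] graded_right_module_res[OF N] gr_hom_res[OF M N \<phi>] \<psi>])
    fix n x assume "x \<in> gcomp (res M) n"
    then have x: "x \<in> gcomp M (\<rho> n)" by simp
    have one: "\<one>\<^bsub>R\<^esub> \<in> hcomp R (\<rho> n - \<rho> n)" using R.one_deg by simp
    have "W (\<rho> n) x = \<psi> x"
      using W(2)[OF x one] N.ract_one[OF N.MG.C_carrier[OF W(1)[OF x]]] M.ract_one[OF M.MG.C_carrier[OF x]] by simp
    then show "restrict ?\<phi> (carrier (res M)) x = \<psi> x"
      using \<phi>_hom[OF x] res_homogeneous_carrier[OF M x] by simp
  qed
  ultimately show ?thesis by blast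
qed

lemma res_faithful:
  assumes M: "graded_right_module R M" and N: "graded_right_module R N"
    and \<phi>: "\<phi> \<in> gr_hom R M N" and \<psi>: "\<psi> \<in> gr_hom R M N"
    and eq: "restrict \<phi> (carrier (res M)) = restrict \<psi> (carrier (res M))"
  shows "\<phi> = \<psi>"
proof (rule gr_hom_eqI[OF M N \<phi> \<psi>])
  interpret M: graded_right_module R M by fact
  fix g m assume m: "m \<in> gcomp M g"
  show "\<phi> m = \<psi> m"
  proof (rule separated[OF N gr_hom_deg[OF \<phi> m] gr_hom_deg[OF \<psi> m]])
    fix n c assume c: "c \<in> hcomp R (\<rho> n - g)"
    have "ract M m c \<in> gcomp M (\<rho> n)" using M.ract_degree[OF m c] by simp
    then have "\<phi> (ract M m c) = \<psi> (ract M m c)"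
      using res_homogeneous_carrier[OF M] eq by (metis restrict_apply')
    then show "ract N (\<phi> m) c = ract N (\<psi> m) c"
      using gr_hom_ract[OF \<phi> M.MG.C_carrier[OF m] R.RG.C_carrier[OF c]]
        gr_hom_ract[OF \<psi> M.MG.C_carrier[OF m] R.RG.C_carrier[OF c]] by simp
  qed
qed

subsection \<open>Finite generation\<close>

text \<open>
  A homogeneous generator of degree \<open>g\<close> is replaced by its multiples by the left factors \<open>d\<^sub>i\<close> of the
  decomposition of \<open>1\<close> for \<open>g\<close>; these have degrees in the range of \<open>\<rho>\<close>.
\<close>

lemma fin_gen_res:
  assumes M: "graded_right_module R M" and fg: "fin_gen R M"
  shows "fin_gen S (res M)"
proof -
  interpret M: graded_right_module R M by fact
  interpret rM: graded_right_module S "res M" by (rule graded_right_module_res[OF M])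
  obtain T where T: "finite T" "T \<subseteq> carrier M" "\<And>t. t \<in> T \<Longrightarrow> \<exists>g. t \<in> gcomp M g" "carrier M = M.span T"
    using M.fin_gen_homogeneous[OF fg] by blast
  obtain \<gamma> where \<gamma>: "\<And>t. t \<in> T \<Longrightarrow> t \<in> gcomp M (\<gamma> t)" using T(3) by metis
  obtain I :: "'g \<Rightarrow> nat set" and p d d' where I: "\<And>g. finite (I g)"
    "\<And>g i. i \<in> I g \<Longrightarrow> d g i \<in> hcomp R (\<rho> (p g i) - g)" "\<And>g i. i \<in> I g \<Longrightarrow> d' g i \<in> hcomp R (g - \<rho> (p g i))"
    "\<And>g. \<one>\<^bsub>R\<^esub> = (\<Oplus>\<^bsub>R\<^esub>i\<in>I g. d g i \<otimes>\<^bsub>R\<^esub> d' g i)"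
  proof -
    have "\<forall>g. \<exists>(I :: nat set) p d d'. finite I \<and>
      (\<forall>i\<in>I. d i \<in> hcomp R (\<rho> (p i) - g) \<and> d' i \<in> hcomp R (g - \<rho> (p i))) \<and>
      \<one>\<^bsub>R\<^esub> = (\<Oplus>\<^bsub>R\<^esub>i\<in>I. d i \<otimes>\<^bsub>R\<^esub> d' i)"
      using cover by blast
    then show thesis using that by (simp only: choice_iff) blast
  qed
  note c = R.RG.C_carrier[OF I(2)] R.RG.C_carrier[OF I(3)]
  define U where "U = (\<Union>t\<in>T. (\<lambda>i. ract M t (d (\<gamma> t) i)) ` I (\<gamma> t))"
  have td: "ract M t (d (\<gamma> t) i) \<in> gcomp M (\<rho> (p (\<gamma> t) i))" if "t \<in> T" "i \<in> I (\<gamma> t)" for t i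
    using M.ract_degree[OF \<gamma>[OF that(1)] I(2)[OF that(2)]] by simp
  have U: "finite U" "U \<subseteq> carrier (res M)"
    unfolding U_def using T(1) I(1) res_homogeneous_carrier[OF M td] by auto
  show ?thesis
  proof (rule rM.fin_genI[OF U])
    fix n m assume "m \<in> gcomp (res M) n"
    then have m: "m \<in> gcomp M (\<rho> n)" by simp
    have "m \<in> M.span T" using M.MG.C_carrier[OF m] T(4) by simp
    then obtain r where r: "r \<in> T \<rightarrow> carrier R" "m = (\<Oplus>\<^bsub>M\<^esub>t\<in>T. ract M t (r t))"
      unfolding M.span_def by auto
    define q where "q t = R.RG.part (r t) (\<rho> n - \<gamma> t)" for t
    have q: "q t \<in> hcomp R (\<rho> n - \<gamma> t)" if "t \<in> T" for t
      unfolding q_def using r(1) that by (intro R.RG.part_in) auto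
    have dq: "d' (\<gamma> t) i \<otimes>\<^bsub>R\<^esub> q t \<in> hcomp R (\<rho> n - \<rho> (p (\<gamma> t) i))" if "t \<in> T" "i \<in> I (\<gamma> t)" for t i
      by (rule R_mult_deg[OF I(3)[OF that(2)] q[OF that(1)]])
    have x: "ract M (ract M t (d (\<gamma> t) i)) (d' (\<gamma> t) i \<otimes>\<^bsub>R\<^esub> q t) \<in> rM.span U" (is "?x \<in> _")
      if t: "t \<in> T" and i: "i \<in> I (\<gamma> t)" for t i
    proof -
      obtain a where a: "a \<in> hcomp S (n - p (\<gamma> t) i)"
        "d' (\<gamma> t) i \<otimes>\<^bsub>R\<^esub> q t = lam (p (\<gamma> t) i) (n - p (\<gamma> t) i) a"
        by (rule lam_surj[OF dq[OF t i]])
      have "?x = ract (res M) (ract M t (d (\<gamma> t) i)) a"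
        using res_ract[OF M td[OF t i] a(1)] a(2) by simp
      moreover have "ract M t (d (\<gamma> t) i) \<in> rM.span U"
        using t i by (intro rM.span_gen[OF U(2,1)]) (auto simp: U_def)
      ultimately show ?thesis using rM.span_ract[OF U(2) _ S.RG.C_carrier[OF a(1)]] by simp
    qed
    have tq: "ract M t (q t) = (\<Oplus>\<^bsub>res M\<^esub>i\<in>I (\<gamma> t). ract M (ract M t (d (\<gamma> t) i)) (d' (\<gamma> t) i \<otimes>\<^bsub>R\<^esub> q t))"
      if t: "t \<in> T" for t
    proof -
      have tc: "t \<in> carrier M" and qc: "q t \<in> carrier R" using T(2) t R.RG.C_carrier[OF q[OF t]] by auto
      have cc: "d (\<gamma> t) i \<otimes>\<^bsub>R\<^esub> d' (\<gamma> t) i \<in> carrier R" if "i \<in> I (\<gamma> t)" for i using c[OF that] by simp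
      have "q t = (\<Oplus>\<^bsub>R\<^esub>i\<in>I (\<gamma> t). d (\<gamma> t) i \<otimes>\<^bsub>R\<^esub> d' (\<gamma> t) i) \<otimes>\<^bsub>R\<^esub> q t" using qc by (simp flip: I(4)[of "\<gamma> t"])
      also have "\<dots> = (\<Oplus>\<^bsub>R\<^esub>i\<in>I (\<gamma> t). (d (\<gamma> t) i \<otimes>\<^bsub>R\<^esub> d' (\<gamma> t) i) \<otimes>\<^bsub>R\<^esub> q t)"
        using cc qc I(1) by (intro R.finsum_ldistr) auto
      finally have "ract M t (q t) = ract M t (\<Oplus>\<^bsub>R\<^esub>i\<in>I (\<gamma> t). (d (\<gamma> t) i \<otimes>\<^bsub>R\<^esub> d' (\<gamma> t) i) \<otimes>\<^bsub>R\<^esub> q t)" by simp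
      also have "\<dots> = (\<Oplus>\<^bsub>M\<^esub>i\<in>I (\<gamma> t). ract M t ((d (\<gamma> t) i \<otimes>\<^bsub>R\<^esub> d' (\<gamma> t) i) \<otimes>\<^bsub>R\<^esub> q t))"
        using cc qc
        by (intro additive_map_finsum[OF R.abelian_group_axioms M.M.abelian_group_axioms M.ract_additive_right[OF tc]]) auto
      also have "\<dots> = (\<Oplus>\<^bsub>M\<^esub>i\<in>I (\<gamma> t). ract M (ract M t (d (\<gamma> t) i)) (d' (\<gamma> t) i \<otimes>\<^bsub>R\<^esub> q t))"
        using c qc tc by (intro M.M.finsum_cong') (auto simp: R.m_assoc M.ract_assoc M.ract_closed)
      also have "\<dots> = (\<Oplus>\<^bsub>res M\<^esub>i\<in>I (\<gamma> t). ract M (ract M t (d (\<gamma> t) i)) (d' (\<gamma> t) i \<otimes>\<^bsub>R\<^esub> q t))"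
        using x[OF t] rM.span_carrier[OF U(2)]
        by (intro additive_map_finsum[OF rM.M.abelian_group_axioms M.M.abelian_group_axioms, of "\<lambda>x. x", symmetric])
          (auto simp: additive_map_def res_carrier)
      finally show ?thesis .
    qed
    have ts: "ract M t (q t) \<in> rM.span U" if t: "t \<in> T" for t
      unfolding tq[OF t] using x[OF t] by (intro rM.span_finsum[OF U(2)]) auto
    have "m = M.MG.part m (\<rho> n)" using M.MG.part_homogeneous[OF m] by simp
    also have "\<dots> = (\<Oplus>\<^bsub>M\<^esub>t\<in>T. M.MG.part (ract M t (r t)) (\<rho> n))"
      unfolding r(2) using r(1) T(2) M.ract_closed
      by (intro additive_map_finsum[OF M.M.abelian_group_axioms M.M.abelian_group_axioms M.MG.part_additive_map])
        (auto simp: Pi_iff subset_iff)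
    also have "\<dots> = (\<Oplus>\<^bsub>M\<^esub>t\<in>T. ract M t (q t))"
      using r(1) T(2) M.ract_closed R.RG.C_carrier[OF q]
      by (intro M.M.finsum_cong') (auto simp: Pi_iff subset_iff q_def M.part_ract[OF \<gamma> _ R.graded_ring_axioms])
    also have "\<dots> = (\<Oplus>\<^bsub>res M\<^esub>t\<in>T. ract M t (q t))"
      using ts rM.span_carrier[OF U(2)]
      by (intro additive_map_finsum[OF rM.M.abelian_group_axioms M.M.abelian_group_axioms, of "\<lambda>x. x", symmetric])
        (auto simp: additive_map_def res_carrier)
    also have "\<dots> \<in> rM.span U" using ts by (intro rM.span_finsum[OF U(2)]) auto
    finally show "m \<in> rM.span U" .
  qed
qed

text \<open>
  Generators of the restriction generate the whole module: \<open>m = \<Sum> (m d\<^sub>i) d'\<^sub>i\<close>, and the factors \<open>m d\<^sub>i\<close>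
  lie in the restriction.
\<close>

lemma fin_gen_of_res:
  assumes M: "graded_right_module R M" and fg: "fin_gen S (res M)"
  shows "fin_gen R M"
proof -
  interpret M: graded_right_module R M by fact
  interpret rM: graded_right_module S "res M" by (rule graded_right_module_res[OF M])
  obtain T where T: "finite T" "T \<subseteq> carrier (res M)" "\<And>t. t \<in> T \<Longrightarrow> \<exists>n. t \<in> gcomp (res M) n" "carrier (res M) = rM.span T"
    using rM.fin_gen_homogeneous[OF fg] by blast
  have TM: "T \<subseteq> carrier M" using T(2) by (auto simp: res_carrier)
  have ract: "ract (res M) t a \<in> M.span T" if t: "t \<in> T" and a: "a \<in> carrier S" for t a
    using a
  proof (induction rule: S.RG.homogeneous_induct)
    case (add a b)
    then show ?case
      using M.span_add[OF TM] rM.ract_add_right[of t a b] t T(2) by auto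
  next
    case (homogeneous j a)
    obtain n where n: "t \<in> gcomp M (\<rho> n)" using T(3)[OF t] by auto
    show ?case
      unfolding res_ract[OF M n homogeneous]
      by (intro M.span_ract[OF TM] M.span_gen[OF TM T(1) t] R.RG.C_carrier[OF lam_in[OF homogeneous]])
  qed
  have sub: "carrier (res M) \<subseteq> M.span T"
  proof
    fix m assume "m \<in> carrier (res M)"
    then have "m \<in> rM.span T" using T(4) by simp
    then obtain r where r: "r \<in> T \<rightarrow> carrier S" "m = (\<Oplus>\<^bsub>res M\<^esub>t\<in>T. ract (res M) t (r t))"
      unfolding rM.span_def by auto
    have "m = (\<Oplus>\<^bsub>M\<^esub>t\<in>T. ract (res M) t (r t))"
      unfolding r(2) using r(1) T(2) rM.ract_closed
      by (intro additive_map_finsum[OF rM.M.abelian_group_axioms M.M.abelian_group_axioms, of "\<lambda>x. x"])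
        (auto simp: additive_map_def res_carrier Pi_iff subset_iff)
    also have "\<dots> \<in> M.span T" using r(1) ract by (intro M.span_finsum[OF TM]) auto
    finally show "m \<in> M.span T" .
  qed
  show ?thesis
  proof (rule M.fin_genI[OF T(1) TM])
    fix g m assume m: "m \<in> gcomp M g"
    have mc: "m \<in> carrier M" using M.MG.C_carrier[OF m] .
    obtain I :: "nat set" and p d d' where I: "finite I"
      "\<And>i. i \<in> I \<Longrightarrow> d i \<in> hcomp R (\<rho> (p i) - g)" "\<And>i. i \<in> I \<Longrightarrow> d' i \<in> hcomp R (g - \<rho> (p i))"
      "\<one>\<^bsub>R\<^esub> = (\<Oplus>\<^bsub>R\<^esub>i\<in>I. d i \<otimes>\<^bsub>R\<^esub> d' i)"
      using cover[of g] by blast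
    note c = R.RG.C_carrier[OF I(2)] R.RG.C_carrier[OF I(3)]
    have md: "ract M m (d i) \<in> M.span T" if "i \<in> I" for i
      using M.ract_degree[OF m I(2)[OF that]] res_homogeneous_carrier[OF M, of _ "p i"] sub by auto
    have "m = ract M m (\<Oplus>\<^bsub>R\<^esub>i\<in>I. d i \<otimes>\<^bsub>R\<^esub> d' i)" using M.ract_one[OF mc] I(4) by simp
    also have "\<dots> = (\<Oplus>\<^bsub>M\<^esub>i\<in>I. ract M m (d i \<otimes>\<^bsub>R\<^esub> d' i))"
      using c
      by (intro additive_map_finsum[OF R.abelian_group_axioms M.M.abelian_group_axioms M.ract_additive_right[OF mc]]) auto
    also have "\<dots> \<in> M.span T"
      using M.span_ract[OF TM md c(2)] c mc by (intro M.span_finsum[OF TM]) (auto simp: M.ract_assoc)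
    finally show "m \<in> M.span T" .
  qed
qed

end

context corner
begin

subsection \<open>Coinduction\<close>

text \<open>
  The degree \<open>g\<close> part of the coinduced module consists of the homomorphisms of graded \<open>S\<close>-modules to
  \<open>N\<close> from the sum of the components of degree \<open>\<rho> n - g\<close> of \<open>R\<close>; such a homomorphism is extended
  by zero, so that it is determined by its values on these components.
\<close>

definition coind_comp :: "('b, 'm, 'h) gr_mod \<Rightarrow> 'g \<Rightarrow> ('h \<Rightarrow> 'a \<Rightarrow> 'm) set" where
  "coind_comp N g = {v.
     (\<forall>n. \<forall>c\<in>hcomp R (\<rho> n - g). v n c \<in> gcomp N n) \<and>
     (\<forall>n. \<forall>c\<in>hcomp R (\<rho> n - g). \<forall>c'\<in>hcomp R (\<rho> n - g). v n (c \<oplus>\<^bsub>R\<^esub> c') = v n c \<oplus>\<^bsub>N\<^esub> v n c') \<and>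
     (\<forall>n j. \<forall>c\<in>hcomp R (\<rho> n - g). \<forall>a\<in>hcomp S j. v (n + j) (c \<otimes>\<^bsub>R\<^esub> lam n j a) = ract N (v n c) a) \<and>
     (\<forall>n c. c \<notin> hcomp R (\<rho> n - g) \<longrightarrow> v n c = \<zero>\<^bsub>N\<^esub>)}"

definition coind_group :: "('b, 'm, 'h) gr_mod \<Rightarrow> ('a, 'g \<Rightarrow> 'h \<Rightarrow> 'a \<Rightarrow> 'm, 'g) gr_mod" where
  "coind_group N = \<lparr>carrier = {V. (\<forall>g. V g \<in> coind_comp N g) \<and> finite {g. V g \<noteq> (\<lambda>_ _. \<zero>\<^bsub>N\<^esub>)}},
     monoid.mult = undefined, one = undefined, ring.zero = (\<lambda>_ _ _. \<zero>\<^bsub>N\<^esub>),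
     add = (\<lambda>V W g n c. V g n c \<oplus>\<^bsub>N\<^esub> W g n c), ract = (\<lambda>V _. V),
     gcomp = (\<lambda>g. {V. V g \<in> coind_comp N g \<and> (\<forall>h. h \<noteq> g \<longrightarrow> V h = (\<lambda>_ _. \<zero>\<^bsub>N\<^esub>))})\<rparr>"

definition coind_act ::
  "('b, 'm, 'h) gr_mod \<Rightarrow> 'g \<Rightarrow> 'g \<Rightarrow> ('g \<Rightarrow> 'h \<Rightarrow> 'a \<Rightarrow> 'm) \<Rightarrow> 'a \<Rightarrow> 'g \<Rightarrow> 'h \<Rightarrow> 'a \<Rightarrow> 'm" where
  "coind_act N g h V e k n c =
     (if k = g + h \<and> c \<in> hcomp R (\<rho> n - k) then V g n (e \<otimes>\<^bsub>R\<^esub> c) else \<zero>\<^bsub>N\<^esub>)"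

definition coind :: "('b, 'm, 'h) gr_mod \<Rightarrow> ('a, 'g \<Rightarrow> 'h \<Rightarrow> 'a \<Rightarrow> 'm, 'g) gr_mod" where
  "coind N = (coind_group N)\<lparr>ract := graded_action.act R (coind_group N) (coind_act N)\<rparr>"

lemma coind_simps [simp]:
  "carrier (coind_group N) = {V. (\<forall>g. V g \<in> coind_comp N g) \<and> finite {g. V g \<noteq> (\<lambda>_ _. \<zero>\<^bsub>N\<^esub>)}}"
  "\<zero>\<^bsub>coind_group N\<^esub> = (\<lambda>_ _ _. \<zero>\<^bsub>N\<^esub>)"
  "V \<oplus>\<^bsub>coind_group N\<^esub> W = (\<lambda>g n c. V g n c \<oplus>\<^bsub>N\<^esub> W g n c)"
  "gcomp (coind_group N) g = {V. V g \<in> coind_comp N g \<and> (\<forall>h. h \<noteq> g \<longrightarrow> V h = (\<lambda>_ _. \<zero>\<^bsub>N\<^esub>))}"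
  "carrier (coind N) = carrier (coind_group N)"
  "\<zero>\<^bsub>coind N\<^esub> = \<zero>\<^bsub>coind_group N\<^esub>"
  "add (coind N) = add (coind_group N)"
  "gcomp (coind N) g = gcomp (coind_group N) g"
  by (simp_all add: coind_group_def coind_def)

lemma coind_compD:
  assumes "v \<in> coind_comp N g"
  shows "c \<in> hcomp R (\<rho> n - g) \<Longrightarrow> v n c \<in> gcomp N n"
    and "c \<in> hcomp R (\<rho> n - g) \<Longrightarrow> c' \<in> hcomp R (\<rho> n - g) \<Longrightarrow> v n (c \<oplus>\<^bsub>R\<^esub> c') = v n c \<oplus>\<^bsub>N\<^esub> v n c'"
    and "c \<in> hcomp R (\<rho> n - g) \<Longrightarrow> a \<in> hcomp S j \<Longrightarrow> v (n + j) (c \<otimes>\<^bsub>R\<^esub> lam n j a) = ract N (v n c) a"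
    and "c \<notin> hcomp R (\<rho> n - g) \<Longrightarrow> v n c = \<zero>\<^bsub>N\<^esub>"
  using assms unfolding coind_comp_def by auto

lemma R_mult_lam_deg:
  assumes "c \<in> hcomp R (\<rho> n - g)" "a \<in> hcomp S j"
  shows "c \<otimes>\<^bsub>R\<^esub> lam n j a \<in> hcomp R (\<rho> (n + j) - g)"
  by (rule R_mult_deg[OF assms(1) lam_in[OF assms(2)]])

context
  fixes N :: "('b, 'm, 'h) gr_mod"
  assumes N: "graded_right_module S N"
begin

interpretation N: graded_right_module S N by (fact N)

lemma coind_value: "v \<in> coind_comp N g \<Longrightarrow> v n c \<in> gcomp N n"
  using coind_compD(1,4)[of v N g] N.MG.C_zero by (cases "c \<in> hcomp R (\<rho> n - g)") auto

lemma coind_value_carrier: "v \<in> coind_comp N g \<Longrightarrow> v n c \<in> carrier N"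
  using coind_value N.MG.C_carrier by blast

lemma coind_comp_zero: "(\<lambda>_ _. \<zero>\<^bsub>N\<^esub>) \<in> coind_comp N g"
  unfolding coind_comp_def using N.MG.C_zero N.ract_zero_left S.RG.C_carrier by auto

lemma coind_comp_add:
  assumes v: "v \<in> coind_comp N g" and w: "w \<in> coind_comp N g"
  shows "(\<lambda>n c. v n c \<oplus>\<^bsub>N\<^esub> w n c) \<in> coind_comp N g"
  unfolding coind_comp_def mem_Collect_eq
proof (intro conjI allI ballI impI)
  fix n c c' assume c: "c \<in> hcomp R (\<rho> n - g)" "c' \<in> hcomp R (\<rho> n - g)"
  show "v n (c \<oplus>\<^bsub>R\<^esub> c') \<oplus>\<^bsub>N\<^esub> w n (c \<oplus>\<^bsub>R\<^esub> c') = v n c \<oplus>\<^bsub>N\<^esub> w n c \<oplus>\<^bsub>N\<^esub> (v n c' \<oplus>\<^bsub>N\<^esub> w n c')"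
    using coind_compD(2)[OF v c] coind_compD(2)[OF w c] coind_value_carrier[OF v] coind_value_carrier[OF w]
    by (simp add: N.M.add.m_ac)
next
  fix n j c a assume c: "c \<in> hcomp R (\<rho> n - g)" and a: "a \<in> hcomp S j"
  show "v (n + j) (c \<otimes>\<^bsub>R\<^esub> lam n j a) \<oplus>\<^bsub>N\<^esub> w (n + j) (c \<otimes>\<^bsub>R\<^esub> lam n j a) = ract N (v n c \<oplus>\<^bsub>N\<^esub> w n c) a"
    using coind_compD(3)[OF v c a] coind_compD(3)[OF w c a] coind_value_carrier[OF v] coind_value_carrier[OF w]
      S.RG.C_carrier[OF a] by (simp add: N.ract_add_left)
qed (use coind_value[OF v] coind_value[OF w] N.MG.C_add coind_compD(4)[OF v] coind_compD(4)[OF w] in auto)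

lemma coind_comp_minus:
  assumes v: "v \<in> coind_comp N g"
  shows "(\<lambda>n c. \<ominus>\<^bsub>N\<^esub> v n c) \<in> coind_comp N g"
  unfolding coind_comp_def mem_Collect_eq
proof (intro conjI allI ballI impI)
  fix n c c' assume c: "c \<in> hcomp R (\<rho> n - g)" "c' \<in> hcomp R (\<rho> n - g)"
  show "\<ominus>\<^bsub>N\<^esub> v n (c \<oplus>\<^bsub>R\<^esub> c') = \<ominus>\<^bsub>N\<^esub> v n c \<oplus>\<^bsub>N\<^esub> \<ominus>\<^bsub>N\<^esub> v n c'"
    using coind_compD(2)[OF v c] coind_value_carrier[OF v] by (simp add: N.M.minus_add)
next
  fix n j c a assume c: "c \<in> hcomp R (\<rho> n - g)" and a: "a \<in> hcomp S j"
  show "\<ominus>\<^bsub>N\<^esub> v (n + j) (c \<otimes>\<^bsub>R\<^esub> lam n j a) = ract N (\<ominus>\<^bsub>N\<^esub> v n c) a"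
    using coind_compD(3)[OF v c a] coind_value_carrier[OF v]
      additive_map_minus[OF N.M.abelian_group_axioms N.M.abelian_group_axioms N.ract_additive_left[OF S.RG.C_carrier[OF a]]]
    by simp
qed (use coind_value[OF v] N.MG.C_minus coind_compD(4)[OF v] in auto)

lemma coind_graded_group: "graded_group (coind_group N) (gcomp (coind_group N))"
proof -
  let ?G = "coind_group N"
  note val = coind_value_carrier
  have sub: "V \<in> carrier ?G" if V: "V \<in> gcomp ?G g" for V g
  proof -
    have "{h. V h \<noteq> (\<lambda>_ _. \<zero>\<^bsub>N\<^esub>)} \<subseteq> {g}" using V by auto
    moreover have "V h \<in> coind_comp N h" for h using V coind_comp_zero by (cases "h = g") auto
    ultimately show ?thesis using finite_subset by auto
  qed
  have fin_add: "finite {g. (\<lambda>n c. V g n c \<oplus>\<^bsub>N\<^esub> W g n c) \<noteq> (\<lambda>_ _. \<zero>\<^bsub>N\<^esub>)}"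
    if "finite {g. V g \<noteq> (\<lambda>_ _. \<zero>\<^bsub>N\<^esub>)}" "finite {g. W g \<noteq> (\<lambda>_ _. \<zero>\<^bsub>N\<^esub>)}" for V W :: "'g \<Rightarrow> 'h \<Rightarrow> 'a \<Rightarrow> 'm"
    by (rule finite_subset[OF _ finite_UnI[OF that]]) auto
  have mz: "\<ominus>\<^bsub>N\<^esub> \<zero>\<^bsub>N\<^esub> = \<zero>\<^bsub>N\<^esub>" by (rule N.M.minus_equality) auto
  have fin_minus: "finite {g. (\<lambda>n c. \<ominus>\<^bsub>N\<^esub> V g n c) \<noteq> (\<lambda>_ _. \<zero>\<^bsub>N\<^esub>)}"
    if "finite {g. V g \<noteq> (\<lambda>_ _. \<zero>\<^bsub>N\<^esub>)}" for V :: "'g \<Rightarrow> 'h \<Rightarrow> 'a \<Rightarrow> 'm"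
    by (rule finite_subset[OF _ that]) (auto simp: mz)
  have vc: "V h n c \<in> carrier N" if "V \<in> carrier ?G" for V h n c
    using val[of "V h" h] that by simp
  have ab: "abelian_group ?G"
  proof (rule abelian_groupI)
    fix V assume V: "V \<in> carrier ?G"
    then show "\<exists>W\<in>carrier ?G. W \<oplus>\<^bsub>?G\<^esub> V = \<zero>\<^bsub>?G\<^esub>"
      using coind_comp_minus fin_minus[of V] vc[OF V]
      by (intro bexI[of _ "\<lambda>g n c. \<ominus>\<^bsub>N\<^esub> V g n c"]) (simp_all add: N.M.l_neg)
  next
    fix V W assume V: "V \<in> carrier ?G" and W: "W \<in> carrier ?G"
    then show "V \<oplus>\<^bsub>?G\<^esub> W \<in> carrier ?G" using coind_comp_add fin_add by auto
    show "V \<oplus>\<^bsub>?G\<^esub> W = W \<oplus>\<^bsub>?G\<^esub> V" using vc[OF V] vc[OF W] by (simp add: fun_eq_iff N.M.a_comm)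
    fix U assume U: "U \<in> carrier ?G"
    show "V \<oplus>\<^bsub>?G\<^esub> W \<oplus>\<^bsub>?G\<^esub> U = V \<oplus>\<^bsub>?G\<^esub> (W \<oplus>\<^bsub>?G\<^esub> U)"
      using vc[OF U] vc[OF V] vc[OF W] by (simp add: fun_eq_iff N.M.a_assoc)
  next
    show "\<zero>\<^bsub>?G\<^esub> \<in> carrier ?G" using coind_comp_zero by simp
    fix V assume V: "V \<in> carrier ?G"
    then show "\<zero>\<^bsub>?G\<^esub> \<oplus>\<^bsub>?G\<^esub> V = V" using vc[OF V] by (simp add: fun_eq_iff)
  qed
  interpret G: abelian_group ?G by fact
  define \<pi> where "\<pi> g V = (\<lambda>h. if h = g then V h else (\<lambda>_ _. \<zero>\<^bsub>N\<^esub>))" for g and V :: "'g \<Rightarrow> 'h \<Rightarrow> 'a \<Rightarrow> 'm"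
  have \<pi>in: "\<pi> g V \<in> gcomp ?G g" if "V \<in> carrier ?G" for g V using that by (auto simp: \<pi>_def)
  show ?thesis
  proof (rule graded_groupI[OF ab, where \<pi> = \<pi>])
    show "additive_subgroup (gcomp ?G g) ?G" for g
    proof (rule G.additive_subgroupI')
      fix V assume V: "V \<in> gcomp ?G g"
      then have "(\<lambda>h n c. \<ominus>\<^bsub>N\<^esub> V h n c) \<in> gcomp ?G g" using coind_comp_minus by (auto simp: mz)
      moreover have "(\<lambda>h n c. \<ominus>\<^bsub>N\<^esub> V h n c) \<oplus>\<^bsub>?G\<^esub> V = \<zero>\<^bsub>?G\<^esub>"
        using vc[OF sub[OF V]] by (simp add: N.M.l_neg)
      ultimately show "\<exists>W\<in>gcomp ?G g. W \<oplus>\<^bsub>?G\<^esub> V = \<zero>\<^bsub>?G\<^esub>" by blast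
    qed (use sub coind_comp_zero coind_comp_add in auto)
    show "additive_map ?G ?G (\<pi> g)" for g
      unfolding additive_map_def using sub[OF \<pi>in] by (auto simp: \<pi>_def fun_eq_iff)
    show "\<pi> g V \<in> gcomp ?G g" if "V \<in> carrier ?G" for g V by (rule \<pi>in[OF that])
    show "\<pi> g V = V" if "V \<in> gcomp ?G g" for g V using that by (auto simp: \<pi>_def)
    show "\<pi> h V = \<zero>\<^bsub>?G\<^esub>" if "V \<in> gcomp ?G g" "h \<noteq> g" for g h V using that by (auto simp: \<pi>_def)
    fix V assume V: "V \<in> carrier ?G"
    have \<pi>0: "\<pi> g V = \<zero>\<^bsub>?G\<^esub> \<longleftrightarrow> V g = (\<lambda>_ _. \<zero>\<^bsub>N\<^esub>)" for g by (auto simp: \<pi>_def fun_eq_iff)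
    let ?A = "{g. \<pi> g V \<noteq> \<zero>\<^bsub>?G\<^esub>}"
    show fin: "finite ?A" unfolding \<pi>0 using V by simp
    have "V h n c = (\<Oplus>\<^bsub>?G\<^esub>g\<in>?A. \<pi> g V) h n c" for h n c
    proof -
      have ev: "additive_map ?G N (\<lambda>W. W h n c)" unfolding additive_map_def using vc by simp
      have "(\<Oplus>\<^bsub>?G\<^esub>g\<in>?A. \<pi> g V) h n c = (\<Oplus>\<^bsub>N\<^esub>g\<in>?A. \<pi> g V h n c)"
        using sub[OF \<pi>in[OF V]] by (intro additive_map_finsum[OF ab N.M.abelian_group_axioms ev]) auto
      also have "\<dots> = (\<Oplus>\<^bsub>N\<^esub>g\<in>?A. if h = g then V g n c else \<zero>\<^bsub>N\<^esub>)"
        using vc[OF V] by (intro N.M.finsum_cong') (auto simp: \<pi>_def)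
      also have "\<dots> = V h n c"
      proof (cases "h \<in> ?A")
        case True
        then show ?thesis using N.M.finsum_singleton[OF True fin, of "\<lambda>g. V g n c"] vc[OF V] by simp
      next
        case False
        then have "(\<Oplus>\<^bsub>N\<^esub>g\<in>?A. if h = g then V g n c else \<zero>\<^bsub>N\<^esub>) = (\<Oplus>\<^bsub>N\<^esub>g\<in>?A. \<zero>\<^bsub>N\<^esub>)"
          by (intro N.M.finsum_cong') auto
        then show ?thesis using False \<pi>0[of h] by simp
      qed
      finally show ?thesis by simp
    qed
    then show "V = (\<Oplus>\<^bsub>?G\<^esub>g\<in>?A. \<pi> g V)" by blast
  qed
qed

lemma coind_action: "graded_action R (coind_group N) (coind_act N)"
proof (intro graded_action.intro graded_action_axioms.intro R.graded_ring_axioms coind_graded_group)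
  let ?G = "coind_group N"
  have ec: "e \<otimes>\<^bsub>R\<^esub> c \<in> hcomp R (k - g)" if "e \<in> hcomp R h" "c \<in> hcomp R (k - (g + h))" for e c g h k
    using R.mult_deg[OF that] by (simp add: algebra_simps)
  show "coind_act N g h V e \<in> gcomp ?G (g + h)" if V: "V \<in> gcomp ?G g" and e: "e \<in> hcomp R h" for V e g h
  proof -
    have v: "V g \<in> coind_comp N g" using V by simp
    note ec = ec[OF e]
    have "coind_act N g h V e (g + h) \<in> coind_comp N (g + h)"
      unfolding coind_comp_def mem_Collect_eq
    proof (intro conjI allI ballI impI)
      fix n c assume c: "c \<in> hcomp R (\<rho> n - (g + h))"
      show "coind_act N g h V e (g + h) n c \<in> gcomp N n"
        using coind_value[OF v] N.MG.C_zero by (simp add: coind_act_def)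
      fix c' assume c': "c' \<in> hcomp R (\<rho> n - (g + h))"
      show "coind_act N g h V e (g + h) n (c \<oplus>\<^bsub>R\<^esub> c') =
          coind_act N g h V e (g + h) n c \<oplus>\<^bsub>N\<^esub> coind_act N g h V e (g + h) n c'"
        using c c' coind_compD(2)[OF v ec[OF c] ec[OF c']] R.RG.C_add[OF c c'] R.RG.C_carrier[OF e]
          R.RG.C_carrier[OF c] R.RG.C_carrier[OF c'] by (simp add: coind_act_def R.r_distr)
    next
      fix n j c a assume c: "c \<in> hcomp R (\<rho> n - (g + h))" and a: "a \<in> hcomp S j"
      show "coind_act N g h V e (g + h) (n + j) (c \<otimes>\<^bsub>R\<^esub> lam n j a) = ract N (coind_act N g h V e (g + h) n c) a"
        using c R_mult_lam_deg[OF c a] coind_compD(3)[OF v ec[OF c] a] R.RG.C_carrier[OF e]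
          R.RG.C_carrier[OF c] R.RG.C_carrier[OF lam_in[OF a]] by (simp add: coind_act_def R.m_assoc)
    qed (simp add: coind_act_def)
    then show ?thesis by (auto simp: coind_act_def fun_eq_iff)
  qed
  show "coind_act N g h (V \<oplus>\<^bsub>?G\<^esub> W) e = coind_act N g h V e \<oplus>\<^bsub>?G\<^esub> coind_act N g h W e"
    if "V \<in> gcomp ?G g" "W \<in> gcomp ?G g" "e \<in> hcomp R h" for V W e g h
    by (auto simp: coind_act_def fun_eq_iff)
  show "coind_act N g h V (e \<oplus>\<^bsub>R\<^esub> e') = coind_act N g h V e \<oplus>\<^bsub>?G\<^esub> coind_act N g h V e'"
    if V: "V \<in> gcomp ?G g" and e: "e \<in> hcomp R h" "e' \<in> hcomp R h" for V e e' g h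
  proof (intro ext)
    fix k n c
    have v: "V g \<in> coind_comp N g" using V by simp
    show "coind_act N g h V (e \<oplus>\<^bsub>R\<^esub> e') k n c = (coind_act N g h V e \<oplus>\<^bsub>?G\<^esub> coind_act N g h V e') k n c"
    proof (cases "k = g + h \<and> c \<in> hcomp R (\<rho> n - k)")
      case True
      then have c: "c \<in> hcomp R (\<rho> n - (g + h))" by auto
      show ?thesis
        using True coind_compD(2)[OF v ec[OF e(1) c] ec[OF e(2) c]] R.RG.C_carrier[OF c] R.RG.C_carrier[OF e(1)]
          R.RG.C_carrier[OF e(2)] by (simp add: coind_act_def R.l_distr)
    qed (auto simp: coind_act_def)
  qed
  show "coind_act N g (h + k) V (e \<otimes>\<^bsub>R\<^esub> f) = coind_act N (g + h) k (coind_act N g h V e) f"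
    if V: "V \<in> gcomp ?G g" and e: "e \<in> hcomp R h" and f: "f \<in> hcomp R k" for V g e h f k
  proof (intro ext)
    fix l n c
    show "coind_act N g (h + k) V (e \<otimes>\<^bsub>R\<^esub> f) l n c = coind_act N (g + h) k (coind_act N g h V e) f l n c"
    proof (cases "l = g + h + k \<and> c \<in> hcomp R (\<rho> n - l)")
      case True
      then have c: "c \<in> hcomp R (\<rho> n - (g + h + k))" by auto
      show ?thesis
        using True ec[OF f c] R.RG.C_carrier[OF c] R.RG.C_carrier[OF e] R.RG.C_carrier[OF f]
        by (simp add: coind_act_def R.m_assoc add.assoc)
    qed (auto simp: coind_act_def add.assoc)
  qed
  show "coind_act N g 0 V \<one>\<^bsub>R\<^esub> = V" if V: "V \<in> gcomp ?G g" for V g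
  proof (intro ext)
    fix k n c
    have v: "V g \<in> coind_comp N g" "\<And>h. h \<noteq> g \<Longrightarrow> V h = (\<lambda>_ _. \<zero>\<^bsub>N\<^esub>)" using V by auto
    show "coind_act N g 0 V \<one>\<^bsub>R\<^esub> k n c = V k n c"
      using R.RG.C_carrier[of c "\<rho> n - g"] coind_compD(4)[OF v(1), of c n] v(2)[of k]
      by (cases "k = g") (auto simp: coind_act_def)
  qed
qed

lemma graded_right_module_coind: "graded_right_module R (coind N)"
  unfolding coind_def by (rule graded_action.graded_right_module_ract_update[OF coind_action])

lemma coind_ract:
  "V \<in> gcomp (coind N) g \<Longrightarrow> e \<in> hcomp R h \<Longrightarrow> ract (coind N) V e = coind_act N g h V e"
  using graded_action.act_homogeneous[OF coind_action, of V g e h] by (simp add: coind_def)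

text \<open>
  Evaluation at \<open>1\<close> in degree \<open>\<rho> n\<close> is the Yoneda isomorphism.
\<close>

lemma res_coind:
  "\<exists>\<phi>\<in>gr_hom S (res (coind N)) N. bij_betw \<phi> (carrier (res (coind N))) (carrier N)"
proof -
  note C = graded_right_module_coind
  interpret C: graded_right_module R "coind N" by (rule C)
  interpret rC: graded_right_module S "res (coind N)" by (rule graded_right_module_res[OF C])
  define \<theta> :: "'h \<Rightarrow> ('g \<Rightarrow> 'h \<Rightarrow> 'a \<Rightarrow> 'm) \<Rightarrow> 'm" where "\<theta> n V = V (\<rho> n) n \<one>\<^bsub>R\<^esub>" for n V
  have one: "\<one>\<^bsub>R\<^esub> \<in> hcomp R (\<rho> n - \<rho> n)" for n using R.one_deg by simp
  have comp: "V (\<rho> n) \<in> coind_comp N (\<rho> n)" if "V \<in> gcomp (res (coind N)) n" for V n using that by simp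
  have \<theta>_deg: "\<theta> n V \<in> gcomp N n" if "V \<in> gcomp (res (coind N)) n" for V n
    unfolding \<theta>_def by (rule coind_value[OF comp[OF that]])
  have \<theta>_add: "\<theta> n (V \<oplus>\<^bsub>res (coind N)\<^esub> W) = \<theta> n V \<oplus>\<^bsub>N\<^esub> \<theta> n W"
    if "V \<in> gcomp (res (coind N)) n" "W \<in> gcomp (res (coind N)) n" for n V W
    by (simp add: \<theta>_def)
  note ext = N.M.abelian_group_axioms N.MG.C_carrier[OF \<theta>_deg] \<theta>_add
  let ?e = "rC.MG.extend N \<theta>" and ?\<phi> = "restrict (rC.MG.extend N \<theta>) (carrier (res (coind N)))"
  have e_add: "additive_map (res (coind N)) N ?e" by (rule rC.MG.extend_additive[where \<theta> = \<theta>, OF ext])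
  have \<phi>_hom: "?\<phi> V = \<theta> n V" if "V \<in> gcomp (res (coind N)) n" for V n
    using rC.MG.extend_homogeneous[where \<theta> = \<theta>, OF ext that] rC.MG.C_carrier[OF that] by (simp del: res_simps coind_simps)
  have \<phi>: "?\<phi> \<in> gr_hom S (res (coind N)) N"
  proof (rule gr_hom_homogeneousI[OF S.graded_ring_axioms graded_right_module_res[OF C] N])
    show "additive_map (res (coind N)) N ?\<phi>"
      unfolding additive_map_def using additive_map_closed[OF e_add] additive_map_add[OF e_add] rC.M.add.m_closed
      by (simp del: res_simps coind_simps)
    show "?\<phi> V \<in> gcomp N n" if "V \<in> gcomp (res (coind N)) n" for V n using \<theta>_deg[OF that] \<phi>_hom[OF that] by simp
    fix n V j a assume V: "V \<in> gcomp (res (coind N)) n" and a: "a \<in> hcomp S j"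
    have V': "V \<in> gcomp (coind N) (\<rho> n)" using V by simp
    have la: "lam n j a \<in> hcomp R (\<rho> (n + j) - \<rho> n)" by (rule lam_in[OF a])
    have "\<theta> (n + j) (ract (res (coind N)) V a) = coind_act N (\<rho> n) (\<rho> (n + j) - \<rho> n) V (lam n j a) (\<rho> (n + j)) (n + j) \<one>\<^bsub>R\<^esub>"
      unfolding \<theta>_def res_ract[OF C V' a] coind_ract[OF V' la] ..
    also have "\<dots> = V (\<rho> n) (n + j) (\<one>\<^bsub>R\<^esub> \<otimes>\<^bsub>R\<^esub> lam n j a)"
      using one[of "n + j"] R.RG.C_carrier[OF la] by (simp add: coind_act_def)
    also have "\<dots> = ract N (\<theta> n V) a" unfolding \<theta>_def by (rule coind_compD(3)[OF comp[OF V] one a])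
    finally show "?\<phi> (ract (res (coind N)) V a) = ract N (?\<phi> V) a"
      using \<phi>_hom[OF rC.ract_degree[OF V a]] \<phi>_hom[OF V] by simp
  qed auto
  have "bij_betw ?\<phi> (carrier (res (coind N))) (carrier N)"
  proof (rule gr_hom_bijI[OF graded_right_module_res[OF C] N \<phi>])
    fix n V assume V: "V \<in> gcomp (res (coind N)) n" and "?\<phi> V = \<zero>\<^bsub>N\<^esub>"
    then have z: "\<theta> n V = \<zero>\<^bsub>N\<^esub>" using \<phi>_hom[OF V] by simp
    have "V (\<rho> n) l c = \<zero>\<^bsub>N\<^esub>" for l c
    proof (cases "c \<in> hcomp R (\<rho> l - \<rho> n)")
      case True
      obtain a where a: "a \<in> hcomp S (l - n)" "c = lam n (l - n) a" by (rule lam_surj[OF True])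
      have "V (\<rho> n) (n + (l - n)) (\<one>\<^bsub>R\<^esub> \<otimes>\<^bsub>R\<^esub> lam n (l - n) a) = ract N (\<theta> n V) a"
        unfolding \<theta>_def by (rule coind_compD(3)[OF comp[OF V] one a(1)])
      then show ?thesis
        using z a R.RG.C_carrier[OF True] N.ract_zero_left[OF S.RG.C_carrier[OF a(1)]] by simp
    qed (rule coind_compD(4)[OF comp[OF V]])
    then show "V = \<zero>\<^bsub>res (coind N)\<^esub>" using V by (auto simp: fun_eq_iff) metis
  next
    fix n x assume x: "x \<in> gcomp N n"
    have xc: "x \<in> carrier N" using N.MG.C_carrier[OF x] .
    define u where "u l c = inv_into (hcomp S (l - n)) (lam n (l - n)) c" for l c
    have u: "u l c \<in> hcomp S (l - n)" "lam n (l - n) (u l c) = c" if "c \<in> hcomp R (\<rho> l - \<rho> n)" for l c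
      using that lam_bij[of n "l - n"] unfolding u_def by (auto simp: bij_betw_def inv_into_into f_inv_into_f)
    have u_eq: "u l c = a" if "a \<in> hcomp S (l - n)" "lam n (l - n) a = c" for l c a
      using that lam_bij[of n "l - n"] unfolding u_def by (auto simp: bij_betw_def inv_into_f_f)
    define v where "v l c = (if c \<in> hcomp R (\<rho> l - \<rho> n) then ract N x (u l c) else \<zero>\<^bsub>N\<^esub>)" for l c
    have vin: "v \<in> coind_comp N (\<rho> n)"
      unfolding coind_comp_def mem_Collect_eq
    proof (intro conjI allI ballI impI)
      fix l c assume c: "c \<in> hcomp R (\<rho> l - \<rho> n)"
      show "v l c \<in> gcomp N l" using N.ract_degree[OF x u(1)[OF c]] c by (simp add: v_def)
      fix c' assume c': "c' \<in> hcomp R (\<rho> l - \<rho> n)"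
      have "u l (c \<oplus>\<^bsub>R\<^esub> c') = u l c \<oplus>\<^bsub>S\<^esub> u l c'"
        using u(1)[OF c] u(1)[OF c'] u(2)[OF c] u(2)[OF c'] S.RG.C_add lam_add by (intro u_eq) auto
      then show "v l (c \<oplus>\<^bsub>R\<^esub> c') = v l c \<oplus>\<^bsub>N\<^esub> v l c'"
        using c c' R.RG.C_add[OF c c'] S.RG.C_carrier[OF u(1)[OF c]] S.RG.C_carrier[OF u(1)[OF c']] xc
        by (simp add: v_def N.ract_add_right)
    next
      fix l j c a assume c: "c \<in> hcomp R (\<rho> l - \<rho> n)" and a: "a \<in> hcomp S j"
      have jd: "l - n + j = l + j - n" by simp
      have "u (l + j) (c \<otimes>\<^bsub>R\<^esub> lam l j a) = u l c \<otimes>\<^bsub>S\<^esub> a"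
      proof (rule u_eq)
        show "u l c \<otimes>\<^bsub>S\<^esub> a \<in> hcomp S (l + j - n)" using S.mult_deg[OF u(1)[OF c] a] jd by simp
        show "lam n (l + j - n) (u l c \<otimes>\<^bsub>S\<^esub> a) = c \<otimes>\<^bsub>R\<^esub> lam l j a"
          using lam_mult[OF u(1)[OF c] a, of n] u(2)[OF c] jd by simp
      qed
      then show "v (l + j) (c \<otimes>\<^bsub>R\<^esub> lam l j a) = ract N (v l c) a"
        using c R_mult_lam_deg[OF c a] S.RG.C_carrier[OF u(1)[OF c]] S.RG.C_carrier[OF a] xc
        by (simp add: v_def N.ract_assoc)
    qed (simp add: v_def)
    define V where "V = (\<lambda>g. if g = \<rho> n then v else (\<lambda>_ _. \<zero>\<^bsub>N\<^esub>))"
    have V: "V \<in> gcomp (res (coind N)) n" using vin by (simp add: V_def)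
    have "u n \<one>\<^bsub>R\<^esub> = \<one>\<^bsub>S\<^esub>" using S.one_deg lam_one by (intro u_eq) auto
    then have "\<theta> n V = x" using one[of n] N.ract_one[OF xc] by (simp add: \<theta>_def V_def v_def)
    then show "\<exists>V\<in>gcomp (res (coind N)) n. ?\<phi> V = x" using V \<phi>_hom[OF V] by auto
  qed
  then show ?thesis using \<phi> by blast
qed

end

text \<open>
  Full faithfulness is separation and gluing, essential surjectivity is coinduction. The coinduced
  module has its elements in a larger type; the hypothesis says that \<open>'m\<close> is large enough to hold a
  copy of it.
\<close>

theorem equivalence_functor_res:
  assumes large: "\<And>M :: ('a, 'g \<Rightarrow> 'h \<Rightarrow> 'a \<Rightarrow> 'm, 'g) gr_mod.
    graded_right_module R M \<Longrightarrow> fin_gen R M \<Longrightarrow> \<exists>f :: _ \<Rightarrow> 'm. inj_on f (carrier M)"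
  shows "equivalence_functor (gr_cat TYPE('m) R) (gr_cat TYPE('m) S) res (\<lambda>M N \<phi>. restrict \<phi> (carrier (res M)))"
proof -
  let ?C = "gr_cat TYPE('m) R" and ?D = "gr_cat TYPE('m) S"
  have obj: "graded_right_module R M" "fin_gen R M" if "M \<in> Obj ?C" for M using that by auto
  have sub: "carrier (res M) \<subseteq> carrier M" for M :: "('a, 'm, 'g) gr_mod" by (auto simp: res_carrier)
  have cl: "\<phi> m \<in> carrier (res N)"
    if "graded_right_module R M" "graded_right_module R N" "\<phi> \<in> gr_hom R M N" "m \<in> carrier (res M)"
    for M N :: "('a, 'm, 'g) gr_mod" and \<phi> m
    using gr_hom_closed[OF gr_hom_res[OF that(1-3)] that(4)] that(4) by simp
  have "linear_functor ?C ?D res (\<lambda>M N \<phi>. restrict \<phi> (carrier (res M)))"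
    unfolding linear_functor_def
  proof (intro conjI ballI allI)
    fix U assume U: "U \<in> Obj ?C"
    show "res U \<in> Obj ?D" using graded_right_module_res[OF obj(1)[OF U]] fin_gen_res[OF obj[OF U]] by simp
    show "restrict (Idt ?C U) (carrier (res U)) = Idt ?D (res U)" using sub[of U] by (auto simp: fun_eq_iff)
  next
    fix U V f assume U: "U \<in> Obj ?C" "V \<in> Obj ?C" and f: "f \<in> Hom ?C U V"
    then show "restrict f (carrier (res U)) \<in> Hom ?D (res U) (res V)"
      using gr_hom_res[OF obj(1)[OF U(1)] obj(1)[OF U(2)], of f] by simp
  next
    fix U V W f g assume U: "U \<in> Obj ?C" "V \<in> Obj ?C" "W \<in> Obj ?C" and f: "f \<in> Hom ?C U V" and g: "g \<in> Hom ?C V W"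
    have "f x \<in> carrier (res V)" if "x \<in> carrier (res U)" for x
      using cl[OF obj(1)[OF U(1)] obj(1)[OF U(2)] _ that] f by simp
    then show "restrict (Cmp ?C U V W g f) (carrier (res U)) =
        Cmp ?D (res U) (res V) (res W) (restrict g (carrier (res V))) (restrict f (carrier (res U)))"
      using sub[of U] by (auto simp: compose_def fun_eq_iff)
  next
    fix U V f g assume U: "U \<in> Obj ?C" "V \<in> Obj ?C" and f: "f \<in> Hom ?C U V" and g: "g \<in> Hom ?C U V"
    show "restrict (Hadd ?C U V f g) (carrier (res U)) =
        Hadd ?D (res U) (res V) (restrict f (carrier (res U))) (restrict g (carrier (res U)))"
      using sub[of U] by (auto simp: fun_eq_iff)
  next
    fix U V c f assume U: "U \<in> Obj ?C" "V \<in> Obj ?C" and f: "f \<in> Hom ?C U V"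
    have "ract (res V) (f x) (scal S c) = ract V (f x) (scal R c)" if "x \<in> carrier (res U)" for x
      using res_scal[OF obj(1)[OF U(2)] cl[OF obj(1)[OF U(1)] obj(1)[OF U(2)] _ that]] f by simp
    then show "restrict (Hscale ?C U V c f) (carrier (res U)) =
        Hscale ?D (res U) (res V) c (restrict f (carrier (res U)))"
      using sub[of U] by (auto simp: fun_eq_iff)
  qed
  moreover have "bij_betw (\<lambda>\<phi>. restrict \<phi> (carrier (res U))) (Hom ?C U V) (Hom ?D (res U) (res V))"
    if U: "U \<in> Obj ?C" "V \<in> Obj ?C" for U V
    unfolding bij_betw_def inj_on_def
    using res_faithful[OF obj(1)[OF U(1)] obj(1)[OF U(2)]] gr_hom_res[OF obj(1)[OF U(1)] obj(1)[OF U(2)]]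
      res_full[OF obj(1)[OF U(1)] obj(1)[OF U(2)]] by auto blast
  moreover have "\<exists>U\<in>Obj ?C. \<exists>f. iso_arrow ?D (res U) N f" if N: "N \<in> Obj ?D" for N
  proof -
    have No: "graded_right_module S N" "fin_gen S N" using N by auto
    note C = graded_right_module_coind[OF No(1)]
    obtain \<phi> where \<phi>: "\<phi> \<in> gr_hom S (res (coind N)) N" "bij_betw \<phi> (carrier (res (coind N))) (carrier N)"
      using res_coind[OF No(1)] by blast
    have surj: "(\<lambda>n\<in>carrier N. inv_into (carrier (res (coind N))) \<phi> n) ` carrier N = carrier (res (coind N))"
      using \<phi>(2) bij_betw_inv_into[OF \<phi>(2)] by (auto simp: bij_betw_def)
    note \<phi>' = gr_hom_inverse[OF graded_right_module_res[OF C] No(1) \<phi>]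
    have fg: "fin_gen R (coind N)"
      by (rule fin_gen_of_res[OF C fin_gen_iso[OF No(1) graded_right_module_res[OF C] \<phi>' surj No(2)]])
    obtain f :: "('g \<Rightarrow> 'h \<Rightarrow> 'a \<Rightarrow> 'm) \<Rightarrow> 'm" where f: "inj_on f (carrier (coind N))"
      using large[OF C fg] by blast
    let ?U = "transport f (coind N)"
    note T = graded_right_module_transport[OF R.ring_axioms C f] gr_hom_transport[OF R.ring_axioms C f]
      bij_betw_transport[OF R.ring_axioms C f]
    have U: "?U \<in> Obj ?C" using T fin_gen_iso[OF C T(1,2) _ fg] by (auto simp: bij_betw_def)
    define h where "h = restrict (inv_into (carrier (coind N)) (restrict f (carrier (coind N)))) (carrier ?U)"
    have h: "h \<in> gr_hom R ?U (coind N)" unfolding h_def by (rule gr_hom_inverse[OF C T])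
    have hb: "bij_betw h (carrier ?U) (carrier (coind N))"
      unfolding h_def using bij_betw_inv_into[OF T(3)] by (simp cong: bij_betw_cong)
    let ?h = "restrict h (carrier (res ?U))"
    have rh: "?h \<in> gr_hom S (res ?U) (res (coind N))" by (rule gr_hom_res[OF T(1) C h])
    have rhb: "bij_betw ?h (carrier (res ?U)) (carrier (res (coind N)))"
    proof (rule gr_hom_bijI[OF graded_right_module_res[OF T(1)] graded_right_module_res[OF C] rh])
      interpret U: graded_right_module R ?U by (rule T(1))
      interpret C: graded_right_module R "coind N" by (rule C)
      have h0: "h \<zero>\<^bsub>?U\<^esub> = \<zero>\<^bsub>coind N\<^esub>"
        by (rule additive_map_zero[OF U.M.abelian_group_axioms C.M.abelian_group_axioms gr_hom_additive[OF h]])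
      fix n m assume m: "m \<in> gcomp (res ?U) n" and z: "?h m = \<zero>\<^bsub>res (coind N)\<^esub>"
      have mc: "m \<in> carrier ?U" "m \<in> carrier (res ?U)"
        using m U.MG.C_carrier res_homogeneous_carrier[OF T(1)] by auto
      have "h m = h \<zero>\<^bsub>?U\<^esub>" using z mc h0 by (simp del: coind_simps(2))
      then show "m = \<zero>\<^bsub>res ?U\<^esub>"
        using hb mc(1) by (metis U.M.zero_closed bij_betw_imp_inj_on inj_onD res_simps(1))
    next
      fix n x assume x: "x \<in> gcomp (res (coind N)) n"
      interpret C: graded_right_module R "coind N" by (rule C)
      have x': "x \<in> gcomp (coind N) (\<rho> n)" using x res_simps(3) by metis
      have xc: "x \<in> carrier (coind N)" using C.MG.C_carrier[OF x'] .
      let ?y = "restrict f (carrier (coind N)) x"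
      have y: "?y \<in> gcomp ?U (\<rho> n)" by (rule gr_hom_deg[OF T(2) x'])
      have "h ?y = x"
        unfolding h_def restrict_apply'[OF gr_hom_closed[OF T(2) xc]] by (rule bij_betw_inv_into_left[OF T(3) xc])
      then show "\<exists>m\<in>gcomp (res ?U) n. ?h m = x"
        using y res_homogeneous_carrier[OF T(1) y] by (intro bexI[of _ ?y]) auto
    qed
    let ?\<psi> = "compose (carrier (res ?U)) \<phi> ?h"
    have "?\<psi> \<in> gr_hom S (res ?U) N" by (rule gr_hom_compose[OF graded_right_module_res[OF T(1)] rh \<phi>(1)])
    moreover have "bij_betw ?\<psi> (carrier (res ?U)) (carrier N)"
      using bij_betw_trans[OF rhb \<phi>(2)] by (subst bij_betw_cong[of _ _ "\<phi> \<circ> ?h"]) (auto simp: compose_def)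
    ultimately have "iso_arrow ?D (res ?U) N ?\<psi>"
      by (intro iso_arrow_gr_cat graded_right_module_res[OF T(1)] No(1))
    then show ?thesis using U by blast
  qed
  ultimately show ?thesis unfolding equivalence_functor_def by blast
qed

end

section \<open>Twisted convolution\<close>

lemma poly_mapping_sum_single: "(\<Sum>i\<in>Poly_Mapping.keys p. Poly_Mapping.single i (Poly_Mapping.lookup p i)) = p"
  by (rule poly_mapping_eqI) (auto simp: lookup_sum lookup_single when_def in_keys_iff)

lemma poly_mapping_additive_induct [case_names zero single add]:
  fixes p :: "'a \<Rightarrow>\<^sub>0 'b::comm_monoid_add"
  assumes zero: "P 0" and single: "\<And>i c. P (Poly_Mapping.single i c)" and add: "\<And>p q. P p \<Longrightarrow> P q \<Longrightarrow> P (p + q)"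
  shows "P p"
proof -
  have "P (\<Sum>i\<in>A. Poly_Mapping.single i (f i))" if "finite A" for A and f :: "'a \<Rightarrow> 'b"
    using that by (induction A) (auto intro: assms)
  from this[of "Poly_Mapping.keys p" "Poly_Mapping.lookup p"] show ?thesis
    by (simp add: poly_mapping_sum_single)
qed

definition tconv :: "('g::plus \<Rightarrow> 'g \<Rightarrow> 'c \<Rightarrow> 'c \<Rightarrow> 'c) \<Rightarrow> ('g \<Rightarrow>\<^sub>0 'c::ab_group_add) \<Rightarrow> ('g \<Rightarrow>\<^sub>0 'c) \<Rightarrow> ('g \<Rightarrow>\<^sub>0 'c)" where
  "tconv \<mu> p q = (\<Sum>i\<in>Poly_Mapping.keys p. \<Sum>j\<in>Poly_Mapping.keys q.
     Poly_Mapping.single (i + j) (\<mu> i j (Poly_Mapping.lookup p i) (Poly_Mapping.lookup q j)))"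

text \<open>
  Elements of degree \<open>i\<close> and \<open>j\<close> are multiplied by \<open>\<mu> i j\<close>. Both the skew Laurent ring and \<open>D\<close> arise in this
  way: the twist is \<open>a \<sigma>\<^sup>i(b)\<close> for the former and \<open>a b\<close> divided by a cocycle for the latter.
\<close>

locale twist =
  fixes \<mu> :: "'g::ab_group_add \<Rightarrow> 'g \<Rightarrow> 'c::ab_group_add \<Rightarrow> 'c \<Rightarrow> 'c" and e :: 'c
  assumes \<mu>_add_left: "\<mu> i j (a + b) c = \<mu> i j a c + \<mu> i j b c"
    and \<mu>_add_right: "\<mu> i j a (b + c) = \<mu> i j a b + \<mu> i j a c"
    and \<mu>_assoc: "\<mu> (i + j) k (\<mu> i j a b) c = \<mu> i (j + k) a (\<mu> j k b c)"
    and \<mu>_one_left: "\<mu> 0 j e b = b" and \<mu>_one_right: "\<mu> i 0 a e = a"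
begin

lemma \<mu>_zero [simp]: "\<mu> i j 0 b = 0" "\<mu> i j a 0 = 0"
  using \<mu>_add_left[of i j 0 0 b] \<mu>_add_right[of i j a 0 0] by simp_all

lemma tconv_superset:
  assumes "finite A" "Poly_Mapping.keys p \<subseteq> A" "finite B" "Poly_Mapping.keys q \<subseteq> B"
  shows "tconv \<mu> p q = (\<Sum>i\<in>A. \<Sum>j\<in>B.
     Poly_Mapping.single (i + j) (\<mu> i j (Poly_Mapping.lookup p i) (Poly_Mapping.lookup q j)))"
proof -
  have "tconv \<mu> p q = (\<Sum>i\<in>Poly_Mapping.keys p. \<Sum>j\<in>B.
     Poly_Mapping.single (i + j) (\<mu> i j (Poly_Mapping.lookup p i) (Poly_Mapping.lookup q j)))"
    unfolding tconv_def using assms by (intro sum.cong refl sum.mono_neutral_left) (auto simp: in_keys_iff)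
  also have "\<dots> = (\<Sum>i\<in>A. \<Sum>j\<in>B.
     Poly_Mapping.single (i + j) (\<mu> i j (Poly_Mapping.lookup p i) (Poly_Mapping.lookup q j)))"
    using assms by (intro sum.mono_neutral_left) (auto simp: in_keys_iff)
  finally show ?thesis .
qed

lemma tconv_add_left: "tconv \<mu> (p + p') q = tconv \<mu> p q + tconv \<mu> p' q"
proof -
  let ?A = "Poly_Mapping.keys p \<union> Poly_Mapping.keys p'" and ?B = "Poly_Mapping.keys q"
  have "Poly_Mapping.keys (p + p') \<subseteq> ?A" using keys_add[of p p'] by auto
  then show ?thesis
    by (subst (1 2 3) tconv_superset[of ?A _ ?B])
      (auto simp: lookup_add \<mu>_add_left single_add sum.distrib)
qed

lemma tconv_add_right: "tconv \<mu> p (q + q') = tconv \<mu> p q + tconv \<mu> p q'"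
proof -
  let ?A = "Poly_Mapping.keys q \<union> Poly_Mapping.keys q'" and ?B = "Poly_Mapping.keys p"
  have "Poly_Mapping.keys (q + q') \<subseteq> ?A" using keys_add[of q q'] by auto
  then show ?thesis
    by (subst (1 2 3) tconv_superset[of ?B _ ?A])
      (auto simp: lookup_add \<mu>_add_right single_add sum.distrib)
qed

lemma tconv_zero [simp]: "tconv \<mu> 0 q = 0" "tconv \<mu> p 0 = 0"
  by (simp_all add: tconv_def)

lemma tconv_single [simp]:
  "tconv \<mu> (Poly_Mapping.single i a) (Poly_Mapping.single j b) = Poly_Mapping.single (i + j) (\<mu> i j a b)"
  by (subst tconv_superset[of "{i}" _ "{j}"]) auto

lemma tconv_assoc: "tconv \<mu> (tconv \<mu> p q) r = tconv \<mu> p (tconv \<mu> q r)"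
proof (induction p rule: poly_mapping_additive_induct)
  case (single i a)
  show ?case
  proof (induction q rule: poly_mapping_additive_induct)
    case (single j b)
    show ?case
      by (induction r rule: poly_mapping_additive_induct) (simp_all add: tconv_add_right \<mu>_assoc add.assoc)
  qed (simp_all add: tconv_add_right tconv_add_left)
qed (simp_all add: tconv_add_left)

lemma tconv_one: "tconv \<mu> (Poly_Mapping.single 0 e) p = p" "tconv \<mu> p (Poly_Mapping.single 0 e) = p"
  by (induction p rule: poly_mapping_additive_induct)
    (simp_all add: tconv_add_right tconv_add_left \<mu>_one_left \<mu>_one_right)

lemma keys_tconv:
  assumes "Poly_Mapping.keys p \<subseteq> {i}" "Poly_Mapping.keys q \<subseteq> {j}"
  shows "Poly_Mapping.keys (tconv \<mu> p q) \<subseteq> {i + j}"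
  by (subst tconv_superset[OF _ assms(1) _ assms(2)]) auto

end

lemma keys_subset_single:
  assumes "Poly_Mapping.keys p \<subseteq> {i}"
  shows "p = Poly_Mapping.single i (Poly_Mapping.lookup p i)"
  by (rule poly_mapping_eqI) (use assms in \<open>auto simp: lookup_single when_def in_keys_iff\<close>)

text \<open>
  The ring axioms and the grading are inherited from a twisted convolution ring along an additive,
  multiplicative embedding.
\<close>

lemma (in twist) graded_ring_of_embedding:
  fixes R :: "('a, 'g, 'k) gr_alg" and V :: "'a \<Rightarrow> ('g \<Rightarrow>\<^sub>0 'c)"
  assumes inj: "inj_on V (carrier R)"
    and zero: "\<zero>\<^bsub>R\<^esub> \<in> carrier R" "V \<zero>\<^bsub>R\<^esub> = 0"
    and one: "\<one>\<^bsub>R\<^esub> \<in> carrier R" "V \<one>\<^bsub>R\<^esub> = Poly_Mapping.single 0 e"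
    and add: "\<And>a b. a \<in> carrier R \<Longrightarrow> b \<in> carrier R \<Longrightarrow> a \<oplus>\<^bsub>R\<^esub> b \<in> carrier R"
      "\<And>a b. a \<in> carrier R \<Longrightarrow> b \<in> carrier R \<Longrightarrow> V (a \<oplus>\<^bsub>R\<^esub> b) = V a + V b"
    and mult: "\<And>a b. a \<in> carrier R \<Longrightarrow> b \<in> carrier R \<Longrightarrow> a \<otimes>\<^bsub>R\<^esub> b \<in> carrier R"
      "\<And>a b. a \<in> carrier R \<Longrightarrow> b \<in> carrier R \<Longrightarrow> V (a \<otimes>\<^bsub>R\<^esub> b) = tconv \<mu> (V a) (V b)"
    and neg: "\<And>a. a \<in> carrier R \<Longrightarrow> \<exists>b\<in>carrier R. V b = - V a"
    and hcomp: "\<And>g. hcomp R g = {a \<in> carrier R. Poly_Mapping.keys (V a) \<subseteq> {g}}"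
    and part: "\<And>a g. a \<in> carrier R \<Longrightarrow> \<exists>b\<in>carrier R. V b = Poly_Mapping.single g (Poly_Mapping.lookup (V a) g)"
    and scal: "\<And>c. scal R c \<in> carrier R" "\<And>c. Poly_Mapping.keys (V (scal R c)) \<subseteq> {0}"
      "\<And>c a. a \<in> carrier R \<Longrightarrow> tconv \<mu> (V (scal R c)) (V a) = tconv \<mu> (V a) (V (scal R c))"
  shows "graded_ring R"
proof -
  have eq: "a = b" if "a \<in> carrier R" "b \<in> carrier R" "V a = V b" for a b
    using inj that by (auto dest: inj_onD)
  have ab: "abelian_group R"
  proof (rule abelian_groupI)
    fix x assume x: "x \<in> carrier R"
    then obtain y where y: "y \<in> carrier R" "V y = - V x" using neg by blast
    then show "\<exists>y\<in>carrier R. y \<oplus>\<^bsub>R\<^esub> x = \<zero>\<^bsub>R\<^esub>"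
      using x by (intro bexI[of _ y] eq) (auto simp: add zero)
  qed (auto intro!: eq simp: add zero algebra_simps)
  interpret A: abelian_group R by fact
  have mon: "monoid R"
    by (rule monoidI) (auto intro!: eq simp: mult one tconv_assoc tconv_one)
  have ring: "ring R"
    by (rule ringI[OF ab mon]) (auto intro!: eq simp: mult add tconv_add_left tconv_add_right)
  interpret R: ring R by fact
  define \<pi> where "\<pi> g a = (SOME b. b \<in> carrier R \<and> V b = Poly_Mapping.single g (Poly_Mapping.lookup (V a) g))" for g a
  have \<pi>: "\<pi> g a \<in> carrier R" "V (\<pi> g a) = Poly_Mapping.single g (Poly_Mapping.lookup (V a) g)" if "a \<in> carrier R" for g a
    using someI_ex[OF part[OF that, of g, unfolded Bex_def]] unfolding \<pi>_def by auto
  have \<pi>0: "\<pi> g a = \<zero>\<^bsub>R\<^esub> \<longleftrightarrow> Poly_Mapping.lookup (V a) g = 0" if "a \<in> carrier R" for g a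
  proof
    assume "\<pi> g a = \<zero>\<^bsub>R\<^esub>"
    then have "Poly_Mapping.single g (Poly_Mapping.lookup (V a) g) = 0" using \<pi>(2)[OF that, of g] zero by simp
    then show "Poly_Mapping.lookup (V a) g = 0" by (metis lookup_single_eq lookup_zero)
  next
    assume "Poly_Mapping.lookup (V a) g = 0"
    then show "\<pi> g a = \<zero>\<^bsub>R\<^esub>" using \<pi>[OF that, of g] zero by (intro eq) auto
  qed
  have gg: "graded_group R (hcomp R)"
  proof (rule graded_groupI[OF ab, where \<pi> = \<pi>])
    show "additive_subgroup (hcomp R g) R" for g
    proof (rule A.additive_subgroupI')
      fix a assume a: "a \<in> hcomp R g"
      then obtain b where b: "b \<in> carrier R" "V b = - V a" using neg hcomp by blast
      then show "\<exists>b\<in>hcomp R g. b \<oplus>\<^bsub>R\<^esub> a = \<zero>\<^bsub>R\<^esub>"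
        using a by (intro bexI[of _ b] eq) (auto simp: hcomp add zero in_keys_iff subset_iff)
    next
      fix a b assume "a \<in> hcomp R g" "b \<in> hcomp R g"
      then show "a \<oplus>\<^bsub>R\<^esub> b \<in> hcomp R g" using keys_add[of "V a" "V b"] by (auto simp: hcomp add)
    qed (auto simp: hcomp zero)
    show "additive_map R R (\<pi> g)" for g
      unfolding additive_map_def by (auto simp: \<pi> add lookup_add single_add intro!: eq)
    show "\<pi> g a \<in> hcomp R g" if "a \<in> carrier R" for g a using \<pi>[OF that] by (auto simp: hcomp)
    show "\<pi> g a = a" if "a \<in> hcomp R g" for g a
      using that \<pi>[of a g] keys_subset_single[of "V a" g] by (intro eq) (auto simp: hcomp)
    show "\<pi> h a = \<zero>\<^bsub>R\<^esub>" if "a \<in> hcomp R g" "h \<noteq> g" for g h a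
      using that \<pi>0[of a h] by (auto simp: hcomp in_keys_iff subset_iff)
    fix a assume a: "a \<in> carrier R"
    have A: "{g. \<pi> g a \<noteq> \<zero>\<^bsub>R\<^esub>} = Poly_Mapping.keys (V a)" 
      unfolding \<pi>0[OF a] by (auto simp: in_keys_iff)
    show "finite {g. \<pi> g a \<noteq> \<zero>\<^bsub>R\<^esub>}" unfolding A by simp
    have Vsum: "V (finsum R f B) = (\<Sum>b\<in>B. V (f b))" if "finite B" "\<And>b. b \<in> B \<Longrightarrow> f b \<in> carrier R" for f and B :: "'g set"
      using that
    proof (induction B)
      case (insert b B)
      have "finsum R f B \<in> carrier R" using insert by (intro A.finsum_closed) auto
      then show ?case using insert by (subst A.finsum_insert) (auto simp: add Pi_iff)
    qed (simp add: zero)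
    show "a = (\<Oplus>\<^bsub>R\<^esub>g\<in>{g. \<pi> g a \<noteq> \<zero>\<^bsub>R\<^esub>}. \<pi> g a)"
      unfolding A
    proof (rule eq[OF a])
      show "V a = V (\<Oplus>\<^bsub>R\<^esub>g\<in>Poly_Mapping.keys (V a). \<pi> g a)"
        using \<pi>[OF a] by (subst Vsum) (auto simp: poly_mapping_sum_single)
    qed (use \<pi>[OF a] in \<open>auto intro!: A.finsum_closed\<close>)
  qed
  show ?thesis
  proof (intro graded_ring.intro graded_ring_axioms.intro ring gg)
    fix a b g h assume "a \<in> hcomp R g" "b \<in> hcomp R h"
    then show "a \<otimes>\<^bsub>R\<^esub> b \<in> hcomp R (g + h)" using keys_tconv by (auto simp: hcomp mult)
  qed (use scal in \<open>auto simp: hcomp one mult intro!: eq\<close>)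
qed

section \<open>The skew Laurent ring\<close>

abbreviation tr :: "int \<Rightarrow> 'k::field_char_0 poly \<Rightarrow> 'k poly" where
  "tr n p \<equiv> pcompose p [:of_int n, 1:]"

lemma tr_tr: "tr m (tr n p) = tr (m + n) p"
  by (simp add: pcompose_assoc[symmetric] pcompose_pCons add.commute)

lemma tr_0: "tr 0 p = p"
  by simp

lemma tr_eq_0_iff [simp]: "tr n p = 0 \<longleftrightarrow> p = 0"
  by (simp add: pcompose_eq_0_iff)

lemma poly_tr [simp]: "poly (tr n p) x = poly p (x + of_int n)"
  by (simp add: poly_pcompose add.commute)

lemma zshift_to_fract [simp]: "zshift n (to_fract p) = to_fract (tr n p)"
  by (simp add: to_fract_def zshift_Fract pcompose_1)

lemma zshift_add: "zshift n (p + q) = zshift n p + zshift n q"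
proof -
  obtain a b where p: "p = Fract a b" "b \<noteq> 0" by (cases p rule: Fract_cases)
  obtain c d where q: "q = Fract c d" "d \<noteq> 0" by (cases q rule: Fract_cases)
  show ?thesis using p q by (simp add: zshift_Fract pcompose_add pcompose_mult)
qed

lemma zshift_mult: "zshift n (p * q) = zshift n p * zshift n q"
proof -
  obtain a b where p: "p = Fract a b" "b \<noteq> 0" by (cases p rule: Fract_cases)
  obtain c d where q: "q = Fract c d" "d \<noteq> 0" by (cases q rule: Fract_cases)
  show ?thesis using p q by (simp add: zshift_Fract pcompose_mult)
qed

lemma zshift_zshift: "zshift m (zshift n q) = zshift (m + n) q"
proof -
  obtain c d where q: "q = Fract c d" "d \<noteq> 0" by (cases q rule: Fract_cases)
  show ?thesis using q by (simp add: zshift_Fract tr_tr del: of_int_add)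
qed

lemma zshift_zero [simp]: "zshift n 0 = 0"
  using zshift_to_fract[of n 0] by simp

lemma zshift_one [simp]: "zshift n 1 = 1"
  using zshift_to_fract[of n 1] by (simp add: pcompose_1)

lemma zshift_by_0 [simp]: "zshift 0 q = q"
proof -
  obtain c d where q: "q = Fract c d" "d \<noteq> 0" by (cases q rule: Fract_cases)
  show ?thesis using q by (simp add: zshift_Fract)
qed

interpretation skew: twist "\<lambda>i j a b. a * zshift i b" "1 :: 'k::field_char_0 poly fract"
  by standard (simp_all add: algebra_simps zshift_add zshift_mult zshift_zshift)

lemma skew_mult_tconv: "skew_mult = tconv (\<lambda>i j a b. a * zshift i b)"
  by (simp add: skew_mult_def tconv_def fun_eq_iff)

lemmas skew_mult_add_left = skew.tconv_add_left[folded skew_mult_tconv]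
  and skew_mult_add_right = skew.tconv_add_right[folded skew_mult_tconv]
  and skew_mult_zero = skew.tconv_zero[folded skew_mult_tconv]
  and skew_mult_single = skew.tconv_single[folded skew_mult_tconv]
  and skew_mult_assoc = skew.tconv_assoc[folded skew_mult_tconv]
  and skew_mult_one = skew.tconv_one[folded skew_mult_tconv]

lemma lookup_kz_mult: "Poly_Mapping.lookup (kz_mult r q) i = r * Poly_Mapping.lookup q i"
  unfolding kz_mult_def
  by (induction q rule: poly_mapping_additive_induct)
    (simp_all add: skew_mult_zero skew_mult_single skew_mult_add_right lookup_add lookup_single when_def algebra_simps)

lemma lookup_single_skew_mult:
  "Poly_Mapping.lookup (skew_mult (Poly_Mapping.single i r) q) j = r * zshift i (Poly_Mapping.lookup q (j - i))"
  by (induction q rule: poly_mapping_additive_induct)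
    (auto simp: skew_mult_zero skew_mult_single skew_mult_add_right lookup_add lookup_single when_def algebra_simps zshift_add)

lemma kz_mult_add: "kz_mult r (p + q) = kz_mult r p + kz_mult r q"
  by (simp add: kz_mult_def skew_mult_add_right)

lemma kz_mult_skew_mult: "kz_mult r (skew_mult p q) = skew_mult (kz_mult r p) q"
  by (simp add: kz_mult_def skew_mult_assoc)

lemma kz_mult_kz_mult: "kz_mult r (kz_mult s q) = kz_mult (r * s) q"
  by (rule poly_mapping_eqI) (simp add: lookup_kz_mult algebra_simps)

lemma kz_mult_const_central: "skew_mult p (kz_mult (to_fract [:c:]) q) = kz_mult (to_fract [:c:]) (skew_mult p q)"
proof -
  have "skew_mult p (Poly_Mapping.single 0 (to_fract [:c:])) = skew_mult (Poly_Mapping.single 0 (to_fract [:c:])) p"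
    by (induction p rule: poly_mapping_additive_induct)
      (simp_all add: skew_mult_zero skew_mult_single skew_mult_add_left skew_mult_add_right mult.commute)
  then show ?thesis by (metis kz_mult_def skew_mult_assoc)
qed

section \<open>The generalized Weyl algebra inside the skew Laurent ring\<close>

subsection \<open>The evaluation homomorphism\<close>

definition wval :: "'k::field_char_0 poly \<Rightarrow> gen list \<Rightarrow> 'k skewl" where
  "wval f ws = foldr (\<lambda>g. skew_mult (gen_val f g)) ws (Poly_Mapping.single 0 1)"

lemmas skew_mult_1 [simp] = skew_mult_one[unfolded single_one]

lemma wval_Nil [simp]: "wval f [] = 1"
  by (simp add: wval_def)

lemma wval_Cons: "wval f (g # ws) = skew_mult (gen_val f g) (wval f ws)"
  by (simp add: wval_def)

lemma wval_append: "wval f (v @ w) = skew_mult (wval f v) (wval f w)"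
  by (induction v) (simp_all add: wval_Cons skew_mult_assoc)

lemma falg_val_superset:
  assumes "finite A" "Poly_Mapping.keys p \<subseteq> A"
  shows "falg_val f p = (\<Sum>w\<in>A. kz_mult (to_fract [:Poly_Mapping.lookup p w:]) (wval f (letters w)))"
proof -
  have z: "kz_mult 0 q = 0" for q :: "'a skewl" by (rule poly_mapping_eqI) (simp add: lookup_kz_mult)
  show ?thesis
    unfolding falg_val_def wval_def[symmetric] to_fract_def[symmetric]
    using assms by (intro sum.mono_neutral_left) (auto simp: in_keys_iff z)
qed

lemma falg_val_zero [simp]: "falg_val f 0 = 0"
  by (simp add: falg_val_def)

lemma falg_val_single: "falg_val f (Poly_Mapping.single w c) = kz_mult (to_fract [:c:]) (wval f (letters w))"
  by (subst falg_val_superset[of "{w}"]) auto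

lemma falg_val_add: "falg_val f (p + q) = falg_val f p + falg_val f q"
proof -
  let ?A = "Poly_Mapping.keys p \<union> Poly_Mapping.keys q"
  have k: "kz_mult (r + s) t = kz_mult r t + kz_mult s t" for r s :: "'a poly fract" and t
    by (rule poly_mapping_eqI) (simp add: lookup_kz_mult lookup_add algebra_simps)
  have c: "[:a + b:] = [:a:] + [:b:]" for a b :: 'a by simp
  have "Poly_Mapping.keys (p + q) \<subseteq> ?A" using keys_add[of p q] by auto
  then show ?thesis
    by (subst (1 2 3) falg_val_superset[of ?A]) (auto simp: lookup_add c k sum.distrib simp del: add_pCons)
qed

lemma falg_val_diff: "falg_val f (p - q) = falg_val f p - falg_val f q"
  using falg_val_add[of f "p - q" q] by simp

lemma falg_val_sum: "falg_val f (sum g A) = (\<Sum>a\<in>A. falg_val f (g a))"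
  by (induction A rule: infinite_finite_induct) (simp_all add: falg_val_add)

lemma letters_plus [simp]: "letters (v + w) = letters v @ letters w"
  by (simp add: plus_gword_def)

lemma letters_zero [simp]: "letters 0 = []"
  by (simp add: zero_gword_def)

lemma falg_val_mult: "falg_val f (p * q) = skew_mult (falg_val f p) (falg_val f q)"
proof (induction p rule: poly_mapping_additive_induct)
  case (single w c)
  show ?case
  proof (induction q rule: poly_mapping_additive_induct)
    case (single v d)
    have "to_fract [:c * d:] = to_fract [:c:] * to_fract [:d:]" by (simp flip: to_fract_mult)
    then show ?case
      by (simp add: mult_single falg_val_single wval_append kz_mult_const_central
          kz_mult_skew_mult[symmetric] kz_mult_kz_mult mult.commute)
  qed (simp_all add: skew_mult_zero distrib_left falg_val_add skew_mult_add_right)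
qed (simp_all add: skew_mult_zero distrib_right falg_val_add skew_mult_add_left)

lemma falg_val_fconst: "falg_val f (fconst c) = Poly_Mapping.single 0 (to_fract [:c:])"
  by (simp add: falg_val_single kz_mult_def)

lemma falg_val_one [simp]: "falg_val f 1 = 1"
  using falg_val_fconst[of f 1] by (simp add: one_pCons[symmetric])

lemma falg_val_gens [simp]:
  "falg_val f fx = Poly_Mapping.single 1 1"
  "falg_val f fy = Poly_Mapping.single (-1) (to_fract (tr (-1) f))"
  "falg_val f fz = Poly_Mapping.single 0 (to_fract [:0, 1:])"
proof -
  have 1: "kz_mult (to_fract [:1:]) q = q" for q :: "'a skewl"
    by (simp add: kz_mult_def one_pCons[symmetric])
  show "falg_val f fx = Poly_Mapping.single 1 1"
    "falg_val f fy = Poly_Mapping.single (-1) (to_fract (tr (-1) f))"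
    "falg_val f fz = Poly_Mapping.single 0 (to_fract [:0, 1:])"
    unfolding falg_val_single 1
    by (simp_all add: wval_Cons skew_mult_single to_fract_def[symmetric])
qed

subsection \<open>Polynomials in the free algebra\<close>

lemma fconst_central: "fconst c * p = p * fconst c"
  by (induction p rule: poly_mapping_additive_induct) (simp_all add: mult_single distrib_left distrib_right mult.commute)

lemma peval_upto: "degree u \<le> n \<Longrightarrow> peval u t = (\<Sum>i\<le>n. fconst (coeff u i) * t ^ i)"
  unfolding peval_def by (intro sum.mono_neutral_left) (auto simp: coeff_eq_0)

lemma peval_zero [simp]: "peval 0 t = 0"
  by (simp add: peval_def)

lemma peval_pCons [simp]: "peval (pCons c u) t = fconst c + t * peval u t"
proof -
  have "peval (pCons c u) t = (\<Sum>i\<le>Suc (degree u). fconst (coeff (pCons c u) i) * t ^ i)"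
    by (rule peval_upto) (rule degree_pCons_le)
  also have "\<dots> = fconst c + (\<Sum>i\<le>degree u. fconst (coeff u i) * (t * t ^ i))"
    by (subst sum.atMost_Suc_shift) simp
  also have "(\<Sum>i\<le>degree u. fconst (coeff u i) * (t * t ^ i)) = t * peval u t"
    unfolding peval_def sum_distrib_left by (intro sum.cong refl) (metis fconst_central mult.assoc)
  finally show ?thesis .
qed

lemma peval_add: "peval (u + v) t = peval u t + peval v t"
proof -
  let ?n = "max (degree u) (degree v)"
  show ?thesis
    by (subst (1 2 3) peval_upto[of _ ?n])
      (auto simp: degree_add_le sum.distrib[symmetric] single_add distrib_right)
qed

lemma peval_smult: "peval (smult c u) t = fconst c * peval u t"
proof (induction u)
  case (pCons a u)
  have "t * (fconst c * peval u t) = fconst c * (t * peval u t)"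
    by (metis fconst_central mult.assoc)
  then show ?case using pCons by (simp add: distrib_left mult_single)
qed simp

lemma peval_mult: "peval (u * v) t = peval u t * peval v t"
  by (induction u) (simp_all add: peval_add peval_smult distrib_right mult.assoc)

lemma peval_shift: "peval (pcompose u [:c, 1:]) t = peval u (t + fconst c)"
proof (induction u)
  case (pCons a u)
  have "peval [:a:] t = fconst a" by simp
  moreover have "peval [:c, 1:] t = t + fconst c"
    by (simp add: add.commute)
  ultimately show ?case
    using pCons by (simp add: pcompose_pCons peval_add peval_smult distrib_right add.commute)
qed simp

lemma falg_val_peval:
  assumes "falg_val f t = Poly_Mapping.single 0 (to_fract [:c, 1:])"
  shows "falg_val f (peval u t) = Poly_Mapping.single 0 (to_fract (pcompose u [:c, 1:]))"
proof (induction u)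
  case (pCons a u)
  have "falg_val f (peval (pCons a u) t) =
      Poly_Mapping.single 0 (to_fract [:a:] + to_fract [:c, 1:] * to_fract (pcompose u [:c, 1:]))"
    using pCons by (simp add: falg_val_add falg_val_mult falg_val_fconst assms skew_mult_single flip: single_add)
  then show ?case by (simp only: pcompose_pCons to_fract_add to_fract_mult)
qed simp

lemma falg_val_peval_fz: "falg_val f (peval u fz) = Poly_Mapping.single 0 (to_fract u)"
  using falg_val_peval[of f fz 0 u] by simp

subsection \<open>The defining ideal\<close>

abbreviation type_ring :: "'a::ring_1 ring" where "type_ring \<equiv> ring_of_type_algebra"

lemma type_ring_simps [simp]:
  "carrier type_ring = UNIV" "x \<otimes>\<^bsub>type_ring\<^esub> y = x * y" "x \<oplus>\<^bsub>type_ring\<^esub> y = x + y"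
  "\<one>\<^bsub>type_ring\<^esub> = 1" "\<zero>\<^bsub>type_ring\<^esub> = 0"
  by (auto simp: ring_of_type_algebra_def)

lemma ring_type_ring: "ring (type_ring :: 'a::ring_1 ring)"
proof (rule ringI)
  show "abelian_group (type_ring :: 'a ring)"
    by (rule abelian_groupI) (auto simp: algebra_simps intro: exI[of _ "- _"])
  show "monoid (type_ring :: 'a ring)" by (rule monoidI) (auto simp: algebra_simps)
qed (auto simp: algebra_simps)

lemma type_ring_minus [simp]: "\<ominus>\<^bsub>type_ring\<^esub> x = - x"
proof -
  interpret ring "type_ring :: 'a ring" by (rule ring_type_ring)
  show ?thesis using minus_equality[of "- x" x] by simp
qed

lemma ideal_gwa_ideal: "ideal (gwa_ideal f) type_ring"
  unfolding gwa_ideal_def using ring.genideal_ideal[OF ring_type_ring] by simp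

lemma gwa_ideal_rels: "gwa_rels f \<subseteq> gwa_ideal f"
  unfolding gwa_ideal_def using ring.genideal_self[OF ring_type_ring] by simp

lemma
  shows gwa_ideal_zero: "0 \<in> gwa_ideal f"
    and gwa_ideal_add: "p \<in> gwa_ideal f \<Longrightarrow> q \<in> gwa_ideal f \<Longrightarrow> p + q \<in> gwa_ideal f"
    and gwa_ideal_minus: "p \<in> gwa_ideal f \<Longrightarrow> - p \<in> gwa_ideal f"
    and gwa_ideal_mult_left: "p \<in> gwa_ideal f \<Longrightarrow> a * p \<in> gwa_ideal f"
    and gwa_ideal_mult_right: "p \<in> gwa_ideal f \<Longrightarrow> p * a \<in> gwa_ideal f"
proof -
  interpret ideal "gwa_ideal f" type_ring by (rule ideal_gwa_ideal)
  show "0 \<in> gwa_ideal f" 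
    using additive_subgroup.zero_closed[OF ideal.axioms(1)[OF ideal_gwa_ideal]] by simp
  show "p \<in> gwa_ideal f \<Longrightarrow> q \<in> gwa_ideal f \<Longrightarrow> p + q \<in> gwa_ideal f"
    using additive_subgroup.a_closed[OF ideal.axioms(1)[OF ideal_gwa_ideal]] by (metis type_ring_simps(3))
  show "p \<in> gwa_ideal f \<Longrightarrow> - p \<in> gwa_ideal f" using I_l_closed[of p "- 1"] by simp
  show "p \<in> gwa_ideal f \<Longrightarrow> a * p \<in> gwa_ideal f" using I_l_closed by simp
  show "p \<in> gwa_ideal f \<Longrightarrow> p * a \<in> gwa_ideal f" using I_r_closed by simp
qed

lemma falg_val_gwa_ideal:
  assumes "p \<in> gwa_ideal f"
  shows "falg_val f p = 0"
proof -
  interpret B: ring "type_ring :: 'a falg ring" by (rule ring_type_ring)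
  let ?K = "{p. falg_val f p = 0}"
  have neg: "falg_val f (- p) = - falg_val f p" for p using falg_val_diff[of f 0 p] by simp
  have "ideal ?K type_ring"
  proof (rule idealI[OF B.ring_axioms])
    show "subgroup ?K (add_monoid type_ring)"
    proof (rule group.subgroupI[OF B.a_group])
      show "inv\<^bsub>add_monoid type_ring\<^esub> a \<in> ?K" if "a \<in> ?K" for a
        unfolding a_inv_def[symmetric] using that by (simp add: neg)
    qed (auto simp: falg_val_add intro: exI[of _ 0])
  qed (auto simp: falg_val_mult skew_mult_zero)
  moreover have "gwa_rels f \<subseteq> ?K"
  proof -
    have o: "[:1, 1:] = [:0, 1:] + (1 :: 'a poly)" "[:-1, 1:] = [:0, 1:] - (1 :: 'a poly)" by (simp_all add: one_pCons)
    have z1: "falg_val f (fz + 1) = Poly_Mapping.single 0 (to_fract [:1, 1:])"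
      unfolding falg_val_add falg_val_gens falg_val_one o to_fract_add single_add by simp
    have z2: "falg_val f (fz - 1) = Poly_Mapping.single 0 (to_fract [:-1, 1:])"
      unfolding falg_val_diff falg_val_gens falg_val_one o to_fract_diff single_diff by simp
    have c1: "tr 1 [:0, 1:] = [:1, 1 :: 'a:]" "tr (-1) [:0, 1:] = [:-1, 1 :: 'a:]" by (simp_all add: pcompose_pCons)
    have t: "tr 1 (tr (-1) f) = f" unfolding tr_tr by simp
    have d: "falg_val f (p - q) = 0" if "falg_val f p = falg_val f q" for p q
      using that by (simp add: falg_val_diff)
    note vs = falg_val_mult z1 z2 falg_val_gens skew_mult_single zshift_to_fract falg_val_peval_fz
      falg_val_peval[OF z2]
    have "falg_val f (fx * fz - (fz + 1) * fx) = 0" by (rule d) (simp only: vs c1, simp)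
    moreover have "falg_val f (fy * fz - (fz - 1) * fy) = 0"
      by (rule d) (simp only: vs c1, simp add: mult.commute del: mult_pCons_left mult_pCons_right)
    moreover have "falg_val f (fx * fy - peval f fz) = 0" by (rule d) (simp only: vs t, simp)
    moreover have "falg_val f (fy * fx - peval f (fz - 1)) = 0" by (rule d) (simp only: vs, simp)
    ultimately show ?thesis unfolding gwa_rels_def by auto
  qed
  ultimately have "genideal type_ring (gwa_rels f) \<subseteq> ?K" by (rule B.genideal_minimal)
  then show ?thesis using assms unfolding gwa_ideal_def by auto
qed


subsection \<open>Normal forms\<close>

definition gcong :: "'k::field_char_0 poly \<Rightarrow> 'k falg \<Rightarrow> 'k falg \<Rightarrow> bool" where
  "gcong f p q \<longleftrightarrow> p - q \<in> gwa_ideal f"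

lemma gcong_refl [simp]: "gcong f p p"
  by (simp add: gcong_def gwa_ideal_zero)

lemma gcong_trans: "gcong f p q \<Longrightarrow> gcong f q r \<Longrightarrow> gcong f p r"
  unfolding gcong_def using gwa_ideal_add[of "p - q" f "q - r"] by simp

lemma gcong_add: "gcong f p q \<Longrightarrow> gcong f p' q' \<Longrightarrow> gcong f (p + p') (q + q')"
  unfolding gcong_def using gwa_ideal_add[of "p - q" f "p' - q'"] by (simp add: algebra_simps)

lemma gcong_mult_left: "gcong f p q \<Longrightarrow> gcong f (a * p) (a * q)"
  unfolding gcong_def using gwa_ideal_mult_left[of "p - q" f a] by (simp add: algebra_simps)

lemma gcong_mult_right: "gcong f p q \<Longrightarrow> gcong f (p * a) (q * a)"
  unfolding gcong_def using gwa_ideal_mult_right[of "p - q" f a] by (simp add: algebra_simps)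

lemma gcong_rels:
  shows "gcong f (fx * fz) ((fz + 1) * fx)" "gcong f (fy * fz) ((fz - 1) * fy)"
    "gcong f (fx * fy) (peval f fz)" "gcong f (fy * fx) (peval (tr (-1) f) fz)"
proof -
  have "peval (tr (-1) f) fz = peval f (fz - 1)"
    using peval_shift[of f "-1" fz] by (simp flip: single_one add: single_uminus)
  then show "gcong f (fx * fz) ((fz + 1) * fx)" "gcong f (fy * fz) ((fz - 1) * fy)"
    "gcong f (fx * fy) (peval f fz)" "gcong f (fy * fx) (peval (tr (-1) f) fz)"
    unfolding gcong_def using gwa_ideal_rels[of f] unfolding gwa_rels_def by auto
qed

text \<open>It suffices to move the generator past constants, which are central, and past \<open>z\<close>.\<close>

lemma gcong_commute_peval:
  assumes "gcong f (g * fz) ((fz + fconst c) * g)"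
  shows "gcong f (g * peval u fz) (peval (pcompose u [:c, 1:]) fz * g)"
  unfolding peval_shift
proof (induction u)
  case (pCons a u)
  have "gcong f (g * fz * peval u fz) ((fz + fconst c) * g * peval u fz)"
    by (rule gcong_mult_right[OF assms])
  moreover have "gcong f ((fz + fconst c) * g * peval u fz) ((fz + fconst c) * (peval u (fz + fconst c) * g))"
    using gcong_mult_left[OF pCons(2), of "fz + fconst c"] by (simp add: mult.assoc)
  ultimately have "gcong f (g * fz * peval u fz) ((fz + fconst c) * (peval u (fz + fconst c) * g))"
    by (rule gcong_trans)
  from gcong_add[OF gcong_refl this, of "fconst a * g"] show ?case
    by (simp add: distrib_left distrib_right mult.assoc fconst_central[of a g])
qed simp

definition xpow :: "int \<Rightarrow> 'k::field_char_0 falg" where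
  "xpow j = (if 0 \<le> j then fx ^ nat j else fy ^ nat (- j))"

definition nf :: "int \<Rightarrow> 'k::field_char_0 poly \<Rightarrow> 'k falg" where
  "nf j u = peval u fz * xpow j"

definition nfsum :: "(int \<Rightarrow>\<^sub>0 'k::field_char_0 poly) \<Rightarrow> 'k falg" where
  "nfsum U = (\<Sum>j\<in>Poly_Mapping.keys U. nf j (Poly_Mapping.lookup U j))"

lemma nf_add: "nf j (u + v) = nf j u + nf j v"
  by (simp add: nf_def peval_add distrib_right)

lemma nf_zero [simp]: "nf j 0 = 0"
  by (simp add: nf_def)

lemma nfsum_superset:
  assumes "finite A" "Poly_Mapping.keys U \<subseteq> A"
  shows "nfsum U = (\<Sum>j\<in>A. nf j (Poly_Mapping.lookup U j))"
  unfolding nfsum_def using assms by (intro sum.mono_neutral_left) (auto simp: in_keys_iff)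

lemma nfsum_add: "nfsum (U + V) = nfsum U + nfsum V"
proof -
  let ?A = "Poly_Mapping.keys U \<union> Poly_Mapping.keys V"
  have "Poly_Mapping.keys (U + V) \<subseteq> ?A" using keys_add[of U V] by auto
  then show ?thesis
    by (subst (1 2 3) nfsum_superset[of ?A]) (auto simp: lookup_add nf_add sum.distrib)
qed

lemma nfsum_single [simp]: "nfsum (Poly_Mapping.single j u) = nf j u"
  by (subst nfsum_superset[of "{j}"]) auto

lemma nfsum_zero [simp]: "nfsum 0 = 0"
  by (simp add: nfsum_def)

lemma fz_nf: "fz * nf j u = nf j ([:0, 1:] * u)"
proof -
  have "peval ([:0, 1:] * u) fz = peval [:0, 1:] fz * peval u fz" by (rule peval_mult)
  then show ?thesis by (simp add: nf_def mult.assoc)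
qed

lemma fconst_nf: "fconst c * nf j u = nf j (smult c u)"
  by (simp add: nf_def peval_smult mult.assoc)

lemma fx_nf: "\<exists>v. gcong f (fx * nf j u) (nf (j + 1) v)"
proof -
  have "gcong f (fx * peval u fz) (peval (tr 1 u) fz * fx)"
    using gcong_rels(1)[of f] by (intro gcong_commute_peval) simp
  from gcong_mult_right[OF this, of "xpow j"] have c: "gcong f (fx * nf j u) (peval (tr 1 u) fz * (fx * xpow j))"
    by (simp add: nf_def mult.assoc)
  show ?thesis
  proof (cases "0 \<le> j")
    case True
    then have "fx * xpow j = (xpow (j + 1) :: 'a falg)" by (simp add: xpow_def nat_add_distrib)
    then show ?thesis using c by (intro exI[of _ "tr 1 u"]) (simp add: nf_def)
  next
    case False
    define m where "m = nat (- j - 1)"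
    have j: "nat (- j) = Suc m" "j + 1 = - int m" using False by (auto simp: m_def)
    have x: "fx * xpow j = fx * fy * (xpow (j + 1) :: 'a falg)"
      using False j by (auto simp: xpow_def mult.assoc)
    have "gcong f (peval (tr 1 u) fz * (fx * xpow j)) (peval (tr 1 u) fz * (peval f fz * xpow (j + 1)))"
      unfolding x by (intro gcong_mult_left gcong_mult_right gcong_rels(3))
    from gcong_trans[OF c this] show ?thesis
      by (intro exI[of _ "tr 1 u * f"]) (simp add: nf_def peval_mult mult.assoc)
  qed
qed

lemma fy_nf: "\<exists>v. gcong f (fy * nf j u) (nf (j - 1) v)"
proof -
  have "gcong f (fy * fz) ((fz + fconst (- 1)) * fy)"
    using gcong_rels(2)[of f] by (simp add: single_uminus)
  then have "gcong f (fy * peval u fz) (peval (tr (- 1) u) fz * fy)"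
    using gcong_commute_peval[of f fy "- 1" u] by simp
  from gcong_mult_right[OF this, of "xpow j"] have c: "gcong f (fy * nf j u) (peval (tr (- 1) u) fz * (fy * xpow j))"
    by (simp add: nf_def mult.assoc)
  show ?thesis
  proof (cases "j \<le> 0")
    case True
    define m where "m = nat (- j)"
    have j: "j = - int m" using True by (simp add: m_def)
    have "fy * xpow j = (xpow (j - 1) :: 'a falg)"
    proof -
      have "nat (1 + int m) = Suc m" by simp
      then show ?thesis unfolding j by (auto simp: xpow_def)
    qed
    then show ?thesis using c by (intro exI[of _ "tr (- 1) u"]) (simp add: nf_def)
  next
    case False
    define m where "m = nat (j - 1)"
    have j: "j = 1 + int m" using False by (auto simp: m_def)
    have "nat (1 + int m) = Suc m" by simp
    then have x: "fy * xpow j = fy * fx * (xpow (j - 1) :: 'a falg)"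
      unfolding j by (auto simp: xpow_def mult.assoc)
    have "gcong f (peval (tr (- 1) u) fz * (fy * xpow j)) (peval (tr (- 1) u) fz * (peval (tr (- 1) f) fz * xpow (j - 1)))"
      unfolding x by (intro gcong_mult_left gcong_mult_right gcong_rels(4))
    from gcong_trans[OF c this] show ?thesis
      by (intro exI[of _ "tr (- 1) u * tr (- 1) f"]) (simp add: nf_def peval_mult mult.assoc)
  qed
qed

text \<open>
  The normal forms are closed under left multiplication by the generators up to congruence, so they
  exhaust the algebra.
\<close>

lemma ex_nfsum: "\<exists>U. gcong f p (nfsum U)"
proof -
  let ?N = "{p. \<exists>U. gcong f p (nfsum U)}"
  have N_add: "p + q \<in> ?N" if p: "p \<in> ?N" and q: "q \<in> ?N" for p q
  proof -
    obtain U V where "gcong f p (nfsum U)" "gcong f q (nfsum V)" using p q by auto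
    then have "gcong f (p + q) (nfsum (U + V))" unfolding nfsum_add by (rule gcong_add)
    then show ?thesis by blast
  qed
  have zero: "0 \<in> ?N" using gcong_refl[of f 0] nfsum_zero by (metis mem_Collect_eq)
  have sing: "p \<in> ?N" if "gcong f p (nf j u)" for p j u
    using that by (auto intro!: exI[of _ "Poly_Mapping.single j u"])
  have gen: "a * p \<in> ?N" if a: "\<And>j u. a * nf j u \<in> ?N" and p: "p \<in> ?N" for a p
  proof -
    obtain U where U: "gcong f p (nfsum U)" using p by auto
    have "a * nfsum V \<in> ?N" for V
    proof (induction V rule: poly_mapping_additive_induct)
      case (single j u)
      then show ?case using a[of j u] by simp
    next
      case (add V W)
      then show ?case using N_add[of "a * nfsum V" "a * nfsum W"]
        by (simp only: nfsum_add distrib_left)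
    qed (use zero in simp)
    then obtain W where "gcong f (a * nfsum U) (nfsum W)" by auto
    then show ?thesis using gcong_trans[OF gcong_mult_left[OF U]] by blast
  qed
  have letter: "Poly_Mapping.single (GWord [g]) 1 * p \<in> ?N" if "p \<in> ?N" for g p
  proof (cases g)
    case GX
    have "fx * nf j u \<in> ?N" for j u using fx_nf[of f j u] sing by blast
    then show ?thesis using gen[OF _ that] GX by simp
  next
    case GY
    have "fy * nf j u \<in> ?N" for j u using fy_nf[of f j u] sing by blast
    then show ?thesis using gen[OF _ that] GY by simp
  next
    case GZ
    have "fz * nf j u \<in> ?N" for j u using sing[of _ j "[:0, 1:] * u"] fz_nf by (metis gcong_refl)
    then show ?thesis using gen[OF _ that] GZ by simp
  qed
  have const: "fconst c * p \<in> ?N" if "p \<in> ?N" for c p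
  proof (rule gen[OF _ that])
    show "fconst c * nf j u \<in> ?N" for j u using sing[of "nf j (smult c u)" j "smult c u"] by (simp add: fconst_nf)
  qed
  have word: "Poly_Mapping.single (GWord ws) 1 \<in> ?N" for ws
  proof (induction ws)
    case Nil
    have "Poly_Mapping.single (GWord []) 1 = (nf 0 1 :: 'a falg)"
      by (simp add: nf_def xpow_def one_pCons flip: zero_gword_def)
    then show ?case using sing[of _ 0 1] by simp
  next
    case (Cons g ws)
    have "Poly_Mapping.single (GWord (g # ws)) (1 :: 'a) = Poly_Mapping.single (GWord [g]) 1 * Poly_Mapping.single (GWord ws) 1"
      by (simp add: mult_single plus_gword_def)
    then show ?case using letter[OF Cons] by simp
  qed
  have "p \<in> ?N"
  proof (induction p rule: poly_mapping_additive_induct)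
    case (single w c)
    have "Poly_Mapping.single w c = fconst c * Poly_Mapping.single (GWord (letters w)) 1"
      by (simp add: mult_single)
    then show ?case using const[OF word[of "letters w"], of c] by simp
  qed (use zero N_add in auto)
  then show ?thesis by simp
qed

text \<open>
  The coefficient of the monomial that represents \<open>y\<^sup>-\<^sup>j\<close> in the skew Laurent ring if \<open>j < 0\<close>; the powers of \<open>x\<close> have coefficient \<open>1\<close>.
\<close>

definition apol :: "'k::field_char_0 poly \<Rightarrow> int \<Rightarrow> 'k poly" where
  "apol f j = (\<Prod>k\<in>{j..<0}. tr k f)"

lemma apol_nonneg [simp]: "0 \<le> j \<Longrightarrow> apol f j = 1"
  by (simp add: apol_def)

lemma apol_pred: "j \<le> 0 \<Longrightarrow> apol f (j - 1) = tr (j - 1) f * apol f j"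
proof -
  assume "j \<le> 0"
  then have "{j - 1..<0} = insert (j - 1) {j..<0}" by auto
  then show ?thesis by (simp add: apol_def)
qed

lemma apol_nonzero: "f \<noteq> 0 \<Longrightarrow> apol f j \<noteq> 0"
  by (simp add: apol_def)

lemma falg_val_xpow: "falg_val f (xpow j) = Poly_Mapping.single j (to_fract (apol f j))"
proof (cases "0 \<le> j")
  case True
  have "falg_val f (fx ^ n) = Poly_Mapping.single (int n) 1" for n
    by (induction n) (simp_all add: falg_val_mult skew_mult_single)
  then show ?thesis using True by (simp add: xpow_def)
next
  case False
  have "falg_val f (fy ^ n) = Poly_Mapping.single (- int n) (to_fract (apol f (- int n)))" for n
  proof (induction n)
    case (Suc n)
    have H: "falg_val f (fy ^ Suc n) = Poly_Mapping.single (- int n - 1) (to_fract (apol f (- int n) * tr (- int n - 1) f))"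
      unfolding power_Suc2 falg_val_mult Suc falg_val_gens skew_mult_single zshift_to_fract tr_tr by simp
    have e: "- int (Suc n) = - int n - 1" by simp
    show ?case unfolding H e using apol_pred[of "- int n" f] by (simp add: mult.commute)
  qed simp
  from this[of "nat (- j)"] show ?thesis using False by (simp add: xpow_def)
qed

lemma falg_val_nf: "falg_val f (nf j u) = Poly_Mapping.single j (to_fract (u * apol f j))"
  by (simp add: nf_def falg_val_mult falg_val_peval_fz falg_val_xpow skew_mult_single)

lemma lookup_falg_val_nfsum:
  "Poly_Mapping.lookup (falg_val f (nfsum U)) j = to_fract (Poly_Mapping.lookup U j * apol f j)"
  by (induction U rule: poly_mapping_additive_induct)
    (auto simp: nfsum_add falg_val_add falg_val_nf lookup_add lookup_single when_def distrib_right)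

lemma falg_val_gcong: "gcong f p q \<Longrightarrow> falg_val f p = falg_val f q"
  unfolding gcong_def using falg_val_gwa_ideal[of "p - q" f] by (simp add: falg_val_diff)

text \<open>
  Normal forms are determined by their values, as \<open>f \<noteq> 0\<close>; so the relations are all the relations.
\<close>

lemma falg_val_eq_0_iff:
  assumes f: "f \<noteq> 0"
  shows "falg_val f p = 0 \<longleftrightarrow> p \<in> gwa_ideal f"
proof
  assume p: "falg_val f p = 0"
  obtain U where U: "gcong f p (nfsum U)" using ex_nfsum by blast
  have "Poly_Mapping.lookup U j = 0" for j
    using lookup_falg_val_nfsum[of f U j] falg_val_gcong[OF U] p apol_nonzero[OF f, of j] by simp
  then have "U = 0" by (intro poly_mapping_eqI) simp
  then show "p \<in> gwa_ideal f" using U by (simp add: gcong_def)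
qed (rule falg_val_gwa_ideal)

subsection \<open>The image\<close>

lemma cls_alt: "cls f p = {h + p | h. h \<in> gwa_ideal f}"
  by (auto simp: cls_def a_r_coset_def r_coset_def)

lemma cls_eq_iff: "cls f p = cls f q \<longleftrightarrow> p - q \<in> gwa_ideal f"
proof
  assume "cls f p = cls f q"
  moreover have "p \<in> cls f p" unfolding cls_alt using gwa_ideal_zero by force
  ultimately show "p - q \<in> gwa_ideal f" unfolding cls_alt by auto
next
  have sub: "cls f p \<subseteq> cls f q" if "p - q \<in> gwa_ideal f" for p q
  proof
    fix x assume "x \<in> cls f p"
    then obtain h where h: "x = h + p" "h \<in> gwa_ideal f" unfolding cls_alt by auto
    have "x = (h + (p - q)) + q" using h by simp
    then show "x \<in> cls f q" unfolding cls_alt using gwa_ideal_add[OF h(2) that] by blast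
  qed
  assume "p - q \<in> gwa_ideal f"
  then show "cls f p = cls f q" using sub[of p q] sub[of q p] gwa_ideal_minus[of "p - q" f] by simp
qed

lemma gwa_val_cls [simp]: "gwa_val f (cls f p) = falg_val f p"
proof -
  have "falg_val f ` cls f p = {falg_val f p}"
    unfolding cls_alt using gwa_ideal_zero[of f] by (force simp: falg_val_add falg_val_gwa_ideal image_iff)
  then show ?thesis by (simp add: gwa_val_def)
qed

lemma gwa_carrier: "carrier (gwa f) = range (cls f)"
  by (auto simp: gwa_def Let_def FactRing_simps cls_def a_r_coset_def)

lemma cls_in_carrier: "cls f p \<in> carrier (gwa f)"
  by (simp add: gwa_carrier)

lemma
  shows cls_add: "cls f p \<oplus>\<^bsub>gwa f\<^esub> cls f q = cls f (p + q)"
    and cls_mult: "cls f p \<otimes>\<^bsub>gwa f\<^esub> cls f q = cls f (p * q)"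
    and cls_one: "\<one>\<^bsub>gwa f\<^esub> = cls f 1"
    and cls_zero: "\<zero>\<^bsub>gwa f\<^esub> = cls f 0"
proof -
  note h = ideal.rcos_ring_hom[OF ideal_gwa_ideal[of f]]
  have gs: "add (gwa f) = add (type_ring Quot gwa_ideal f)" "monoid.mult (gwa f) = monoid.mult (type_ring Quot gwa_ideal f)"
    "\<one>\<^bsub>gwa f\<^esub> = \<one>\<^bsub>type_ring Quot gwa_ideal f\<^esub>" "\<zero>\<^bsub>gwa f\<^esub> = \<zero>\<^bsub>type_ring Quot gwa_ideal f\<^esub>"
    by (simp_all add: gwa_def Let_def)
  show "cls f p \<oplus>\<^bsub>gwa f\<^esub> cls f q = cls f (p + q)"
    unfolding gs cls_def using ring_hom_add[OF h, of p q] by simp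
  show "cls f p \<otimes>\<^bsub>gwa f\<^esub> cls f q = cls f (p * q)"
    unfolding gs cls_def using ring_hom_mult[OF h, of p q] by simp
  show "\<one>\<^bsub>gwa f\<^esub> = cls f 1"
    unfolding gs cls_def using ring_hom_one[OF h] by simp
  have "\<zero>\<^bsub>type_ring Quot gwa_ideal f\<^esub> = gwa_ideal f" by (simp add: FactRing_def)
  also have "\<dots> = cls f 0" unfolding cls_alt by simp
  finally show "\<zero>\<^bsub>gwa f\<^esub> = cls f 0" unfolding gs .
qed

text \<open>Every element is a sum of normal forms, and these take the values \<open>u(z) a\<^sub>j(z) x\<^sup>j\<close> with \<open>a\<^sub>j\<close> = \<^term>\<open>apol f j\<close>.\<close>

lemma gwa_sub_iff: "q \<in> gwa_sub f \<longleftrightarrow> (\<forall>j. \<exists>u. Poly_Mapping.lookup q j = to_fract (u * apol f j))"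
proof
  assume "q \<in> gwa_sub f"
  then obtain p where p: "q = falg_val f p" by (auto simp: gwa_sub_def gwa_carrier)
  obtain U where U: "gcong f p (nfsum U)" using ex_nfsum by blast
  show "\<forall>j. \<exists>u. Poly_Mapping.lookup q j = to_fract (u * apol f j)"
    unfolding p falg_val_gcong[OF U] lookup_falg_val_nfsum by blast
next
  assume "\<forall>j. \<exists>u. Poly_Mapping.lookup q j = to_fract (u * apol f j)"
  then obtain u where u: "\<And>j. Poly_Mapping.lookup q j = to_fract (u j * apol f j)" by metis
  have "q = falg_val f (\<Sum>j\<in>Poly_Mapping.keys q. nf j (u j))"
    by (simp add: falg_val_sum falg_val_nf u[symmetric] poly_mapping_sum_single del: to_fract_mult)
  then have "q = gwa_val f (cls f (\<Sum>j\<in>Poly_Mapping.keys q. nf j (u j)))" by simp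
  then show "q \<in> gwa_sub f" unfolding gwa_sub_def gwa_carrier by blast
qed

lemma gwa_val_inj: "f \<noteq> 0 \<Longrightarrow> inj_on (gwa_val f) (carrier (gwa f))"
proof (rule inj_onI)
  assume f: "f \<noteq> 0"
  fix C C' assume "C \<in> carrier (gwa f)" "C' \<in> carrier (gwa f)" and eq: "gwa_val f C = gwa_val f C'"
  then obtain p q where pq: "C = cls f p" "C' = cls f q" by (auto simp: gwa_carrier)
  have "falg_val f (p - q) = 0" using eq by (simp add: pq falg_val_diff)
  then show "C = C'" unfolding pq cls_eq_iff using falg_val_eq_0_iff[OF f] by blast
qed

definition wt :: "gword \<Rightarrow> int" where "wt w = (\<Sum>g\<leftarrow>letters w. gdeg g)"

lemma wt_plus: "wt (v + w) = wt v + wt w"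
  by (simp add: wt_def)

lemma keys_wval: "Poly_Mapping.keys (wval f ws) \<subseteq> {\<Sum>g\<leftarrow>ws. gdeg g}"
proof (induction ws)
  case (Cons g ws)
  have "Poly_Mapping.keys (gen_val f g) \<subseteq> {gdeg g}"
    by (cases g) (auto simp: skew_mult_single)
  then show ?case using skew.keys_tconv[OF _ Cons] by (simp add: wval_Cons skew_mult_tconv)
qed simp

lemma keys_falg_val:
  assumes "\<And>w. w \<in> Poly_Mapping.keys p \<Longrightarrow> wt w = n"
  shows "Poly_Mapping.keys (falg_val f p) \<subseteq> {n}"
proof -
  have "Poly_Mapping.lookup (falg_val f p) j = 0" if "j \<noteq> n" for j
  proof -
    have "Poly_Mapping.lookup (wval f (letters w)) j = 0" if "w \<in> Poly_Mapping.keys p" for w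
      using keys_wval[of f "letters w"] assms[OF that] \<open>j \<noteq> n\<close> by (auto simp: in_keys_iff wt_def)
    then show ?thesis
      by (subst falg_val_superset[of "Poly_Mapping.keys p"]) (auto simp: lookup_sum lookup_kz_mult)
  qed
  then show ?thesis by (auto simp: in_keys_iff)
qed

lemma weight_nf:
  assumes "w \<in> Poly_Mapping.keys (nf j u)"
  shows "wt w = j"
proof -
  have mult: "wt w = a + b"
    if "w \<in> Poly_Mapping.keys (p * q)" "\<And>w. w \<in> Poly_Mapping.keys p \<Longrightarrow> wt w = a" "\<And>w. w \<in> Poly_Mapping.keys q \<Longrightarrow> wt w = b"
    for w a b and p q :: "'a falg"
    using keys_mult[of p q] that by (auto simp: wt_plus)
  have gens: "wt 0 = 0" "wt (GWord [GX]) = 1" "wt (GWord [GY]) = -1" "wt (GWord [GZ]) = 0"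
    by (simp_all add: wt_def)
  have pz: "wt w = 0" if "w \<in> Poly_Mapping.keys (peval u fz)" for w and u :: "'a poly"
    using that
  proof (induction u arbitrary: w)
    case (pCons a u)
    have "wt v = 0" if "v \<in> Poly_Mapping.keys (fz * peval u fz)" for v
      using mult[OF that, of 0 0] pCons(2) gens by (auto split: if_splits)
    moreover have "wt v = 0" if "v \<in> Poly_Mapping.keys (fconst a)" for v
      using that gens by (auto split: if_splits)
    ultimately show ?case using pCons(3) keys_add[of "fconst a" "fz * peval u fz"] by auto
  qed simp
  have px: "wt w = int n" if "w \<in> Poly_Mapping.keys (fx ^ n :: 'a falg)" for w n
    using that
  proof (induction n arbitrary: w)
    case (Suc n)
    then show ?case using mult[of w fx "fx ^ n" 1 "int n"] gens by (auto split: if_splits)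
  qed (use gens in auto)
  have py: "wt w = - int n" if "w \<in> Poly_Mapping.keys (fy ^ n :: 'a falg)" for w n
    using that
  proof (induction n arbitrary: w)
    case (Suc n)
    then show ?case using mult[of w fy "fy ^ n" "-1" "- int n"] gens by (auto split: if_splits)
  qed (use gens in auto)
  have "wt v = j" if "v \<in> Poly_Mapping.keys (xpow j :: 'a falg)" for v
    using that px[of v "nat j"] py[of v "nat (- j)"] by (auto simp: xpow_def split: if_splits)
  then show ?thesis using mult[of w "peval u fz" "xpow j" 0 j] pz assms unfolding nf_def by simp
qed

lemma gwa_hcomp:
  assumes f: "f \<noteq> 0"
  shows "hcomp (gwa f) n = {C \<in> carrier (gwa f). Poly_Mapping.keys (gwa_val f C) \<subseteq> {n}}"
proof -
  have h: "hcomp (gwa f) n = cls f ` {p. \<forall>w\<in>Poly_Mapping.keys p. wt w = n}"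
    by (simp add: gwa_def Let_def wt_def)
  show ?thesis
  proof (intro equalityI subsetI)
    fix C assume "C \<in> hcomp (gwa f) n"
    then obtain p where "C = cls f p" "\<forall>w\<in>Poly_Mapping.keys p. wt w = n" unfolding h by auto
    then show "C \<in> {C \<in> carrier (gwa f). Poly_Mapping.keys (gwa_val f C) \<subseteq> {n}}"
      using keys_falg_val[of p n f] unfolding gwa_carrier by auto
  next
    fix C assume C: "C \<in> {C \<in> carrier (gwa f). Poly_Mapping.keys (gwa_val f C) \<subseteq> {n}}"
    then have "gwa_val f C \<in> gwa_sub f" by (auto simp: gwa_sub_def)
    then obtain u where "Poly_Mapping.lookup (gwa_val f C) n = to_fract (u * apol f n)"
      unfolding gwa_sub_iff by blast
    then have eq: "gwa_val f C = gwa_val f (cls f (nf n u))"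
      using keys_subset_single[of "gwa_val f C" n] C by (simp add: falg_val_nf)
    have "C = cls f (nf n u)"
      using C by (intro inj_onD[OF gwa_val_inj[OF f] eq]) (auto simp: gwa_carrier)
    then show "C \<in> hcomp (gwa f) n" unfolding h using weight_nf by blast
  qed
qed

lemma gwa_sub_ex:
  assumes "q \<in> gwa_sub f"
  obtains C where "C \<in> carrier (gwa f)" "gwa_val f C = q"
  using assms by (auto simp: gwa_sub_def)

lemma
  assumes "C \<in> carrier (gwa f)" "C' \<in> carrier (gwa f)"
  shows gwa_add_closed: "C \<oplus>\<^bsub>gwa f\<^esub> C' \<in> carrier (gwa f)"
    and gwa_val_add: "gwa_val f (C \<oplus>\<^bsub>gwa f\<^esub> C') = gwa_val f C + gwa_val f C'"
    and gwa_mult_closed: "C \<otimes>\<^bsub>gwa f\<^esub> C' \<in> carrier (gwa f)"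
    and gwa_val_mult: "gwa_val f (C \<otimes>\<^bsub>gwa f\<^esub> C') = skew_mult (gwa_val f C) (gwa_val f C')"
  using assms by (auto simp: gwa_carrier cls_add cls_mult falg_val_add falg_val_mult)

lemma gwa_scal: "scal (gwa f) c = cls f (fconst c)"
  by (simp add: gwa_def Let_def)

lemma gwa_val_one: "gwa_val f \<one>\<^bsub>gwa f\<^esub> = 1"
  by (simp add: cls_one)

lemma gwa_sub_zero: "0 \<in> gwa_sub f"
  unfolding gwa_sub_iff by (intro allI exI[of _ 0]) simp

lemma gwa_sub_uminus: "q \<in> gwa_sub f \<Longrightarrow> - q \<in> gwa_sub f"
  unfolding gwa_sub_iff by (metis lookup_uminus mult_minus_left to_fract_uminus)

lemma gwa_sub_single: "q \<in> gwa_sub f \<Longrightarrow> Poly_Mapping.single j (Poly_Mapping.lookup q j) \<in> gwa_sub f"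
  unfolding gwa_sub_iff lookup_single when_def by (metis mult_zero_left to_fract_0)

lemma graded_ring_gwa:
  assumes f: "f \<noteq> 0"
  shows "graded_ring (gwa f)"
proof (rule skew.graded_ring_of_embedding[where V = "gwa_val f"])
  show "\<exists>C'\<in>carrier (gwa f). gwa_val f C' = - gwa_val f C" if "C \<in> carrier (gwa f)" for C
    using that gwa_sub_uminus[of "gwa_val f C" f] by (auto simp: gwa_sub_def)
  show "\<exists>C'\<in>carrier (gwa f). gwa_val f C' = Poly_Mapping.single g (Poly_Mapping.lookup (gwa_val f C) g)"
    if "C \<in> carrier (gwa f)" for C g
    using that gwa_sub_single[of "gwa_val f C" f g] by (auto simp: gwa_sub_def)
  have k: "Poly_Mapping.single 0 (to_fract [:c:]) = kz_mult (to_fract [:c:]) (1 :: 'a skewl)" for c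
    by (simp add: kz_mult_def)
  show "tconv (\<lambda>i j a b. a * zshift i b) (gwa_val f (scal (gwa f) c)) (gwa_val f C) =
      tconv (\<lambda>i j a b. a * zshift i b) (gwa_val f C) (gwa_val f (scal (gwa f) c))" for C c
    by (simp only: skew_mult_tconv[symmetric] gwa_scal gwa_val_cls falg_val_fconst k kz_mult_const_central
      kz_mult_skew_mult[symmetric] skew_mult_1)
qed (simp_all add: gwa_val_inj[OF f] cls_zero cls_one gwa_add_closed gwa_val_add gwa_mult_closed gwa_val_mult
      skew_mult_tconv gwa_hcomp[OF f] gwa_scal falg_val_fconst cls_in_carrier)

section \<open>Rank one projectives and their simple quotients\<close>

(* Products stay folded inside to_fract, so that identities of polynomials can be applied to them. *)
declare to_fract_mult [simp del]

abbreviation lin :: "'k::field_char_0 \<Rightarrow> int \<Rightarrow> 'k poly" where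
  "lin \<beta> n \<equiv> [:of_int n + \<beta>, 1:]"

abbreviation rt :: "'k::field_char_0 \<Rightarrow> int \<Rightarrow> 'k" where
  "rt \<beta> n \<equiv> - of_int n - \<beta>"

lemma poly_lin: "poly (lin \<beta> n) x = of_int n + \<beta> + x"
  by simp

lemma lin_dvd_iff: "lin \<beta> n dvd u \<longleftrightarrow> poly u (rt \<beta> n) = 0"
  using poly_eq_0_iff_dvd[of u "rt \<beta> n"] by (simp add: add.commute)

lemma tr_lin: "tr m (lin \<beta> n) = lin \<beta> (n + m)"
  by (simp add: pcompose_pCons algebra_simps)

lemma tr_falpha: "tr n (falpha \<alpha>) = lin 0 n * lin \<alpha> n"
  by (simp add: falpha_def pcompose_mult pcompose_pCons)

lemma lin_dvd_tr_falpha: "\<beta> \<in> {0, \<alpha>} \<Longrightarrow> lin \<beta> n dvd tr n (falpha \<alpha>)"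
  unfolding tr_falpha by (elim insertE emptyE) (simp_all only: dvd_triv_left dvd_triv_right)

lemma falpha_nonzero: "falpha \<alpha> \<noteq> 0"
  by (simp add: falpha_def)

lemma single_in_gwa_sub: "Poly_Mapping.single j (to_fract (u * apol f j)) \<in> gwa_sub f"
  unfolding gwa_sub_iff lookup_single when_def by (metis mult_zero_left to_fract_0)

definition Pl :: "(int \<Rightarrow> 'k::field_char_0 poly) \<Rightarrow> 'k skewl set" where
  "Pl p = {q. \<forall>m. \<exists>u. Poly_Mapping.lookup q m = to_fract (u * p m)}"

lemma gwa_sub_eq_Pl: "gwa_sub f = Pl (apol f)"
  by (auto simp: Pl_def gwa_sub_iff)

lemma Pl_single_iff: "Poly_Mapping.single m r \<in> Pl p \<longleftrightarrow> (\<exists>u. r = to_fract (u * p m))"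
proof
  assume "Poly_Mapping.single m r \<in> Pl p"
  then show "\<exists>u. r = to_fract (u * p m)" unfolding Pl_def by (auto dest: spec[of _ m])
next
  assume r: "\<exists>u. r = to_fract (u * p m)"
  have "\<exists>u. Poly_Mapping.lookup (Poly_Mapping.single m r) l = to_fract (u * p l)" for l
  proof (cases "l = m")
    case False
    then show ?thesis by (intro exI[of _ 0]) (simp add: lookup_single)
  qed (use r in simp)
  then show "Poly_Mapping.single m r \<in> Pl p" by (simp add: Pl_def)
qed

lemma Pl_part: "q \<in> Pl p \<Longrightarrow> Poly_Mapping.single m (Poly_Mapping.lookup q m) \<in> Pl p"
  unfolding Pl_single_iff by (simp add: Pl_def)

lemma Pl_zero: "0 \<in> Pl p"
  by (auto simp: Pl_def intro: exI[of _ 0])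

lemma Pl_add: "q \<in> Pl p \<Longrightarrow> q' \<in> Pl p \<Longrightarrow> q + q' \<in> Pl p"
  unfolding Pl_def by (simp add: lookup_add) (metis distrib_right to_fract_add to_fract_mult)

lemma Pl_sum: "(\<And>i. i \<in> I \<Longrightarrow> g i \<in> Pl p) \<Longrightarrow> sum g I \<in> Pl p"
  by (induction I rule: infinite_finite_induct) (auto simp: Pl_zero Pl_add)

text \<open>
  A graded submodule \<open>P\<close> with \<open>P\<^sub>m = p\<^sub>m k[z] x\<^sup>m\<close> is described by the quotients \<open>p\<^sub>m / p\<^sub>m\<^sub>+\<^sub>1\<close>, which
  divide \<open>(z + m)(z + m + \<alpha>)\<close>. The set \<open>T\<close> records which of the two linear factors occur; \<open>(\<beta>, n) \<in> T\<close>
  means that \<open>P\<close> surjects onto \<open>Y\<^sub>\<beta>\<langle>n\<rangle>\<close>, and \<open>(\<beta>, n) \<notin> T\<close> that it surjects onto \<open>X\<^sub>\<beta>\<langle>n\<rangle>\<close>. Far out to both sides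
  the projective looks like \<open>A\<close> itself, which makes it comparable with \<open>A\<close>.
\<close>

definition gT :: "'k::field_char_0 \<Rightarrow> ('k \<times> int) set \<Rightarrow> int \<Rightarrow> 'k poly" where
  "gT \<alpha> T m = (if (0, m) \<in> T then lin 0 m else 1) * (if (\<alpha>, m) \<in> T then lin \<alpha> m else 1)"

definition good :: "'k::field_char_0 \<Rightarrow> ('k \<times> int) set \<Rightarrow> (int \<Rightarrow> 'k poly) \<Rightarrow> bool" where
  "good \<alpha> T p \<longleftrightarrow> (\<forall>m. p m \<noteq> 0) \<and> (\<forall>m. p m = p (m + 1) * gT \<alpha> T m) \<and>
     (\<exists>N. \<forall>j\<ge>N. (0, j) \<notin> T \<and> (\<alpha>, j) \<notin> T) \<and> (\<exists>N. \<forall>j<N. (0, j) \<in> T \<and> (\<alpha>, j) \<in> T)"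

lemma gT_compl: "gT \<alpha> T m * gT \<alpha> (- T) m = tr m (falpha \<alpha>)"
  by (auto simp: gT_def tr_falpha)

lemma good_apol: "good \<alpha> ({0, \<alpha>} \<times> {..<0}) (apol (falpha \<alpha>))"
  unfolding good_def
proof (intro conjI allI)
  fix m :: int
  show "apol (falpha \<alpha>) m \<noteq> 0" by (rule apol_nonzero[OF falpha_nonzero])
  show "apol (falpha \<alpha>) m = apol (falpha \<alpha>) (m + 1) * gT \<alpha> ({0, \<alpha>} \<times> {..<0}) m"
  proof (cases "m < 0")
    case True
    then show ?thesis using apol_pred[of "m + 1" "falpha \<alpha>"] by (simp add: gT_def tr_falpha mult.commute)
  qed (simp add: gT_def)
qed (auto intro: exI[of _ 0])

context
  fixes \<alpha> :: "'k::field_char_0"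
  assumes alpha: "\<alpha> \<notin> \<int>"
begin

lemma lin_root_iff:
  assumes "\<beta> \<in> {0, \<alpha>}" "\<beta>' \<in> {0, \<alpha>}"
  shows "poly (lin \<beta>' m) (rt \<beta> n) = 0 \<longleftrightarrow> \<beta>' = \<beta> \<and> m = n"
proof -
  have "\<alpha> \<noteq> 0" using alpha by auto
  moreover have "\<alpha> + of_int i \<noteq> of_int j" for i j
  proof
    assume "\<alpha> + of_int i = of_int j"
    then have "\<alpha> = of_int (j - i)" by (simp add: eq_diff_eq)
    then show False using alpha by simp
  qed
  moreover from this have "of_int j \<noteq> \<alpha> + of_int i" for i j by metis
  ultimately show ?thesis using assms by (auto simp: algebra_simps)
qed

lemma gT_root_iff: "\<beta> \<in> {0, \<alpha>} \<Longrightarrow> poly (gT \<alpha> T m) (rt \<beta> n) = 0 \<longleftrightarrow> m = n \<and> (\<beta>, n) \<in> T"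
  using lin_root_iff[of \<beta> 0 m n] lin_root_iff[of \<beta> \<alpha> m n] unfolding gT_def poly_mult by auto

lemma tr_falpha_root_iff: "\<beta> \<in> {0, \<alpha>} \<Longrightarrow> poly (tr m (falpha \<alpha>)) (rt \<beta> n) = 0 \<longleftrightarrow> m = n"
  using lin_root_iff[of \<beta> 0 m n] lin_root_iff[of \<beta> \<alpha> m n] unfolding tr_falpha poly_mult by auto

lemma good_ge: "good \<alpha> T p \<Longrightarrow> p m = p (m + int k) * (\<Prod>j\<in>{m..<m + int k}. gT \<alpha> T j)"
proof (induction k)
  case (Suc k)
  have "{m..<m + int (Suc k)} = insert (m + int k) {m..<m + int k}" by auto
  moreover have "p (m + int k) = p (m + int k + 1) * gT \<alpha> T (m + int k)" using Suc(2) unfolding good_def by blast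
  ultimately show ?case using Suc by (simp add: algebra_simps)
qed simp

lemma good_dvd:
  assumes g: "good \<alpha> T p"
  shows "p (l + j) dvd p l * tr l (apol (falpha \<alpha>) j)"
proof (cases "0 \<le> j")
  case True
  have "p (l + j) dvd p l" using good_ge[OF g, of l "nat j"] True by simp
  then show ?thesis using True by (simp add: pcompose_1)
next
  case False
  have "p (l - int k) dvd p l * tr l (apol (falpha \<alpha>) (- int k))" for k
  proof (induction k)
    case (Suc k)
    let ?m = "l - int k"
    have "p ?m * tr (?m - 1) (falpha \<alpha>) = p (?m - 1) * gT \<alpha> (- T) (?m - 1)"
    proof -
      have "p (?m - 1) = p (?m - 1 + 1) * gT \<alpha> T (?m - 1)" using g unfolding good_def by blast
      then show ?thesis unfolding gT_compl[symmetric, where T = T] by simp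
    qed
    then have "p (?m - 1) dvd p ?m * tr (?m - 1) (falpha \<alpha>)" by simp
    also have "\<dots> dvd p l * tr l (apol (falpha \<alpha>) (- int k)) * tr (?m - 1) (falpha \<alpha>)"
      by (rule mult_dvd_mono[OF Suc dvd_refl])
    also have "\<dots> = p l * tr l (apol (falpha \<alpha>) (- int (Suc k)))"
    proof -
      have "- int (Suc k) = - int k - 1" "l + (- int k - 1) = ?m - 1" by simp_all
      then show ?thesis using apol_pred[of "- int k" "falpha \<alpha>"]
        by (simp only: pcompose_mult tr_tr) (simp only: ac_simps)
    qed
    finally show ?case by (simp add: algebra_simps)
  qed (simp add: pcompose_1)
  from this[of "nat (- j)"] show ?thesis using False by simp
qed

lemma good_skew_mult:
  assumes g: "good \<alpha> T p" and q: "q \<in> Pl p" and a: "a \<in> Asub \<alpha>"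
  shows "skew_mult q a \<in> Pl p"
proof -
  have 1: "skew_mult (Poly_Mapping.single l r) (Poly_Mapping.single j s) \<in> Pl p"
    if r: "Poly_Mapping.single l r \<in> Pl p" and s: "Poly_Mapping.single j s \<in> Pl (apol (falpha \<alpha>))" for l r j s
  proof -
    obtain u v where uv: "r = to_fract (u * p l)" "s = to_fract (v * apol (falpha \<alpha>) j)"
      using r s unfolding Pl_single_iff by blast
    obtain d where d: "p l * tr l (apol (falpha \<alpha>) j) = p (l + j) * d" using good_dvd[OF g] by (auto simp: dvd_def)
    have "u * p l * tr l (v * apol (falpha \<alpha>) j) = u * tr l v * (p l * tr l (apol (falpha \<alpha>) j))"
      by (simp only: pcompose_mult ac_simps)
    also have "\<dots> = (u * tr l v * d) * p (l + j)" unfolding d by (simp only: ac_simps)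
    finally show ?thesis
      unfolding uv skew_mult_single zshift_to_fract to_fract_mult[symmetric] Pl_single_iff
      by (intro exI[of _ "u * tr l v * d"]) (rule arg_cong)
  qed
  have 2: "skew_mult (Poly_Mapping.single l (Poly_Mapping.lookup q l)) a \<in> Pl p" for l
  proof -
    have "skew_mult (Poly_Mapping.single l (Poly_Mapping.lookup q l)) (\<Sum>j\<in>J. Poly_Mapping.single j (Poly_Mapping.lookup a j)) \<in> Pl p"
      if "finite J" for J
      using that
    proof (induction J)
      case (insert j J)
      then show ?case
        using 1[OF Pl_part[OF q] Pl_part[OF a[unfolded gwa_sub_eq_Pl]], of l j] by (simp add: skew_mult_add_right Pl_add)
    qed (simp add: skew_mult_zero Pl_zero)
    from this[of "Poly_Mapping.keys a"] show ?thesis by (simp add: poly_mapping_sum_single)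
  qed
  have "skew_mult (\<Sum>l\<in>J. Poly_Mapping.single l (Poly_Mapping.lookup q l)) a \<in> Pl p" if "finite J" for J
    using that
  proof (induction J)
    case (insert l J)
    then show ?case using 2[of l] by (simp add: skew_mult_add_left Pl_add)
  qed (simp add: skew_mult_zero Pl_zero)
  from this[of "Poly_Mapping.keys q"] show ?thesis by (simp add: poly_mapping_sum_single)
qed

text \<open>
  Two rank one projectives can be compared by left multiplication by a rational function. Here the
  second one is \<open>x\<^sup>c A\<close>, and the comparison is exact at the roots of \<open>z + n + \<beta>\<close>, provided that both
  projectives have the same simple quotients there.
\<close>

lemma compare:
  assumes g: "good \<alpha> T p"
  obtains w t where "w \<noteq> 0" "\<And>m. w * to_fract (p m) = to_fract (t m * tr c (apol (falpha \<alpha>) (m - c)))"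
    "\<And>\<beta> n m. \<beta> \<in> {0, \<alpha>} \<Longrightarrow> (c = n \<and> (\<beta>, n) \<notin> T \<and> m \<le> n) \<or> (c = n + 1 \<and> (\<beta>, n) \<in> T \<and> n < m) \<Longrightarrow>
      poly (t m) (rt \<beta> n) \<noteq> 0"
proof -
  obtain N0 where N0: "\<And>j. j \<ge> N0 \<Longrightarrow> (0, j) \<notin> T \<and> (\<alpha>, j) \<notin> T" using g unfolding good_def by blast
  obtain M0 where M0: "\<And>j. j < M0 \<Longrightarrow> (0, j) \<in> T \<and> (\<alpha>, j) \<in> T" using g unfolding good_def by blast
  define N where "N = max N0 c"
  define M where "M = min M0 c"
  let ?g = "gT \<alpha> T" and ?g' = "gT \<alpha> (- T)"
  have gN: "?g j = 1" if "j \<ge> N" for j using N0[of j] that by (simp add: N_def gT_def)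
  have gM: "?g' j = 1" if "j < M" for j using M0[of j] that by (simp add: M_def gT_def)
  have cN: "M \<le> c" "c \<le> N" by (auto simp: N_def M_def)
  have p0: "p m \<noteq> 0" for m using g unfolding good_def by blast
  have pm: "p m = p N * (\<Prod>j\<in>{m..<N}. ?g j)" for m
  proof (cases "m \<le> N")
    case True
    then show ?thesis using good_ge[OF g, of m "nat (N - m)"] by simp
  next
    case False
    have "(\<Prod>j\<in>{N..<m}. ?g j) = 1" by (rule prod.neutral) (auto simp: gN)
    then show ?thesis using False good_ge[OF g, of N "nat (m - N)"] by simp
  qed
  define V where "V = (\<Prod>j\<in>{M..<c}. ?g' j)"
  define t where "t m = (\<Prod>j\<in>{max m c..<N}. ?g j) * (\<Prod>j\<in>{M..<min m c}. ?g' j)" for m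
  have trc: "tr c (apol (falpha \<alpha>) (m - c)) = (\<Prod>j\<in>{m..<c}. tr j (falpha \<alpha>))" for m
  proof -
    have "tr c (apol (falpha \<alpha>) (m - c)) = (\<Prod>k\<in>{m - c..<0}. tr (k + c) (falpha \<alpha>))"
      unfolding apol_def pcompose_prod tr_tr by (simp only: add.commute)
    also have "\<dots> = (\<Prod>j\<in>{m..<c}. tr j (falpha \<alpha>))"
      by (rule prod.reindex_bij_witness[of _ "\<lambda>j. j - c" "\<lambda>k. k + c"]) auto
    finally show ?thesis .
  qed
  have gF: "(\<Prod>j\<in>A. tr j (falpha \<alpha>)) = (\<Prod>j\<in>A. ?g j) * (\<Prod>j\<in>A. ?g' j)" for A
    by (simp add: gT_compl flip: prod.distrib)
  have key: "(\<Prod>j\<in>{m..<N}. ?g j) * V = t m * tr c (apol (falpha \<alpha>) (m - c))" for m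
  proof (cases "m \<le> c")
    case True
    have 1: "(\<Prod>j\<in>{m..<N}. ?g j) = (\<Prod>j\<in>{m..<c}. ?g j) * (\<Prod>j\<in>{c..<N}. ?g j)"
    proof -
      have "{m..<N} = {m..<c} \<union> {c..<N}" using True cN by auto
      then show ?thesis by (metis finite_atLeastLessThan_int ivl_disj_int_two(3) prod.union_disjoint)
    qed
    have 2: "V = (\<Prod>j\<in>{M..<m}. ?g' j) * (\<Prod>j\<in>{m..<c}. ?g' j)"
    proof (cases "M \<le> m")
      case True
      then have "{M..<c} = {M..<m} \<union> {m..<c}" using \<open>m \<le> c\<close> by auto
      then show ?thesis unfolding V_def by (metis finite_atLeastLessThan_int ivl_disj_int_two(3) prod.union_disjoint)
    next
      case False
      then have "{m..<c} = {m..<M} \<union> {M..<c}" using cN by auto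
      then have "(\<Prod>j\<in>{m..<c}. ?g' j) = (\<Prod>j\<in>{m..<M}. ?g' j) * V"
        unfolding V_def by (metis finite_atLeastLessThan_int ivl_disj_int_two(3) prod.union_disjoint)
      moreover have "(\<Prod>j\<in>{m..<M}. ?g' j) = 1" by (rule prod.neutral) (auto simp: gM)
      ultimately show ?thesis using False by simp
    qed
    show ?thesis unfolding trc gF t_def 1 2 using True by (simp add: max_absorb2 min_absorb1)
  next
    case False
    then show ?thesis unfolding trc t_def V_def by simp
  qed
  show ?thesis
  proof (rule that[of "to_fract V / to_fract (p N)" t])
    have "V \<noteq> 0" unfolding V_def by (auto simp: gT_def)
    then show "to_fract V / to_fract (p N) \<noteq> 0" using p0 by simp
    show "to_fract V / to_fract (p N) * to_fract (p m) = to_fract (t m * tr c (apol (falpha \<alpha>) (m - c)))" for m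
      unfolding key[symmetric] pm[of m] using p0[of N] by (simp add: field_simps to_fract_mult)
    show "poly (t m) (rt \<beta> n) \<noteq> 0" if \<beta>: "\<beta> \<in> {0, \<alpha>}"
      and mn: "(c = n \<and> (\<beta>, n) \<notin> T \<and> m \<le> n) \<or> (c = n + 1 \<and> (\<beta>, n) \<in> T \<and> n < m)" for \<beta> n m
    proof -
      have "poly (?g j) (rt \<beta> n) \<noteq> 0" if "j \<in> {max m c..<N}" for j
        using that mn unfolding gT_root_iff[OF \<beta>] by auto
      moreover have "poly (?g' j) (rt \<beta> n) \<noteq> 0" if "j \<in> {M..<min m c}" for j
        using that mn unfolding gT_root_iff[OF \<beta>] by auto
      ultimately show ?thesis unfolding t_def poly_mult poly_prod by simp
    qed
  qed
qed

end

lemma submod_simps [simp]: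
  "carrier (submod f P) = P" "\<zero>\<^bsub>submod f P\<^esub> = 0" "x \<oplus>\<^bsub>submod f P\<^esub> y = x + y"
  "ract (submod f P) q C = skew_mult q (gwa_val f C)"
  "gcomp (submod f P) n = P \<inter> range (Poly_Mapping.single n)"
  by (auto simp: submod_def)

text \<open>
  The common features of the simple modules \<open>X\<^sub>\<beta>\<langle>n\<rangle>\<close> (for \<open>c = n\<close>) and \<open>Y\<^sub>\<beta>\<langle>n\<rangle>\<close> (for \<open>c = n + 1\<close>): a
  quotient map \<open>\<pi>\<close> from \<open>A\<close> shifted by \<open>c\<close>, and its kernel.
\<close>

locale simple_quotient =
  fixes \<alpha> \<beta> :: "'k::field_char_0" and n c :: int
    and S :: "('k falg set, 's, int) gr_mod" and \<pi> :: "'k skewl \<Rightarrow> 's"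
  assumes alpha: "\<alpha> \<notin> \<int>" and beta: "\<beta> \<in> {0, \<alpha>}" and cut: "c = n \<or> c = n + 1"
    and S_carrier: "carrier S = \<pi> ` Asub \<alpha>"
    and S_add: "q \<in> Asub \<alpha> \<Longrightarrow> q' \<in> Asub \<alpha> \<Longrightarrow> \<pi> q \<oplus>\<^bsub>S\<^esub> \<pi> q' = \<pi> (q + q')"
    and S_ract: "q \<in> Asub \<alpha> \<Longrightarrow> C \<in> carrier (gwa (falpha \<alpha>)) \<Longrightarrow>
      ract S (\<pi> q) C = \<pi> (skew_mult q (gwa_val (falpha \<alpha>) C))"
    and S_gcomp: "gcomp S m = \<pi> ` (Asub \<alpha> \<inter> range (Poly_Mapping.single (m - c)))"
    and S_zero: "q \<in> Asub \<alpha> \<Longrightarrow> \<pi> q = \<zero>\<^bsub>S\<^esub> \<longleftrightarrow>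
      (\<forall>m. (m \<le> n \<longleftrightarrow> c = n) \<longrightarrow> (\<exists>u. Poly_Mapping.lookup q (m - c) =
         to_fract (u * lin \<beta> (n - c) * apol (falpha \<alpha>) (m - c))))"
begin

abbreviation "f \<equiv> falpha \<alpha>"

abbreviation alive :: "int \<Rightarrow> bool" where "alive m \<equiv> (m \<le> n \<longleftrightarrow> c = n)"

abbreviation sg :: "int \<Rightarrow> 'k poly fract \<Rightarrow> 'k skewl" where "sg \<equiv> Poly_Mapping.single"

lemma S_zero_single:
  assumes "sg (m - c) r \<in> Asub \<alpha>"
  shows "\<pi> (sg (m - c) r) = \<zero>\<^bsub>S\<^esub> \<longleftrightarrow>
    (alive m \<longrightarrow> (\<exists>u. r = to_fract (u * lin \<beta> (n - c) * apol f (m - c))))"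
proof -
  have "\<exists>u. Poly_Mapping.lookup (sg (m - c) r) (l - c) = to_fract (u * lin \<beta> (n - c) * apol f (l - c))"
    if "l \<noteq> m" for l
    using that by (intro exI[of _ 0]) (simp add: lookup_single)
  then show ?thesis unfolding S_zero[OF assms] by (metis lookup_single_eq)
qed

lemma Asub_single_iff: "sg m r \<in> Asub \<alpha> \<longleftrightarrow> (\<exists>u. r = to_fract (u * apol f m))"
  by (simp add: gwa_sub_eq_Pl Pl_single_iff)

lemma S_gcompE:
  assumes "s \<in> gcomp S m"
  obtains u where "s = \<pi> (sg (m - c) (to_fract (u * apol f (m - c))))"
  using assms unfolding S_gcomp by (auto simp: Asub_single_iff)

lemma Asub_zero: "0 \<in> Asub \<alpha>" by (rule gwa_sub_zero)

lemma pi_zero: "\<pi> 0 = \<zero>\<^bsub>S\<^esub>"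
  using S_zero[OF Asub_zero] by (auto intro: exI[of _ 0])

lemma ract_zero: "C \<in> carrier (gwa f) \<Longrightarrow> ract S \<zero>\<^bsub>S\<^esub> C = \<zero>\<^bsub>S\<^esub>"
  using S_ract[OF Asub_zero] by (simp add: pi_zero skew_mult_zero)

lemma zero_add_zero: "\<zero>\<^bsub>S\<^esub> \<oplus>\<^bsub>S\<^esub> \<zero>\<^bsub>S\<^esub> = \<zero>\<^bsub>S\<^esub>"
  using S_add[OF Asub_zero Asub_zero] by (simp add: pi_zero)

lemma dead_zero: "s \<in> gcomp S m \<Longrightarrow> \<not> alive m \<Longrightarrow> s = \<zero>\<^bsub>S\<^esub>"
  using S_gcompE[of s m] S_zero_single[OF single_in_gwa_sub] by metis

lemma el_gens:
  obtains cx cy where "cx \<in> carrier (gwa f)" "gwa_val f cx = sg 1 1"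
    "cy \<in> carrier (gwa f)" "gwa_val f cy = sg (- 1) (to_fract (tr (- 1) f))"
  using that[of "cls f fx" "cls f fy"] by (simp add: cls_in_carrier)

lemma el_poly:
  obtains C where "C \<in> carrier (gwa f)" "gwa_val f C = sg 0 (to_fract u)"
  using that[of "cls f (peval u fz)"] by (simp add: cls_in_carrier falg_val_peval_fz)

lemma root_mult: "poly u (rt \<beta> (n - c)) = 0 \<Longrightarrow> \<exists>v. u = v * lin \<beta> (n - c)"
  using lin_dvd_iff[of "n - c" \<beta> u] by (auto simp: dvd_def mult.commute)

lemma x_injective:
  assumes s: "s \<in> gcomp S m" and a: "alive m" "alive (m + 1)"
    and cx: "cx \<in> carrier (gwa f)" "gwa_val f cx = sg 1 1" and z: "ract S s cx = \<zero>\<^bsub>S\<^esub>"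
  shows "s = \<zero>\<^bsub>S\<^esub>"
proof -
  obtain u where u: "s = \<pi> (sg (m - c) (to_fract (u * apol f (m - c))))" by (rule S_gcompE[OF s])
  have sx: "ract S s cx = \<pi> (sg (m + 1 - c) (to_fract (u * apol f (m - c))))"
    unfolding u S_ract[OF single_in_gwa_sub cx(1)] cx(2) skew_mult_single by (simp add: algebra_simps)
  define G where "G = (if m - c < 0 then tr (m - c) f else 1)"
  have ap: "apol f (m - c) = G * apol f (m + 1 - c)"
    using apol_pred[of "m + 1 - c" f] by (auto simp: G_def algebra_simps)
  have "sg (m + 1 - c) (to_fract (u * apol f (m - c))) \<in> Asub \<alpha>"
    unfolding Asub_single_iff ap by (intro exI[of _ "u * G"]) (simp add: algebra_simps)
  from S_zero_single[OF this] z a(2)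
  obtain v where "to_fract (u * apol f (m - c)) = to_fract (v * lin \<beta> (n - c) * apol f (m + 1 - c))"
    unfolding sx by blast
  then have "u * apol f (m - c) = v * lin \<beta> (n - c) * apol f (m + 1 - c)" by (simp only: to_fract_eq_iff)
  then have "u * G = v * lin \<beta> (n - c)"
    using apol_nonzero[OF falpha_nonzero, of \<alpha> "m + 1 - c"] unfolding ap by simp
  then have "poly (u * G) (rt \<beta> (n - c)) = 0" by (simp add: algebra_simps)
  moreover have "poly G (rt \<beta> (n - c)) \<noteq> 0"
  proof -
    have "m \<noteq> n" using a cut by auto
    then show ?thesis using tr_falpha_root_iff[OF alpha beta, where m = "m - c" and n = "n - c"] by (auto simp: G_def)
  qed
  ultimately have "\<exists>v. u = v * lin \<beta> (n - c)" by (intro root_mult) simp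
  then show ?thesis unfolding u S_zero_single[OF single_in_gwa_sub] by auto
qed

lemma y_injective:
  assumes s: "s \<in> gcomp S m" and a: "alive m" "alive (m - 1)"
    and cy: "cy \<in> carrier (gwa f)" "gwa_val f cy = sg (- 1) (to_fract (tr (- 1) f))" and z: "ract S s cy = \<zero>\<^bsub>S\<^esub>"
  shows "s = \<zero>\<^bsub>S\<^esub>"
proof -
  obtain u where u: "s = \<pi> (sg (m - c) (to_fract (u * apol f (m - c))))" by (rule S_gcompE[OF s])
  have sy: "ract S s cy = \<pi> (sg (m - 1 - c) (to_fract (u * apol f (m - c) * tr (m - 1 - c) f)))"
  proof -
    have "ract S s cy = \<pi> (skew_mult (sg (m - c) (to_fract (u * apol f (m - c)))) (gwa_val f cy))"
      unfolding u by (rule S_ract[OF single_in_gwa_sub cy(1)])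
    moreover have "m - c + - 1 = m - 1 - c" by simp
    ultimately show ?thesis
      by (simp only: cy(2) skew_mult_single zshift_to_fract tr_tr to_fract_mult)
  qed
  define G where "G = (if m - c \<le> 0 then 1 else tr (m - 1 - c) f)"
  have ap: "apol f (m - c) * tr (m - 1 - c) f = G * apol f (m - 1 - c)"
    using apol_pred[of "m - c" f] by (auto simp: G_def algebra_simps)
  have ap': "u * apol f (m - c) * tr (m - 1 - c) f = u * G * apol f (m - 1 - c)"
    using ap by (simp add: mult.assoc)
  have "sg (m - 1 - c) (to_fract (u * apol f (m - c) * tr (m - 1 - c) f)) \<in> Asub \<alpha>"
    unfolding Asub_single_iff ap' by blast
  from S_zero_single[OF this] z a(2)
  obtain v where "to_fract (u * apol f (m - c) * tr (m - 1 - c) f) = to_fract (v * lin \<beta> (n - c) * apol f (m - 1 - c))"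
    unfolding sy by blast
  then have "u * apol f (m - c) * tr (m - 1 - c) f = v * lin \<beta> (n - c) * apol f (m - 1 - c)"
    by (simp only: to_fract_eq_iff)
  then have "u * G = v * lin \<beta> (n - c)"
    using apol_nonzero[OF falpha_nonzero, of \<alpha> "m - 1 - c"] unfolding ap' by simp
  then have "poly (u * G) (rt \<beta> (n - c)) = 0" by (simp add: algebra_simps)
  moreover have "poly G (rt \<beta> (n - c)) \<noteq> 0"
  proof -
    have "m - c \<le> 0 \<or> m - 1 \<noteq> n" using a cut by auto
    then show ?thesis using tr_falpha_root_iff[OF alpha beta, where m = "m - 1 - c" and n = "n - c"] by (auto simp: G_def)
  qed
  ultimately have "\<exists>v. u = v * lin \<beta> (n - c)" by (intro root_mult) simp
  then show ?thesis unfolding u S_zero_single[OF single_in_gwa_sub] by auto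
qed

lemma lin_kills:
  assumes s: "s \<in> gcomp S m" and C: "C \<in> carrier (gwa f)" "gwa_val f C = sg 0 (to_fract (tr (- m) (lin \<beta> n)))"
  shows "ract S s C = \<zero>\<^bsub>S\<^esub>"
proof -
  obtain u where u: "s = \<pi> (sg (m - c) (to_fract (u * apol f (m - c))))" by (rule S_gcompE[OF s])
  have t: "tr (m - c) (tr (- m) (lin \<beta> n)) = lin \<beta> (n - c)"
    unfolding tr_tr tr_lin by (simp add: algebra_simps)
  have e: "to_fract (u * apol f (m - c)) * to_fract (lin \<beta> (n - c)) = to_fract (u * lin \<beta> (n - c) * apol f (m - c))"
    by (simp add: ac_simps to_fract_mult del: mult_pCons_left mult_pCons_right)
  have e': "sg (m - c) (to_fract (u * lin \<beta> (n - c) * apol f (m - c))) \<in> Asub \<alpha>"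
    by (rule single_in_gwa_sub)
  show ?thesis
    unfolding u S_ract[OF single_in_gwa_sub C(1)] C(2) skew_mult_single zshift_to_fract t e add_0_right
      S_zero_single[OF e'] by blast
qed

subsection \<open>Morphisms from a projective\<close>

context
  fixes T p
  assumes g: "good \<alpha> T p"
begin

lemma p_next: "p m = p (m + 1) * gT \<alpha> T m" and p_nonzero: "p m \<noteq> 0"
  using g unfolding good_def by blast+

lemma p_prev: "p m * tr (m - 1) f = p (m - 1) * gT \<alpha> (- T) (m - 1)"
  unfolding gT_compl[symmetric, where T = T] using p_next[of "m - 1"] by simp

context
  fixes \<phi>
  assumes \<phi>: "\<phi> \<in> gr_hom (gwa f) (submod f (Pl p)) S"
begin

lemma phi_ract: "q \<in> Pl p \<Longrightarrow> C \<in> carrier (gwa f) \<Longrightarrow> \<phi> (skew_mult q (gwa_val f C)) = ract S (\<phi> q) C"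
  using gr_hom_ract[OF \<phi>, of q C] by simp

lemma phi_add: "q \<in> Pl p \<Longrightarrow> q' \<in> Pl p \<Longrightarrow> \<phi> (q + q') = \<phi> q \<oplus>\<^bsub>S\<^esub> \<phi> q'"
  using gr_hom_add[OF \<phi>, of q q'] by simp

lemma phi_deg: "sg m r \<in> Pl p \<Longrightarrow> \<phi> (sg m r) \<in> gcomp S m"
  using gr_hom_deg[OF \<phi>, of "sg m r" m] by simp

lemma Pl_singleI: "sg m (to_fract (u * p m)) \<in> Pl p"
  unfolding Pl_single_iff by blast

lemma phi_dead: "sg m r \<in> Pl p \<Longrightarrow> \<not> alive m \<Longrightarrow> \<phi> (sg m r) = \<zero>\<^bsub>S\<^esub>"
  using dead_zero[OF phi_deg] .

lemma phi_poly:
  assumes C: "C \<in> carrier (gwa f)" "gwa_val f C = sg 0 (to_fract v)"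
  shows "\<phi> (sg m (to_fract (u * tr m v * p m))) = ract S (\<phi> (sg m (to_fract (u * p m)))) C"
proof -
  have "sg m (to_fract (u * tr m v * p m)) = skew_mult (sg m (to_fract (u * p m))) (gwa_val f C)"
    by (simp add: C(2) skew_mult_single ac_simps flip: to_fract_mult)
  then show ?thesis using phi_ract[OF Pl_singleI C(1), of m u] by simp
qed

lemma phi_root:
  assumes "poly u (rt \<beta> n) = 0"
  shows "\<phi> (sg m (to_fract (u * p m))) = \<zero>\<^bsub>S\<^esub>"
proof -
  obtain v where v: "u = v * lin \<beta> n" using assms lin_dvd_iff[of n \<beta> u] by (auto simp: dvd_def mult.commute)
  obtain C where C: "C \<in> carrier (gwa f)" "gwa_val f C = sg 0 (to_fract (tr (- m) (lin \<beta> n)))"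
    by (rule el_poly)
  have "tr m (tr (- m) (lin \<beta> n)) = lin \<beta> n" unfolding tr_tr by simp
  then show ?thesis
    using phi_poly[OF C, of m v] lin_kills[OF phi_deg[OF Pl_singleI] C, of v] unfolding v by simp
qed

definition vanishes :: "int \<Rightarrow> bool" where
  "vanishes m \<longleftrightarrow> (\<forall>u. \<phi> (sg m (to_fract (u * p m))) = \<zero>\<^bsub>S\<^esub>)"

text \<open>Modulo \<open>z + n + \<beta>\<close> a component of the projective has dimension one.\<close>

lemma vanishesI:
  assumes z: "\<phi> (sg m (to_fract (u * p m))) = \<zero>\<^bsub>S\<^esub>" and u: "poly u (rt \<beta> n) \<noteq> 0"
  shows "vanishes m"
  unfolding vanishes_def
proof
  fix v
  define k where "k = poly v (rt \<beta> n) / poly u (rt \<beta> n)"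
  define d where "d = v - u * [:k:]"
  have d: "poly d (rt \<beta> n) = 0" using u by (simp add: d_def k_def)
  obtain C where C: "C \<in> carrier (gwa f)" "gwa_val f C = sg 0 (to_fract [:k:])" by (rule el_poly)
  have 1: "\<phi> (sg m (to_fract (u * [:k:] * p m))) = \<zero>\<^bsub>S\<^esub>"
    using phi_poly[OF C, of m u] z ract_zero[OF C(1)] by simp
  have "sg m (to_fract (v * p m)) = sg m (to_fract (u * [:k:] * p m)) + sg m (to_fract (d * p m))"
    unfolding single_add[symmetric] to_fract_add[symmetric] distrib_right[symmetric] by (simp add: d_def)
  then have "\<phi> (sg m (to_fract (v * p m))) = \<zero>\<^bsub>S\<^esub> \<oplus>\<^bsub>S\<^esub> \<zero>\<^bsub>S\<^esub>"
    using phi_add[OF Pl_singleI Pl_singleI, of m "u * [:k:]" m d] phi_root[OF d, of m] 1 by simp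
  then show "\<phi> (sg m (to_fract (v * p m))) = \<zero>\<^bsub>S\<^esub>"
    by (simp add: zero_add_zero)
qed

lemma phi_x:
  assumes cx: "cx \<in> carrier (gwa f)" "gwa_val f cx = sg 1 1"
  shows "ract S (\<phi> (sg m (to_fract (u * p m)))) cx = \<phi> (sg (m + 1) (to_fract (u * gT \<alpha> T m * p (m + 1))))"
proof -
  have "skew_mult (sg m (to_fract (u * p m))) (gwa_val f cx) = sg (m + 1) (to_fract (u * gT \<alpha> T m * p (m + 1)))"
    unfolding cx(2) skew_mult_single p_next[of m] by (simp add: ac_simps flip: to_fract_mult)
  then show ?thesis using phi_ract[OF Pl_singleI cx(1), of m u] by simp
qed

lemma phi_y:
  assumes cy: "cy \<in> carrier (gwa f)" "gwa_val f cy = sg (- 1) (to_fract (tr (- 1) f))"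
  shows "ract S (\<phi> (sg m (to_fract (u * p m)))) cy =
    \<phi> (sg (m - 1) (to_fract (u * gT \<alpha> (- T) (m - 1) * p (m - 1))))"
proof -
  have "u * p m * tr (m - 1) f = u * gT \<alpha> (- T) (m - 1) * p (m - 1)"
    using p_prev[of m] by (simp add: ac_simps)
  moreover have "m + - 1 = m - 1" by simp
  ultimately have "skew_mult (sg m (to_fract (u * p m))) (gwa_val f cy) =
      sg (m - 1) (to_fract (u * gT \<alpha> (- T) (m - 1) * p (m - 1)))"
    by (simp only: cy(2) skew_mult_single zshift_to_fract tr_tr to_fract_mult[symmetric])
  then show ?thesis using phi_ract[OF Pl_singleI cy(1), of m u] by simp
qed

lemma vanishes_down:
  assumes "vanishes (m + 1)" "alive m" "alive (m + 1)"
  shows "vanishes m"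
proof -
  obtain cx cy where cx: "cx \<in> carrier (gwa f)" "gwa_val f cx = sg 1 1" by (rule el_gens)
  show ?thesis
    unfolding vanishes_def
    using x_injective[OF phi_deg[OF Pl_singleI] assms(2,3) cx] phi_x[OF cx] assms(1) unfolding vanishes_def by metis
qed

lemma vanishes_up:
  assumes "vanishes (m - 1)" "alive m" "alive (m - 1)"
  shows "vanishes m"
proof -
  obtain cx cy where cy: "cy \<in> carrier (gwa f)" "gwa_val f cy = sg (- 1) (to_fract (tr (- 1) f))" by (rule el_gens)
  show ?thesis
    unfolding vanishes_def
    using y_injective[OF phi_deg[OF Pl_singleI] assms(2,3) cy] phi_y[OF cy] assms(1) unfolding vanishes_def by metis
qed

text \<open>
  Between degrees in which the simple module lives, \<open>x\<close> and \<open>y\<close> act injectively on it.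
\<close>

lemma vanishes_all:
  assumes v: "vanishes m" and a: "alive m"
  shows "vanishes l"
proof (cases "alive l")
  case al: True
  have up: "vanishes (m + int k)" if "\<And>i. i \<le> int k \<Longrightarrow> 0 \<le> i \<Longrightarrow> alive (m + i)" for k
    using that
  proof (induction k)
    case (Suc k)
    have "vanishes (m + int k)" using Suc by auto
    moreover have "alive (m + int k)" "alive (m + int (Suc k))"
      using Suc(2)[of "int k"] Suc(2)[of "int (Suc k)"] by auto
    ultimately show ?case using vanishes_up[of "m + int (Suc k)"] by (simp add: algebra_simps)
  qed (use v in simp)
  have down: "vanishes (m - int k)" if "\<And>i. i \<le> int k \<Longrightarrow> 0 \<le> i \<Longrightarrow> alive (m - i)" for k
    using that
  proof (induction k)
    case (Suc k)
    have "vanishes (m - int k)" using Suc by auto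
    moreover have "alive (m - int k)" "alive (m - int (Suc k))"
      using Suc(2)[of "int k"] Suc(2)[of "int (Suc k)"] by auto
    ultimately show ?case using vanishes_down[of "m - int (Suc k)"] by (simp add: algebra_simps)
  qed (use v in simp)
  show ?thesis
  proof (cases "m \<le> l")
    case True
    have "vanishes (m + int (nat (l - m)))" using a al True by (intro up) auto
    then show ?thesis using True by simp
  next
    case False
    have "vanishes (m - int (nat (m - l)))" using a al False by (intro down) auto
    then show ?thesis using False by simp
  qed
next
  case False
  then show ?thesis unfolding vanishes_def using phi_dead[OF Pl_singleI] by blast
qed

lemma phi_sum_zero:
  assumes "finite I" "\<And>i. i \<in> I \<Longrightarrow> h i \<in> Pl p" "\<And>i. i \<in> I \<Longrightarrow> \<phi> (h i) = \<zero>\<^bsub>S\<^esub>"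
  shows "\<phi> (sum h I) = \<zero>\<^bsub>S\<^esub>"
  using assms
proof (induction I)
  case empty
  have "\<phi> (sg 0 (to_fract (0 * p 0))) = \<zero>\<^bsub>S\<^esub>" by (rule phi_root) simp
  then show ?case by simp
next
  case (insert i I)
  then show ?case
    using phi_add[of "h i" "sum h I"] Pl_sum[of I h p] by (simp add: zero_add_zero)
qed

lemma phi_zero_by_parts:
  assumes q: "q \<in> Pl p" and "\<And>m. \<phi> (sg m (Poly_Mapping.lookup q m)) = \<zero>\<^bsub>S\<^esub>"
  shows "\<phi> q = \<zero>\<^bsub>S\<^esub>"
  using phi_sum_zero[of "Poly_Mapping.keys q" "\<lambda>m. sg m (Poly_Mapping.lookup q m)"] Pl_part[OF q] assms(2)
  by (simp add: poly_mapping_sum_single)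

lemma phi_eq_zeroI:
  assumes v: "\<And>l. vanishes l" and q: "q \<in> Pl p"
  shows "\<phi> q = \<zero>\<^bsub>S\<^esub>"
proof (rule phi_zero_by_parts[OF q])
  fix m
  obtain u where "Poly_Mapping.lookup q m = to_fract (u * p m)" using q by (auto simp: Pl_def)
  then show "\<phi> (sg m (Poly_Mapping.lookup q m)) = \<zero>\<^bsub>S\<^esub>" using v[of m] by (simp add: vanishes_def)
qed

lemma phi_parts_zero:
  assumes q: "q \<in> Pl p" and z: "\<phi> q = \<zero>\<^bsub>S\<^esub>"
  shows "\<phi> (sg m (Poly_Mapping.lookup q m)) = \<zero>\<^bsub>S\<^esub>"
proof -
  have "\<exists>u. \<phi> (sg l (Poly_Mapping.lookup q l)) = \<pi> (sg (l - c) (to_fract (u * apol f (l - c))))" for l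
    using S_gcompE[OF phi_deg[OF Pl_part[OF q]]] by metis
  then obtain u where u: "\<And>l. \<phi> (sg l (Poly_Mapping.lookup q l)) = \<pi> (sg (l - c) (to_fract (u l * apol f (l - c))))"
    by metis
  let ?s = "\<lambda>l. sg (l - c) (to_fract (u l * apol f (l - c)))"
  have sA: "sum ?s I \<in> Asub \<alpha>" for I
    unfolding gwa_sub_eq_Pl by (rule Pl_sum) (simp only: single_in_gwa_sub flip: gwa_sub_eq_Pl)
  have sum: "\<phi> (\<Sum>l\<in>I. sg l (Poly_Mapping.lookup q l)) = \<pi> (sum ?s I)" if "finite I" for I
    using that
  proof (induction I)
    case empty
    have "\<phi> (sg 0 (to_fract (0 * p 0))) = \<zero>\<^bsub>S\<^esub>" by (rule phi_root) simp
    then show ?case by (simp add: pi_zero)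
  next
    case (insert l I)
    have "(\<Sum>l\<in>I. sg l (Poly_Mapping.lookup q l)) \<in> Pl p" by (rule Pl_sum) (rule Pl_part[OF q])
    then show ?case
      using insert phi_add[OF Pl_part[OF q], of "\<Sum>l\<in>I. sg l (Poly_Mapping.lookup q l)" l]
        S_add[OF single_in_gwa_sub sA, of "l - c" "u l" I] by (simp add: u)
  qed
  let ?I = "insert m (Poly_Mapping.keys q)"
  have "(\<Sum>l\<in>?I. sg l (Poly_Mapping.lookup q l)) = (\<Sum>l\<in>Poly_Mapping.keys q. sg l (Poly_Mapping.lookup q l))"
    by (rule sum.mono_neutral_right) (auto simp: in_keys_iff)
  then have s0: "\<pi> (sum ?s ?I) = \<zero>\<^bsub>S\<^esub>"
    using z sum[of ?I] by (simp add: poly_mapping_sum_single)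
  have L: "Poly_Mapping.lookup (sum ?s ?I) (m - c) = to_fract (u m * apol f (m - c))"
    by (simp add: lookup_sum lookup_single when_def)
  have "alive m \<longrightarrow> (\<exists>v. to_fract (u m * apol f (m - c)) = to_fract (v * lin \<beta> (n - c) * apol f (m - c)))"
    using spec[OF iffD1[OF S_zero[OF sA] s0], of m] unfolding L .
  then show ?thesis unfolding u S_zero_single[OF single_in_gwa_sub] .
qed

text \<open>
  Across the cut, \<open>x\<close> or \<open>y\<close> leads from a degree in which the simple module is zero to one in which it
  is not, and the generator of the former component goes to a multiple of the generator of the latter
  by a factor that does not vanish at the root. So the morphism vanishes on that generator, hence everywhere.
\<close>

lemma phi_mismatch:
  assumes mm: "(c = n) = ((\<beta>, n) \<in> T)" and q: "q \<in> Pl p"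
  shows "\<phi> q = \<zero>\<^bsub>S\<^esub>"
proof -
  obtain cx cy where XY: "cx \<in> carrier (gwa f)" "gwa_val f cx = sg 1 1"
    "cy \<in> carrier (gwa f)" "gwa_val f cy = sg (- 1) (to_fract (tr (- 1) f))" by (rule el_gens)
  have "\<exists>m. alive m \<and> vanishes m"
  proof (cases "c = n")
    case True
    have "\<phi> (sg (n + 1) (to_fract (1 * p (n + 1)))) = \<zero>\<^bsub>S\<^esub>" using True by (intro phi_dead Pl_singleI) auto
    then have "\<phi> (sg n (to_fract (1 * gT \<alpha> (- T) n * p n))) = \<zero>\<^bsub>S\<^esub>"
      using phi_y[OF XY(3,4), of "n + 1" 1] ract_zero[OF XY(3)] by simp
    moreover have "poly (1 * gT \<alpha> (- T) n) (rt \<beta> n) \<noteq> 0"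
      using True mm gT_root_iff[OF alpha beta, where T = "- T" and m = n and n = n] by simp
    ultimately show ?thesis using True by (intro exI[of _ n] conjI vanishesI) auto
  next
    case False
    have "\<phi> (sg n (to_fract (1 * p n))) = \<zero>\<^bsub>S\<^esub>" using False by (intro phi_dead Pl_singleI) auto
    then have "\<phi> (sg (n + 1) (to_fract (1 * gT \<alpha> T n * p (n + 1)))) = \<zero>\<^bsub>S\<^esub>"
      using phi_x[OF XY(1,2), of n 1] ract_zero[OF XY(1)] by simp
    moreover have "poly (1 * gT \<alpha> T n) (rt \<beta> n) \<noteq> 0"
      using False mm gT_root_iff[OF alpha beta, where T = T and m = n and n = n] by simp
    ultimately show ?thesis using False by (intro exI[of _ "n + 1"] conjI vanishesI) auto
  qed
  then have "vanishes l" for l using vanishes_all by blast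
  then show ?thesis by (rule phi_eq_zeroI[OF _ q])
qed

text \<open>
  A nonzero morphism vanishes in no degree in which the simple module lives, so there its kernel
  consists of the multiples of \<open>z + n + \<beta>\<close>.
\<close>

lemma phi_kernel:
  assumes nz: "\<exists>q\<in>Pl p. \<phi> q \<noteq> \<zero>\<^bsub>S\<^esub>"
  shows "{q \<in> Pl p. \<phi> q = \<zero>\<^bsub>S\<^esub>} = Pl (\<lambda>m. if alive m then p m * lin \<beta> n else p m)" (is "_ = Pl ?p'")
proof (intro equalityI subsetI)
  fix q assume "q \<in> {q \<in> Pl p. \<phi> q = \<zero>\<^bsub>S\<^esub>}"
  then have q: "q \<in> Pl p" and z: "\<phi> q = \<zero>\<^bsub>S\<^esub>" by auto
  have "\<exists>v. Poly_Mapping.lookup q m = to_fract (v * ?p' m)" for m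
  proof -
    obtain u where u: "Poly_Mapping.lookup q m = to_fract (u * p m)" using q by (auto simp: Pl_def)
    show ?thesis
    proof (cases "alive m")
      case True
      have "poly u (rt \<beta> n) = 0"
      proof (rule ccontr)
        assume "poly u (rt \<beta> n) \<noteq> 0"
        then have "vanishes m" using phi_parts_zero[OF q z, of m] by (intro vanishesI) (simp add: u)
        then have "vanishes l" for l using vanishes_all True by blast
        then show False using nz phi_eq_zeroI by blast
      qed
      then obtain v where "u = v * lin \<beta> n" using lin_dvd_iff[of n \<beta> u] by (auto simp: dvd_def mult.commute)
      then have "u * p m = v * ?p' m" using True by (simp add: ac_simps del: mult_pCons_left mult_pCons_right)
      then show ?thesis using u by metis
    qed (use u in auto)
  qed
  then show "q \<in> Pl ?p'" by (simp add: Pl_def)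
next
  fix q assume q': "q \<in> Pl ?p'"
  have q: "q \<in> Pl p"
    unfolding Pl_def
  proof (intro CollectI allI)
    fix m
    obtain v where "Poly_Mapping.lookup q m = to_fract (v * ?p' m)" using q' by (auto simp: Pl_def)
    then show "\<exists>u. Poly_Mapping.lookup q m = to_fract (u * p m)"
      by (intro exI[of _ "v * (if alive m then lin \<beta> n else 1)"])
        (simp add: ac_simps del: mult_pCons_left mult_pCons_right)
  qed
  have "\<phi> (sg m (Poly_Mapping.lookup q m)) = \<zero>\<^bsub>S\<^esub>" for m
  proof (cases "alive m")
    case True
    have "\<exists>v. Poly_Mapping.lookup q m = to_fract (v * ?p' m)" using q' by (simp add: Pl_def)
    then obtain v where "Poly_Mapping.lookup q m = to_fract (v * (p m * lin \<beta> n))" unfolding if_P[OF True] by blast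
    then have "Poly_Mapping.lookup q m = to_fract ((v * lin \<beta> n) * p m)"
      by (simp only: ac_simps)
    then show ?thesis using phi_root[of "v * lin \<beta> n" m] by (simp add: poly_lin del: mult_pCons_left mult_pCons_right)
  next
    case False
    then show ?thesis using phi_dead Pl_part[OF q] by blast
  qed
  then show "q \<in> {q \<in> Pl p. \<phi> q = \<zero>\<^bsub>S\<^esub>}" using phi_zero_by_parts[OF q] q by blast
qed

end

text \<open>
  Compare the projective with the shifted algebra by left multiplication by a rational function, then apply the quotient map.
\<close>

lemma ex_nonzero_morphism:
  assumes mt: "(c = n) \<noteq> ((\<beta>, n) \<in> T)"
  shows "\<exists>\<phi>\<in>gr_hom (gwa f) (submod f (Pl p)) S. \<exists>q\<in>Pl p. \<phi> q \<noteq> \<zero>\<^bsub>S\<^esub>"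
proof -
  obtain w t where w: "w \<noteq> 0" "\<And>m. w * to_fract (p m) = to_fract (t m * tr c (apol f (m - c)))"
    "\<And>\<beta> n m. \<beta> \<in> {0, \<alpha>} \<Longrightarrow> (c = n \<and> (\<beta>, n) \<notin> T \<and> m \<le> n) \<or> (c = n + 1 \<and> (\<beta>, n) \<in> T \<and> n < m) \<Longrightarrow>
      poly (t m) (rt \<beta> n) \<noteq> 0"
    using compare[OF alpha g, of c] by blast
  define a where "a = sg (- c) (zshift (- c) w)"
  have a: "Poly_Mapping.lookup (skew_mult a q) (m - c) = zshift (- c) (w * Poly_Mapping.lookup q m)" for q m
    unfolding a_def lookup_single_skew_mult by (simp add: zshift_mult)
  have a': "Poly_Mapping.lookup (skew_mult a q) (m - c) = to_fract (tr (- c) (u * t m) * apol f (m - c))"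
    if "Poly_Mapping.lookup q m = to_fract (u * p m)" for q m u
  proof -
    have "w * Poly_Mapping.lookup q m = to_fract u * (w * to_fract (p m))"
      unfolding that by (simp add: to_fract_mult)
    also have "\<dots> = to_fract (u * t m * tr c (apol f (m - c)))" unfolding w(2) by (simp add: to_fract_mult)
    finally show ?thesis
      unfolding a by (simp only: zshift_to_fract pcompose_mult tr_tr) simp
  qed
  have aA: "skew_mult a q \<in> Asub \<alpha>" if "q \<in> Pl p" for q
    unfolding gwa_sub_iff
  proof
    fix j
    obtain u where "Poly_Mapping.lookup q (j + c) = to_fract (u * p (j + c))" using \<open>q \<in> Pl p\<close> by (auto simp: Pl_def)
    from a'[OF this] show "\<exists>v. Poly_Mapping.lookup (skew_mult a q) j = to_fract (v * apol f j)" by auto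
  qed
  define \<phi> where "\<phi> = (\<lambda>q\<in>Pl p. \<pi> (skew_mult a q))"
  have Pl_ract: "skew_mult q (gwa_val f C) \<in> Pl p" if q: "q \<in> Pl p" and C: "C \<in> carrier (gwa f)" for q C
    using good_skew_mult[OF alpha g q] C by (simp add: gwa_sub_def)
  have "\<phi> \<in> gr_hom (gwa f) (submod f (Pl p)) S"
  proof (rule gr_homI)
    show "\<phi> q \<in> carrier S" if "q \<in> carrier (submod f (Pl p))" for q
      using that aA by (simp add: \<phi>_def S_carrier)
    show "\<phi> (q \<oplus>\<^bsub>submod f (Pl p)\<^esub> q') = \<phi> q \<oplus>\<^bsub>S\<^esub> \<phi> q'"
      if "q \<in> carrier (submod f (Pl p))" "q' \<in> carrier (submod f (Pl p))" for q q'
      using that aA by (simp add: \<phi>_def Pl_add skew_mult_add_right S_add)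
    show "\<phi> (ract (submod f (Pl p)) q C) = ract S (\<phi> q) C"
      if "q \<in> carrier (submod f (Pl p))" "C \<in> carrier (gwa f)" for q C
      using that aA Pl_ract by (simp add: \<phi>_def S_ract skew_mult_assoc)
    show "\<phi> q \<in> gcomp S m" if qm: "q \<in> gcomp (submod f (Pl p)) m" for m q
    proof -
      obtain r where r: "q = sg m r" "q \<in> Pl p" using qm by auto
      have "skew_mult a q \<in> range (sg (m - c))" unfolding r(1) a_def skew_mult_single by (auto simp: algebra_simps)
      then show ?thesis unfolding S_gcomp \<phi>_def using aA[OF r(2)] r(2) by auto
    qed
  qed (simp add: \<phi>_def)
  moreover have "\<exists>q\<in>Pl p. \<phi> q \<noteq> \<zero>\<^bsub>S\<^esub>"
  proof -
    obtain m where m: "alive m" using cut by (cases "c = n") (auto intro: that[of n] that[of "n + 1"])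
    have P: "sg m (to_fract (p m)) \<in> Pl p" using Pl_single_iff[of m _ p] by (metis mult_1)
    have l: "Poly_Mapping.lookup (skew_mult a (sg m (to_fract (p m)))) (m - c) = to_fract (tr (- c) (1 * t m) * apol f (m - c))"
      by (rule a') simp
    have "poly (t m) (rt \<beta> n) \<noteq> 0" using mt m cut by (intro w(3)[OF beta]) auto
    then have nz: "poly (tr (- c) (t m)) (rt \<beta> (n - c)) \<noteq> 0" unfolding poly_tr by simp
    have "\<pi> (skew_mult a (sg m (to_fract (p m)))) \<noteq> \<zero>\<^bsub>S\<^esub>"
    proof
      assume "\<pi> (skew_mult a (sg m (to_fract (p m)))) = \<zero>\<^bsub>S\<^esub>"
      then obtain v where "to_fract (tr (- c) (1 * t m) * apol f (m - c)) = to_fract (v * lin \<beta> (n - c) * apol f (m - c))"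
        using S_zero[OF aA[OF P]] m l by metis
      then have "tr (- c) (t m) = v * lin \<beta> (n - c)"
        using apol_nonzero[OF falpha_nonzero, of \<alpha> "m - c"] by (simp only: to_fract_eq_iff mult_1 mult_cancel_right) auto
      then show False using nz by (simp add: poly_lin del: mult_pCons_left mult_pCons_right)
    qed
    then show ?thesis using P by (intro bexI[of _ "sg m (to_fract (p m))"]) (auto simp: \<phi>_def)
  qed
  ultimately show ?thesis by blast
qed

end

end


subsection \<open>The simple modules\<close>

lemma a_rcosets_alt: "a_rcosets\<^bsub>R\<^esub> K = {K +>\<^bsub>R\<^esub> x | x. x \<in> carrier R}"
  by (auto simp: A_RCOSETS_defs a_r_coset_def r_coset_def)

locale two_generator_right_ideal = ring R for R :: "('a, 'g, 'k) gr_alg" (structure) +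
  fixes a b assumes ab: "a \<in> carrier R" "b \<in> carrier R"
begin

abbreviation "K \<equiv> right_ideal2 R a b"

lemma K_sub: "K \<subseteq> carrier R"
  using ab by (auto simp: right_ideal2_def)

lemma K_mult: "k \<in> K \<Longrightarrow> r \<in> carrier R \<Longrightarrow> k \<otimes> r \<in> K"
  unfolding right_ideal2_def using ab by (auto simp: l_distr m_assoc) blast

lemma K_subgroup: "additive_subgroup K R"
proof (rule additive_subgroupI')
  show "\<zero> \<in> K"
    unfolding right_ideal2_def using ab by (auto intro!: exI[of _ \<zero>])
  fix k assume k: "k \<in> K"
  have "k \<otimes> \<ominus> \<one> \<in> K" using k by (intro K_mult) auto
  moreover have "k \<otimes> \<ominus> \<one> \<oplus> k = \<zero>" using k K_sub by (auto simp: r_minus l_neg)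
  ultimately show "\<exists>l\<in>K. l \<oplus> k = \<zero>" by blast
  fix l assume l: "l \<in> K"
  obtain r s r' s' where e: "k = a \<otimes> r \<oplus> b \<otimes> s" "r \<in> carrier R" "s \<in> carrier R"
    "l = a \<otimes> r' \<oplus> b \<otimes> s'" "r' \<in> carrier R" "s' \<in> carrier R"
    using k l unfolding right_ideal2_def by auto
  have "k \<oplus> l = a \<otimes> (r \<oplus> r') \<oplus> b \<otimes> (s \<oplus> s')"
    using e ab by (simp add: r_distr add.m_ac)
  then show "k \<oplus> l \<in> K" unfolding right_ideal2_def using e by blast
qed (rule K_sub)

sublocale K: abelian_subgroup K R
  by (rule abelian_subgroupI3[OF K_subgroup abelian_group_axioms])

lemma coset_eq_K_iff:
  assumes "x \<in> carrier R"
  shows "K +> x = K \<longleftrightarrow> x \<in> K"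
  using K.a_rcos_self[OF assms] K.a_rcos_const by auto

lemma coset_ract:
  assumes x: "x \<in> carrier R" and r: "r \<in> carrier R"
  shows "(\<Union>c\<in>K +> x. K +> (c \<otimes> r)) = K +> (x \<otimes> r)"
proof -
  have "K +> (c \<otimes> r) = K +> (x \<otimes> r)" if c: "c \<in> K +> x" for c
  proof -
    obtain k where k: "k \<in> K" "c = k \<oplus> x" using c by (auto simp: a_r_coset_def r_coset_def)
    have kc: "k \<in> carrier R" using k K_sub by auto
    have "c \<otimes> r \<in> K +> (x \<otimes> r)"
      unfolding k(2) l_distr[OF kc x r] using K_mult[OF k(1) r] by (auto simp: a_r_coset_def r_coset_def)
    then show ?thesis using K.a_repr_independence'[of "c \<otimes> r" "x \<otimes> r"] x r by simp
  qed
  moreover have "K +> x \<noteq> {}" using K.a_rcos_self[OF x] by blast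
  ultimately show ?thesis by (intro SUP_eq_const) auto
qed

end

text \<open>
  The cosets of the right ideal are the fibres of the quotient map, so all that is specific to the two
  families of simple modules is the membership criterion for the ideal.
\<close>

lemma simple_quotient_cyclic2:
  fixes \<alpha> \<beta> :: "'k::field_char_0"
  defines "A \<equiv> gwa (falpha \<alpha>)" and "val \<equiv> gwa_val (falpha \<alpha>)"
  assumes alpha: "\<alpha> \<notin> \<int>" and beta: "\<beta> \<in> {0, \<alpha>}" and cut: "c = n \<or> c = n + 1"
    and ab: "a \<in> carrier A" "b \<in> carrier A"
    and ker: "\<And>q. q \<in> Asub \<alpha> \<Longrightarrow>
      (\<exists>r\<in>Asub \<alpha>. \<exists>s\<in>Asub \<alpha>. q = skew_mult (val a) r + skew_mult (val b) s) \<longleftrightarrow>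
      (\<forall>m. (m \<le> n \<longleftrightarrow> c = n) \<longrightarrow> (\<exists>u. Poly_Mapping.lookup q (m - c) =
         to_fract (u * lin \<beta> (n - c) * apol (falpha \<alpha>) (m - c))))"
    and gc: "\<And>m. gcomp S m = gcomp (cyclic2 A a b) (m - c)"
    and S: "carrier S = carrier (cyclic2 A a b)" "\<zero>\<^bsub>S\<^esub> = \<zero>\<^bsub>cyclic2 A a b\<^esub>" "add S = add (cyclic2 A a b)"
      "ract S = ract (cyclic2 A a b)"
  shows "\<exists>\<pi>. simple_quotient \<alpha> \<beta> n c S \<pi>"
proof -
  note f0 = falpha_nonzero[of \<alpha>]
  interpret A: graded_ring A unfolding A_def by (rule graded_ring_gwa[OF f0])
  interpret K: two_generator_right_ideal A a b by unfold_locales (use ab in auto)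
  let ?K = "right_ideal2 A a b"
  define el where "el q = inv_into (carrier A) val q" for q
  have im: "val ` carrier A = Asub \<alpha>" by (simp add: gwa_sub_def val_def A_def)
  have el: "el q \<in> carrier A" "val (el q) = q" if "q \<in> Asub \<alpha>" for q
    using that unfolding im[symmetric] el_def by (auto simp: inv_into_into f_inv_into_f)
  have inj: "x = y" if "x \<in> carrier A" "y \<in> carrier A" "val x = val y" for x y
    using gwa_val_inj[OF f0] that unfolding A_def val_def by (auto dest: inj_onD)
  have valA: "val x \<in> Asub \<alpha>" if "x \<in> carrier A" for x using that im by auto
  have val_add: "val (x \<oplus>\<^bsub>A\<^esub> y) = val x + val y" and val_mult: "val (x \<otimes>\<^bsub>A\<^esub> y) = skew_mult (val x) (val y)"
    if "x \<in> carrier A" "y \<in> carrier A" for x y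
    using that unfolding A_def val_def by (auto simp: gwa_val_add gwa_val_mult)
  have elv: "el (val x) = x" if "x \<in> carrier A" for x using that el[OF valA[OF that]] by (intro inj) auto
  have Asub_add: "q + q' \<in> Asub \<alpha>" if "q \<in> Asub \<alpha>" "q' \<in> Asub \<alpha>" for q q'
    using that unfolding gwa_sub_eq_Pl by (rule Pl_add)
  have el_add: "el (q + q') = el q \<oplus>\<^bsub>A\<^esub> el q'" if "q \<in> Asub \<alpha>" "q' \<in> Asub \<alpha>" for q q'
    using el[OF that(1)] el[OF that(2)] el[OF Asub_add[OF that]] by (intro inj) (auto simp: val_add)
  have el_mult: "el (skew_mult q (val C)) = el q \<otimes>\<^bsub>A\<^esub> C" if "q \<in> Asub \<alpha>" "C \<in> carrier A" for q C
  proof -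
    have "skew_mult q (val C) = val (el q \<otimes>\<^bsub>A\<^esub> C)" using el[OF that(1)] that(2) by (simp add: val_mult)
    then show ?thesis using elv el(1)[OF that(1)] that(2) by simp
  qed
  have memK: "el q \<in> ?K \<longleftrightarrow> (\<exists>r\<in>Asub \<alpha>. \<exists>s\<in>Asub \<alpha>. q = skew_mult (val a) r + skew_mult (val b) s)"
    if q: "q \<in> Asub \<alpha>" for q
  proof
    assume "el q \<in> ?K"
    then obtain r s where rs: "r \<in> carrier A" "s \<in> carrier A" "el q = a \<otimes>\<^bsub>A\<^esub> r \<oplus>\<^bsub>A\<^esub> b \<otimes>\<^bsub>A\<^esub> s"
      unfolding right_ideal2_def by auto
    have "q = skew_mult (val a) (val r) + skew_mult (val b) (val s)"
      using el(2)[OF q] rs ab by (simp add: val_add val_mult)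
    then show "\<exists>r\<in>Asub \<alpha>. \<exists>s\<in>Asub \<alpha>. q = skew_mult (val a) r + skew_mult (val b) s" using valA rs by blast
  next
    assume "\<exists>r\<in>Asub \<alpha>. \<exists>s\<in>Asub \<alpha>. q = skew_mult (val a) r + skew_mult (val b) s"
    then obtain r s where rs: "r \<in> Asub \<alpha>" "s \<in> Asub \<alpha>" "q = skew_mult (val a) r + skew_mult (val b) s" by auto
    have "el q = a \<otimes>\<^bsub>A\<^esub> el r \<oplus>\<^bsub>A\<^esub> b \<otimes>\<^bsub>A\<^esub> el s"
      using el[OF q] el[OF rs(1)] el[OF rs(2)] ab rs(3) by (intro inj) (auto simp: val_add val_mult)
    then show "el q \<in> ?K" unfolding right_ideal2_def using el(1) rs by blast
  qed
  define \<pi> where "\<pi> q = ?K +>\<^bsub>A\<^esub> el q" for q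
  have cyc: "carrier (cyclic2 A a b) = {?K +>\<^bsub>A\<^esub> x | x. x \<in> carrier A}" "\<zero>\<^bsub>cyclic2 A a b\<^esub> = ?K"
    "add (cyclic2 A a b) = set_add A" "ract (cyclic2 A a b) = (\<lambda>C r. \<Union>c\<in>C. ?K +>\<^bsub>A\<^esub> (c \<otimes>\<^bsub>A\<^esub> r))"
    "\<And>m. gcomp (cyclic2 A a b) m = (\<lambda>r. ?K +>\<^bsub>A\<^esub> r) ` hcomp A m"
    by (auto simp: cyclic2_def Let_def a_rcosets_alt)
  have "simple_quotient \<alpha> \<beta> n c S \<pi>"
  proof (rule simple_quotient.intro[OF alpha beta cut])
    show "carrier S = \<pi> ` Asub \<alpha>"
      unfolding S cyc \<pi>_def im[symmetric] image_image using elv by (auto simp: image_iff)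
    show "\<pi> q \<oplus>\<^bsub>S\<^esub> \<pi> q' = \<pi> (q + q')" if "q \<in> Asub \<alpha>" "q' \<in> Asub \<alpha>" for q q'
      unfolding S cyc \<pi>_def using that el el_add K.K.a_rcos_sum by simp
    show "ract S (\<pi> q) C = \<pi> (skew_mult q (gwa_val (falpha \<alpha>) C))"
      if "q \<in> Asub \<alpha>" "C \<in> carrier (gwa (falpha \<alpha>))" for q C
      unfolding S cyc \<pi>_def using that K.coset_ract[of "el q" C] el el_mult unfolding A_def val_def by simp
    show "\<pi> q = \<zero>\<^bsub>S\<^esub> \<longleftrightarrow> (\<forall>m. (m \<le> n \<longleftrightarrow> c = n) \<longrightarrow> (\<exists>u. Poly_Mapping.lookup q (m - c) =
         to_fract (u * lin \<beta> (n - c) * apol (falpha \<alpha>) (m - c))))" if q: "q \<in> Asub \<alpha>" for q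
      unfolding S cyc \<pi>_def K.coset_eq_K_iff[OF el(1)[OF q]] memK[OF q] ker[OF q] ..
    show "gcomp S m = \<pi> ` (Asub \<alpha> \<inter> range (Poly_Mapping.single (m - c)))" for m
    proof -
      have "hcomp A (m - c) = el ` (Asub \<alpha> \<inter> range (Poly_Mapping.single (m - c)))"
      proof (intro equalityI subsetI)
        fix C assume "C \<in> hcomp A (m - c)"
        then have C: "C \<in> carrier A" "Poly_Mapping.keys (val C) \<subseteq> {m - c}"
          unfolding A_def val_def gwa_hcomp[OF f0] by auto
        have "val C \<in> Asub \<alpha> \<inter> range (Poly_Mapping.single (m - c))"
          using valA[OF C(1)] keys_subset_single[OF C(2)] by auto
        then show "C \<in> el ` (Asub \<alpha> \<inter> range (Poly_Mapping.single (m - c)))" using elv[OF C(1)] by force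
      next
        fix C assume "C \<in> el ` (Asub \<alpha> \<inter> range (Poly_Mapping.single (m - c)))"
        then show "C \<in> hcomp A (m - c)"
          using el unfolding A_def val_def gwa_hcomp[OF f0] by (auto split: if_splits)
      qed
      then show ?thesis unfolding gc cyc \<pi>_def by (simp add: image_image)
    qed
  qed
  then show ?thesis by blast
qed

lemma tr_apol: "tr c (apol f j) = (\<Prod>k\<in>{j + c..<c}. tr k f)"
proof -
  have "tr c (apol f j) = (\<Prod>k\<in>{j..<0}. tr (k + c) f)"
    unfolding apol_def pcompose_prod tr_tr by (simp only: add.commute)
  also have "\<dots> = (\<Prod>k\<in>{j + c..<c}. tr k f)"
    by (rule prod.reindex_bij_witness[of _ "\<lambda>k. k - c" "\<lambda>k. k + c"]) auto
  finally show ?thesis .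
qed

lemma skew_ideal_closed:
  fixes va vb :: "'k::field_char_0 skewl" and f :: "'k poly"
  defines "L \<equiv> {skew_mult va r + skew_mult vb s | r s. r \<in> gwa_sub f \<and> s \<in> gwa_sub f}"
  assumes "\<And>i. Poly_Mapping.single i (Poly_Mapping.lookup q i) \<in> L"
  shows "q \<in> L"
proof -
  have zero: "0 \<in> L" unfolding L_def using gwa_sub_zero[of f] by (auto intro!: exI[of _ 0] simp: skew_mult_zero)
  have add: "x + y \<in> L" if "x \<in> L" "y \<in> L" for x y
  proof -
    obtain r s r' s' where e: "x = skew_mult va r + skew_mult vb s" "r \<in> gwa_sub f" "s \<in> gwa_sub f"
      "y = skew_mult va r' + skew_mult vb s'" "r' \<in> gwa_sub f" "s' \<in> gwa_sub f"
      using \<open>x \<in> L\<close> \<open>y \<in> L\<close> unfolding L_def by blast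
    have "x + y = skew_mult va (r + r') + skew_mult vb (s + s')"
      unfolding e by (simp add: skew_mult_add_right)
    moreover have "r + r' \<in> gwa_sub f" "s + s' \<in> gwa_sub f" using e Pl_add unfolding gwa_sub_eq_Pl by blast+
    ultimately show ?thesis unfolding L_def by blast
  qed
  have "(\<Sum>i\<in>I. Poly_Mapping.single i (Poly_Mapping.lookup q i)) \<in> L" if "finite I" for I
    using that by (induction I) (auto simp: zero add assms(2))
  from this[of "Poly_Mapping.keys q"] show ?thesis by (simp add: poly_mapping_sum_single)
qed

text \<open>
  The multiples of \<open>x\<close> fill the positive degrees; in the others they are multiples of \<open>f\<close>, hence of \<open>z + \<beta>\<close>.
\<close>

lemma simple_quotient_X:
  fixes \<alpha> \<beta> :: "'k::field_char_0"
  assumes alpha: "\<alpha> \<notin> \<int>" and beta: "\<beta> \<in> {0, \<alpha>}"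
  shows "\<exists>\<pi>. simple_quotient \<alpha> \<beta> n n (shift (simpleX (falpha \<alpha>) \<beta>) n) \<pi>"
proof (rule simple_quotient_cyclic2[OF alpha beta, where a = "cls (falpha \<alpha>) fx" and b = "cls (falpha \<alpha>) (fz + fconst \<beta>)"])
  let ?f = "falpha \<alpha>"
  have vb: "falg_val ?f (fz + fconst \<beta>) = Poly_Mapping.single 0 (to_fract (lin \<beta> 0))"
    unfolding falg_val_add falg_val_gens falg_val_fconst single_add[symmetric] to_fract_add[symmetric] by simp
  obtain h where h: "?f = lin \<beta> 0 * h" using lin_dvd_tr_falpha[OF beta, of 0] unfolding tr_0 by (rule dvdE)
  fix q assume q: "q \<in> Asub \<alpha>"
  let ?L = "{skew_mult (falg_val ?f fx) r + skew_mult (falg_val ?f (fz + fconst \<beta>)) s | r s. r \<in> Asub \<alpha> \<and> s \<in> Asub \<alpha>}"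
  have "q \<in> ?L \<longleftrightarrow> (\<forall>m\<le>n. \<exists>u. Poly_Mapping.lookup q (m - n) = to_fract (u * lin \<beta> 0 * apol ?f (m - n)))"
  proof
    assume "q \<in> ?L"
    then obtain r s where rs: "r \<in> Asub \<alpha>" "s \<in> Asub \<alpha>"
      "q = skew_mult (falg_val ?f fx) r + skew_mult (falg_val ?f (fz + fconst \<beta>)) s" by auto
    show "\<forall>m\<le>n. \<exists>u. Poly_Mapping.lookup q (m - n) = to_fract (u * lin \<beta> 0 * apol ?f (m - n))"
    proof (intro allI impI)
      fix m :: int assume m: "m \<le> n"
      define i where "i = m - n"
      have i: "i \<le> 0" using m by (simp add: i_def)
      obtain u where u: "Poly_Mapping.lookup r (i - 1) = to_fract (u * apol ?f (i - 1))" using rs(1) unfolding gwa_sub_iff by blast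
      obtain v where v: "Poly_Mapping.lookup s i = to_fract (v * apol ?f i)" using rs(2) unfolding gwa_sub_iff by blast
      have "{i..<1} = insert 0 {i..<0}" using i by auto
      then have ta: "tr 1 (apol ?f (i - 1)) = ?f * apol ?f i"
        unfolding tr_apol by (simp add: apol_def)
      have "Poly_Mapping.lookup q i = to_fract (tr 1 (u * apol ?f (i - 1))) + to_fract (lin \<beta> 0) * to_fract (v * apol ?f i)"
        unfolding rs(3) lookup_add vb falg_val_gens lookup_single_skew_mult u v zshift_to_fract by (simp add: v)
      also have "\<dots> = to_fract ((tr 1 u * h + v) * lin \<beta> 0 * apol ?f i)"
        unfolding to_fract_mult[symmetric] to_fract_add[symmetric] pcompose_mult ta
        by (subst h) (simp add: algebra_simps del: mult_pCons_left mult_pCons_right)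
      finally show "\<exists>u. Poly_Mapping.lookup q (m - n) = to_fract (u * lin \<beta> 0 * apol ?f (m - n))"
        unfolding i_def by blast
    qed
  next
    assume c: "\<forall>m\<le>n. \<exists>u. Poly_Mapping.lookup q (m - n) = to_fract (u * lin \<beta> 0 * apol ?f (m - n))"
    show "q \<in> ?L"
    proof (rule skew_ideal_closed)
      fix i
      show "Poly_Mapping.single i (Poly_Mapping.lookup q i) \<in> ?L"
      proof (cases "i \<le> 0")
        case True
        then obtain u where u: "Poly_Mapping.lookup q i = to_fract (u * lin \<beta> 0 * apol ?f i)"
          using c[rule_format, of "i + n"] by auto
        have "Poly_Mapping.single i (Poly_Mapping.lookup q i) = skew_mult (falg_val ?f fx) 0
            + skew_mult (falg_val ?f (fz + fconst \<beta>)) (Poly_Mapping.single i (to_fract (u * apol ?f i)))"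
          unfolding u vb skew_mult_single skew_mult_zero by (simp only: zshift_by_0 to_fract_mult ac_simps add_0)
        then show ?thesis using gwa_sub_zero single_in_gwa_sub by blast
      next
        case False
        obtain u where u: "Poly_Mapping.lookup q i = to_fract (u * apol ?f i)" using q unfolding gwa_sub_iff by blast
        have "Poly_Mapping.single i (Poly_Mapping.lookup q i) =
          skew_mult (falg_val ?f fx) (Poly_Mapping.single (i - 1) (to_fract (tr (- 1) u * apol ?f (i - 1))))
            + skew_mult (falg_val ?f (fz + fconst \<beta>)) 0"
        proof -
          have "tr 1 (tr (- 1) u) = u" unfolding tr_tr by simp
          then show ?thesis
            unfolding u falg_val_gens skew_mult_single skew_mult_zero zshift_to_fract
            using False by (simp add: pcompose_mult pcompose_1)
        qed
        then show ?thesis using gwa_sub_zero single_in_gwa_sub by blast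
      qed
    qed
  qed
  then show "(\<exists>r\<in>Asub \<alpha>. \<exists>s\<in>Asub \<alpha>. q = skew_mult (gwa_val ?f (cls ?f fx)) r + skew_mult (gwa_val ?f (cls ?f (fz + fconst \<beta>))) s)
      \<longleftrightarrow> (\<forall>m. (m \<le> n \<longleftrightarrow> n = n) \<longrightarrow> (\<exists>u. Poly_Mapping.lookup q (m - n) = to_fract (u * lin \<beta> (n - n) * apol ?f (m - n))))"
    unfolding gwa_val_cls by (simp only: diff_self mem_Collect_eq simp_thms) blast
qed (auto simp: shift_def simpleX_def cls_in_carrier)

text \<open>
  Here the multiples of \<open>y\<close> fill the negative degrees, which is why the shift moves the cut between \<open>n\<close> and \<open>n + 1\<close> to the same place.
\<close>

lemma simple_quotient_Y:
  fixes \<alpha> \<beta> :: "'k::field_char_0"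
  assumes alpha: "\<alpha> \<notin> \<int>" and beta: "\<beta> \<in> {0, \<alpha>}"
  shows "\<exists>\<pi>. simple_quotient \<alpha> \<beta> n (n + 1) (shift (simpleY (falpha \<alpha>) \<beta>) n) \<pi>"
proof (rule simple_quotient_cyclic2[OF alpha beta, where a = "cls (falpha \<alpha>) fy" and b = "cls (falpha \<alpha>) (fz + fconst \<beta> - 1)"])
  let ?f = "falpha \<alpha>"
  have vb: "falg_val ?f (fz + fconst \<beta> - 1) = Poly_Mapping.single 0 (to_fract (lin \<beta> (- 1)))"
  proof -
    have "lin \<beta> (- 1) = [:0, 1:] + [:\<beta>:] - 1" by (simp add: one_pCons)
    then show ?thesis
      unfolding falg_val_diff falg_val_add falg_val_gens falg_val_fconst falg_val_one
      by (simp only: to_fract_add to_fract_diff single_add single_diff to_fract_1 single_one)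
  qed
  obtain h where h: "tr (- 1) ?f = lin \<beta> (- 1) * h" using lin_dvd_tr_falpha[OF beta, of "- 1"] by (rule dvdE)
  fix q assume q: "q \<in> Asub \<alpha>"
  let ?L = "{skew_mult (falg_val ?f fy) r + skew_mult (falg_val ?f (fz + fconst \<beta> - 1)) s | r s. r \<in> Asub \<alpha> \<and> s \<in> Asub \<alpha>}"
  have "q \<in> ?L \<longleftrightarrow> (\<forall>i\<ge>0. \<exists>u. Poly_Mapping.lookup q i = to_fract (u * lin \<beta> (- 1) * apol ?f i))"
  proof
    assume "q \<in> ?L"
    then obtain r s where rs: "r \<in> Asub \<alpha>" "s \<in> Asub \<alpha>"
      "q = skew_mult (falg_val ?f fy) r + skew_mult (falg_val ?f (fz + fconst \<beta> - 1)) s" by auto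
    show "\<forall>i\<ge>0. \<exists>u. Poly_Mapping.lookup q i = to_fract (u * lin \<beta> (- 1) * apol ?f i)"
    proof (intro allI impI)
      fix i :: int assume i: "0 \<le> i"
      obtain u where u: "Poly_Mapping.lookup r (i - - 1) = to_fract (u * apol ?f (i - - 1))" using rs(1) unfolding gwa_sub_iff by blast
      obtain v where v: "Poly_Mapping.lookup s i = to_fract (v * apol ?f i)" using rs(2) unfolding gwa_sub_iff by blast
      have "Poly_Mapping.lookup q i = to_fract (tr (- 1) ?f) * to_fract (tr (- 1) (u * apol ?f (i - - 1)))
          + to_fract (lin \<beta> (- 1)) * to_fract (v * apol ?f i)"
        unfolding rs(3) lookup_add vb falg_val_gens lookup_single_skew_mult u v zshift_to_fract by (simp add: v)
      also have "\<dots> = to_fract ((h * tr (- 1) u + v) * lin \<beta> (- 1) * apol ?f i)"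
      proof -
        have "apol ?f (i - - 1) = 1" "apol ?f i = 1" using i by simp_all
        then show ?thesis
          unfolding h to_fract_mult[symmetric] to_fract_add[symmetric] pcompose_mult
          by (simp add: algebra_simps pcompose_1 del: mult_pCons_left mult_pCons_right)
      qed
      finally show "\<exists>u. Poly_Mapping.lookup q i = to_fract (u * lin \<beta> (- 1) * apol ?f i)" by blast
    qed
  next
    assume c: "\<forall>i\<ge>0. \<exists>u. Poly_Mapping.lookup q i = to_fract (u * lin \<beta> (- 1) * apol ?f i)"
    show "q \<in> ?L"
    proof (rule skew_ideal_closed)
      fix i
      show "Poly_Mapping.single i (Poly_Mapping.lookup q i) \<in> ?L"
      proof (cases "0 \<le> i")
        case True
        then obtain u where u: "Poly_Mapping.lookup q i = to_fract (u * lin \<beta> (- 1) * apol ?f i)"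
          using c by blast
        have "Poly_Mapping.single i (Poly_Mapping.lookup q i) = skew_mult (falg_val ?f fy) 0
            + skew_mult (falg_val ?f (fz + fconst \<beta> - 1)) (Poly_Mapping.single i (to_fract (u * apol ?f i)))"
          unfolding u vb skew_mult_single skew_mult_zero by (simp only: zshift_by_0 to_fract_mult ac_simps add_0)
        then show ?thesis using gwa_sub_zero single_in_gwa_sub by blast
      next
        case False
        obtain u where u: "Poly_Mapping.lookup q i = to_fract (u * apol ?f i)" using q unfolding gwa_sub_iff by blast
        have "Poly_Mapping.single i (Poly_Mapping.lookup q i) =
          skew_mult (falg_val ?f fy) (Poly_Mapping.single (i + 1) (to_fract (tr 1 u * apol ?f (i + 1))))
            + skew_mult (falg_val ?f (fz + fconst \<beta> - 1)) 0"
        proof -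
          have 1: "tr (- 1) (tr 1 u) = u" unfolding tr_tr by simp
          have "{i..<0} = insert (- 1) {i..<- 1}" using False by auto
          then have 2: "apol ?f i = tr (- 1) ?f * tr (- 1) (apol ?f (i + 1))"
            unfolding tr_apol by (simp add: apol_def)
          have 3: "- 1 + (i + 1) = i" by simp
          show ?thesis
            unfolding u falg_val_gens skew_mult_single skew_mult_zero zshift_to_fract pcompose_mult 1 2 3
            by (simp only: to_fract_mult ac_simps add_0)
        qed
        then show ?thesis using gwa_sub_zero single_in_gwa_sub by blast
      qed
    qed
  qed
  moreover have "(\<forall>i\<ge>0. \<exists>u. Poly_Mapping.lookup q i = to_fract (u * lin \<beta> (- 1) * apol ?f i)) \<longleftrightarrow>
    (\<forall>m. (m \<le> n \<longleftrightarrow> n + 1 = n) \<longrightarrow> (\<exists>u. Poly_Mapping.lookup q (m - (n + 1)) =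
      to_fract (u * lin \<beta> (n - (n + 1)) * apol ?f (m - (n + 1)))))" (is "?A \<longleftrightarrow> ?B")
  proof
    assume ?A
    then show ?B by auto
  next
    assume B: ?B
    show ?A
    proof (intro allI impI)
      fix i :: int assume "0 \<le> i"
      then show "\<exists>u. Poly_Mapping.lookup q i = to_fract (u * lin \<beta> (- 1) * apol ?f i)"
        using B[rule_format, of "i + n + 1"] by simp
    qed
  qed
  ultimately show "(\<exists>r\<in>Asub \<alpha>. \<exists>s\<in>Asub \<alpha>. q = skew_mult (gwa_val ?f (cls ?f fy)) r +
        skew_mult (gwa_val ?f (cls ?f (fz + fconst \<beta> - 1))) s)
      \<longleftrightarrow> (\<forall>m. (m \<le> n \<longleftrightarrow> n + 1 = n) \<longrightarrow> (\<exists>u. Poly_Mapping.lookup q (m - (n + 1)) =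
      to_fract (u * lin \<beta> (n - (n + 1)) * apol ?f (m - (n + 1)))))"
    unfolding gwa_val_cls by blast
qed (auto simp: shift_def simpleY_def cls_in_carrier algebra_simps)


section \<open>The functors on rank one projectives\<close>

text \<open>
  The effect of the elementary functor for \<open>\<beta>\<close> and \<open>n\<close> on the polynomials \<open>p\<^sub>m\<close> and on the set \<open>T\<close>.
\<close>

definition step :: "('k::field_char_0 \<times> int) set \<Rightarrow> 'k \<Rightarrow> int \<Rightarrow> (int \<Rightarrow> 'k poly) \<Rightarrow> int \<Rightarrow> 'k poly" where
  "step T \<beta> n p m = (if (m \<le> n) = ((\<beta>, n) \<notin> T) then p m * lin \<beta> n else p m)"

definition flip :: "('k::field_char_0 \<times> int) set \<Rightarrow> 'k \<Rightarrow> int \<Rightarrow> ('k \<times> int) set" where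
  "flip T \<beta> n = {x. (x \<in> T) \<noteq> (x = (\<beta>, n))}"

definition hpol :: "'k::field_char_0 \<Rightarrow> gam \<Rightarrow> 'k poly" where
  "hpol \<alpha> \<gamma> = (\<Prod>j\<in>zset (fst \<gamma>). lin 0 j) * (\<Prod>j\<in>zset (snd \<gamma>). lin \<alpha> j)"

lemma finite_zset [simp]: "finite (zset I)"
  using zset[of I] by simp

lemma hfun_hpol: "hfun (\<alpha> :: 'a::field_char_0) \<gamma> = to_fract (hpol \<alpha> \<gamma>)"
proof -
  have "to_fract (\<Prod>j\<in>A. g j) = (\<Prod>j\<in>A. to_fract (g j))" for A :: "int set" and g :: "int \<Rightarrow> 'a poly"
    by (induction A rule: infinite_finite_induct) (simp_all add: to_fract_mult)
  then show ?thesis by (simp add: hfun_def hpol_def to_fract_mult to_fract_def[symmetric])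
qed

lemma prod_list_sorted: "finite A \<Longrightarrow> (\<Prod>n\<leftarrow>sorted_list_of_set A. g n) = (\<Prod>n\<in>A. g n)"
  for g :: "int \<Rightarrow> 'k::field_char_0 poly"
  by (metis distinct_sorted_list_of_set prod.distinct_set_conv_list set_sorted_list_of_set)

context
  fixes \<alpha> :: "'k::field_char_0"
  assumes alpha: "\<alpha> \<notin> \<int>"
begin

lemma good_step:
  assumes g: "good \<alpha> T p" and beta: "\<beta> \<in> {0, \<alpha>}"
  shows "good \<alpha> (flip T \<beta> n) (step T \<beta> n p)"
proof -
  have a0: "\<alpha> \<noteq> 0" using alpha by auto
  obtain N where N: "\<And>j. j \<ge> N \<Longrightarrow> (0, j) \<notin> T \<and> (\<alpha>, j) \<notin> T" using g unfolding good_def by blast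
  obtain M where M: "\<And>j. j < M \<Longrightarrow> (0, j) \<in> T \<and> (\<alpha>, j) \<in> T" using g unfolding good_def by blast
  have p: "p m \<noteq> 0" "p m = p (m + 1) * gT \<alpha> T m" for m using g unfolding good_def by blast+
  show ?thesis
    unfolding good_def
  proof (intro conjI allI)
    fix m
    show "step T \<beta> n p m \<noteq> 0" using p(1)[of m] by (simp add: step_def del: mult_pCons_left mult_pCons_right)
    show "step T \<beta> n p m = step T \<beta> n p (m + 1) * gT \<alpha> (flip T \<beta> n) m"
    proof (cases "m = n")
      case True
      have "gT \<alpha> (flip T \<beta> n) n * (if (\<beta>, n) \<in> T then lin \<beta> n else 1) =
          gT \<alpha> T n * (if (\<beta>, n) \<in> T then 1 else lin \<beta> n)"
        using beta a0 by (auto simp: gT_def flip_def ac_simps simp del: mult_pCons_left mult_pCons_right)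
      then show ?thesis
        using p(2)[of n] True by (auto simp: step_def ac_simps simp del: mult_pCons_left mult_pCons_right)
    next
      case False
      then have "gT \<alpha> (flip T \<beta> n) m = gT \<alpha> T m" by (auto simp: gT_def flip_def)
      moreover have "(m \<le> n) = (m + 1 \<le> n)" using False by auto
      ultimately show ?thesis
        using p(2)[of m] by (auto simp: step_def ac_simps simp del: mult_pCons_left mult_pCons_right)
    qed
  next
    show "\<exists>N. \<forall>j\<ge>N. (0, j) \<notin> flip T \<beta> n \<and> (\<alpha>, j) \<notin> flip T \<beta> n"
      using N by (intro exI[of _ "max N (n + 1)"]) (auto simp: flip_def)
    show "\<exists>N. \<forall>j<N. (0, j) \<in> flip T \<beta> n \<and> (\<alpha>, j) \<in> flip T \<beta> n"
      using M by (intro exI[of _ "min M n"]) (auto simp: flip_def)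
  qed
qed

text \<open>
  Only one of the two simple modules admits a nonzero morphism, and all these morphisms have the same
  kernel, so the kernel in the definition of the functor is unique.
\<close>

lemma iota1_Pl:
  assumes g: "good \<alpha> T p" and beta: "\<beta> \<in> {0, \<alpha>}"
  shows "iota1 \<alpha> \<beta> n (Pl p) = Pl (step T \<beta> n p)"
proof -
  let ?SX = "shift (simpleX (falpha \<alpha>) \<beta>) n" and ?SY = "shift (simpleY (falpha \<alpha>) \<beta>) n"
  obtain \<pi>1 where "simple_quotient \<alpha> \<beta> n n ?SX \<pi>1" using simple_quotient_X[OF alpha beta] by blast
  then interpret SX: simple_quotient \<alpha> \<beta> n n ?SX \<pi>1 .
  obtain \<pi>2 where "simple_quotient \<alpha> \<beta> n (n + 1) ?SY \<pi>2" using simple_quotient_Y[OF alpha beta] by blast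
  then interpret SY: simple_quotient \<alpha> \<beta> n "n + 1" ?SY \<pi>2 .
  let ?Q = "\<lambda>K. \<exists>S \<in> {?SX, ?SY}. \<exists>\<phi> \<in> gr_hom (gwa (falpha \<alpha>)) (submod (falpha \<alpha>) (Pl p)) S.
       (\<exists>q\<in>Pl p. \<phi> q \<noteq> \<zero>\<^bsub>S\<^esub>) \<and> K = {q \<in> Pl p. \<phi> q = \<zero>\<^bsub>S\<^esub>}"
  have step: "Pl (step T \<beta> n p) = (if (\<beta>, n) \<in> T
      then Pl (\<lambda>m. if (m \<le> n \<longleftrightarrow> n + 1 = n) then p m * lin \<beta> n else p m)
      else Pl (\<lambda>m. if (m \<le> n \<longleftrightarrow> n = n) then p m * lin \<beta> n else p m))"
    by (simp add: step_def[abs_def])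
  have uniq: "K = Pl (step T \<beta> n p)" if K: "?Q K" for K
  proof -
    consider (X) \<phi> where "\<phi> \<in> gr_hom (gwa (falpha \<alpha>)) (submod (falpha \<alpha>) (Pl p)) ?SX"
        "\<exists>q\<in>Pl p. \<phi> q \<noteq> \<zero>\<^bsub>?SX\<^esub>" "K = {q \<in> Pl p. \<phi> q = \<zero>\<^bsub>?SX\<^esub>}"
      | (Y) \<phi> where "\<phi> \<in> gr_hom (gwa (falpha \<alpha>)) (submod (falpha \<alpha>) (Pl p)) ?SY"
        "\<exists>q\<in>Pl p. \<phi> q \<noteq> \<zero>\<^bsub>?SY\<^esub>" "K = {q \<in> Pl p. \<phi> q = \<zero>\<^bsub>?SY\<^esub>}"
      using K by blast
    then show ?thesis
    proof cases
      case X
      have "(\<beta>, n) \<notin> T" using SX.phi_mismatch[OF g X(1)] X(2) by blast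
      then show ?thesis using SX.phi_kernel[OF g X(1,2)] X(3) unfolding step by simp
    next
      case Y
      have "(\<beta>, n) \<in> T" using SY.phi_mismatch[OF g Y(1)] Y(2) by auto
      then show ?thesis using SY.phi_kernel[OF g Y(1,2)] Y(3) unfolding step by simp
    qed
  qed
  have "\<exists>K. ?Q K"
  proof (cases "(\<beta>, n) \<in> T")
    case True
    then have "\<exists>\<phi>\<in>gr_hom (gwa (falpha \<alpha>)) (submod (falpha \<alpha>) (Pl p)) ?SY. \<exists>q\<in>Pl p. \<phi> q \<noteq> \<zero>\<^bsub>?SY\<^esub>"
      using SY.ex_nonzero_morphism[OF g] by simp
    then obtain \<phi> where \<phi>: "\<phi> \<in> gr_hom (gwa (falpha \<alpha>)) (submod (falpha \<alpha>) (Pl p)) ?SY"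
      "\<exists>q\<in>Pl p. \<phi> q \<noteq> \<zero>\<^bsub>?SY\<^esub>" by (erule bexE)
    show ?thesis
      by (rule exI[of _ "{q \<in> Pl p. \<phi> q = \<zero>\<^bsub>?SY\<^esub>}"], rule bexI[of _ ?SY], rule bexI[OF _ \<phi>(1)],
          rule conjI[OF \<phi>(2) refl]) simp
  next
    case False
    then have "\<exists>\<phi>\<in>gr_hom (gwa (falpha \<alpha>)) (submod (falpha \<alpha>) (Pl p)) ?SX. \<exists>q\<in>Pl p. \<phi> q \<noteq> \<zero>\<^bsub>?SX\<^esub>"
      using SX.ex_nonzero_morphism[OF g] by simp
    then obtain \<phi> where \<phi>: "\<phi> \<in> gr_hom (gwa (falpha \<alpha>)) (submod (falpha \<alpha>) (Pl p)) ?SX"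
      "\<exists>q\<in>Pl p. \<phi> q \<noteq> \<zero>\<^bsub>?SX\<^esub>" by (erule bexE)
    show ?thesis
      by (rule exI[of _ "{q \<in> Pl p. \<phi> q = \<zero>\<^bsub>?SX\<^esub>}"], rule bexI[of _ ?SX], rule bexI[OF _ \<phi>(1)],
          rule conjI[OF \<phi>(2) refl]) simp
  qed
  then obtain K where K: "?Q K" by (rule exE)
  have "?Q (Pl (step T \<beta> n p))" using K unfolding uniq[OF K] .
  then show ?thesis unfolding iota1_def using uniq by (rule the_equality)
qed

lemma Pl_step_sub: "Pl (step T \<beta> n p) \<subseteq> Pl p"
proof
  fix q assume q: "q \<in> Pl (step T \<beta> n p)"
  show "q \<in> Pl p"
    unfolding Pl_def
  proof (intro CollectI allI)
    fix m
    obtain u where "Poly_Mapping.lookup q m = to_fract (u * step T \<beta> n p m)" using q by (auto simp: Pl_def)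
    then show "\<exists>u. Poly_Mapping.lookup q m = to_fract (u * p m)"
      by (intro exI[of _ "u * (if (m \<le> n) = ((\<beta>, n) \<notin> T) then lin \<beta> n else 1)"])
        (simp add: step_def ac_simps del: mult_pCons_left mult_pCons_right)
  qed
qed

lemma Pl_step_sup:
  assumes q: "q \<in> Pl p"
  shows "kz_mult (to_fract (lin \<beta> n)) q \<in> Pl (step T \<beta> n p)"
  unfolding Pl_def
proof (intro CollectI allI)
  fix m
  obtain u where u: "Poly_Mapping.lookup q m = to_fract (u * p m)" using q by (auto simp: Pl_def)
  have "lin \<beta> n * (u * p m) = (u * (if (m \<le> n) = ((\<beta>, n) \<notin> T) then 1 else lin \<beta> n)) * step T \<beta> n p m"
    by (simp add: step_def ac_simps del: mult_pCons_left mult_pCons_right)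
  then show "\<exists>u. Poly_Mapping.lookup (kz_mult (to_fract (lin \<beta> n)) q) m = to_fract (u * step T \<beta> n p m)"
    unfolding lookup_kz_mult u to_fract_mult[symmetric] by metis
qed

text \<open>
  The index sets have no repetitions, so each factor meets the projective in the state given by the
  original \<open>T\<close>. If \<open>T\<close> is that of \<open>A\<close>, then the degree \<open>0\<close> lies on the side of the cut that is multiplied,
  for positive and for negative \<open>n\<close> alike.
\<close>

lemma foldr_iota1:
  assumes beta: "\<beta> \<in> {0, \<alpha>}" and g: "good \<alpha> T p"
  shows "\<exists>T' p'. foldr (iota1 \<alpha> \<beta>) ns (Pl p) = Pl p' \<and> good \<alpha> T' p' \<and> Pl p' \<subseteq> Pl p \<and>
    (\<forall>q\<in>Pl p. kz_mult (to_fract (\<Prod>n\<leftarrow>ns. lin \<beta> n)) q \<in> Pl p') \<and>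
    (\<forall>x. fst x \<noteq> \<beta> \<longrightarrow> (x \<in> T' \<longleftrightarrow> x \<in> T)) \<and> (\<forall>m. m \<notin> set ns \<longrightarrow> ((\<beta>, m) \<in> T' \<longleftrightarrow> (\<beta>, m) \<in> T)) \<and>
    (distinct ns \<longrightarrow> (\<forall>n\<in>set ns. (\<beta>, n) \<in> T \<longleftrightarrow> n < 0) \<longrightarrow> p' 0 = p 0 * (\<Prod>n\<leftarrow>ns. lin \<beta> n))"
proof (induction ns)
  case Nil
  have "kz_mult (to_fract 1) q = q" for q :: "'k skewl" by (simp add: kz_mult_def)
  then show ?case using g by (intro exI[of _ T] exI[of _ p]) simp
next
  case (Cons n ns)
  then obtain T' p' where IH: "foldr (iota1 \<alpha> \<beta>) ns (Pl p) = Pl p'" "good \<alpha> T' p'" "Pl p' \<subseteq> Pl p"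
    "\<forall>q\<in>Pl p. kz_mult (to_fract (\<Prod>n\<leftarrow>ns. lin \<beta> n)) q \<in> Pl p'"
    "\<forall>x. fst x \<noteq> \<beta> \<longrightarrow> (x \<in> T' \<longleftrightarrow> x \<in> T)" "\<forall>m. m \<notin> set ns \<longrightarrow> ((\<beta>, m) \<in> T' \<longleftrightarrow> (\<beta>, m) \<in> T)"
    "distinct ns \<longrightarrow> (\<forall>n\<in>set ns. (\<beta>, n) \<in> T \<longleftrightarrow> n < 0) \<longrightarrow> p' 0 = p 0 * (\<Prod>n\<leftarrow>ns. lin \<beta> n)"
    by blast
  let ?p = "step T' \<beta> n p'" and ?T = "flip T' \<beta> n"
  show ?case
  proof (intro exI[of _ ?T] exI[of _ ?p] conjI)
    show "foldr (iota1 \<alpha> \<beta>) (n # ns) (Pl p) = Pl ?p" using IH(1) iota1_Pl[OF IH(2) beta] by simp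
    show "good \<alpha> ?T ?p" by (rule good_step[OF IH(2) beta])
    show "Pl ?p \<subseteq> Pl p" using Pl_step_sub IH(3) by blast
    show "\<forall>q\<in>Pl p. kz_mult (to_fract (\<Prod>n\<leftarrow>n # ns. lin \<beta> n)) q \<in> Pl ?p"
    proof
      fix q assume "q \<in> Pl p"
      then have "kz_mult (to_fract (lin \<beta> n)) (kz_mult (to_fract (\<Prod>n\<leftarrow>ns. lin \<beta> n)) q) \<in> Pl ?p"
        using IH(4) by (intro Pl_step_sup) blast
      then show "kz_mult (to_fract (\<Prod>n\<leftarrow>n # ns. lin \<beta> n)) q \<in> Pl ?p"
        unfolding kz_mult_kz_mult to_fract_mult[symmetric] by (simp only: list.map prod_list.Cons)
    qed
    show "\<forall>x. fst x \<noteq> \<beta> \<longrightarrow> (x \<in> ?T \<longleftrightarrow> x \<in> T)" using IH(5) by (auto simp: flip_def)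
    show "\<forall>m. m \<notin> set (n # ns) \<longrightarrow> ((\<beta>, m) \<in> ?T \<longleftrightarrow> (\<beta>, m) \<in> T)" using IH(6) by (auto simp: flip_def)
    show "distinct (n # ns) \<longrightarrow> (\<forall>n\<in>set (n # ns). (\<beta>, n) \<in> T \<longleftrightarrow> n < 0) \<longrightarrow> ?p 0 = p 0 * (\<Prod>n\<leftarrow>n # ns. lin \<beta> n)"
    proof (intro impI)
      assume d: "distinct (n # ns)" and t: "\<forall>n\<in>set (n # ns). (\<beta>, n) \<in> T \<longleftrightarrow> n < 0"
      have "(\<beta>, n) \<in> T' \<longleftrightarrow> n < 0" using d t IH(6) by auto
      then have "?p 0 = p' 0 * lin \<beta> n" by (simp add: step_def linorder_not_less)
      also have "p' 0 = p 0 * (\<Prod>n\<leftarrow>ns. lin \<beta> n)" using IH(7) d t by simp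
      finally show "?p 0 = p 0 * (\<Prod>n\<leftarrow>n # ns. lin \<beta> n)"
        by (simp only: list.map prod_list.Cons ac_simps)
    qed
  qed
qed

lemma iota_Pl:
  assumes g: "good \<alpha> T p"
  shows "\<exists>T' p'. iota \<alpha> \<gamma> (Pl p) = Pl p' \<and> good \<alpha> T' p' \<and> Pl p' \<subseteq> Pl p \<and>
    (\<forall>q\<in>Pl p. kz_mult (to_fract (hpol \<alpha> \<gamma>)) q \<in> Pl p') \<and>
    ((\<forall>n\<in>zset (fst \<gamma>). (0, n) \<in> T \<longleftrightarrow> n < 0) \<longrightarrow> (\<forall>n\<in>zset (snd \<gamma>). (\<alpha>, n) \<in> T \<longleftrightarrow> n < 0) \<longrightarrow>
      p' 0 = p 0 * hpol \<alpha> \<gamma>)"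
proof -
  let ?a = "sorted_list_of_set (zset (snd \<gamma>))" and ?b = "sorted_list_of_set (zset (fst \<gamma>))"
  have a0: "\<alpha> \<noteq> 0" using alpha by auto
  obtain T1 p1 where 1: "foldr (iota1 \<alpha> \<alpha>) ?a (Pl p) = Pl p1" "good \<alpha> T1 p1" "Pl p1 \<subseteq> Pl p"
    "\<And>q. q \<in> Pl p \<Longrightarrow> kz_mult (to_fract (\<Prod>n\<leftarrow>?a. lin \<alpha> n)) q \<in> Pl p1"
    "\<And>x. fst x \<noteq> \<alpha> \<Longrightarrow> (x \<in> T1 \<longleftrightarrow> x \<in> T)"
    "distinct ?a \<Longrightarrow> (\<forall>n\<in>set ?a. (\<alpha>, n) \<in> T \<longleftrightarrow> n < 0) \<Longrightarrow> p1 0 = p 0 * (\<Prod>n\<leftarrow>?a. lin \<alpha> n)"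
    using foldr_iota1[of \<alpha> T p ?a] g by blast
  obtain T2 p2 where 2: "foldr (iota1 \<alpha> 0) ?b (Pl p1) = Pl p2" "good \<alpha> T2 p2" "Pl p2 \<subseteq> Pl p1"
    "\<And>q. q \<in> Pl p1 \<Longrightarrow> kz_mult (to_fract (\<Prod>n\<leftarrow>?b. lin 0 n)) q \<in> Pl p2"
    "distinct ?b \<Longrightarrow> (\<forall>n\<in>set ?b. (0, n) \<in> T1 \<longleftrightarrow> n < 0) \<Longrightarrow> p2 0 = p1 0 * (\<Prod>n\<leftarrow>?b. lin 0 n)"
    using foldr_iota1[of 0 T1 p1 ?b] 1(2) by blast
  have h: "hpol \<alpha> \<gamma> = (\<Prod>n\<leftarrow>?b. lin 0 n) * (\<Prod>n\<leftarrow>?a. lin \<alpha> n)"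
    unfolding hpol_def by (simp only: prod_list_sorted[OF finite_zset])
  show ?thesis
  proof (intro exI[of _ T2] exI[of _ p2] conjI ballI impI)
    show "iota \<alpha> \<gamma> (Pl p) = Pl p2" unfolding iota_def 1(1) 2(1) ..
    show "kz_mult (to_fract (hpol \<alpha> \<gamma>)) q \<in> Pl p2" if "q \<in> Pl p" for q
      using 2(4)[OF 1(4)[OF that]] unfolding h kz_mult_kz_mult to_fract_mult .
    assume t: "\<forall>n\<in>zset (fst \<gamma>). (0, n) \<in> T \<longleftrightarrow> n < 0" "\<forall>n\<in>zset (snd \<gamma>). (\<alpha>, n) \<in> T \<longleftrightarrow> n < 0"
    have "p1 0 = p 0 * (\<Prod>n\<leftarrow>?a. lin \<alpha> n)" using t(2) by (intro 1(6)) auto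
    moreover have "p2 0 = p1 0 * (\<Prod>n\<leftarrow>?b. lin 0 n)" using t(1) 1(5) a0 by (intro 2(5)) auto
    ultimately show "p2 0 = p 0 * hpol \<alpha> \<gamma>" unfolding h by (simp only: ac_simps)
  qed (use 1 2 in auto)
qed

end

section \<open>The ring \<open>D\<close>\<close>

lemma zset_plus: "zset (I + J) = (zset I - zset J) \<union> (zset J - zset I)"
  by transfer simp

lemma zset_zinter: "zset (zinter I J) = zset I \<inter> zset J"
  by transfer simp

lemma zset_zero: "zset 0 = {}"
  by transfer simp

lemma zset_eqD: "zset I = zset J \<Longrightarrow> I = J"
  by (simp add: zset_inject)

lemma zfin_minus: "(I :: zfin) - J = I + J"
  by (simp add: minus_zfin_def)

lemma gam_minus: "(\<gamma> :: gam) - \<delta> = \<gamma> + \<delta>"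
  by (simp add: prod_eq_iff zfin_minus)

lemma ginter_commute: "ginter \<gamma> \<delta> = ginter \<delta> \<gamma>"
  by (auto simp: ginter_def zset_zinter intro!: zset_eqD)

lemma ginter_self: "ginter \<gamma> \<gamma> = \<gamma>"
  by (auto simp: ginter_def zset_zinter prod_eq_iff intro!: zset_eqD)

lemma hpol_nonzero [simp]: "hpol \<alpha> \<gamma> \<noteq> 0"
  by (auto simp: hpol_def simp del: mult_pCons_left mult_pCons_right)

lemma hpol_zero [simp]: "hpol \<alpha> 0 = 1"
  by (simp add: hpol_def zset_zero)

text \<open>
  Both sides are the product of the linear factors whose index lies in at least two of the three sets.
\<close>

lemma hpol_cocycle:
  "hpol \<alpha> (ginter \<gamma> \<delta>) * hpol \<alpha> (ginter (\<gamma> + \<delta>) \<epsilon>) = hpol \<alpha> (ginter \<delta> \<epsilon>) * hpol \<alpha> (ginter \<gamma> (\<delta> + \<epsilon>))"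
proof -
  have *: "(\<Prod>j\<in>zset (zinter I J). g j) * (\<Prod>j\<in>zset (zinter (I + J) K). g j) =
      (\<Prod>j\<in>zset (zinter J K). g j) * (\<Prod>j\<in>zset (zinter I (J + K)). g j)" for I J K :: zfin and g :: "int \<Rightarrow> 'a poly"
  proof -
    let ?M = "(zset I \<inter> zset J) \<union> (zset J \<inter> zset K) \<union> (zset I \<inter> zset K)"
    have "(\<Prod>j\<in>zset (zinter I J). g j) * (\<Prod>j\<in>zset (zinter (I + J) K). g j) = (\<Prod>j\<in>?M. g j)"
      by (subst prod.union_disjoint[symmetric]) (auto simp: zset_zinter zset_plus intro!: prod.cong)
    moreover have "(\<Prod>j\<in>zset (zinter J K). g j) * (\<Prod>j\<in>zset (zinter I (J + K)). g j) = (\<Prod>j\<in>?M. g j)"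
      by (subst prod.union_disjoint[symmetric]) (auto simp: zset_zinter zset_plus intro!: prod.cong)
    ultimately show ?thesis by simp
  qed
  have "(a * c) * (b * d) = (a' * c') * (b' * d')" if "a * b = a' * b'" "c * d = c' * d'" for a b c d a' b' c' d' :: "'a poly"
    using arg_cong2[OF that, of "(*)"] by (simp only: ac_simps)
  from this[OF *[of "lin 0" "fst \<gamma>" "fst \<delta>" "fst \<epsilon>"] *[of "lin \<alpha>" "snd \<gamma>" "snd \<delta>" "snd \<epsilon>"]]
  show ?thesis unfolding hpol_def ginter_def fst_conv snd_conv fst_add snd_add .
qed

text \<open>
  The linear factors whose index lies in both sets occur twice.
\<close>

lemma hpol_mult: "hpol \<alpha> \<gamma> * hpol \<alpha> \<delta> = hpol \<alpha> (\<gamma> + \<delta>) * hpol \<alpha> (ginter \<gamma> \<delta>) * hpol \<alpha> (ginter \<gamma> \<delta>)"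
proof -
  have *: "(\<Prod>j\<in>zset I. g j) * (\<Prod>j\<in>zset J. g j) =
      (\<Prod>j\<in>zset (I + J). g j) * (\<Prod>j\<in>zset (zinter I J). g j) * (\<Prod>j\<in>zset (zinter I J). g j)"
    for I J :: zfin and g :: "int \<Rightarrow> 'a poly"
  proof -
    let ?X = "zset I \<inter> zset J"
    have "(\<Prod>j\<in>zset I. g j) = (\<Prod>j\<in>zset I - zset J. g j) * (\<Prod>j\<in>?X. g j)"
      by (subst prod.union_disjoint[symmetric]) (auto intro!: prod.cong)
    moreover have "(\<Prod>j\<in>zset J. g j) = (\<Prod>j\<in>zset J - zset I. g j) * (\<Prod>j\<in>?X. g j)"
      by (subst prod.union_disjoint[symmetric]) (auto intro!: prod.cong)
    moreover have "(\<Prod>j\<in>zset (I + J). g j) = (\<Prod>j\<in>zset I - zset J. g j) * (\<Prod>j\<in>zset J - zset I. g j)"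
      unfolding zset_plus by (subst prod.union_disjoint) auto
    ultimately show ?thesis by (simp add: zset_zinter ac_simps)
  qed
  have "(a * c) * (b * d) = (x * y) * (x' * y') * (x' * y')" if "a * b = x * x' * x'" "c * d = y * y' * y'"
    for a b c d x y x' y' :: "'a poly"
    using arg_cong2[OF that, of "(*)"] by (simp only: ac_simps)
  from this[OF *[of "lin 0" "fst \<gamma>" "fst \<delta>"] *[of "lin \<alpha>" "snd \<gamma>" "snd \<delta>"]]
  show ?thesis unfolding hpol_def ginter_def fst_conv snd_conv fst_add snd_add .
qed

text \<open>The multiplication of \<open>D\<close> in terms of the rational functions by which morphisms act.\<close>

definition mu :: "'k::field_char_0 \<Rightarrow> gam \<Rightarrow> gam \<Rightarrow> 'k poly fract \<Rightarrow> 'k poly fract \<Rightarrow> 'k poly fract" where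
  "mu \<alpha> \<gamma> \<delta> a b = a * b * inverse (to_fract (hpol \<alpha> (ginter \<gamma> \<delta>)))"

interpretation dt: twist "mu \<alpha>" "1 :: 'k::field_char_0 poly fract" for \<alpha> :: "'k::field_char_0"
proof
  fix \<gamma> \<delta> \<epsilon> :: gam and a b c :: "'k poly fract"
  show "mu \<alpha> (\<gamma> + \<delta>) \<epsilon> (mu \<alpha> \<gamma> \<delta> a b) c = mu \<alpha> \<gamma> (\<delta> + \<epsilon>) a (mu \<alpha> \<delta> \<epsilon> b c)"
  proof -
    have "inverse (to_fract (hpol \<alpha> (ginter \<gamma> \<delta>))) * inverse (to_fract (hpol \<alpha> (ginter (\<gamma> + \<delta>) \<epsilon>))) =
      inverse (to_fract (hpol \<alpha> (ginter \<delta> \<epsilon>))) * inverse (to_fract (hpol \<alpha> (ginter \<gamma> (\<delta> + \<epsilon>))))"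
      unfolding inverse_mult_distrib[symmetric] to_fract_mult[symmetric] hpol_cocycle ..
    then show ?thesis by (simp add: mu_def ac_simps)
  qed
  have z: "ginter 0 \<gamma> = 0" "ginter \<gamma> 0 = 0"
    by (auto simp: ginter_def zset_zinter zset_zero prod_eq_iff intro!: zset_eqD)
  show "mu \<alpha> 0 \<gamma> 1 b = b" "mu \<alpha> \<gamma> 0 a 1 = a" by (simp_all add: mu_def z)
qed (simp_all add: mu_def algebra_simps)

lemma mu_commute: "mu \<alpha> \<gamma> \<delta> a b = mu \<alpha> \<delta> \<gamma> b a"
  by (simp add: mu_def ginter_commute[of \<gamma>] ac_simps)

definition dset :: "'k::field_char_0 \<Rightarrow> (gam \<Rightarrow>\<^sub>0 'k poly fract) set" where
  "dset \<alpha> = {v. \<forall>\<gamma>. \<exists>u. Poly_Mapping.lookup v \<gamma> = to_fract (u * hpol \<alpha> \<gamma>)}"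

definition D_of :: "'k::field_char_0 \<Rightarrow> (gam \<Rightarrow>\<^sub>0 'k poly fract) \<Rightarrow> gam \<Rightarrow> 'k skewl \<Rightarrow> 'k skewl" where
  "D_of \<alpha> v = (\<lambda>\<gamma>. \<lambda>p\<in>Asub \<alpha>. kz_mult (Poly_Mapping.lookup v \<gamma>) p)"

lemma dset_single: "Poly_Mapping.single \<gamma> (to_fract (u * hpol \<alpha> \<gamma>)) \<in> dset \<alpha>"
proof -
  have "\<exists>w. Poly_Mapping.lookup (Poly_Mapping.single \<gamma> (to_fract (u * hpol \<alpha> \<gamma>))) \<delta> = to_fract (w * hpol \<alpha> \<delta>)" for \<delta>
    by (cases "\<gamma> = \<delta>") (auto simp: lookup_single intro: exI[of _ 0])
  then show ?thesis by (simp add: dset_def)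
qed

lemma dset_zero: "0 \<in> dset \<alpha>"
  by (auto simp: dset_def intro: exI[of _ 0])

lemma dset_add: "v \<in> dset \<alpha> \<Longrightarrow> w \<in> dset \<alpha> \<Longrightarrow> v + w \<in> dset \<alpha>"
proof -
  assume v: "v \<in> dset \<alpha>" and w: "w \<in> dset \<alpha>"
  have "\<exists>u. Poly_Mapping.lookup (v + w) \<gamma> = to_fract (u * hpol \<alpha> \<gamma>)" for \<gamma>
  proof -
    obtain a b where "Poly_Mapping.lookup v \<gamma> = to_fract (a * hpol \<alpha> \<gamma>)" "Poly_Mapping.lookup w \<gamma> = to_fract (b * hpol \<alpha> \<gamma>)"
      using v w unfolding dset_def by blast
    then show ?thesis by (intro exI[of _ "a + b"]) (simp add: lookup_add distrib_right)
  qed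
  then show "v + w \<in> dset \<alpha>" by (simp add: dset_def)
qed

lemma dset_uminus: "v \<in> dset \<alpha> \<Longrightarrow> - v \<in> dset \<alpha>"
proof -
  assume v: "v \<in> dset \<alpha>"
  have "\<exists>u. Poly_Mapping.lookup (- v) \<gamma> = to_fract (u * hpol \<alpha> \<gamma>)" for \<gamma>
  proof -
    obtain a where "Poly_Mapping.lookup v \<gamma> = to_fract (a * hpol \<alpha> \<gamma>)"
      using v unfolding dset_def by blast
    then show ?thesis by (intro exI[of _ "- a"]) simp
  qed
  then show "- v \<in> dset \<alpha>" by (simp add: dset_def)
qed

lemma dset_sum: "(\<And>i. i \<in> I \<Longrightarrow> g i \<in> dset \<alpha>) \<Longrightarrow> sum g I \<in> dset \<alpha>"
  by (induction I rule: infinite_finite_induct) (auto simp: dset_zero dset_add)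

lemma mu_hpol:
  "mu \<alpha> \<gamma> \<delta> (to_fract (u * hpol \<alpha> \<gamma>)) (to_fract (v * hpol \<alpha> \<delta>)) =
    to_fract (u * v * hpol \<alpha> (ginter \<gamma> \<delta>) * hpol \<alpha> (\<gamma> + \<delta>))"
proof -
  have "u * hpol \<alpha> \<gamma> * (v * hpol \<alpha> \<delta>) = u * v * (hpol \<alpha> \<gamma> * hpol \<alpha> \<delta>)" by (simp add: ac_simps)
  also have "\<dots> = u * v * hpol \<alpha> (ginter \<gamma> \<delta>) * hpol \<alpha> (\<gamma> + \<delta>) * hpol \<alpha> (ginter \<gamma> \<delta>)"
    by (subst hpol_mult) (simp only: ac_simps)
  finally have "to_fract (u * hpol \<alpha> \<gamma>) * to_fract (v * hpol \<alpha> \<delta>) =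
      to_fract (u * v * hpol \<alpha> (ginter \<gamma> \<delta>) * hpol \<alpha> (\<gamma> + \<delta>)) * to_fract (hpol \<alpha> (ginter \<gamma> \<delta>))"
    by (simp only: to_fract_mult[symmetric])
  moreover have "x * inverse h = y" if "x = y * h" "h \<noteq> 0" for x y h :: "'a poly fract"
    using that by (simp add: mult.assoc)
  ultimately show ?thesis unfolding mu_def by (metis hpol_nonzero to_fract_eq_0_iff)
qed

lemma dset_tconv:
  assumes "v \<in> dset \<alpha>" "w \<in> dset \<alpha>"
  shows "tconv (mu \<alpha>) v w \<in> dset \<alpha>"
  unfolding tconv_def
proof (intro dset_sum)
  fix \<gamma> \<delta>
  obtain u u' where "Poly_Mapping.lookup v \<gamma> = to_fract (u * hpol \<alpha> \<gamma>)"
    "Poly_Mapping.lookup w \<delta> = to_fract (u' * hpol \<alpha> \<delta>)"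
    using assms unfolding dset_def by blast
  then show "Poly_Mapping.single (\<gamma> + \<delta>) (mu \<alpha> \<gamma> \<delta> (Poly_Mapping.lookup v \<gamma>) (Poly_Mapping.lookup w \<delta>)) \<in> dset \<alpha>"
    unfolding mu_hpol by (simp only: mu_hpol dset_single)
qed

lemma one_in_Asub: "1 \<in> Asub \<alpha>"
  using single_in_gwa_sub[of 0 1 "falpha \<alpha>"] by simp

lemma D_of_lookup: "Poly_Mapping.lookup (D_of \<alpha> v \<gamma> 1) 0 = Poly_Mapping.lookup v \<gamma>"
  using one_in_Asub[of \<alpha>] by (simp add: D_of_def kz_mult_def)

lemma D_of_inject: "D_of \<alpha> v = D_of \<alpha> w \<Longrightarrow> v = w"
  by (rule poly_mapping_eqI) (metis D_of_lookup)

lemma D_of_zero_iff: "D_of \<alpha> v \<gamma> = D_zero \<alpha> \<longleftrightarrow> Poly_Mapping.lookup v \<gamma> = 0"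
proof
  assume "D_of \<alpha> v \<gamma> = D_zero \<alpha>"
  then show "Poly_Mapping.lookup v \<gamma> = 0"
    using D_of_lookup[of \<alpha> v \<gamma>] one_in_Asub[of \<alpha>] by (simp add: D_zero_def)
next
  assume "Poly_Mapping.lookup v \<gamma> = 0"
  then show "D_of \<alpha> v \<gamma> = D_zero \<alpha>"
    by (simp add: D_of_def D_zero_def kz_mult_def skew_mult_zero cong: restrict_cong)
qed

lemma D_supp_D_of: "D_supp \<alpha> (D_of \<alpha> v) = Poly_Mapping.keys v"
  by (auto simp: D_supp_def D_of_zero_iff in_keys_iff)

lemma D_single_eq_D_of: "D_single \<alpha> \<gamma> (\<lambda>p\<in>Asub \<alpha>. kz_mult r p) = D_of \<alpha> (Poly_Mapping.single \<gamma> r)"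
  by (auto simp: D_single_def D_of_def D_zero_def kz_mult_def skew_mult_zero lookup_single fun_eq_iff)

definition D_val :: "'k::field_char_0 \<Rightarrow> (gam \<Rightarrow> 'k skewl \<Rightarrow> 'k skewl) \<Rightarrow> (gam \<Rightarrow>\<^sub>0 'k poly fract)" where
  "D_val \<alpha> = inv_into UNIV (D_of \<alpha>)"

lemma D_val_D_of [simp]: "D_val \<alpha> (D_of \<alpha> v) = v"
  unfolding D_val_def using D_of_inject by (intro inv_f_f injI)

context
  fixes \<alpha> :: "'k::field_char_0"
  assumes alpha: "\<alpha> \<notin> \<int>"
begin

lemma iota_Asub:
  "\<exists>p. iota \<alpha> \<gamma> (Asub \<alpha>) = Pl p \<and> p 0 = hpol \<alpha> \<gamma> \<and> Pl p \<subseteq> Asub \<alpha> \<and>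
    (\<forall>q\<in>Asub \<alpha>. kz_mult (to_fract (hpol \<alpha> \<gamma>)) q \<in> Pl p)"
  using iota_Pl[OF alpha good_apol, of \<gamma>] unfolding gwa_sub_eq_Pl by auto

lemma Pl_kz_mult: "q \<in> Pl p \<Longrightarrow> kz_mult (to_fract u) q \<in> Pl p"
proof -
  assume q: "q \<in> Pl p"
  have "\<exists>w. Poly_Mapping.lookup (kz_mult (to_fract u) q) n = to_fract (w * p n)" for n
  proof -
    obtain w where "Poly_Mapping.lookup q n = to_fract (w * p n)" using q unfolding Pl_def by blast
    then show ?thesis
      by (intro exI[of _ "u * w"]) (simp only: lookup_kz_mult to_fract_mult mult.assoc)
  qed
  then show "kz_mult (to_fract u) q \<in> Pl p" by (simp add: Pl_def)
qed

text \<open>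
  A morphism out of \<open>A\<close> is left multiplication by the image of \<open>1\<close>, so \<open>D\<^sub>\<gamma>\<close> is the degree zero part
  of \<open>\<iota>\<^sub>\<gamma> A\<close>, which is \<open>h\<^sub>\<gamma> k[z]\<close>.
\<close>

lemma D_hom_iff: "d \<in> D_hom \<alpha> \<gamma> \<longleftrightarrow> (\<exists>u. d = (\<lambda>q\<in>Asub \<alpha>. kz_mult (to_fract (u * hpol \<alpha> \<gamma>)) q))"
proof -
  obtain p where *: "iota \<alpha> \<gamma> (Asub \<alpha>) = Pl p \<and> p 0 = hpol \<alpha> \<gamma> \<and> Pl p \<subseteq> Asub \<alpha> \<and>
    (\<forall>q\<in>Asub \<alpha>. kz_mult (to_fract (hpol \<alpha> \<gamma>)) q \<in> Pl p)"
    using iota_Asub ..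
  note p = *[THEN conjunct1] *[THEN conjunct2, THEN conjunct1] *[THEN conjunct2, THEN conjunct2, THEN conjunct2, rule_format]
  let ?f = "falpha \<alpha>"
  show ?thesis
  proof
    assume d: "d \<in> D_hom \<alpha> \<gamma>"
    then have dh: "d \<in> gr_hom (gwa ?f) (submod ?f (Asub \<alpha>)) (submod ?f (Pl p))" by (simp add: D_hom_def p)
    have "(1 :: 'k skewl) \<in> range (Poly_Mapping.single 0)" by (metis rangeI single_one)
    then have "d 1 \<in> gcomp (submod ?f (Pl p)) 0" using one_in_Asub[of \<alpha>] by (intro gr_hom_deg[OF dh]) simp
    then obtain r where r: "d 1 = Poly_Mapping.single 0 r" "Poly_Mapping.single 0 r \<in> Pl p" by auto
    obtain u where u: "r = to_fract (u * p 0)" using r(2) unfolding Pl_single_iff by blast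
    have "d q = kz_mult r q" if q: "q \<in> Asub \<alpha>" for q
    proof -
      obtain C where C: "C \<in> carrier (gwa ?f)" "gwa_val ?f C = q" using gwa_sub_ex[OF q] .
      show ?thesis
        using gr_hom_ract[OF dh, of 1 C] one_in_Asub[of \<alpha>] C r(1) by (simp add: kz_mult_def)
    qed
    then have "d = (\<lambda>q\<in>Asub \<alpha>. kz_mult (to_fract (u * hpol \<alpha> \<gamma>)) q)"
      using gr_hom_extensional[OF dh] unfolding u p(2) by (auto simp: extensional_def fun_eq_iff)
    then show "\<exists>u. d = (\<lambda>q\<in>Asub \<alpha>. kz_mult (to_fract (u * hpol \<alpha> \<gamma>)) q)" by blast
  next
    assume "\<exists>u. d = (\<lambda>q\<in>Asub \<alpha>. kz_mult (to_fract (u * hpol \<alpha> \<gamma>)) q)"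
    then obtain u where d: "d = (\<lambda>q\<in>Asub \<alpha>. kz_mult (to_fract (u * hpol \<alpha> \<gamma>)) q)" by blast
    have in_P: "kz_mult (to_fract (u * hpol \<alpha> \<gamma>)) q \<in> Pl p" if "q \<in> Asub \<alpha>" for q
      using Pl_kz_mult[OF p(3)[OF that], of u] by (simp add: kz_mult_kz_mult to_fract_mult)
    have mult: "skew_mult q (gwa_val ?f C) \<in> Asub \<alpha>" if "q \<in> Asub \<alpha>" "C \<in> carrier (gwa ?f)" for q C
      using good_skew_mult[OF alpha good_apol, of q "gwa_val ?f C"] that by (auto simp: gwa_sub_eq_Pl[symmetric] gwa_sub_def)
    have "d \<in> gr_hom (gwa ?f) (submod ?f (Asub \<alpha>)) (submod ?f (Pl p))"
    proof (rule gr_homI)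
      fix n q assume q: "q \<in> gcomp (submod ?f (Asub \<alpha>)) n"
      then obtain r where r: "q = Poly_Mapping.single n r" by auto
      have "kz_mult (to_fract (u * hpol \<alpha> \<gamma>)) q = Poly_Mapping.single n (to_fract (u * hpol \<alpha> \<gamma>) * r)"
        unfolding r by (simp add: kz_mult_def skew_mult_single)
      then show "d q \<in> gcomp (submod ?f (Pl p)) n" using q in_P[of q] by (auto simp: d)
    qed (use Pl_add[of _ "apol ?f"] in_P mult in
        \<open>auto simp: d kz_mult_add kz_mult_skew_mult simp flip: gwa_sub_eq_Pl\<close>)
    then show "d \<in> D_hom \<alpha> \<gamma>" by (simp add: D_hom_def p)
  qed
qed

lemma D_carrier_eq: "D_carrier \<alpha> = D_of \<alpha> ` dset \<alpha>"
proof (intro equalityI subsetI)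
  fix d assume d: "d \<in> D_carrier \<alpha>"
  then have "\<forall>\<gamma>. \<exists>u. d \<gamma> = (\<lambda>q\<in>Asub \<alpha>. kz_mult (to_fract (u * hpol \<alpha> \<gamma>)) q)"
    unfolding D_carrier_def D_hom_iff by blast
  then obtain u where u: "\<And>\<gamma>. d \<gamma> = (\<lambda>q\<in>Asub \<alpha>. kz_mult (to_fract (u \<gamma> * hpol \<alpha> \<gamma>)) q)" by metis
  have supp: "d \<gamma> \<noteq> D_zero \<alpha>" if "to_fract (u \<gamma> * hpol \<alpha> \<gamma>) \<noteq> 0" for \<gamma>
  proof
    assume "d \<gamma> = D_zero \<alpha>"
    then have "d \<gamma> 1 = 0" using one_in_Asub[of \<alpha>] by (simp add: D_zero_def)
    then have "Poly_Mapping.lookup (d \<gamma> 1) 0 = 0" by simp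
    then show False using that one_in_Asub[of \<alpha>] by (simp add: u lookup_kz_mult lookup_one)
  qed
  have fin: "finite {\<gamma>. to_fract (u \<gamma> * hpol \<alpha> \<gamma>) \<noteq> 0}"
    by (rule finite_subset[of _ "D_supp \<alpha> d"]) (use d supp in \<open>auto simp: D_supp_def D_carrier_def\<close>)
  define v where "v = Abs_poly_mapping (\<lambda>\<gamma>. to_fract (u \<gamma> * hpol \<alpha> \<gamma>))"
  have v: "Poly_Mapping.lookup v \<gamma> = to_fract (u \<gamma> * hpol \<alpha> \<gamma>)" for \<gamma>
    unfolding v_def by (subst lookup_Abs_poly_mapping[OF fin]) simp
  have "d = D_of \<alpha> v" unfolding D_of_def v by (rule ext) (simp add: u)
  moreover have "v \<in> dset \<alpha>" unfolding dset_def mem_Collect_eq v by blast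
  ultimately show "d \<in> D_of \<alpha> ` dset \<alpha>" by blast
next
  fix d assume "d \<in> D_of \<alpha> ` dset \<alpha>"
  then obtain v where v: "d = D_of \<alpha> v" "v \<in> dset \<alpha>" by blast
  have "d \<gamma> \<in> D_hom \<alpha> \<gamma>" for \<gamma>
  proof -
    obtain u where "Poly_Mapping.lookup v \<gamma> = to_fract (u * hpol \<alpha> \<gamma>)" using v(2) unfolding dset_def by blast
    then show ?thesis unfolding D_hom_iff v(1) D_of_def by auto
  qed
  moreover have "finite (D_supp \<alpha> d)" unfolding v(1) D_supp_D_of by simp
  ultimately show "d \<in> D_carrier \<alpha>" by (simp add: D_carrier_def)
qed

text \<open>
  Up to the restrictions of domain, the product of left multiplications by \<open>a \<in> D\<^sub>\<gamma>\<close> and \<open>b \<in> D\<^sub>\<delta>\<close> is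
  left multiplication by \<open>a b / h\<close>, where \<open>h\<close> belongs to the intersection of \<open>\<gamma>\<close> and \<open>\<delta>\<close>. The domains do not interfere:
  \<open>\<iota>\<^sub>\<epsilon> P\<close> contains \<open>h\<^sub>\<epsilon> P\<close> for all the projectives involved.
\<close>

lemma D_mult_eq:
  assumes q: "q \<in> Asub \<alpha>"
  shows "D_mult \<alpha> \<gamma> \<delta> (\<lambda>p\<in>Asub \<alpha>. kz_mult (to_fract (u * hpol \<alpha> \<gamma>)) p)
      (\<lambda>p\<in>Asub \<alpha>. kz_mult (to_fract (v * hpol \<alpha> \<delta>)) p) q =
    kz_mult (mu \<alpha> \<gamma> \<delta> (to_fract (u * hpol \<alpha> \<gamma>)) (to_fract (v * hpol \<alpha> \<delta>))) q"
proof -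
  let ?\<epsilon> = "ginter \<delta> \<gamma>"
  obtain pd where *: "iota \<alpha> \<delta> (Asub \<alpha>) = Pl pd \<and> pd 0 = hpol \<alpha> \<delta> \<and> Pl pd \<subseteq> Asub \<alpha> \<and>
    (\<forall>q\<in>Asub \<alpha>. kz_mult (to_fract (hpol \<alpha> \<delta>)) q \<in> Pl pd)"
    using iota_Asub ..
  note pd = *[THEN conjunct1] *[THEN conjunct2, THEN conjunct2, THEN conjunct1] *[THEN conjunct2, THEN conjunct2, THEN conjunct2, rule_format]
  obtain T1 p1 where "iota \<alpha> ?\<epsilon> (Pl (apol (falpha \<alpha>))) = Pl p1" "good \<alpha> T1 p1" "Pl p1 \<subseteq> Pl (apol (falpha \<alpha>))"
    "\<And>q. q \<in> Pl (apol (falpha \<alpha>)) \<Longrightarrow> kz_mult (to_fract (hpol \<alpha> ?\<epsilon>)) q \<in> Pl p1"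
    using iota_Pl[OF alpha good_apol, of ?\<epsilon>] by blast
  note p1 = this[folded gwa_sub_eq_Pl]
  obtain T2 p2 where p2: "iota \<alpha> ?\<epsilon> (Pl p1) = Pl p2" "good \<alpha> T2 p2" "Pl p2 \<subseteq> Pl p1"
    "\<And>q. q \<in> Pl p1 \<Longrightarrow> kz_mult (to_fract (hpol \<alpha> ?\<epsilon>)) q \<in> Pl p2"
    using iota_Pl[OF alpha p1(2), of ?\<epsilon>] by blast
  obtain T3 p3 where p3: "iota \<alpha> (\<delta> + \<gamma>) (Pl p2) = Pl p3" "good \<alpha> T3 p3" "Pl p3 \<subseteq> Pl p2"
    "\<And>q. q \<in> Pl p2 \<Longrightarrow> kz_mult (to_fract (hpol \<alpha> (\<delta> + \<gamma>))) q \<in> Pl p3"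
    using iota_Pl[OF alpha p2(2), of "\<delta> + \<gamma>"] by blast
  have b: "kz_mult (to_fract (v * hpol \<alpha> \<delta>)) q \<in> Pl pd"
    using Pl_kz_mult[OF pd(3)[OF q], of v] by (simp add: kz_mult_kz_mult to_fract_mult)
  define r where "r = kz_mult (to_fract (u * hpol \<alpha> \<gamma> * (v * hpol \<alpha> \<delta>))) q"
  have "u * hpol \<alpha> \<gamma> * (v * hpol \<alpha> \<delta>) = (u * v) * (hpol \<alpha> \<delta> * hpol \<alpha> \<gamma>)" by (simp add: ac_simps)
  also have "\<dots> = (u * v) * (hpol \<alpha> (\<delta> + \<gamma>) * (hpol \<alpha> ?\<epsilon> * hpol \<alpha> ?\<epsilon>))" by (subst hpol_mult) (simp only: ac_simps)
  finally have e: "u * hpol \<alpha> \<gamma> * (v * hpol \<alpha> \<delta>) = (u * v) * (hpol \<alpha> (\<delta> + \<gamma>) * (hpol \<alpha> ?\<epsilon> * hpol \<alpha> ?\<epsilon>))" .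
  have r: "r = kz_mult (to_fract (u * v)) (kz_mult (to_fract (hpol \<alpha> (\<delta> + \<gamma>)))
      (kz_mult (to_fract (hpol \<alpha> ?\<epsilon>)) (kz_mult (to_fract (hpol \<alpha> ?\<epsilon>)) q)))"
    unfolding r_def e by (simp only: kz_mult_kz_mult to_fract_mult mult.assoc)
  have rP: "r \<in> Pl p3" unfolding r by (intro Pl_kz_mult p3(4) p2(4) p1(4) q)
  have rP2: "r \<in> Pl p2" using rP p3(3) by blast
  have "D_mult \<alpha> \<gamma> \<delta> (\<lambda>p\<in>Asub \<alpha>. kz_mult (to_fract (u * hpol \<alpha> \<gamma>)) p)
      (\<lambda>p\<in>Asub \<alpha>. kz_mult (to_fract (v * hpol \<alpha> \<delta>)) p) q = Theta \<alpha> \<delta> \<gamma> r"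
    using q b pd(2) by (auto simp: D_mult_def compose_def iota_mor_def pd(1) r_def kz_mult_kz_mult to_fract_mult)
  also have "\<dots> = kz_mult (inverse (hfun \<alpha> ?\<epsilon>)) r"
    using rP rP2 by (simp add: Theta_def iota_mor_def sigma_map_def p1(1) p2(1) p3(1))
  also have "\<dots> = kz_mult (mu \<alpha> \<gamma> \<delta> (to_fract (u * hpol \<alpha> \<gamma>)) (to_fract (v * hpol \<alpha> \<delta>))) q"
    unfolding r_def kz_mult_kz_mult hfun_hpol mu_def ginter_commute[of \<delta> \<gamma>] to_fract_mult by (simp add: ac_simps)
  finally show ?thesis .
qed

lemma D_simps:
  "carrier (D_ring \<alpha>) = D_of \<alpha> ` dset \<alpha>" "\<zero>\<^bsub>D_ring \<alpha>\<^esub> = D_of \<alpha> 0"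
  "\<one>\<^bsub>D_ring \<alpha>\<^esub> = D_of \<alpha> (Poly_Mapping.single 0 1)"
  "scal (D_ring \<alpha>) c = D_of \<alpha> (Poly_Mapping.single 0 (to_fract [:c:]))"
proof -
  show "carrier (D_ring \<alpha>) = D_of \<alpha> ` dset \<alpha>" by (simp add: D_ring_def D_carrier_eq)
  show "\<zero>\<^bsub>D_ring \<alpha>\<^esub> = D_of \<alpha> 0"
    by (auto simp: D_ring_def D_of_def D_zero_def kz_mult_def skew_mult_zero fun_eq_iff)
  have "(\<lambda>p\<in>Asub \<alpha>. p) = (\<lambda>p\<in>Asub \<alpha>. kz_mult 1 p)" by (auto simp: kz_mult_def)
  then show "\<one>\<^bsub>D_ring \<alpha>\<^esub> = D_of \<alpha> (Poly_Mapping.single 0 1)"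
    by (simp add: D_ring_def D_single_eq_D_of del: single_one)
  show "scal (D_ring \<alpha>) c = D_of \<alpha> (Poly_Mapping.single 0 (to_fract [:c:]))"
    by (simp add: D_ring_def D_single_eq_D_of to_fract_def)
qed

lemma D_add: "D_of \<alpha> v \<oplus>\<^bsub>D_ring \<alpha>\<^esub> D_of \<alpha> w = D_of \<alpha> (v + w)"
proof -
  have "kz_mult (a + b) q = kz_mult a q + kz_mult b q" for a b and q :: "'k skewl"
    by (rule poly_mapping_eqI) (simp add: lookup_kz_mult lookup_add algebra_simps)
  then show ?thesis by (auto simp: D_ring_def D_of_def lookup_add fun_eq_iff)
qed

lemma D_mult_D_of:
  assumes v: "v \<in> dset \<alpha>" and w: "w \<in> dset \<alpha>"
  shows "D_of \<alpha> v \<otimes>\<^bsub>D_ring \<alpha>\<^esub> D_of \<alpha> w = D_of \<alpha> (tconv (mu \<alpha>) v w)"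
proof (rule ext, rule ext)
  fix \<epsilon> and q :: "'k skewl"
  let ?L = Poly_Mapping.lookup
  let ?P = "{(\<gamma>, \<delta>). \<gamma> \<in> Poly_Mapping.keys v \<and> \<delta> \<in> Poly_Mapping.keys w \<and> \<gamma> + \<delta> = \<epsilon>}"
  have kz_sum: "kz_mult (sum g A) q = (\<Sum>a\<in>A. kz_mult (g a) q)" if "finite A"
    for g and A :: "(gam \<times> gam) set"
    by (rule poly_mapping_eqI) (simp add: lookup_kz_mult lookup_sum sum_distrib_right)
  have fin: "finite ?P" by (rule finite_subset[of _ "Poly_Mapping.keys v \<times> Poly_Mapping.keys w"]) auto
  have L: "?L (tconv (mu \<alpha>) v w) \<epsilon> = (\<Sum>(\<gamma>, \<delta>)\<in>?P. mu \<alpha> \<gamma> \<delta> (?L v \<gamma>) (?L w \<delta>))"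
  proof -
    have "?L (tconv (mu \<alpha>) v w) \<epsilon> = (\<Sum>(\<gamma>, \<delta>)\<in>Poly_Mapping.keys v \<times> Poly_Mapping.keys w.
        if \<gamma> + \<delta> = \<epsilon> then mu \<alpha> \<gamma> \<delta> (?L v \<gamma>) (?L w \<delta>) else 0)"
      by (simp add: tconv_def lookup_sum lookup_single when_def sum.cartesian_product case_prod_unfold)
    also have "\<dots> = (\<Sum>(\<gamma>, \<delta>)\<in>?P. mu \<alpha> \<gamma> \<delta> (?L v \<gamma>) (?L w \<delta>))"
      by (rule sum.mono_neutral_cong_right) (auto split: if_splits)
    finally show ?thesis .
  qed
  show "(D_of \<alpha> v \<otimes>\<^bsub>D_ring \<alpha>\<^esub> D_of \<alpha> w) \<epsilon> q = D_of \<alpha> (tconv (mu \<alpha>) v w) \<epsilon> q"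
  proof (cases "q \<in> Asub \<alpha>")
    case True
    have "D_mult \<alpha> \<gamma> \<delta> (D_of \<alpha> v \<gamma>) (D_of \<alpha> w \<delta>) q = kz_mult (mu \<alpha> \<gamma> \<delta> (?L v \<gamma>) (?L w \<delta>)) q" for \<gamma> \<delta>
    proof -
      obtain u u' where "?L v \<gamma> = to_fract (u * hpol \<alpha> \<gamma>)" "?L w \<delta> = to_fract (u' * hpol \<alpha> \<delta>)"
        using v w unfolding dset_def by blast
      then show ?thesis using D_mult_eq[OF True, of \<gamma> \<delta> u u'] by (simp add: D_of_def)
    qed
    then have "(D_of \<alpha> v \<otimes>\<^bsub>D_ring \<alpha>\<^esub> D_of \<alpha> w) \<epsilon> q = (\<Sum>(\<gamma>, \<delta>)\<in>?P. kz_mult (mu \<alpha> \<gamma> \<delta> (?L v \<gamma>) (?L w \<delta>)) q)"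
      using True by (simp add: D_ring_def D_supp_D_of)
    also have "\<dots> = kz_mult (?L (tconv (mu \<alpha>) v w) \<epsilon>) q"
      unfolding L kz_sum[OF fin] by (simp add: case_prod_unfold)
    finally show ?thesis using True by (simp add: D_of_def)
  next
    case False
    then show ?thesis by (simp add: D_ring_def D_of_def)
  qed
qed

lemma D_hcomp: "hcomp (D_ring \<alpha>) \<gamma> = (\<lambda>u. D_of \<alpha> (Poly_Mapping.single \<gamma> (to_fract (u * hpol \<alpha> \<gamma>)))) ` UNIV"
proof -
  have "D_hom \<alpha> \<gamma> = range (\<lambda>u. \<lambda>q\<in>Asub \<alpha>. kz_mult (to_fract (u * hpol \<alpha> \<gamma>)) q)"
    unfolding set_eq_iff D_hom_iff by blast
  then show ?thesis by (simp add: D_ring_def image_image D_single_eq_D_of)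
qed

lemma graded_ring_D: "graded_ring (D_ring \<alpha>)"
proof (rule dt.graded_ring_of_embedding[where V = "D_val \<alpha>"])
  show "inj_on (D_val \<alpha>) (carrier (D_ring \<alpha>))" by (rule inj_onI) (auto simp: D_simps)
  show "a \<oplus>\<^bsub>D_ring \<alpha>\<^esub> b \<in> carrier (D_ring \<alpha>)" "D_val \<alpha> (a \<oplus>\<^bsub>D_ring \<alpha>\<^esub> b) = D_val \<alpha> a + D_val \<alpha> b"
    "a \<otimes>\<^bsub>D_ring \<alpha>\<^esub> b \<in> carrier (D_ring \<alpha>)" "D_val \<alpha> (a \<otimes>\<^bsub>D_ring \<alpha>\<^esub> b) = tconv (mu \<alpha>) (D_val \<alpha> a) (D_val \<alpha> b)"
    if "a \<in> carrier (D_ring \<alpha>)" "b \<in> carrier (D_ring \<alpha>)" for a b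
    using that unfolding D_simps by (auto simp: D_add D_mult_D_of dset_add dset_tconv)
  show "\<exists>b\<in>carrier (D_ring \<alpha>). D_val \<alpha> b = - D_val \<alpha> a" if "a \<in> carrier (D_ring \<alpha>)" for a
    using that unfolding D_simps by (auto intro: dset_uminus bexI[of _ "D_of \<alpha> (- _)"])
  have part: "Poly_Mapping.single g (Poly_Mapping.lookup v g) \<in> dset \<alpha>" if v: "v \<in> dset \<alpha>" for v g
  proof -
    obtain u where "Poly_Mapping.lookup v g = to_fract (u * hpol \<alpha> g)" using v unfolding dset_def by blast
    then show ?thesis using dset_single by metis
  qed
  show "\<exists>b\<in>carrier (D_ring \<alpha>). D_val \<alpha> b = Poly_Mapping.single g (Poly_Mapping.lookup (D_val \<alpha> a) g)"
    if a: "a \<in> carrier (D_ring \<alpha>)" for a g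
  proof -
    obtain v where v: "a = D_of \<alpha> v" "v \<in> dset \<alpha>" using a unfolding D_simps by blast
    have "D_of \<alpha> (Poly_Mapping.single g (Poly_Mapping.lookup v g)) \<in> carrier (D_ring \<alpha>)"
      unfolding D_simps(1) by (rule imageI[OF part[OF v(2)]])
    then show ?thesis by (rule bexI[rotated]) (simp only: v(1) D_val_D_of)
  qed
  show "hcomp (D_ring \<alpha>) g = {a \<in> carrier (D_ring \<alpha>). Poly_Mapping.keys (D_val \<alpha> a) \<subseteq> {g}}" for g
  proof (intro equalityI subsetI)
    fix a assume "a \<in> hcomp (D_ring \<alpha>) g"
    then obtain u where a: "a = D_of \<alpha> (Poly_Mapping.single g (to_fract (u * hpol \<alpha> g)))" unfolding D_hcomp by blast
    have "a \<in> carrier (D_ring \<alpha>)" unfolding D_simps(1) a by (rule imageI[OF dset_single])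
    then show "a \<in> {a \<in> carrier (D_ring \<alpha>). Poly_Mapping.keys (D_val \<alpha> a) \<subseteq> {g}}"
      by (simp only: a D_val_D_of) simp
  next
    fix a assume "a \<in> {a \<in> carrier (D_ring \<alpha>). Poly_Mapping.keys (D_val \<alpha> a) \<subseteq> {g}}"
    then obtain v where v: "a = D_of \<alpha> v" "v \<in> dset \<alpha>" "Poly_Mapping.keys v \<subseteq> {g}" unfolding D_simps by auto
    obtain u where "Poly_Mapping.lookup v g = to_fract (u * hpol \<alpha> g)" using v(2) unfolding dset_def by blast
    then show "a \<in> hcomp (D_ring \<alpha>) g" using keys_subset_single[OF v(3)] unfolding v(1) D_hcomp by auto
  qed
  have one: "Poly_Mapping.single 0 1 \<in> dset \<alpha>" using dset_single[of 0 1 \<alpha>] by simp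
  have sc: "Poly_Mapping.single 0 (to_fract [:c:]) \<in> dset \<alpha>" for c using dset_single[of 0 "[:c:]" \<alpha>] by simp
  show "\<zero>\<^bsub>D_ring \<alpha>\<^esub> \<in> carrier (D_ring \<alpha>)" "\<one>\<^bsub>D_ring \<alpha>\<^esub> \<in> carrier (D_ring \<alpha>)"
    "scal (D_ring \<alpha>) c \<in> carrier (D_ring \<alpha>)" for c
    unfolding D_simps using dset_zero one sc by auto
  show "Poly_Mapping.keys (D_val \<alpha> (scal (D_ring \<alpha>) c)) \<subseteq> {0}" for c unfolding D_simps by simp
  have "tconv (mu \<alpha>) v w = tconv (mu \<alpha>) w v" for v w
  proof (induction v rule: poly_mapping_additive_induct)
    case (single i a)
    show ?case
      by (induction w rule: poly_mapping_additive_induct)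
        (simp_all add: dt.tconv_add_left dt.tconv_add_right dt.tconv_single add.commute mu_commute)
  qed (simp_all add: dt.tconv_add_left dt.tconv_add_right)
  then show "tconv (mu \<alpha>) (D_val \<alpha> (scal (D_ring \<alpha>) c)) (D_val \<alpha> a) = tconv (mu \<alpha>) (D_val \<alpha> a) (D_val \<alpha> (scal (D_ring \<alpha>) c))" for c a .
qed (simp_all add: D_simps del: single_one)

end

section \<open>The algebra inside \<open>D\<close>\<close>

definition initial :: "int \<Rightarrow> zfin" where
  "initial n = Abs_zfin ({0..<n} \<union> {n..<0})"

text \<open>
  The symmetric difference of \<open>initial m\<close> and \<open>initial n\<close> is the interval between \<open>m\<close> and \<open>n\<close>. With
  both components equal, each index \<open>k\<close> contributes the full factor \<open>f(z + k)\<close>.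
\<close>

definition rho :: "int \<Rightarrow> gam" where
  "rho n = (initial n, initial n)"

lemma zset_initial: "zset (initial n) = {0..<n} \<union> {n..<0}"
  by (simp add: initial_def Abs_zfin_inverse)

lemma zset_initial_plus: "zset (initial n + initial m) = {n..<m} \<union> {m..<n}"
  by (auto simp: zset_plus zset_initial)

lemma rho_minus: "rho m - rho n = (initial m + initial n, initial m + initial n)"
  by (simp add: rho_def zfin_minus)

lemma inj_rho: "inj rho"
proof (rule injI)
  fix n m assume "rho n = rho m"
  then have "initial n = initial m" by (simp add: rho_def)
  then have "{n..<m} \<union> {m..<n} = {}" using zset_initial_plus[of n m] zset_initial_plus[of m m] by simp
  then show "n = m" by simp
qed

definition fprod :: "'k::field_char_0 \<Rightarrow> int \<Rightarrow> int \<Rightarrow> 'k poly" where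
  "fprod \<alpha> n m = (\<Prod>k\<in>{n..<m}. tr k (falpha \<alpha>))"

lemma hpol_diagonal: "hpol \<alpha> (I, I) = (\<Prod>k\<in>zset I. tr k (falpha \<alpha>))"
  unfolding hpol_def fst_conv snd_conv tr_falpha prod.distrib ..

lemma hpol_rho: "hpol \<alpha> (rho m - rho n) = fprod \<alpha> m n * fprod \<alpha> n m"
  unfolding rho_minus hpol_diagonal zset_initial_plus fprod_def
  by (rule prod.union_disjoint) auto

text \<open>
  Going from \<open>n\<close> to \<open>r\<close> by way of \<open>m\<close>, an index outside the direct way is passed back and forth, and such
  indices form the intersection of the two intervals; only the steps upwards count in \<open>fprod\<close>.
\<close>

lemma fprod_hpol:
  "fprod \<alpha> n r * hpol \<alpha> (ginter (rho m - rho n) (rho r - rho m)) = fprod \<alpha> n m * fprod \<alpha> m r"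
proof -
  let ?X = "({m..<n} \<union> {n..<m}) \<inter> ({r..<m} \<union> {m..<r})" and ?f = "\<lambda>k. tr k (falpha \<alpha>)"
  have "hpol \<alpha> (ginter (rho m - rho n) (rho r - rho m)) = prod ?f ?X"
    unfolding ginter_def rho_minus fst_conv snd_conv hpol_diagonal zset_zinter zset_initial_plus ..
  moreover have "prod ?f {n..<r} * prod ?f ?X = prod ?f ({n..<r} \<union> ?X)"
    by (rule prod.union_disjoint[symmetric]) auto
  moreover have "{n..<r} \<union> ?X = {n..<m} \<union> {m..<r}"
    by (rule Set.set_eqI) auto
  moreover have "prod ?f ({n..<m} \<union> {m..<r}) = prod ?f {n..<m} * prod ?f {m..<r}"
    by (rule prod.union_disjoint) auto
  ultimately show ?thesis unfolding fprod_def by simp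
qed

text \<open>
  The coefficient is moved to the starting degree \<open>n\<close> by the automorphism \<open>\<sigma>\<^sup>n\<close>. The factor
  \<open>fprod\<close> makes up for the difference between \<open>x\<^sup>j\<close>, which has coefficient \<open>1\<close> in \<open>A\<close>, and the generator of the
  component of \<open>D\<close>, which is a product of translates of \<open>f\<close>; for \<open>j < 0\<close> the powers of \<open>y\<close> already contain it.
\<close>

definition lam :: "'k::field_char_0 \<Rightarrow> int \<Rightarrow> int \<Rightarrow> 'k falg set \<Rightarrow> gam \<Rightarrow> 'k skewl \<Rightarrow> 'k skewl" where
  "lam \<alpha> n j C = D_of \<alpha> (Poly_Mapping.single (rho (n + j) - rho n)
     (zshift n (Poly_Mapping.lookup (gwa_val (falpha \<alpha>) C) j) * to_fract (fprod \<alpha> n (n + j))))"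

lemma gwa_hcomp_iff:
  assumes "f \<noteq> 0"
  shows "C \<in> hcomp (gwa f) j \<longleftrightarrow>
    C \<in> carrier (gwa f) \<and> (\<exists>u. gwa_val f C = Poly_Mapping.single j (to_fract (u * apol f j)))"
proof
  assume "C \<in> hcomp (gwa f) j"
  then have C: "C \<in> carrier (gwa f)" "Poly_Mapping.keys (gwa_val f C) \<subseteq> {j}" unfolding gwa_hcomp[OF assms] by auto
  have "gwa_val f C \<in> gwa_sub f" unfolding gwa_sub_def using C(1) by (rule imageI)
  then obtain u where "Poly_Mapping.lookup (gwa_val f C) j = to_fract (u * apol f j)" unfolding gwa_sub_iff by blast
  then show "C \<in> carrier (gwa f) \<and> (\<exists>u. gwa_val f C = Poly_Mapping.single j (to_fract (u * apol f j)))"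
    using C(1) keys_subset_single[OF C(2)] by metis
next
  assume "C \<in> carrier (gwa f) \<and> (\<exists>u. gwa_val f C = Poly_Mapping.single j (to_fract (u * apol f j)))"
  then show "C \<in> hcomp (gwa f) j" unfolding gwa_hcomp[OF assms] using keys_single by (auto split: if_splits)
qed

lemma lam_eq:
  assumes "gwa_val (falpha \<alpha>) C = Poly_Mapping.single j (to_fract (u * apol (falpha \<alpha>) j))"
  shows "lam \<alpha> n j C = D_of \<alpha> (Poly_Mapping.single (rho (n + j) - rho n)
    (to_fract (tr n u * hpol \<alpha> (rho (n + j) - rho n))))"
proof -
  have "tr n (apol (falpha \<alpha>) j) = fprod \<alpha> (n + j) n"
    unfolding tr_apol fprod_def by (simp only: add.commute)
  then have "zshift n (Poly_Mapping.lookup (gwa_val (falpha \<alpha>) C) j) * to_fract (fprod \<alpha> n (n + j)) =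
      to_fract (tr n u * (fprod \<alpha> (n + j) n * fprod \<alpha> n (n + j)))"
    unfolding assms lookup_single_eq zshift_to_fract pcompose_mult to_fract_mult[symmetric]
    by (simp only: mult.assoc)
  then show ?thesis unfolding lam_def hpol_rho by (rule arg_cong)
qed

text \<open>
  Comaximality of two principal ideals.
\<close>

definition comax :: "'a::comm_ring_1 \<Rightarrow> 'a \<Rightarrow> bool" where
  "comax p q \<longleftrightarrow> (\<exists>a b. a * p + b * q = 1)"

lemma comax_commute: "comax p q \<Longrightarrow> comax q p"
  unfolding comax_def by (metis add.commute)

lemma comax_mult:
  assumes "comax p q" "comax p r"
  shows "comax p (q * r)"
proof -
  obtain a b c d where *: "a * p + b * q = 1" "c * p + d * r = 1" using assms unfolding comax_def by blast
  have "(a * (c * p + d * r) + b * q * c) * p + (b * d) * (q * r) = (a * p + b * q) * (c * p + d * r)"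
    by (simp add: algebra_simps)
  then show ?thesis unfolding comax_def * by (metis mult_1)
qed

lemma comax_prod: "(\<And>i. i \<in> I \<Longrightarrow> comax p (g i)) \<Longrightarrow> comax p (prod g I)"
proof (induction I rule: infinite_finite_induct)
  case (insert i I)
  then show ?case by (simp add: comax_mult)
qed (auto simp: comax_def intro: exI[of _ 0] exI[of _ 1])

lemma comax_lin:
  assumes "\<beta> + of_int n \<noteq> \<beta>' + of_int m"
  shows "comax (lin \<beta> n) (lin \<beta>' m)"
proof -
  define c where "c = (of_int n + \<beta>) - (of_int m + \<beta>')"
  have c: "c \<noteq> 0" using assms by (auto simp: c_def algebra_simps)
  have "[:inverse c:] * lin \<beta> n + [:- inverse c:] * lin \<beta>' m = [:inverse c * c:]"
    by (simp add: c_def algebra_simps)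
  also have "\<dots> = 1" using c by (simp add: one_pCons)
  finally show ?thesis unfolding comax_def by blast
qed

lemma comax_hpol:
  assumes alpha: "\<alpha> \<notin> \<int>"
    and "zset (fst \<gamma>) \<inter> zset (fst \<delta>) = {}" "zset (snd \<gamma>) \<inter> zset (snd \<delta>) = {}"
  shows "comax (hpol \<alpha> \<gamma>) (hpol \<alpha> \<delta>)"
proof -
  have a: "\<alpha> + of_int n \<noteq> of_int m" for n m
  proof
    assume "\<alpha> + of_int n = of_int m"
    then have "\<alpha> = of_int (m - n)" by (simp add: algebra_simps)
    then show False using alpha Ints_of_int by metis
  qed
  have l: "comax (lin (0 :: 'a) n) (lin 0 m)" "comax (lin \<alpha> n) (lin \<alpha> m)" if "n \<noteq> m" for n m
    using that by (intro comax_lin, simp)+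
  have m: "comax (lin 0 n) (lin \<alpha> m)" for n m using a[of m n] by (intro comax_lin) auto
  have p: "comax (prod g I) (prod h J)" if gh: "\<And>i j. i \<in> I \<Longrightarrow> j \<in> J \<Longrightarrow> comax (g i) (h j)"
    for g h :: "int \<Rightarrow> 'a poly" and I J
  proof (rule comax_prod)
    fix j assume j: "j \<in> J"
    show "comax (prod g I) (h j)"
      by (rule comax_commute, rule comax_prod, rule comax_commute, rule gh[OF _ j])
  qed
  have s: "comax (p * q) r" if "comax p r" "comax q r" for p q r :: "'a poly"
    using comax_mult[OF comax_commute[OF that(1)] comax_commute[OF that(2)]] by (rule comax_commute)
  let ?G = "\<lambda>(\<beta> :: 'a) I. \<Prod>j\<in>zset I. lin \<beta> j"
  have "comax (?G 0 (fst \<gamma>)) (?G 0 (fst \<delta>))" by (rule p, rule l(1)) (use assms(2) in auto)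
  moreover have "comax (?G 0 (fst \<gamma>)) (?G \<alpha> (snd \<delta>))" by (rule p) (rule m)
  moreover have "comax (?G \<alpha> (snd \<gamma>)) (?G 0 (fst \<delta>))" by (rule p) (rule comax_commute[OF m])
  moreover have "comax (?G \<alpha> (snd \<gamma>)) (?G \<alpha> (snd \<delta>))" by (rule p, rule l(2)) (use assms(3) in auto)
  ultimately show ?thesis unfolding hpol_def by (intro comax_mult s)
qed

lemma D_in_hcomp:
  assumes "\<alpha> \<notin> \<int>"
  shows "D_of \<alpha> (Poly_Mapping.single \<gamma> (to_fract (u * hpol \<alpha> \<gamma>))) \<in> hcomp (D_ring \<alpha>) \<gamma>"
  unfolding D_hcomp[OF assms] by (rule rangeI)

text \<open>
  Beyond the range of the two sets of \<open>g\<close>, the difference with \<open>rho (- N)\<close> contains the elements of \<open>g\<close> that are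
  at least \<open>0\<close> and the negative ones missing from \<open>g\<close>, and the difference with \<open>rho N\<close> the opposite ones. Both
  polynomials occur in degree zero because \<open>\<gamma> + \<gamma> = 0\<close> and the intersection of \<open>\<gamma>\<close> with itself is \<open>\<gamma>\<close>.
\<close>

lemma D_cover:
  assumes alpha: "\<alpha> \<notin> \<int>"
  shows "\<exists>(I :: nat set) p d d'. finite I \<and>
    (\<forall>i\<in>I. d i \<in> hcomp (D_ring \<alpha>) (rho (p i) - g) \<and> d' i \<in> hcomp (D_ring \<alpha>) (g - rho (p i))) \<and>
    \<one>\<^bsub>D_ring \<alpha>\<^esub> = (\<Oplus>\<^bsub>D_ring \<alpha>\<^esub>i\<in>I. d i \<otimes>\<^bsub>D_ring \<alpha>\<^esub> d' i)"
proof -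
  interpret D: graded_ring "D_ring \<alpha>" by (rule graded_ring_D[OF alpha])
  obtain N where N: "\<bar>k\<bar> < N" if "k \<in> zset (fst g) \<union> zset (snd g)" for k
  proof -
    let ?S = "zset (fst g) \<union> zset (snd g)"
    have "\<bar>k\<bar> < Max (insert 0 (abs ` ?S)) + 1" if k: "k \<in> ?S" for k
      using Max_ge[of "insert 0 (abs ` ?S)" "\<bar>k\<bar>"] k by simp
    then show thesis by (rule that)
  qed
  let ?\<gamma> = "rho (- N) - g" and ?\<delta> = "rho N - g"
  have disj: "zset (initial (- N) + G) \<inter> zset (initial N + G) = {}" if "\<And>k. k \<in> zset G \<Longrightarrow> \<bar>k\<bar> < N" for G
    using that by (fastforce simp: zset_plus zset_initial)
  have "comax (hpol \<alpha> ?\<gamma>) (hpol \<alpha> ?\<delta>)"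
  proof (rule comax_hpol[OF alpha])
    show "zset (fst ?\<gamma>) \<inter> zset (fst ?\<delta>) = {}" using disj[of "fst g"] N by (simp add: rho_def zfin_minus)
    show "zset (snd ?\<gamma>) \<inter> zset (snd ?\<delta>) = {}" using disj[of "snd g"] N by (simp add: rho_def zfin_minus)
  qed
  then obtain a b where ab: "a * hpol \<alpha> ?\<gamma> + b * hpol \<alpha> ?\<delta> = 1" unfolding comax_def by blast
  define p :: "nat \<Rightarrow> int" where "p i = (if i = 0 then - N else N)" for i
  define c where "c i = (if i = 0 then a else b)" for i :: nat
  define d where "d i = D_of \<alpha> (Poly_Mapping.single (rho (p i) - g) (to_fract (1 * hpol \<alpha> (rho (p i) - g))))" for i
  define d' where "d' i = D_of \<alpha> (Poly_Mapping.single (g - rho (p i)) (to_fract (c i * hpol \<alpha> (g - rho (p i)))))" for i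
  have prod: "d i \<otimes>\<^bsub>D_ring \<alpha>\<^esub> d' i = D_of \<alpha> (Poly_Mapping.single 0 (to_fract (c i * hpol \<alpha> (rho (p i) - g))))" for i
  proof -
    have s: "g - rho (p i) = rho (p i) - g" by (simp only: gam_minus add.commute)
    have z: "(rho (p i) - g) + (rho (p i) - g) = 0" by (metis gam_minus diff_self)
    show ?thesis
      unfolding d_def d'_def s D_mult_D_of[OF alpha dset_single dset_single] dt.tconv_single mu_hpol ginter_self z
      by simp
  qed
  have closed: "d i \<otimes>\<^bsub>D_ring \<alpha>\<^esub> d' i \<in> carrier (D_ring \<alpha>)" for i
  proof -
    have "Poly_Mapping.single 0 (to_fract ((c i * hpol \<alpha> (rho (p i) - g)) * hpol \<alpha> 0)) \<in> dset \<alpha>" by (rule dset_single)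
    then show ?thesis unfolding prod D_simps(1)[OF alpha] hpol_zero mult_1_right by (rule imageI)
  qed
  have "(\<Oplus>\<^bsub>D_ring \<alpha>\<^esub>i\<in>{0, 1::nat}. d i \<otimes>\<^bsub>D_ring \<alpha>\<^esub> d' i) =
      (d 0 \<otimes>\<^bsub>D_ring \<alpha>\<^esub> d' 0) \<oplus>\<^bsub>D_ring \<alpha>\<^esub> (d 1 \<otimes>\<^bsub>D_ring \<alpha>\<^esub> d' 1)"
    using closed by (simp add: Pi_def del: One_nat_def)
  also have "\<dots> = D_of \<alpha> (Poly_Mapping.single 0 (to_fract (a * hpol \<alpha> ?\<gamma> + b * hpol \<alpha> ?\<delta>)))"
    unfolding prod D_add[OF alpha] single_add[symmetric] by (simp only: c_def p_def if_True if_False simp_thms one_neq_zero to_fract_add)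
  also have "\<dots> = \<one>\<^bsub>D_ring \<alpha>\<^esub>" unfolding ab D_simps(3)[OF alpha] by simp
  finally have one: "\<one>\<^bsub>D_ring \<alpha>\<^esub> = (\<Oplus>\<^bsub>D_ring \<alpha>\<^esub>i\<in>{0, 1::nat}. d i \<otimes>\<^bsub>D_ring \<alpha>\<^esub> d' i)" by (rule sym)
  have mem: "d i \<in> hcomp (D_ring \<alpha>) (rho (p i) - g) \<and> d' i \<in> hcomp (D_ring \<alpha>) (g - rho (p i))" for i
    unfolding d_def d'_def using D_in_hcomp[OF alpha] by blast
  show ?thesis
    by (rule exI[of _ "{0, 1}"], rule exI[of _ p], rule exI[of _ d], rule exI[of _ d']) (intro conjI ballI mem one finite.intros)
qed

lemma corner_D:
  fixes \<alpha> :: "'k::field_char_0"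
  assumes alpha: "\<alpha> \<notin> \<int>"
  shows "corner (D_ring \<alpha>) (gwa (falpha \<alpha>)) rho (lam \<alpha>)"
proof (intro corner.intro corner_axioms.intro)
  let ?f = "falpha \<alpha>"
  have f: "?f \<noteq> 0" by (rule falpha_nonzero)
  note hc = gwa_hcomp_iff[OF f]
  show "graded_ring (D_ring \<alpha>)" by (rule graded_ring_D[OF alpha])
  show "graded_ring (gwa ?f)" by (rule graded_ring_gwa[OF f])
  show "inj rho" by (rule inj_rho)
  show "bij_betw (lam \<alpha> n j) (hcomp (gwa ?f) j) (hcomp (D_ring \<alpha>) (rho (n + j) - rho n))" for n j
    unfolding bij_betw_def
  proof (intro conjI inj_onI)
    let ?\<gamma> = "rho (n + j) - rho n"
    fix C C' assume C: "C \<in> hcomp (gwa ?f) j" and C': "C' \<in> hcomp (gwa ?f) j" and eq: "lam \<alpha> n j C = lam \<alpha> n j C'"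
    obtain u u' where u: "gwa_val ?f C = Poly_Mapping.single j (to_fract (u * apol ?f j))"
      and u': "gwa_val ?f C' = Poly_Mapping.single j (to_fract (u' * apol ?f j))"
      using C C' unfolding hc by blast
    have "Poly_Mapping.single ?\<gamma> (to_fract (tr n u * hpol \<alpha> ?\<gamma>)) = Poly_Mapping.single ?\<gamma> (to_fract (tr n u' * hpol \<alpha> ?\<gamma>))"
      using eq unfolding lam_eq[OF u] lam_eq[OF u'] by (rule D_of_inject)
    then have "to_fract (tr n u * hpol \<alpha> ?\<gamma>) = to_fract (tr n u' * hpol \<alpha> ?\<gamma>)" by (metis lookup_single_eq)
    then have "tr n u = tr n u'" by (simp only: to_fract_eq_iff mult_cancel_right hpol_nonzero simp_thms)
    then have "tr (- n) (tr n u) = tr (- n) (tr n u')" by (rule arg_cong)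
    then have "u = u'" by (simp only: tr_tr add.left_inverse tr_0)
    have "gwa_val ?f C = gwa_val ?f C'" unfolding u u' \<open>u = u'\<close> ..
    then show "C = C'" using C C' unfolding hc by (intro inj_onD[OF gwa_val_inj[OF f]]) blast+
  next
    show "lam \<alpha> n j ` hcomp (gwa ?f) j = hcomp (D_ring \<alpha>) (rho (n + j) - rho n)"
    proof (intro equalityI subsetI)
      fix d assume "d \<in> lam \<alpha> n j ` hcomp (gwa ?f) j"
      then obtain C where C: "d = lam \<alpha> n j C" "C \<in> hcomp (gwa ?f) j" by blast
      obtain u where u: "gwa_val ?f C = Poly_Mapping.single j (to_fract (u * apol ?f j))"
        using C(2) unfolding hc by blast
      show "d \<in> hcomp (D_ring \<alpha>) (rho (n + j) - rho n)"
        unfolding C(1) lam_eq[OF u] by (rule D_in_hcomp[OF alpha])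
    next
      fix d assume "d \<in> hcomp (D_ring \<alpha>) (rho (n + j) - rho n)"
      then obtain v where v: "d = D_of \<alpha> (Poly_Mapping.single (rho (n + j) - rho n) (to_fract (v * hpol \<alpha> (rho (n + j) - rho n))))"
        unfolding D_hcomp[OF alpha] by blast
      obtain C where C: "C \<in> carrier (gwa ?f)" "gwa_val ?f C = Poly_Mapping.single j (to_fract (tr (- n) v * apol ?f j))"
        by (rule gwa_sub_ex[OF single_in_gwa_sub])
      have "d = lam \<alpha> n j C" unfolding v lam_eq[OF C(2)] tr_tr by (simp only: add.right_inverse tr_0)
      moreover have "C \<in> hcomp (gwa ?f) j" unfolding hc using C by blast
      ultimately show "d \<in> lam \<alpha> n j ` hcomp (gwa ?f) j" by (rule image_eqI)
    qed
  qed
  show "lam \<alpha> n j (a \<oplus>\<^bsub>gwa ?f\<^esub> b) = lam \<alpha> n j a \<oplus>\<^bsub>D_ring \<alpha>\<^esub> lam \<alpha> n j b"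
    if a: "a \<in> hcomp (gwa ?f) j" and b: "b \<in> hcomp (gwa ?f) j" for n j a b
  proof -
    have "gwa_val ?f (a \<oplus>\<^bsub>gwa ?f\<^esub> b) = gwa_val ?f a + gwa_val ?f b" using a b unfolding hc by (intro gwa_val_add) auto
    then show ?thesis
      unfolding lam_def D_add[OF alpha] by (simp only: lookup_add zshift_add distrib_right single_add)
  qed
  show "lam \<alpha> n (j + l) (a \<otimes>\<^bsub>gwa ?f\<^esub> b) = lam \<alpha> n j a \<otimes>\<^bsub>D_ring \<alpha>\<^esub> lam \<alpha> (n + j) l b"
    if a: "a \<in> hcomp (gwa ?f) j" and b: "b \<in> hcomp (gwa ?f) l" for n j l a b
  proof -
    let ?m = "n + j" and ?r = "n + j + l"
    let ?h = "hpol \<alpha> (ginter (rho ?m - rho n) (rho ?r - rho ?m))"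
    obtain u v where u: "gwa_val ?f a = Poly_Mapping.single j (to_fract (u * apol ?f j))"
      and v: "gwa_val ?f b = Poly_Mapping.single l (to_fract (v * apol ?f l))"
      using a b unfolding hc by blast
    define s t where "s = to_fract (u * apol ?f j)" and "t = to_fract (v * apol ?f l)"
    note sv = u[folded s_def] v[folded t_def]
    have ab: "gwa_val ?f (a \<otimes>\<^bsub>gwa ?f\<^esub> b) = Poly_Mapping.single (j + l) (s * zshift j t)"
      using a b sv skew_mult_single[of j s l t] unfolding hc by (auto simp: gwa_val_mult)
    have in_dset: "Poly_Mapping.single (rho ?m - rho n) (zshift n s * to_fract (fprod \<alpha> n ?m)) \<in> dset \<alpha>"
      "Poly_Mapping.single (rho ?r - rho ?m) (zshift ?m t * to_fract (fprod \<alpha> ?m ?r)) \<in> dset \<alpha>"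
      using lam_eq[OF u, of n] lam_eq[OF v, of ?m] unfolding lam_def sv lookup_single_eq
      by (auto dest!: D_of_inject simp only: dset_single)
    have "zshift n s * to_fract (fprod \<alpha> n ?m) * (zshift ?m t * to_fract (fprod \<alpha> ?m ?r)) =
        zshift n s * zshift ?m t * to_fract (fprod \<alpha> n ?r) * to_fract ?h"
      by (simp only: fprod_hpol[symmetric] to_fract_mult[symmetric] mult.assoc mult.left_commute[of "to_fract (fprod \<alpha> n ?m)"])
    moreover have "x * inverse h = y" if "x = y * h" "h \<noteq> 0" for x y h :: "'k poly fract"
      using that by (simp add: mult.assoc)
    ultimately have mu: "mu \<alpha> (rho ?m - rho n) (rho ?r - rho ?m) (zshift n s * to_fract (fprod \<alpha> n ?m))
        (zshift ?m t * to_fract (fprod \<alpha> ?m ?r)) = zshift n s * zshift ?m t * to_fract (fprod \<alpha> n ?r)"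
      unfolding mu_def by (metis hpol_nonzero to_fract_eq_0_iff)
    have deg: "(rho ?m - rho n) + (rho ?r - rho ?m) = rho ?r - rho n" by simp
    have "lam \<alpha> n j a \<otimes>\<^bsub>D_ring \<alpha>\<^esub> lam \<alpha> ?m l b =
        D_of \<alpha> (Poly_Mapping.single (rho ?r - rho n) (zshift n s * zshift ?m t * to_fract (fprod \<alpha> n ?r)))"
      unfolding lam_def sv lookup_single_eq D_mult_D_of[OF alpha in_dset] dt.tconv_single mu deg ..
    also have "\<dots> = lam \<alpha> n (j + l) (a \<otimes>\<^bsub>gwa ?f\<^esub> b)"
      unfolding lam_def ab lookup_single_eq by (simp only: zshift_mult zshift_zshift add.assoc)
    finally show ?thesis by (rule sym)
  qed
  show "lam \<alpha> n 0 \<one>\<^bsub>gwa ?f\<^esub> = \<one>\<^bsub>D_ring \<alpha>\<^esub>" for n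
    unfolding lam_def gwa_val_one D_simps(3)[OF alpha] by (simp add: fprod_def lookup_one)
  show "lam \<alpha> n 0 (scal (gwa ?f) c) = scal (D_ring \<alpha>) c" for n c
    unfolding lam_def gwa_scal gwa_val_cls falg_val_fconst D_simps(4)[OF alpha] by (simp add: fprod_def)
qed (rule D_cover[OF alpha])


section \<open>Cardinalities\<close>

lemma ex_inj_poly: "\<exists>c :: 'k::field_char_0 poly \<Rightarrow> 'k. inj c"
proof -
  obtain lc :: "'k list \<Rightarrow> 'k" where "inj lc" using ex_inj_list_code[OF infinite_UNIV_char_0] by blast
  then have "inj (lc \<circ> coeffs)" by (intro injI) (simp add: inj_eq coeffs_eq_iff)
  then show ?thesis by blast
qed

lemma ex_inj_fract: "\<exists>c :: 'k::field_char_0 poly fract \<Rightarrow> 'k. inj c"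
proof -
  obtain lc :: "'k list \<Rightarrow> 'k" where lc: "inj lc" using ex_inj_list_code[OF infinite_UNIV_char_0] by blast
  obtain pc :: "'k poly \<Rightarrow> 'k" where pc: "inj pc" using ex_inj_poly by blast
  have "\<exists>a b. q = Fract a b" for q :: "'k poly fract" by (cases q) blast
  then obtain nu de where nd: "\<And>q :: 'k poly fract. q = Fract (nu q) (de q)" by metis
  have "inj (\<lambda>q. lc [pc (nu q), pc (de q)])"
  proof (rule injI)
    fix q r assume "lc [pc (nu q), pc (de q)] = lc [pc (nu r), pc (de r)]"
    then have "nu q = nu r" "de q = de r" using injD[OF lc] injD[OF pc] by blast+
    then show "q = r" using nd[of q] nd[of r] by simp
  qed
  then show ?thesis by blast
qed

lemma ex_inj_gam: "\<exists>c :: gam \<Rightarrow> 'k::field_char_0. inj c"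
proof -
  obtain lc :: "'k list \<Rightarrow> 'k" where lc: "inj lc" using ex_inj_list_code[OF infinite_UNIV_char_0] by blast
  define zc where "zc I = lc (map of_int (sorted_list_of_set (zset I)))" for I
  have zc: "I = J" if "zc I = zc J" for I J
  proof (rule zset_eqD)
    have "inj (of_int :: int \<Rightarrow> 'k)" by (rule injI) simp
    then have "sorted_list_of_set (zset I) = sorted_list_of_set (zset J)"
      using injD[OF lc that[unfolded zc_def]] by (simp add: inj_map_eq_map)
    then show "zset I = zset J" by (metis finite_zset set_sorted_list_of_set)
  qed
  have "inj (\<lambda>\<gamma>. lc [zc (fst \<gamma>), zc (snd \<gamma>)])"
    by (rule injI) (auto simp: prod_eq_iff dest: injD[OF lc] intro: zc)
  then show ?thesis by blast
qed

text \<open>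
  List the support in some order and code each key together with its value.
\<close>

lemma ex_inj_poly_mapping:
  fixes cg :: "'g \<Rightarrow> 'k" and cf :: "'f::zero \<Rightarrow> 'k"
  assumes inf: "infinite (UNIV :: 'k set)" and cg: "inj cg" and cf: "inj cf"
  shows "\<exists>c :: ('g \<Rightarrow>\<^sub>0 'f) \<Rightarrow> 'k. inj c"
proof -
  obtain lc :: "'k list \<Rightarrow> 'k" where lc: "inj lc" using ex_inj_list_code[OF inf] by blast
  have "\<exists>xs. set xs = Poly_Mapping.keys v" for v :: "'g \<Rightarrow>\<^sub>0 'f" using finite_list[of "Poly_Mapping.keys v"] by simp
  then obtain ks where ks: "\<And>v :: 'g \<Rightarrow>\<^sub>0 'f. set (ks v) = Poly_Mapping.keys v" by metis
  define e where "e v x = lc [cg x, cf (Poly_Mapping.lookup v x)]" for v x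
  have half: "Poly_Mapping.lookup w x = Poly_Mapping.lookup v x"
    if "e v ` Poly_Mapping.keys v = e w ` Poly_Mapping.keys w" "x \<in> Poly_Mapping.keys v" for v w x
  proof -
    obtain y where "e v x = e w y" using \<open>e v ` _ = _\<close> \<open>x \<in> _\<close> by blast
    then have "cg x = cg y" "cf (Poly_Mapping.lookup v x) = cf (Poly_Mapping.lookup w y)"
      unfolding e_def using injD[OF lc] by blast+
    then show ?thesis using injD[OF cg] injD[OF cf] by metis
  qed
  have "inj (\<lambda>v. lc (map (e v) (ks v)))"
  proof (rule injI)
    fix v w assume "lc (map (e v) (ks v)) = lc (map (e w) (ks w))"
    then have "set (map (e v) (ks v)) = set (map (e w) (ks w))" using injD[OF lc] by metis
    then have eq: "e v ` Poly_Mapping.keys v = e w ` Poly_Mapping.keys w" by (simp add: ks)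
    show "v = w"
    proof (rule poly_mapping_eqI)
      fix x
      show "Poly_Mapping.lookup v x = Poly_Mapping.lookup w x"
        using half[OF eq, of x] half[OF eq[symmetric], of x] by (metis in_keys_iff)
    qed
  qed
  then show ?thesis by blast
qed

lemma ex_inj_on_gwa:
  assumes "f \<noteq> 0"
  shows "\<exists>c :: 'k::field_char_0 falg set \<Rightarrow> 'k. inj_on c (carrier (gwa f))"
proof -
  obtain fc :: "'k poly fract \<Rightarrow> 'k" where fc: "inj fc" using ex_inj_fract by blast
  have "inj (of_int :: int \<Rightarrow> 'k)" by (rule injI) simp
  then obtain c :: "'k skewl \<Rightarrow> 'k" where c: "inj c" using ex_inj_poly_mapping[OF infinite_UNIV_char_0 _ fc] by blast
  have "inj_on (c \<circ> gwa_val f) (carrier (gwa f))"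
    using gwa_val_inj[OF assms] c by (rule comp_inj_on[OF _ inj_on_subset]) simp
  then show ?thesis by blast
qed

lemma ex_inj_on_D:
  assumes alpha: "\<alpha> \<notin> \<int>"
  shows "\<exists>c :: (gam \<Rightarrow> 'k skewl \<Rightarrow> 'k skewl) \<Rightarrow> 'k::field_char_0. inj_on c (carrier (D_ring \<alpha>))"
proof -
  obtain fc :: "'k poly fract \<Rightarrow> 'k" where fc: "inj fc" using ex_inj_fract by blast
  obtain gc :: "gam \<Rightarrow> 'k" where gc: "inj gc" using ex_inj_gam by blast
  obtain c :: "(gam \<Rightarrow>\<^sub>0 'k poly fract) \<Rightarrow> 'k" where c: "inj c"
    using ex_inj_poly_mapping[OF infinite_UNIV_char_0 gc fc] by blast
  have "inj_on (D_val \<alpha>) (carrier (D_ring \<alpha>))" unfolding D_simps(1)[OF alpha] by (rule inj_onI) auto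
  then have "inj_on (c \<circ> D_val \<alpha>) (carrier (D_ring \<alpha>))"
    using c by (rule comp_inj_on[OF _ inj_on_subset]) simp
  then show ?thesis by blast
qed

theorem theorem4p10:
  fixes \<alpha> :: "'k::{alg_closed_field, field_char_0}"
    and i :: "'k \<Rightarrow> 'm" and j :: "'k \<Rightarrow> 'n"
  assumes alpha: "\<alpha> \<notin> \<int>"
    and large_enough_universes: "inj i" "inj j"
  shows "linearly_equivalent
    (gr_cat TYPE('m) (gwa ([:0, 1:] * [:\<alpha>, 1:])))
    (gr_cat TYPE('n) (D_ring \<alpha>))"
proof -
  let ?f = "falpha \<alpha>"
  have inf: "infinite (UNIV :: 'k set)" by (rule infinite_UNIV_char_0)
  have f: "?f \<noteq> 0" by (rule falpha_nonzero)
  interpret A: graded_ring "gwa ?f" by (rule graded_ring_gwa[OF f])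
  interpret D: graded_ring "D_ring \<alpha>" by (rule graded_ring_D[OF alpha])
  interpret corner "D_ring \<alpha>" "gwa ?f" rho "lam \<alpha>" by (rule corner_D[OF alpha])
  obtain c where c: "inj_on (c :: _ \<Rightarrow> 'k) (carrier (D_ring \<alpha>))" using ex_inj_on_D[OF alpha] by blast
  obtain c' where c': "inj_on (c' :: _ \<Rightarrow> 'k) (carrier (gwa ?f))" using ex_inj_on_gwa[OF f] by blast
  have large: "\<exists>e :: (gam \<Rightarrow> int \<Rightarrow> (gam \<Rightarrow> 'k skewl \<Rightarrow> 'k skewl) \<Rightarrow> 'n) \<Rightarrow> 'n. inj_on e (carrier M)"
    if M: "graded_right_module (D_ring \<alpha>) M" "fin_gen (D_ring \<alpha>) M" for M
  proof -
    obtain e :: "(gam \<Rightarrow> int \<Rightarrow> (gam \<Rightarrow> 'k skewl \<Rightarrow> 'k skewl) \<Rightarrow> 'n) \<Rightarrow> 'k" where "inj_on e (carrier M)"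
      using fin_gen_inj_on[OF inf c M] by blast
    then have "inj_on (j \<circ> e) (carrier M)"
      using large_enough_universes(2) by (meson comp_inj_on inj_on_subset subset_UNIV)
    then show ?thesis by blast
  qed
  note res = equivalence_functor_res[OF large]
  obtain F F' where F: "equivalence_functor (gr_cat TYPE('n) (gwa ?f)) (gr_cat TYPE('m) (gwa ?f)) F F'"
    using A.equivalence_functor_transport[OF inf c' large_enough_universes(2,1)] by blast
  have "linearly_equivalent (gr_cat TYPE('n) (D_ring \<alpha>)) (gr_cat TYPE('m) (gwa ?f))"
    by (rule equivalence_functor_imp_linearly_equivalent[OF D.linear_category_gr_cat A.linear_category_gr_cat
        equivalence_functor_compose[OF A.linear_category_gr_cat res F]])
  then show ?thesis unfolding falpha_def by (rule linearly_equivalent_sym)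
qed

end
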